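(* Let $m \geq 1$, $n \geq 1$, and $N_x \in \mathbb{Z}$ be integers. Let $u_0,u_1:[0,\infty)\to\mathbb{R}$ be functions ($m+2$ and $m+1$ times weakly differentiable, respectively) satisfying $$\begin{cases} (1+x)^{n} (u_0(x) - 2\pi N_x) \in L^1([0,\infty)),\\ (1+x)^{n}\partial^i u_0(x) \in L^1([0,\infty)), \quad i = 1, \dots, m+2,\\ (1+x)^{n}\partial^i u_1(x) \in L^1([0,\infty)), \quad i = 0,1, \dots, m+1. \end{cases}$$ Then, as $k \to \infty$, $X$ and $Y$ coincide to order $m$ with the formal power series solutions $X_{formal}$ and $Y_{formal}$, respectively, in the following sense: the functions $$X_p(x,k) := I + \frac{X_1(x)}{k} + \cdots + \frac{X_{m+1}(x)}{k^{m+1}},$$ $$Y_p(x,k) := I + \frac{Z_1(x)}{k} + \cdots + \frac{Z_{m+1}(x)}{k^{m+1}} + \bigg(\frac{W_1(x)}{k} + \cdots + \frac{W_{m+1}(x)}{k^{m+1}}\bigg) e^{2i\theta_1 x\sigma_3},$$ are well-defined and there is a constant $C>0$ (independent of $x$ and $k$) such that, for each $j = 0, 1, \dots, n$, $$\bigg|\frac{\partial^j}{\partial k^j}\big(X - X_p\big) \bigg| \leq \frac{C}{|k|^{m+1}(1+x)^{n-j}}, \qquad x \geq 0, \ k \in (\bar{D}_4, \bar{D}_1),$$ $$\bigg|\frac{\partial^j}{\partial k^j}\big(Y - Y_p\big) \bigg| \leq \frac{C(1 + x)^{j+2}e^{\frac{Cx}{|k|^{m+1}}}}{|k|^{m+1}},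 \qquad x \geq 0, \ k \in (\bar{D}_1, \bar{D}_4),$$ $$\bigg|\frac{\partial^j}{\partial k^j}\big((Y - Y_p)e^{-2i\theta_1 x\sigma_3}\big) \bigg| \leq \frac{C(1 + x)^{j+2}e^{\frac{Cx}{|k|^{m+1}}}}{|k|^{m+1}}, \qquad x \geq 0, \ k \in (\bar{D}_4, \bar{D}_1).$$
   Context: Pauli matrices: $\sigma_1=\begin{pmatrix}0&1\\1&0\end{pmatrix}$, $\sigma_2=\begin{pmatrix}0&-i\\i&0\end{pmatrix}$, $\sigma_3=\begin{pmatrix}1&0\\0&-1\end{pmatrix}$. $e^{\alpha\hat\sigma_3}A=e^{\alpha\sigma_3}Ae^{-\alpha\sigma_3}$ for a $2\times2$ matrix $A$. $|A|^2=\sum_{i,j}|A_{ij}|^2$. $A^{(d)}$ and $A^{(o)}$ are the diagonal and off-diagonal parts of $A$. $\theta_1=\theta_1(k)=\frac14(k-\frac1k)$ and $\mathsf{U}(x,k)=\mathsf{U}_0(x)+\frac1k\mathsf{U}_1(x)$ with $$\mathsf{U}_0=-\frac{i(u_{0x}+u_1)}{4}\sigma_2,\qquad \mathsf{U}_1=\frac{i\sin u_0}{4}\sigma_1+\frac{i(\cos u_0-1)}{4}\sigma_3.$$ $X,Y$ are the solutions of $X_x+i\theta_1[\sigma_3,X]=\mathsf{U}X$ defined by the Volterra equations $$X(x,k)=I+\int_\infty^xe^{i\theta_1(x'-x)\hat\sigma_3}(\mathsf{U}X)(x',k)dx',\qquad Y(x,k)=I+\int_0^xe^{i\theta_1(x'-x)\hat\sigma_3}(\mathsf{U}Y)(x',k)dx',$$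 $X$ being defined for $k\in(\{\operatorname{Im}k\le0\},\{\operatorname{Im}k\ge0\})\setminus\{0\}$ (columnwise) and $Y$ for $k\in\mathbb{C}\setminus\{0\}$. Domains: $D_1=\{\operatorname{Im}k>0,|k|>1\}$, $D_4=\{\operatorname{Im}k<0,|k|>1\}$; bars denote closures. For a statement about a $2\times2$ matrix, "$k\in(A,B)$" means it holds for the first column when $k\in A$ and for the second column when $k\in B$. Derivatives at boundary points are continuous extensions from the interior. Formal solutions: $X_{formal}=I+\frac{X_1(x)}{k}+\frac{X_2(x)}{k^2}+\cdots$ and $Y_{formal}=I+\frac{Z_1(x)}{k}+\cdots+\big(\frac{W_1(x)}{k}+\cdots\big)e^{2i\theta_1x\sigma_3}$, where the coefficients are determined recursively from $X_{-1}=Z_{-1}=0$, $X_0=Z_0=I$, $W_{-1}=W_0=0$, the normalizations $$\lim_{x\to\infty}X_j(x)=0,\qquad Z_j(0)+W_j(0)=0,\qquad j\ge1,$$ and, for $j\ge0$, the relations $$X_{j+1}^{(o)}=-2i\sigma_3\big(-\partial_xX_j^{(o)}+\tfrac i2\sigma_3X_{j-1}^{(o)}+\mathsf{U}_0X_j^{(d)}+\mathsf{U}_1^{(o)}X_{j-1}^{(d)}+\mathsf{U}_1^{(d)}X_{j-1}^{(o)}\big),$$ $$\partial_xX_{j+1}^{(d)}=\mathsf{U}_0X_{j+1}^{(o)}+\mathsf{U}_1^{(o)}X_j^{(o)}+\mathsf{U}_1^{(d)}X_j^{(d)},$$ the same two relations with every $X_i$ replaced by $Z_i$, and $$W_{j+1}^{(d)}=-2i\sigma_3\big(-\partial_xW_j^{(d)}+\tfrac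 i2\sigma_3W_{j-1}^{(d)}+\mathsf{U}_0W_j^{(o)}+\mathsf{U}_1^{(o)}W_{j-1}^{(o)}+\mathsf{U}_1^{(d)}W_{j-1}^{(d)}\big),$$ $$\partial_xW_{j+1}^{(o)}=\mathsf{U}_0W_{j+1}^{(d)}+\mathsf{U}_1^{(o)}W_j^{(d)}+\mathsf{U}_1^{(d)}W_j^{(o)}.$$ *)

theory Defs
  imports "HOL-Analysis.Analysis"
begin

type_synonym cmat2 = "complex^2^2"

definition mscale :: "complex \<Rightarrow> cmat2 \<Rightarrow> cmat2"  (infixr "*m" 75)
  where "c *m A = (\<chi> i j. c * A $ i $ j)"

definition sigma1 :: cmat2 where "sigma1 = vector [vector [0, 1], vector [1, 0]]"
definition sigma2 :: cmat2 where "sigma2 = vector [vector [0, - \<i>], vector [\<i>, 0]]"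
definition sigma3 :: cmat2 where "sigma3 = vector [vector [1, 0], vector [0, - 1]]"

definition diag_part :: "cmat2 \<Rightarrow> cmat2"
  where "diag_part A = (\<chi> i j. if i = j then A $ i $ j else 0)"

definition off_part :: "cmat2 \<Rightarrow> cmat2"
  where "off_part A = (\<chi> i j. if i = j then 0 else A $ i $ j)"

text \<open>The matrix exponential of \<open>\<alpha> \<sigma>\<^sub>3\<close>; since \<open>\<sigma>\<^sub>3\<close> is diagonal it is written
  out entrywise.\<close>

definition exp_sigma3 :: "complex \<Rightarrow> cmat2"
  where "exp_sigma3 \<alpha> = vector [vector [exp \<alpha>, 0], vector [0, exp (- \<alpha>)]]"

definition exp_hat_sigma3 :: "complex \<Rightarrow> cmat2 \<Rightarrow> cmat2"
  where "exp_hat_sigma3 \<alpha> A = exp_sigma3 \<alpha> ** A ** exp_sigma3 (- \<alpha>)"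

definition theta1 :: "complex \<Rightarrow> complex"
  where "theta1 k = (k - 1 / k) / 4"


text \<open>In the following \<open>u0x\<close> is the derivative of \<open>u0\<close>.\<close>

definition U0 :: "(real \<Rightarrow> real) \<Rightarrow> (real \<Rightarrow> real) \<Rightarrow> real \<Rightarrow> cmat2"
  where "U0 u0x u1 x = (- (\<i> * of_real (u0x x + u1 x) / 4)) *m sigma2"

definition U1 :: "(real \<Rightarrow> real) \<Rightarrow> real \<Rightarrow> cmat2"
  where "U1 u0 x = (\<i> * of_real (sin (u0 x)) / 4) *m sigma1
                 + (\<i> * of_real (cos (u0 x) - 1) / 4) *m sigma3"

definition U_lax ::
  "(real \<Rightarrow> real) \<Rightarrow> (real \<Rightarrow> real) \<Rightarrow> (real \<Rightarrow> real) \<Rightarrow> real \<Rightarrow> complex \<Rightarrow> cmat2"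
  where "U_lax u0 u0x u1 x k = U0 u0x u1 x + (1 / k) *m U1 u0 x"


text \<open>\<open>colwise A B\<close> encodes \<open>k \<in> (A, B)\<close>: a statement about column \<open>c\<close> is required for
  \<open>k \<in> colwise A B c\<close>.\<close>

definition colwise :: "complex set \<Rightarrow> complex set \<Rightarrow> 2 \<Rightarrow> complex set"
  where "colwise A B c = (if c = 1 then A else B)"

definition D1 :: "complex set" where "D1 = {k. Im k > 0 \<and> norm k > 1}"
definition D4 :: "complex set" where "D4 = {k. Im k < 0 \<and> norm k > 1}"


text \<open>Column \<open>c\<close> of the integrands below only involves column \<open>c\<close> of the unknown, so the
  equation for \<open>X\<close> does not constrain the values of a column at those \<open>k\<close> where this column is
  undefined. The integral from infinity to \<open>x\<close> is minus the integral over \<open>{x..}\<close>.\<close>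

definition volterra_integrand ::
  "(real \<Rightarrow> complex \<Rightarrow> cmat2) \<Rightarrow> (real \<Rightarrow> complex \<Rightarrow> cmat2) \<Rightarrow> complex \<Rightarrow> real \<Rightarrow> real \<Rightarrow> cmat2"
  where "volterra_integrand U M k x t =
    exp_hat_sigma3 (\<i> * theta1 k * of_real (t - x)) (U t k ** M t k)"

definition volterra_X ::
  "(real \<Rightarrow> complex \<Rightarrow> cmat2) \<Rightarrow> (real \<Rightarrow> complex \<Rightarrow> cmat2) \<Rightarrow> bool"
  where "volterra_X U X \<longleftrightarrow>
    (\<forall>c. \<forall>k \<in> colwise ({k. Im k \<le> 0} - {0}) ({k. Im k \<ge> 0} - {0}) c. \<forall>x\<ge>0.
      (\<lambda>t. column c (volterra_integrand U X k x t)) absolutely_integrable_on {x..} \<and>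
      column c (X x k) =
        column c (mat 1) - integral {x..} (\<lambda>t. column c (volterra_integrand U X k x t)))"

definition volterra_Y ::
  "(real \<Rightarrow> complex \<Rightarrow> cmat2) \<Rightarrow> (real \<Rightarrow> complex \<Rightarrow> cmat2) \<Rightarrow> bool"
  where "volterra_Y U Y \<longleftrightarrow>
    (\<forall>k. k \<noteq> 0 \<longrightarrow> (\<forall>x\<ge>0.
      volterra_integrand U Y k x absolutely_integrable_on {0..x} \<and>
      Y x k = mat 1 + integral {0..x} (volterra_integrand U Y k x)))"


definition test_function :: "(real \<Rightarrow> real) \<Rightarrow> bool"
  where "test_function \<phi> \<longleftrightarrow>
    (\<forall>i. (deriv ^^ i) \<phi> differentiable_on UNIV) \<and>
    (\<exists>a b. 0 < a \<and> (\<forall>t. t \<notin> {a..b} \<longrightarrow> \<phi> t = 0))"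

definition weak_derivative :: "(real \<Rightarrow> real) \<Rightarrow> (real \<Rightarrow> real) \<Rightarrow> bool"
  where "weak_derivative f g \<longleftrightarrow>
    (\<forall>a b. 0 < a \<longrightarrow> f absolutely_integrable_on {a..b} \<and> g absolutely_integrable_on {a..b}) \<and>
    (\<forall>\<phi>. test_function \<phi> \<longrightarrow>
      integral {0..} (\<lambda>t. f t * deriv \<phi> t) = - integral {0..} (\<lambda>t. g t * \<phi> t))"

text \<open>\<open>f\<close> is \<open>N\<close> times weakly differentiable on \<open>[0,\<infinity>)\<close> with weak derivatives \<open>d 0 = f\<close>, \<open>d 1\<close>,
  ..., \<open>d N\<close>. Weakly differentiable functions of one variable have continuous representatives;
  as pointwise values of \<open>d i\<close>, \<open>i < N\<close>, enter the formal expansions, \<open>d i\<close> is the continuous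
  representative for these \<open>i\<close>. The derivative of top order is only determined almost everywhere.\<close>

definition weak_derivatives :: "nat \<Rightarrow> (real \<Rightarrow> real) \<Rightarrow> (nat \<Rightarrow> real \<Rightarrow> real) \<Rightarrow> bool"
  where "weak_derivatives N f d \<longleftrightarrow>
    (\<forall>x\<ge>0. d 0 x = f x) \<and>
    (\<forall>i<N. continuous_on {0..} (d i) \<and> weak_derivative (d i) (d (Suc i)))"


text \<open>Coefficients with index \<open>-1\<close> are zero.\<close>

definition pre :: "(nat \<Rightarrow> real \<Rightarrow> cmat2) \<Rightarrow> nat \<Rightarrow> real \<Rightarrow> cmat2"
  where "pre A j x = (if j = 0 then 0 else A (j - 1) x)"

text \<open>The recursions are imposed up to order \<open>N\<close> only, because each order uses one more derivative
  of the coefficients. The derivatives are one-sided at \<open>x = 0\<close>. In both recursions \<open>V0\<close> and \<open>V1\<close>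
  stand for the two coefficients of the Lax matrix.\<close>

definition recursion_XZ ::
  "(real \<Rightarrow> cmat2) \<Rightarrow> (real \<Rightarrow> cmat2) \<Rightarrow> nat \<Rightarrow> (nat \<Rightarrow> real \<Rightarrow> cmat2) \<Rightarrow> bool"
  where "recursion_XZ V0 V1 N A \<longleftrightarrow>
    (\<forall>j<N. \<forall>x\<ge>0.
      (\<lambda>t. off_part (A j t)) differentiable (at x within {0..}) \<and>
      off_part (A (Suc j) x) = (- 2 * \<i>) *m sigma3 **
        (- vector_derivative (\<lambda>t. off_part (A j t)) (at x within {0..})
         + (\<i> / 2) *m sigma3 ** off_part (pre A j x)
         + V0 x ** diag_part (A j x)
         + off_part (V1 x) ** diag_part (pre A j x)
         + diag_part (V1 x) ** off_part (pre A j x)) \<and>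
      ((\<lambda>t. diag_part (A (Suc j) t)) has_vector_derivative
        (V0 x ** off_part (A (Suc j) x)
         + off_part (V1 x) ** off_part (A j x)
         + diag_part (V1 x) ** diag_part (A j x))) (at x within {0..}))"

definition recursion_W ::
  "(real \<Rightarrow> cmat2) \<Rightarrow> (real \<Rightarrow> cmat2) \<Rightarrow> nat \<Rightarrow> (nat \<Rightarrow> real \<Rightarrow> cmat2) \<Rightarrow> bool"
  where "recursion_W V0 V1 N W \<longleftrightarrow>
    (\<forall>j<N. \<forall>x\<ge>0.
      (\<lambda>t. diag_part (W j t)) differentiable (at x within {0..}) \<and>
      diag_part (W (Suc j) x) = (- 2 * \<i>) *m sigma3 **
        (- vector_derivative (\<lambda>t. diag_part (W j t)) (at x within {0..})
         + (\<i> / 2) *m sigma3 ** diag_part (pre W j x)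
         + V0 x ** off_part (W j x)
         + off_part (V1 x) ** off_part (pre W j x)
         + diag_part (V1 x) ** diag_part (pre W j x)) \<and>
      ((\<lambda>t. off_part (W (Suc j) t)) has_vector_derivative
        (V0 x ** diag_part (W (Suc j) x)
         + off_part (V1 x) ** diag_part (W j x)
         + diag_part (V1 x) ** off_part (W j x))) (at x within {0..}))"

definition formal_X ::
  "(real \<Rightarrow> cmat2) \<Rightarrow> (real \<Rightarrow> cmat2) \<Rightarrow> nat \<Rightarrow> (nat \<Rightarrow> real \<Rightarrow> cmat2) \<Rightarrow> bool"
  where "formal_X V0 V1 N A \<longleftrightarrow>
    (\<forall>x\<ge>0. A 0 x = mat 1) \<and> recursion_XZ V0 V1 N A \<and>
    (\<forall>j\<in>{1..N}. (A j \<longlongrightarrow> 0) at_top)"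

definition formal_Y ::
  "(real \<Rightarrow> cmat2) \<Rightarrow> (real \<Rightarrow> cmat2) \<Rightarrow> nat \<Rightarrow>
   (nat \<Rightarrow> real \<Rightarrow> cmat2) \<Rightarrow> (nat \<Rightarrow> real \<Rightarrow> cmat2) \<Rightarrow> bool"
  where "formal_Y V0 V1 N Z W \<longleftrightarrow>
    (\<forall>x\<ge>0. Z 0 x = mat 1 \<and> W 0 x = 0) \<and> recursion_XZ V0 V1 N Z \<and> recursion_W V0 V1 N W \<and>
    (\<forall>j\<in>{1..N}. Z j 0 + W j 0 = 0)"

definition X_trunc :: "(nat \<Rightarrow> real \<Rightarrow> cmat2) \<Rightarrow> nat \<Rightarrow> real \<Rightarrow> complex \<Rightarrow> cmat2"
  where "X_trunc A N x k = mat 1 + (\<Sum>j=1..N. (1 / k ^ j) *m A j x)"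

definition Y_trunc ::
  "(nat \<Rightarrow> real \<Rightarrow> cmat2) \<Rightarrow> (nat \<Rightarrow> real \<Rightarrow> cmat2) \<Rightarrow> nat \<Rightarrow> real \<Rightarrow> complex \<Rightarrow> cmat2"
  where "Y_trunc Z W N x k = mat 1 + (\<Sum>j=1..N. (1 / k ^ j) *m Z j x)
    + (\<Sum>j=1..N. (1 / k ^ j) *m W j x) ** exp_sigma3 (2 * \<i> * theta1 k * of_real x)"


text \<open>\<open>F 0, \<dots>, F n\<close> are the \<open>k\<close>-derivatives of \<open>f\<close> up to order \<open>n\<close>, where column \<open>c\<close> is considered
  on the closure of the open set \<open>D c\<close>: complex derivatives in \<open>D c\<close>, continuous extensions of
  these at boundary points. This determines column \<open>c\<close> of each \<open>F j\<close> on the closure of \<open>D c\<close>.\<close>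

definition k_derivatives ::
  "(2 \<Rightarrow> complex set) \<Rightarrow> nat \<Rightarrow> (complex \<Rightarrow> cmat2) \<Rightarrow> (nat \<Rightarrow> complex \<Rightarrow> cmat2) \<Rightarrow> bool"
  where "k_derivatives D n f F \<longleftrightarrow>
    (\<forall>c. (\<forall>k\<in>closure (D c). column c (F 0 k) = column c (f k)) \<and>
         (\<forall>j\<le>n. continuous_on (closure (D c)) (\<lambda>k. column c (F j k))) \<and>
         (\<forall>j<n. \<forall>k\<in>D c. \<forall>i.
           ((\<lambda>z. F j z $ i $ c) has_field_derivative F (Suc j) k $ i $ c) (at k)))"

text \<open>All derivatives of \<open>f x\<close> up to order \<open>n\<close> exist and \<open>j\<close>-th derivatives are bounded by \<open>B j x k\<close>
  for all \<open>x \<ge> 0\<close> and \<open>k\<close> in the closed domains, columnwise. The norm of a column is the Euclidean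
  one.\<close>

definition k_derivatives_bounded ::
  "(2 \<Rightarrow> complex set) \<Rightarrow> nat \<Rightarrow> (real \<Rightarrow> complex \<Rightarrow> cmat2) \<Rightarrow>
   (nat \<Rightarrow> real \<Rightarrow> complex \<Rightarrow> real) \<Rightarrow> bool"
  where "k_derivatives_bounded D n f B \<longleftrightarrow>
    (\<forall>x\<ge>0. \<exists>F. k_derivatives D n (f x) F \<and>
      (\<forall>j\<le>n. \<forall>c. \<forall>k\<in>closure (D c). norm (column c (F j k)) \<le> B j x k))"

end

theory Submission
  imports Defs
begin

text \<open>
The idea of the proof is to derive, for the difference between a solution and its truncated expansion,
a Volterra equation whose inhomogeneity is of order \<open>k^-(m+1)\<close> and integrable with a weight, and to
solve it by a Neumann series that controls the derivatives in \<open>k\<close> at the same time.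

Continuous functions with a weak derivative are indefinite integrals (\<open>weak_derivative_increment\<close>).
Hence the coefficients \<open>U0\<close> and \<open>U1\<close> of the Lax matrix have \<open>m\<close> continuous derivatives, the last one
absolutely continuous, and are integrable with weight \<open>(1 + x)^n\<close> together with their derivatives
up to order \<open>m + 1\<close> (\<open>lax_coefficients_regular\<close>). Each step of the recursion consists of algebraic
operations, one differentiation and one integration of a weighted integrable function. It can be
carried out up to order \<open>m + 1\<close>, and the normalizations fix the constants of integration. The
recursions for \<open>X, Z\<close> and for \<open>W\<close> differ only by exchanging the diagonal and the off-diagonal part and
are treated as one. By telescoping, the truncated series satisfies the differential equation up to
\<open>k^-(m+1)\<close> times a weighted integrable function (\<open>expansion_residual\<close>).

By variation of constants, each column of \<open>X - X\<^sub>p\<close>, of \<open>Y - Y\<^sub>p\<close> and of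
\<open>(Y - Y\<^sub>p) exp (- 2 i \<theta>\<^sub>1 x \<sigma>\<^sub>3)\<close> then satisfies a Volterra equation, with integrals over
\<open>[x,\<infinity>)\<close> in the first and over \<open>[0,x]\<close> in the other cases. In the respective domains of \<open>k\<close> the
exponentials in the kernel are bounded by 1, and their Taylor coefficients of order \<open>j\<close> in \<open>k\<close> by
\<open>(2 (1 + |x - t|))^j\<close> (\<open>exp_jet_bound\<close>). The values at \<open>k\<close> of a function and its derivatives up to order
\<open>n\<close> are collected in a formal power series, called a jet. In jets, the Neumann series converges
geometrically when measured against the exponential of a large multiple of \<open>\<integral> (|U0| + |U1|)\<close>
(\<open>volterra_jet_bound\<close>). The factors \<open>1 + |x - t|\<close> are absorbed by the decay \<open>(1 + x)^(j - n)\<close> for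
integrals over \<open>[x,\<infinity>)\<close>, and cause the growth \<open>(1 + x)^j\<close> for integrals over \<open>[0,x]\<close>.

The series represents the given solutions, as they are bounded for fixed \<open>k\<close>. For \<open>Y\<close> this holds on
bounded intervals by continuity, which is all that is needed. For \<open>X\<close>, only integrability of the integrand
is known beforehand, and boundedness is a separate argument (\<open>volterra_right_bounded\<close>).
\<close>

section \<open>Smooth test functions and weak derivatives\<close>

text \<open>The functions \<open>P(x) / (x (1 - x))^k * exp (- 1 / (x (1 - x)))\<close> on \<open>(0,1)\<close>, extended by zero, with \<open>P\<close>
a polynomial. This family is closed under differentiation, so all its members are smooth.\<close>

definition flat_fun :: "real poly \<Rightarrow> nat \<Rightarrow> real \<Rightarrow> real" where
  "flat_fun P k x =
    (if 0 < x \<and> x < 1 then poly P x / (x * (1 - x)) ^ k * exp (- (1 / (x * (1 - x)))) else 0)"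

lemma exp_minus_inverse_le_power:
  fixes w :: real
  assumes "w > 0"
  shows "exp (- (1 / w)) \<le> fact m * w ^ m"
proof -
  have "(1 / w) ^ m / fact m \<le> exp (1 / w)"
  proof -
    have "(\<lambda>n. (1 / w) ^ n /\<^sub>R fact n) sums exp (1 / w)"
      by (rule exp_converges)
    then have "(\<Sum>n\<in>{m}. (1 / w) ^ n /\<^sub>R fact n) \<le> exp (1 / w)"
      using assms sum_le_suminf[of "\<lambda>n. (1 / w) ^ n /\<^sub>R fact n" "{m}"] by (auto simp: sums_iff)
    then show ?thesis by (simp add: field_simps)
  qed
  then show ?thesis
    using assms by (simp add: exp_minus field_simps power_one_over)
qed

lemma flat_fun_quadratic_bound:
  obtains C where "\<And>y. \<bar>flat_fun P k y\<bar> \<le> C * y\<^sup>2" "\<And>y. \<bar>flat_fun P k y\<bar> \<le> C * (y - 1)\<^sup>2"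
proof -
  have "compact (poly P ` {0..1})"
    by (intro compact_continuous_image continuous_intros) auto
  then obtain M where M: "\<And>y. y \<in> {0..1} \<Longrightarrow> \<bar>poly P y\<bar> \<le> M"
    using compact_imp_bounded bounded_real by (metis image_eqI)
  define C where "C = M * fact (k + 2)"
  have M0: "M \<ge> 0" using M[of 0] by auto
  have main: "\<bar>flat_fun P k y\<bar> \<le> C * (y * (1 - y))\<^sup>2" for y
  proof (cases "0 < y \<and> y < 1")
    case True
    define w where "w = y * (1 - y)"
    have w: "w > 0" using True by (simp add: w_def)
    have "\<bar>flat_fun P k y\<bar> = \<bar>poly P y\<bar> * (exp (- (1 / w)) / w ^ k)"
      using True w by (simp add: flat_fun_def w_def[symmetric] abs_mult)
    also have "\<dots> \<le> M * ((fact (k + 2) * w ^ (k + 2)) / w ^ k)"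
      using w M0 True by (intro mult_mono M divide_right_mono exp_minus_inverse_le_power) auto
    also have "\<dots> = C * w\<^sup>2"
      using w by (simp add: C_def power_add power2_eq_square)
    finally show ?thesis by (simp add: w_def)
  next
    case False
    then show ?thesis by (auto simp: flat_fun_def C_def M0)
  qed
  have C0: "C \<ge> 0" using M0 by (simp add: C_def)
  have "\<bar>flat_fun P k y\<bar> \<le> C * y\<^sup>2 \<and> \<bar>flat_fun P k y\<bar> \<le> C * (y - 1)\<^sup>2" for y
  proof (cases "0 < y \<and> y < 1")
    case True
    then have "(y * (1 - y))\<^sup>2 \<le> y\<^sup>2" "(y * (1 - y))\<^sup>2 \<le> (1 - y)\<^sup>2"
      by (auto simp: power_mult_distrib mult_left_le mult_left_le_one_le power_le_one)
    then have "(y * (1 - y))\<^sup>2 \<le> y\<^sup>2" "(y * (1 - y))\<^sup>2 \<le> (y - 1)\<^sup>2"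
      by (auto simp: power2_commute)
    then show ?thesis using main[of y] C0 by (meson mult_left_mono order_trans)
  next
    case False
    then show ?thesis using C0 by (auto simp: flat_fun_def)
  qed
  then show ?thesis using that by blast
qed

lemma DERIV_zero_if_quadratic_bound:
  fixes f :: "real \<Rightarrow> real"
  assumes "\<And>y. \<bar>f y\<bar> \<le> C * (y - x)\<^sup>2"
  shows "(f has_real_derivative 0) (at x)"
proof -
  have fx: "f x = 0" using assms[of x] by simp
  have "((\<lambda>y. (f y - f x) / (y - x)) \<longlongrightarrow> 0) (at x)"
  proof (rule Lim_null_comparison)
    show "\<forall>\<^sub>F y in at x. norm ((f y - f x) / (y - x)) \<le> C * \<bar>y - x\<bar>"
      using assms by (auto simp: eventually_at_filter fx divide_simps power2_eq_square abs_mult mult.assoc)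
    have "((\<lambda>y. C * \<bar>y - x\<bar>) \<longlongrightarrow> C * \<bar>x - x\<bar>) (at x)"
      by (intro tendsto_intros)
    then show "((\<lambda>y. C * \<bar>y - x\<bar>) \<longlongrightarrow> 0) (at x)" by simp
  qed
  then show ?thesis by (simp add: has_field_derivative_iff)
qed

lemma DERIV_divide_power_mult_exp_minus_inverse:
  fixes f :: "real \<Rightarrow> real"
  assumes "(f has_real_derivative f') (at x)" "(p has_real_derivative p') (at x)" "f x > 0"
  shows "((\<lambda>x. p x / f x ^ k * exp (- (1 / f x))) has_real_derivative
        (p' * f x ^ k - p x * (of_nat k * f x ^ (k - Suc 0) * f')) / (f x ^ k * f x ^ k)
          * exp (- (1 / f x)) + p x / f x ^ k * (exp (- (1 / f x)) * (f' / (f x * f x)))) (at x)"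
  using assms(3) by (auto intro!: derivative_eq_intros assms(1,2) simp: field_simps)

lemma flat_fun_has_derivative:
  "\<exists>Q. \<forall>x. (flat_fun P k has_real_derivative flat_fun Q (k + 2) x) (at x)"
proof -
  define w :: "real poly" where "w = [:0, 1, -1:]"
  define w' :: "real poly" where "w' = [:1, -2:]"
  define Q where "Q = pderiv P * w\<^sup>2 - smult (of_nat k) (P * w' * w) + P * w'"
  have "(flat_fun P k has_real_derivative flat_fun Q (k + 2) x) (at x)" for x
  proof -
    consider "0 < x \<and> x < 1" | "x < 0" | "x > 1" | "x = 0" | "x = 1" by linarith
    then show ?thesis
    proof cases
      case 1
      define v where "v = x * (1 - x)"
      have v: "v > 0" using 1 by (simp add: v_def)
      have pw: "poly w x = v" "poly w' x = 1 - 2 * x"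
        by (simp_all add: w_def w'_def v_def algebra_simps)
      have k: "of_nat k * v ^ (k - Suc 0) * v = real k * v ^ k"
        by (cases k) auto
      have "((\<lambda>x. poly P x / (x * (1 - x)) ^ k * exp (- (1 / (x * (1 - x))))) has_real_derivative
        (poly (pderiv P) x * v ^ k - poly P x * (of_nat k * v ^ (k - Suc 0) * (1 - 2 * x))) / (v ^ k * v ^ k)
          * exp (- (1 / v)) + poly P x / v ^ k * (exp (- (1 / v)) * ((1 - 2 * x) / (v * v)))) (at x)"
      proof -
        have "((\<lambda>x. x * (1 - x)) has_real_derivative (1 - 2 * x)) (at x)"
          by (auto intro!: derivative_eq_intros simp: algebra_simps)
        from DERIV_divide_power_mult_exp_minus_inverse[OF this poly_DERIV, where k = k] show ?thesis using v unfolding v_def by simp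
      qed
      also have "(poly (pderiv P) x * v ^ k - poly P x * (of_nat k * v ^ (k - Suc 0) * (1 - 2 * x))) / (v ^ k * v ^ k)
          * exp (- (1 / v)) + poly P x / v ^ k * (exp (- (1 / v)) * ((1 - 2 * x) / (v * v)))
          = (poly (pderiv P) x * v\<^sup>2 - real k * (poly P x * (1 - 2 * x) * v) + poly P x * (1 - 2 * x)) / v ^ (k + 2) * exp (- (1 / v))"
      proof -
        have kv: "of_nat k * v ^ (k - Suc 0) = real k * v ^ k / v"
          using v by (cases k) auto
        have alg: "(a * V - p * (n * V / v * c)) / (V * V) * e + p / V * (e * (c / (v * v)))
          = (a * v\<^sup>2 - n * (p * c * v) + p * c) / (V * v\<^sup>2) * e" if "V > 0" for a p n c e V :: real
          using v that by (simp add: field_simps power2_eq_square)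
        show ?thesis using alg[of "v ^ k"] v unfolding kv by (simp add: power_add power2_eq_square)
      qed
      also have "\<dots> = flat_fun Q (k + 2) x"
        using 1 by (simp add: flat_fun_def Q_def pw v_def[symmetric])
      finally show ?thesis
        by (rule has_field_derivative_transform_within_open[where S = "{0<..<1}"])
          (use 1 in \<open>auto simp: flat_fun_def\<close>)
    next
      case 2
      have "((\<lambda>x. 0) has_real_derivative 0) (at x)" by simp
      then have "(flat_fun P k has_real_derivative 0) (at x)"
        by (rule has_field_derivative_transform_within_open[where S = "{..<0}"])
          (use 2 in \<open>auto simp: flat_fun_def\<close>)
      then show ?thesis using 2 by (simp add: flat_fun_def)
    next
      case 3
      have "((\<lambda>x. 0) has_real_derivative 0) (at x)" by simp
      then have "(flat_fun P k has_real_derivative 0) (at x)"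
        by (rule has_field_derivative_transform_within_open[where S = "{1<..}"])
          (use 3 in \<open>auto simp: flat_fun_def\<close>)
      then show ?thesis using 3 by (simp add: flat_fun_def)
    next
      case 4
      then show ?thesis
        using flat_fun_quadratic_bound[of P k] DERIV_zero_if_quadratic_bound[of "flat_fun P k" _ 0]
        by (simp add: flat_fun_def) (metis diff_zero)
    next
      case 5
      then show ?thesis
        using flat_fun_quadratic_bound[of P k] DERIV_zero_if_quadratic_bound[of "flat_fun P k" _ 1]
        by (simp add: flat_fun_def) metis
    qed
  qed
  then show ?thesis by blast
qed

text \<open>A smooth step: \<open>\<Psi>\<close> vanishes on the left of 0 and equals 1 on the right of 1; its derivative is a
nonnegative bump supported in \<open>[0,1]\<close>.\<close>

lemma smooth_step_exists:
  obtains \<Psi> :: "real \<Rightarrow> real" and P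
  where "\<And>x. (\<Psi> has_real_derivative flat_fun P 0 x) (at x)" "\<And>x. flat_fun P 0 x \<ge> 0"
    "\<And>x. x \<le> 0 \<Longrightarrow> \<Psi> x = 0" "\<And>x. x \<ge> 1 \<Longrightarrow> \<Psi> x = 1" "\<And>x. 0 \<le> \<Psi> x \<and> \<Psi> x \<le> 1"
proof -
  have cont: "continuous_on A (flat_fun P 0)" for A P
    using flat_fun_has_derivative[of P 0]
    by (meson DERIV_isCont continuous_at_imp_continuous_on)
  define I where "I = integral {0..1} (flat_fun 1 0)"
  have nonneg: "flat_fun 1 0 x \<ge> 0" for x by (simp add: flat_fun_def)
  have "I \<ge> 0" unfolding I_def by (intro integral_nonneg integrable_continuous_real cont) (simp add: nonneg)
  moreover have "I \<noteq> 0"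
  proof
    assume "I = 0"
    then have "((flat_fun 1 0) has_integral 0) (cbox 0 1)"
      unfolding I_def using integrable_integral[OF integrable_continuous_real[OF cont[of "{0..1}" 1]]] by simp
    then have "flat_fun 1 0 (1/2) = 0"
      by (rule has_integral_0_cbox_imp_0[OF cont, rotated]) (auto simp: nonneg)
    then show False by (simp add: flat_fun_def)
  qed
  ultimately have I: "I > 0" by simp
  define P :: "real poly" where "P = [:1 / I:]"
  have P: "flat_fun P 0 x = flat_fun 1 0 x / I" for x
    by (simp add: flat_fun_def P_def)
  have Pnn: "flat_fun P 0 x \<ge> 0" for x using nonneg[of x] I by (simp add: P)
  define \<Psi> where "\<Psi> x = (if x \<le> -1 then 0 else integral {-1..x} (flat_fun P 0))" for x
  have one: "integral {0..1} (flat_fun P 0) = 1"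
    using I by (simp add: P[abs_def] I_def[symmetric])
  have der: "(\<Psi> has_real_derivative flat_fun P 0 x) (at x)" if "x > -1" for x
  proof -
    have "((\<lambda>u. integral {-1..u} (flat_fun P 0)) has_real_derivative flat_fun P 0 x) (at x within {-1..x+1})"
      using that by (intro integral_has_real_derivative cont) auto
    then have "((\<lambda>u. integral {-1..u} (flat_fun P 0)) has_real_derivative flat_fun P 0 x) (at x)"
      using that by (subst (asm) at_within_interior) auto
    then show ?thesis
      by (rule has_field_derivative_transform_within_open[where S = "{-1<..}"])
        (use that in \<open>auto simp: \<Psi>_def\<close>)
  qed
  have le0: "\<Psi> x = 0" if "x \<le> 0" for x
  proof (cases "x \<le> -1")
    case False
    have "integral {-1..x} (flat_fun P 0) = integral {-1..x} (\<lambda>x. 0)"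
      using that by (intro Henstock_Kurzweil_Integration.integral_cong) (auto simp: flat_fun_def)
    then show ?thesis using False by (simp add: \<Psi>_def)
  qed (simp add: \<Psi>_def)
  have der': "(\<Psi> has_real_derivative flat_fun P 0 x) (at x)" for x
  proof (cases "x > -1")
    case False
    have "((\<lambda>x. 0) has_real_derivative 0) (at x)" by simp
    then have "(\<Psi> has_real_derivative 0) (at x)"
      by (rule has_field_derivative_transform_within_open[where S = "{..<0}"])
        (use False le0 in \<open>auto\<close>)
    then show ?thesis using False by (simp add: flat_fun_def)
  qed (rule der)
  have mono: "\<Psi> x \<le> \<Psi> y" if "x \<le> y" for x y
    using DERIV_nonneg_imp_nondecreasing[OF that] der' Pnn by meson
  have ge1: "\<Psi> x = 1" if "x \<ge> 1" for x
  proof -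
    have int: "flat_fun P 0 integrable_on {a..b}" for a b
      by (intro integrable_continuous_real cont)
    have "integral {-1..x} (flat_fun P 0) = integral {-1..0} (flat_fun P 0) + integral {0..1} (flat_fun P 0)
       + integral {1..x} (flat_fun P 0)"
      using that Henstock_Kurzweil_Integration.integral_combine[of "-1" 0 1 "flat_fun P 0"]
       Henstock_Kurzweil_Integration.integral_combine[of "-1" 1 x "flat_fun P 0"] int by simp
    also have "integral {-1..0} (flat_fun P 0) = 0"
      using le0[of 0] by (simp add: \<Psi>_def)
    also have "integral {1..x} (flat_fun P 0) = integral {1..x} (\<lambda>x. 0)"
      by (intro Henstock_Kurzweil_Integration.integral_cong) (auto simp: flat_fun_def)
    finally show ?thesis using that one by (simp add: \<Psi>_def)
  qed
  have "0 \<le> \<Psi> x \<and> \<Psi> x \<le> 1" for x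
    using mono[of x 1] mono[of 0 x] le0[of 0] ge1[of 1] le0[of x] ge1[of x] by linarith
  then show ?thesis using that[OF der' Pnn le0 ge1] by blast
qed

lemma flat_fun_scaled_derivatives:
  assumes "e > 0"
  shows "\<exists>Q. \<forall>x. ((\<lambda>t. c * flat_fun P k ((t - a) / e) - c * flat_fun P k ((t - b) / e)) has_real_derivative
      (c / e) * flat_fun Q (k + 2) ((x - a) / e) - (c / e) * flat_fun Q (k + 2) ((x - b) / e)) (at x)"
proof -
  obtain Q where Q: "\<And>x. (flat_fun P k has_real_derivative flat_fun Q (k + 2) x) (at x)"
    using flat_fun_has_derivative by blast
  have "((\<lambda>t. flat_fun P k ((t - a) / e)) has_real_derivative flat_fun Q (k + 2) ((x - a) / e) * (1 / e)) (at x)" for a x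
    by (rule DERIV_chain2[OF Q]) (use assms in \<open>auto intro!: derivative_eq_intros\<close>)
  then have "((\<lambda>t. c * flat_fun P k ((t - a) / e) - c * flat_fun P k ((t - b) / e)) has_real_derivative
      c * (flat_fun Q (k + 2) ((x - a) / e) * (1 / e)) - c * (flat_fun Q (k + 2) ((x - b) / e) * (1 / e))) (at x)" for x
    by (intro DERIV_diff DERIV_cmult)
  then show ?thesis by (intro exI[of _ Q]) (simp add: field_simps)
qed

lemma flat_fun_scaled_smooth:
  assumes "e > 0"
  shows "(deriv ^^ i) (\<lambda>t. c * flat_fun P k ((t - a) / e) - c * flat_fun P k ((t - b) / e)) differentiable_on UNIV"
proof -
  have "\<exists>c' P' k'. (deriv ^^ i) (\<lambda>t. c * flat_fun P k ((t - a) / e) - c * flat_fun P k ((t - b) / e))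
     = (\<lambda>t. c' * flat_fun P' k' ((t - a) / e) - c' * flat_fun P' k' ((t - b) / e))"
  proof (induction i)
    case (Suc i)
    then obtain c' P' k' where *: "(deriv ^^ i) (\<lambda>t. c * flat_fun P k ((t - a) / e) - c * flat_fun P k ((t - b) / e))
     = (\<lambda>t. c' * flat_fun P' k' ((t - a) / e) - c' * flat_fun P' k' ((t - b) / e))" by blast
    obtain Q where Q: "\<And>x. ((\<lambda>t. c' * flat_fun P' k' ((t - a) / e) - c' * flat_fun P' k' ((t - b) / e)) has_real_derivative
      (c' / e) * flat_fun Q (k' + 2) ((x - a) / e) - (c' / e) * flat_fun Q (k' + 2) ((x - b) / e)) (at x)"
      using flat_fun_scaled_derivatives[OF assms, of c' P' k' a b] by blast
    show ?case
      by (rule exI[of _ "c' / e"], rule exI[of _ Q], rule exI[of _ "k' + 2"])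
        (simp only: funpow.simps comp_apply * DERIV_imp_deriv[OF Q])
  qed auto
  then obtain c' P' k' where *: "(deriv ^^ i) (\<lambda>t. c * flat_fun P k ((t - a) / e) - c * flat_fun P k ((t - b) / e))
     = (\<lambda>t. c' * flat_fun P' k' ((t - a) / e) - c' * flat_fun P' k' ((t - b) / e))" by blast
  show ?thesis unfolding * differentiable_on_def
    using flat_fun_scaled_derivatives[OF assms, of c' P' k' a b]
    by (meson differentiable_at_withinI real_differentiable_def)
qed

text \<open>A continuous function with a weak derivative \<open>g\<close> is a primitive of \<open>g\<close> on every interval in
\<open>(0,\<infinity>)\<close>. The test functions are \<open>\<Psi>((t - a)/e) - \<Psi>((t - b)/e)\<close>: as \<open>e\<close> tends to 0 they tend
boundedly to the indicator of \<open>(a,b]\<close>, while their derivatives are differences of averaging kernels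
at \<open>a\<close> and \<open>b\<close>.\<close>

lemma weak_derivative_increment:
  assumes wd: "weak_derivative f g" and cont: "continuous_on {0..} f"
    and ab: "0 < a" "a < b"
  shows "f b - f a = integral {a..b} g"
proof -
  obtain \<Psi> P where der: "\<And>x. (\<Psi> has_real_derivative flat_fun P 0 x) (at x)"
    and nn: "\<And>x. flat_fun P 0 x \<ge> 0"
    and le0: "\<And>x. x \<le> 0 \<Longrightarrow> \<Psi> x = 0" and ge1: "\<And>x. x \<ge> 1 \<Longrightarrow> \<Psi> x = 1"
    and bd: "\<And>x. 0 \<le> \<Psi> x \<and> \<Psi> x \<le> 1"
    using smooth_step_exists by metis
  have cP: "continuous_on A (flat_fun P 0)" for A
    using flat_fun_has_derivative[of P 0]
    by (meson DERIV_isCont continuous_at_imp_continuous_on)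
  define \<eta> where "\<eta> e c t = (1 / e) * flat_fun P 0 ((t - c) / e)" for e c t :: real
  have c\<eta>: "continuous_on A (\<eta> e c)" if "e > 0" for A e c
    unfolding \<eta>_def using that
    by (intro continuous_intros continuous_on_compose2[OF cP[of UNIV]]) auto
  have \<eta>0: "\<eta> e c t = 0" if "e > 0" "t \<notin> {c..c+e}" for e c t
    using that by (auto simp: \<eta>_def flat_fun_def divide_simps)
  have dPsi: "((\<lambda>t. \<Psi> ((t - c) / e)) has_real_derivative \<eta> e c x) (at x)" if "e > 0" for c e x
    proof -
    have "((\<lambda>t. \<Psi> ((t - c) / e)) has_real_derivative flat_fun P 0 ((x - c) / e) * (1 / e)) (at x)"
      by (rule DERIV_chain2[OF der]) (use that in \<open>auto intro!: derivative_eq_intros\<close>)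
    then show ?thesis by (simp add: \<eta>_def mult.commute)
  qed
  have \<eta>1: "(\<eta> e c has_integral 1) {c..c+e}" if "e > 0" for e c
  proof -
    have "(\<eta> e c has_integral \<Psi> ((c + e - c) / e) - \<Psi> ((c - c) / e)) {c..c+e}"
      using that
      by (intro fundamental_theorem_of_calculus)
        (auto simp flip: has_real_derivative_iff_has_vector_derivative intro: DERIV_subset dPsi)
    then show ?thesis using that le0[of 0] ge1[of 1] by simp
  qed
  define \<phi> where "\<phi> e t = \<Psi> ((t - a) / e) - \<Psi> ((t - b) / e)" for e t
  have d\<phi>: "(\<phi> e has_real_derivative \<eta> e a x - \<eta> e b x) (at x)" if "e > 0" for e x
    unfolding \<phi>_def using that by (intro DERIV_diff dPsi)
  have \<phi>0: "\<phi> e t = 0" if "e > 0" "t \<notin> {a..b+e}" for e t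
    using that ab by (auto simp: \<phi>_def le0 ge1 divide_simps)
  have test: "test_function (\<phi> e)" if "e > 0" for e
    unfolding test_function_def
  proof (intro conjI allI)
    fix i
    have d: "deriv (\<phi> e) = (\<lambda>t. (1 / e) * flat_fun P 0 ((t - a) / e) - (1 / e) * flat_fun P 0 ((t - b) / e))"
      using DERIV_imp_deriv[OF d\<phi>[OF that]] by (auto simp: \<eta>_def)
    show "(deriv ^^ i) (\<phi> e) differentiable_on UNIV"
    proof (cases i)
      case 0
      then show ?thesis using d\<phi>[OF that]
        by (simp add: differentiable_on_def) (metis real_differentiable_def)
    next
      case (Suc l)
      show ?thesis
        unfolding Suc funpow_Suc_right comp_apply d by (rule flat_fun_scaled_smooth[OF that])
    qed
    show "\<exists>a b. 0 < a \<and> (\<forall>t. t \<notin> {a..b} \<longrightarrow> \<phi> e t = 0)"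
      using \<phi>0[OF that] ab by blast
  qed
  have weak: "integral {0..} (\<lambda>t. f t * (\<eta> e a t - \<eta> e b t)) = - integral {0..} (\<lambda>t. g t * \<phi> e t)" if "e > 0" for e
    using wd test[OF that] DERIV_imp_deriv[OF d\<phi>[OF that]] by (auto simp: weak_derivative_def)
  define e where "e n = 1 / real (Suc n)" for n
  have e0: "e n > 0" for n by (simp add: e_def)
  have elim: "e \<longlonglongrightarrow> 0" unfolding e_def by (rule LIMSEQ_Suc[OF lim_1_over_n])
  have e1: "e n \<le> 1" for n by (simp add: e_def)
  have f\<eta>i: "(\<lambda>t. f t * \<eta> e c t) integrable_on {0..}" "integral {0..} (\<lambda>t. f t * \<eta> e c t) = integral {c..c+e} (\<lambda>t. f t * \<eta> e c t)"
    if "e > 0" "c > 0" for e c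
  proof -
    have "(\<lambda>t. f t * \<eta> e c t) integrable_on {c..c+e}"
      using that by (intro integrable_continuous_real continuous_intros c\<eta> continuous_on_subset[OF cont]) auto
    then have *: "((\<lambda>t. f t * \<eta> e c t) has_integral integral {c..c+e} (\<lambda>t. f t * \<eta> e c t)) {0..}"
      by (intro has_integral_on_superset[OF integrable_integral, of _ "{c..c+e}"]) (use that \<eta>0 in auto)
    then show "(\<lambda>t. f t * \<eta> e c t) integrable_on {0..}" "integral {0..} (\<lambda>t. f t * \<eta> e c t) = integral {c..c+e} (\<lambda>t. f t * \<eta> e c t)"
      by (auto simp: has_integral_integrable integral_unique)
  qed
  \<comment> \<open>Averages of \<open>f\<close> against \<open>\<eta>\<close> tend to point values.\<close>
  have avg: "(\<lambda>n. integral {0..} (\<lambda>t. f t * \<eta> (e n) c t)) \<longlonglongrightarrow> f c" if "c > 0" for c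
  proof (rule LIMSEQ_I)
    fix r :: real assume "r > 0"
    have "isCont f c"
      using cont that by (auto simp: continuous_on_interior)
    then obtain d where d: "d > 0" "\<And>t. \<bar>t - c\<bar> < d \<Longrightarrow> \<bar>f t - f c\<bar> < r / 2"
      using \<open>r > 0\<close> unfolding continuous_at_eps_delta dist_real_def by (meson half_gt_zero)
    obtain N where N: "\<And>n. n \<ge> N \<Longrightarrow> e n < d"
      using LIMSEQ_D[OF elim d(1)] e0 by (auto simp: abs_of_pos)
    show "\<exists>N. \<forall>n\<ge>N. norm (integral {0..} (\<lambda>t. f t * \<eta> (e n) c t) - f c) < r"
    proof (intro exI[of _ N] allI impI)
      fix n assume "n \<ge> N"
      have i1: "(\<lambda>t. f t * \<eta> (e n) c t) integrable_on {c..c+e n}"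
        using that by (intro integrable_continuous_real continuous_intros c\<eta> e0 continuous_on_subset[OF cont]) auto
      have i2: "((\<lambda>t. f c * \<eta> (e n) c t) has_integral f c * 1) {c..c+e n}"
        by (intro has_integral_mult_right \<eta>1 e0)
      have "integral {0..} (\<lambda>t. f t * \<eta> (e n) c t) - f c = integral {c..c+e n} (\<lambda>t. f t * \<eta> (e n) c t - f c * \<eta> (e n) c t)"
        using f\<eta>i(2)[OF e0 that] i1 i2 integral_unique[OF \<eta>1[OF e0, of n c]] by (simp add: integral_diff has_integral_integrable)
      also have "norm \<dots> \<le> integral {c..c+e n} (\<lambda>t. (r / 2) * \<eta> (e n) c t)"
      proof (rule integral_norm_bound_integral)
        show "(\<lambda>t. f t * \<eta> (e n) c t - f c * \<eta> (e n) c t) integrable_on {c..c + e n}"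
          using i1 i2 by (intro integrable_diff) auto
        show "(\<lambda>t. r / 2 * \<eta> (e n) c t) integrable_on {c..c + e n}"
          by (rule has_integral_integrable[OF has_integral_mult_right[OF \<eta>1[OF e0]]])
        fix t assume t: "t \<in> {c..c + e n}"
        have "\<eta> (e n) c t \<ge> 0" using nn e0[of n] by (simp add: \<eta>_def)
        moreover have "\<bar>f t - f c\<bar> \<le> r / 2" using d(2)[of t] N[OF \<open>n \<ge> N\<close>] t by auto
        moreover from this have "\<bar>f t - f c\<bar> * \<eta> (e n) c t \<le> r / 2 * \<eta> (e n) c t"
          using calculation by (intro mult_right_mono)
        ultimately show "norm (f t * \<eta> (e n) c t - f c * \<eta> (e n) c t) \<le> r / 2 * \<eta> (e n) c t"
          by (simp only: left_diff_distrib[symmetric] real_norm_def abs_mult abs_of_nonneg)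
      qed
      also have "\<dots> = r / 2" using integral_unique[OF \<eta>1[OF e0, of n c]] by simp
      finally show "norm (integral {0..} (\<lambda>t. f t * \<eta> (e n) c t) - f c) < r"
        using \<open>r > 0\<close> by simp
    qed
  qed
  have L: "(\<lambda>n. integral {0..} (\<lambda>t. f t * (\<eta> (e n) a t - \<eta> (e n) b t))) \<longlonglongrightarrow> f a - f b"
    using tendsto_diff[OF avg[of a] avg[of b]] ab
    by (simp add: right_diff_distrib integral_diff f\<eta>i e0)
  have gabs: "g absolutely_integrable_on {a..b+1}"
    using wd ab by (auto simp: weak_derivative_def)
  have c\<phi>: "continuous_on A (\<phi> (e n))" for A n
    using d\<phi>[OF e0] by (meson DERIV_isCont continuous_at_imp_continuous_on)
  have \<phi>b: "\<bar>\<phi> (e n) t\<bar> \<le> 1" for n t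
    using bd[of "(t - a) / e n"] bd[of "(t - b) / e n"] unfolding \<phi>_def by linarith
  have g\<phi>: "(\<lambda>t. \<phi> (e n) t * g t) absolutely_integrable_on {a..b+1}" for n
  proof (rule absolutely_integrable_bounded_measurable_product_real[OF _ _ _ gabs])
    show "\<phi> (e n) \<in> borel_measurable (lebesgue_on {a..b + 1})"
      by (intro continuous_imp_measurable_on_sets_lebesgue c\<phi>) auto
    show "bounded (\<phi> (e n) ` {a..b + 1})" using \<phi>b by (auto simp: bounded_real)
  qed auto
  have R: "(\<lambda>n. integral {a..b+1} (\<lambda>t. \<phi> (e n) t * g t)) \<longlonglongrightarrow> integral {a..b+1} (\<lambda>t. (if t \<in> {a<..b} then g t else 0))"
  proof (rule dominated_convergence(2))
    show "(\<lambda>t. \<phi> (e n) t * g t) integrable_on {a..b + 1}" for n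
      using g\<phi> by (simp add: absolutely_integrable_on_def)
    show "(\<lambda>t. norm (g t)) integrable_on {a..b + 1}"
      using gabs by (simp add: absolutely_integrable_on_def)
    show "norm (\<phi> (e n) t * g t) \<le> norm (g t)" for n t
      using \<phi>b[of n t] by (simp add: abs_mult mult_left_le_one_le)
    fix t assume "t \<in> {a..b + 1}"
    have step: "\<forall>\<^sub>F n in sequentially. \<Psi> ((t - c) / e n) = (if t > c then 1 else 0)" for c
    proof (cases "t > c")
      case True
      then have "\<forall>\<^sub>F n in sequentially. e n < t - c"
        using elim by (intro order_tendstoD) auto
      then show ?thesis
        by eventually_elim (use True e0 in \<open>auto intro!: ge1 simp: le_divide_eq\<close>)
    next
      case False
      then show ?thesis by (auto intro!: always_eventually le0 divide_nonpos_pos e0)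
    qed
    have "\<forall>\<^sub>F n in sequentially. \<phi> (e n) t * g t = (if t \<in> {a<..b} then g t else 0)"
      using step[of a] step[of b] by eventually_elim (use ab in \<open>auto simp: \<phi>_def\<close>)
    then show "(\<lambda>n. \<phi> (e n) t * g t) \<longlonglongrightarrow> (if t \<in> {a<..b} then g t else 0)"
      by (rule tendsto_eventually)
  qed
  have "integral {a..b+1} (\<lambda>t. (if t \<in> {a<..b} then g t else 0)) = integral {a<..b} g"
    using ab by (subst integral_restrict_Int) (auto intro!: arg_cong2[where f = integral])
  also have "\<dots> = integral {a..b} g"
    by (rule integral_subset_negligible) (auto intro: negligible_subset[of "{a}"])
  finally have R': "integral {a..b+1} (\<lambda>t. (if t \<in> {a<..b} then g t else 0)) = integral {a..b} g" .
  have "integral {0..} (\<lambda>t. g t * \<phi> (e n) t) = integral {a..b+1} (\<lambda>t. \<phi> (e n) t * g t)" for n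
  proof -
    have "((\<lambda>t. \<phi> (e n) t * g t) has_integral integral {a..b+1} (\<lambda>t. \<phi> (e n) t * g t)) {0..}"
      using g\<phi>[of n] ab e1[of n] \<phi>0[OF e0[of n]]
      by (intro has_integral_on_superset[OF integrable_integral, of _ "{a..b+1}"])
        (auto simp: absolutely_integrable_on_def)
    then show ?thesis by (simp add: integral_unique mult.commute)
  qed
  then have "(\<lambda>n. integral {0..} (\<lambda>t. g t * \<phi> (e n) t)) \<longlonglongrightarrow> integral {a..b} g"
    using R R' by simp
  then have "(\<lambda>n. integral {0..} (\<lambda>t. f t * (\<eta> (e n) a t - \<eta> (e n) b t))) \<longlonglongrightarrow> - integral {a..b} g"
    using weak[OF e0] tendsto_minus by force
  then have "f a - f b = - integral {a..b} g" using L LIMSEQ_unique by blast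
  then show ?thesis by simp
qed

section \<open>Absolutely continuous functions and weighted regularity\<close>

text \<open>\<open>f\<close> is absolutely continuous on bounded intervals of \<open>[0,\<infinity>)\<close> with almost everywhere derivative
\<open>g\<close>, expressed by \<open>f\<close> being an indefinite integral of \<open>g\<close>. The function \<open>g\<close> matters only up to null
sets.\<close>

definition has_ac_derivative :: "(real \<Rightarrow> 'a::euclidean_space) \<Rightarrow> (real \<Rightarrow> 'a) \<Rightarrow> bool" where
  "has_ac_derivative f g \<longleftrightarrow>
    (\<forall>x\<ge>0. g absolutely_integrable_on {0..x} \<and> f x - f 0 = integral {0..x} g)"

lemma has_ac_derivativeD:
  assumes "has_ac_derivative f g" "0 \<le> x"
  shows "g absolutely_integrable_on {0..x}" "f x = f 0 + integral {0..x} g"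
  using assms unfolding has_ac_derivative_def by (blast, metis diff_add_cancel add.commute)

lemma has_ac_derivative_integrable:
  assumes "has_ac_derivative f g" "0 \<le> a"
  shows "g absolutely_integrable_on {a..b}"
proof (cases "0 \<le> b")
  case True
  then show ?thesis
    using assms absolutely_integrable_on_subinterval[of "{0..b}" g a b] by (auto simp: has_ac_derivative_def)
next
  case False
  then have "{a..b} = {}" using assms by auto
  then show ?thesis by (simp add: absolutely_integrable_on_def)
qed

lemma has_ac_derivative_increment:
  assumes "has_ac_derivative f g" "0 \<le> a" "a \<le> b"
  shows "f b - f a = integral {a..b} g"
proof -
  have "g integrable_on {0..b}"
    using has_ac_derivative_integrable[OF assms(1), of 0 b] by (simp add: absolutely_integrable_on_def)
  then have "integral {0..a} g + integral {a..b} g = integral {0..b} g"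
    using assms(2,3) by (intro Henstock_Kurzweil_Integration.integral_combine) auto
  then have "integral {a..b} g = integral {0..b} g - integral {0..a} g" by (simp add: algebra_simps)
  moreover have "f a = f 0 + integral {0..a} g" "f b = f 0 + integral {0..b} g"
    by (rule has_ac_derivativeD(2)[OF assms(1)], use assms(2,3) in linarith)+
  ultimately show ?thesis by (simp only:) simp
qed

lemma has_ac_derivative_continuous:
  assumes "has_ac_derivative f g"
  shows "continuous_on {0..} f"
proof -
  have 1: "continuous_on {0..b} f" for b
  proof -
    have "g integrable_on {0..b}"
      using has_ac_derivative_integrable[OF assms, of 0 b] by (simp add: absolutely_integrable_on_def)
    then have "continuous_on {0..b} (\<lambda>x. f 0 + integral {0..x} g)"
      by (intro continuous_intros indefinite_integral_continuous_1)
    then show ?thesis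
      by (rule continuous_on_eq) (rule has_ac_derivativeD(2)[OF assms, symmetric], simp)
  qed
  show ?thesis
    unfolding continuous_on_eq_continuous_within
  proof
    fix x :: real assume x: "x \<in> {0..}"
    then have "continuous (at x within {0..x+1}) f"
      using 1[of "x+1"] by (simp add: continuous_on_eq_continuous_within)
    moreover have "at x within {0..x+1} = at x within {0..}"
      by (rule at_within_nhd[of x "{..<x+1}"]) (use x in auto)
    ultimately show "continuous (at x within {0..}) f" by simp
  qed
qed

lemma has_ac_derivative_cong:
  assumes "has_ac_derivative f g" "\<And>x. x \<ge> 0 \<Longrightarrow> f x = f' x" "\<And>x. x \<ge> 0 \<Longrightarrow> g x = g' x"
  shows "has_ac_derivative f' g'"
proof -
  have "g' absolutely_integrable_on {0..x} \<and> integral {0..x} g' = integral {0..x} g" if "x \<ge> 0" for x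
  proof
    have "g absolutely_integrable_on {0..x} \<longleftrightarrow> g' absolutely_integrable_on {0..x}"
      by (rule set_integrable_cong) (use assms(3) in auto)
    then show "g' absolutely_integrable_on {0..x}"
      using assms that by (auto simp: has_ac_derivative_def)
    show "integral {0..x} g' = integral {0..x} g"
      by (rule Henstock_Kurzweil_Integration.integral_cong) (use assms(3) in auto)
  qed
  then show ?thesis using assms by (auto simp: has_ac_derivative_def)
qed

lemma has_ac_derivative_of_vector_derivative:
  assumes "\<And>x. x \<ge> 0 \<Longrightarrow> (f has_vector_derivative f' x) (at x within {0..})"
    and "f' absolutely_integrable_on {0..}"
  shows "has_ac_derivative f f'"
  unfolding has_ac_derivative_def
proof (intro allI impI conjI)
  fix x :: real assume x: "x \<ge> 0"
  show "f' absolutely_integrable_on {0..x}"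
    using absolutely_integrable_on_subinterval[OF assms(2)] by auto
  have "(f' has_integral (f x - f 0)) {0..x}"
    using x by (intro fundamental_theorem_of_calculus)
      (auto intro: has_vector_derivative_within_subset[OF assms(1)])
  then show "f x - f 0 = integral {0..x} f'" by (simp add: integral_unique)
qed

lemma has_ac_derivative_linear:
  assumes "bounded_linear L" "has_ac_derivative f g"
  shows "has_ac_derivative (\<lambda>x. L (f x)) (\<lambda>x. L (g x))"
  unfolding has_ac_derivative_def
proof (intro allI impI conjI)
  fix x :: real assume x: "x \<ge> 0"
  have g: "g absolutely_integrable_on {0..x}" "f x = f 0 + integral {0..x} g"
    using has_ac_derivativeD[OF assms(2) x] by blast+
  show "(\<lambda>x. L (g x)) absolutely_integrable_on {0..x}"
    using absolutely_integrable_linear[OF g(1) assms(1)] by (simp add: o_def)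
  have "integral {0..x} (L \<circ> g) = L (integral {0..x} g)"
    using g(1) assms(1) by (intro integral_linear) (auto simp: absolutely_integrable_on_def)
  then show "L (f x) - L (f 0) = integral {0..x} (\<lambda>x. L (g x))"
    using assms(1) by (subst g(2)) (simp add: o_def linear_simps)
qed

lemma has_ac_derivative_add:
  assumes "has_ac_derivative f f'" "has_ac_derivative g g'"
  shows "has_ac_derivative (\<lambda>x. f x + g x) (\<lambda>x. f' x + g' x)"
  unfolding has_ac_derivative_def
proof (intro allI impI conjI)
  fix x :: real assume x: "x \<ge> 0"
  have g: "f' absolutely_integrable_on {0..x}" "f x = f 0 + integral {0..x} f'"
     "g' absolutely_integrable_on {0..x}" "g x = g 0 + integral {0..x} g'"
    using has_ac_derivativeD[OF assms(1) x] has_ac_derivativeD[OF assms(2) x] by blast+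
  show "(\<lambda>x. f' x + g' x) absolutely_integrable_on {0..x}"
    using g by (intro set_integral_add(1))
  have "integral {0..x} (\<lambda>x. f' x + g' x) = integral {0..x} f' + integral {0..x} g'"
    using g by (intro Henstock_Kurzweil_Integration.integral_add) (auto simp: absolutely_integrable_on_def)
  then show "f x + g x - (f 0 + g 0) = integral {0..x} (\<lambda>x. f' x + g' x)"
    by (subst g(2), subst g(4)) simp
qed

lemma has_ac_derivative_sum:
  assumes "finite I" "\<And>i. i \<in> I \<Longrightarrow> has_ac_derivative (f i) (f' i)"
  shows "has_ac_derivative (\<lambda>x. \<Sum>i\<in>I. f i x) (\<lambda>x. \<Sum>i\<in>I. f' i x)"
  using assms
proof (induction I rule: finite_induct)
  case empty
  show ?case by (simp add: has_ac_derivative_def)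
qed (simp add: has_ac_derivative_add)

text \<open>If the increments of \<open>H\<close> over short intervals are bounded by those of \<open>\<mu>\<close>, then so are the increments
over long ones. This replaces the mean value inequality for functions which are not differentiable
everywhere.\<close>

lemma norm_increment_le_if_locally:
  fixes H :: "real \<Rightarrow> 'a::real_normed_vector"
  assumes "d > 0" "b \<ge> 0"
    and "\<And>x y. 0 \<le> x \<Longrightarrow> x \<le> y \<Longrightarrow> y \<le> b \<Longrightarrow> y - x < d \<Longrightarrow> norm (H y - H x) \<le> \<mu> y - \<mu> x"
  shows "norm (H b - H 0) \<le> \<mu> b - \<mu> 0"
proof -
  obtain N :: nat where N: "real N > b / d" "N > 0"
    by (metis reals_Archimedean2 gr0I of_nat_0 order_less_asym assms(1,2) divide_nonneg_pos linorder_not_less)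
  define p where "p i = b * real i / real N" for i
  have step: "norm (H (p (Suc i)) - H (p i)) \<le> \<mu> (p (Suc i)) - \<mu> (p i)" if "i < N" for i
  proof (rule assms(3))
    show "0 \<le> p i" using assms by (simp add: p_def)
    show "p i \<le> p (Suc i)" unfolding p_def using assms by (intro divide_right_mono mult_left_mono) auto
    have "b * real (Suc i) \<le> b * real N" using that assms by (intro mult_left_mono) auto
    then show "p (Suc i) \<le> b" using N by (simp add: p_def field_simps)
    show "p (Suc i) - p i < d" using N assms by (simp add: p_def field_simps)
  qed
  have "norm (H b - H 0) = norm (\<Sum>i<N. H (p (Suc i)) - H (p i))"
    using N by (subst sum_lessThan_telescope) (simp add: p_def)
  also have "\<dots> \<le> (\<Sum>i<N. \<mu> (p (Suc i)) - \<mu> (p i))"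
    by (rule sum_norm_le) (use step in auto)
  also have "\<dots> = \<mu> b - \<mu> 0"
    using N by (subst sum_lessThan_telescope) (simp add: p_def)
  finally show ?thesis .
qed

lemma absolutely_integrable_bilinear_continuous:
  fixes f :: "real \<Rightarrow> 'a::euclidean_space" and g :: "real \<Rightarrow> 'b::euclidean_space"
    and p :: "'a \<Rightarrow> 'b \<Rightarrow> 'c::euclidean_space"
  assumes "bounded_bilinear p" "continuous_on S f" "bounded (f ` S)" "g absolutely_integrable_on S"
    and "S \<in> sets lebesgue"
  shows "(\<lambda>x. p (f x) (g x)) absolutely_integrable_on S"
  using assms
  by (intro absolutely_integrable_bounded_measurable_product[of p] continuous_imp_measurable_on_sets_lebesgue)
    (auto simp: bilinear_conv_bounded_bilinear)

text \<open>The product rule for absolutely continuous functions. The defect \<open>H\<close> between the product and the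
integral of the expected derivative has increments bounded, on short intervals, by any small multiple
\<open>e\<close> of the increments of the integral of \<open>|f'| + |g'|\<close>, because \<open>f\<close> and \<open>g\<close> are uniformly continuous.\<close>

lemma has_ac_derivative_bilinear:
  fixes f :: "real \<Rightarrow> 'a::euclidean_space" and g :: "real \<Rightarrow> 'b::euclidean_space"
    and p :: "'a \<Rightarrow> 'b \<Rightarrow> 'c::euclidean_space"
  assumes p: "bounded_bilinear p" and f: "has_ac_derivative f f'" and g: "has_ac_derivative g g'"
  shows "has_ac_derivative (\<lambda>x. p (f x) (g x)) (\<lambda>x. p (f x) (g' x) + p (f' x) (g x))"
  unfolding has_ac_derivative_def
proof (intro allI impI conjI)
  interpret p: bounded_bilinear p by (rule p)
  fix b :: real assume b: "b \<ge> 0"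
  have fc: "continuous_on {x..y} f" and gc: "continuous_on {x..y} g" if "0 \<le> x" for x y
    using has_ac_derivative_continuous[OF f] has_ac_derivative_continuous[OF g] that
    by (auto elim!: continuous_on_subset)
  have fi: "f' absolutely_integrable_on {x..y}" and gi: "g' absolutely_integrable_on {x..y}" if "0 \<le> x" for x y
    using has_ac_derivative_integrable[OF f that] has_ac_derivative_integrable[OF g that] by auto
  have abs_int: "(\<lambda>t. p (h t) (g' t)) absolutely_integrable_on {x..y}" if "0 \<le> x" "continuous_on {x..y} h" for x y h
    using that by (intro absolutely_integrable_bilinear_continuous[OF p] gi
        compact_imp_bounded compact_continuous_image) auto
  have abs_int': "(\<lambda>t. p (f' t) (h t)) absolutely_integrable_on {x..y}" if "0 \<le> x" "continuous_on {x..y} h" for x y h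
    using that by (intro absolutely_integrable_bilinear_continuous[OF p.flip, of "{x..y}" h f'] fi
        compact_imp_bounded compact_continuous_image) auto
  define G where "G t = p (f t) (g' t) + p (f' t) (g t)" for t
  have Gi: "G absolutely_integrable_on {x..y}" if "0 \<le> x" for x y
    unfolding G_def using that by (intro set_integral_add(1) abs_int abs_int' fc gc)
  show "(\<lambda>x. p (f x) (g' x) + p (f' x) (g x)) absolutely_integrable_on {0..b}"
    using Gi[of 0 b] by (simp add: G_def[abs_def])
  define H where "H x = p (f x) (g x) - integral {0..x} G" for x
  obtain K where K: "K > 0" "\<And>a b. norm (p a b) \<le> norm a * norm b * K"
    using p.pos_bounded by blast
  define \<nu> where "\<nu> x = integral {0..x} (\<lambda>t. norm (f' t) + norm (g' t))" for x
  have ni: "(\<lambda>t. norm (f' t) + norm (g' t)) integrable_on {x..y}" if "0 \<le> x" for x y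
    using fi[OF that] gi[OF that] by (intro integrable_add) (auto simp: absolutely_integrable_on_def)
  have \<nu>0: "\<nu> b \<ge> 0" unfolding \<nu>_def by (rule Henstock_Kurzweil_Integration.integral_nonneg[OF ni]) auto
  have small: "norm (H b - H 0) \<le> e * K * \<nu> b" if e: "e > 0" for e
  proof -
    have "uniformly_continuous_on {0..b} f" "uniformly_continuous_on {0..b} g"
      using fc gc by (auto intro: compact_uniformly_continuous)
    then have "\<exists>d>0. \<forall>x\<in>{0..b}. \<forall>y\<in>{0..b}. dist y x < d \<longrightarrow> dist (f y) (f x) < e"
        "\<exists>d>0. \<forall>x\<in>{0..b}. \<forall>y\<in>{0..b}. dist y x < d \<longrightarrow> dist (g y) (g x) < e"
      using e unfolding uniformly_continuous_on_def by blast+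
    then obtain d1 d2 where d: "d1 > 0" "d2 > 0"
      "\<And>x y. x \<in> {0..b} \<Longrightarrow> y \<in> {0..b} \<Longrightarrow> dist y x < d1 \<Longrightarrow> dist (f y) (f x) < e"
      "\<And>x y. x \<in> {0..b} \<Longrightarrow> y \<in> {0..b} \<Longrightarrow> dist y x < d2 \<Longrightarrow> dist (g y) (g x) < e"
      by blast
    have "norm (H b - H 0) \<le> e * K * \<nu> b - e * K * \<nu> 0"
    proof (rule norm_increment_le_if_locally[of "min d1 d2"])
      fix x y assume xy: "0 \<le> x" "x \<le> y" "y \<le> b" "y - x < min d1 d2"
      have comb: "integral {0..y} h - integral {0..x} h = integral {x..y} h" if "h integrable_on {0..y}"
        for h :: "real \<Rightarrow> 'd::banach"
        using Henstock_Kurzweil_Integration.integral_combine[of 0 x y h] that xy by (simp add: algebra_simps)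
      have i1: "integral {x..y} (\<lambda>t. p (f y) (g' t)) = p (f y) (g y - g x)"
        using integral_linear[OF _ p.bounded_linear_right, of g' "{x..y}"] gi[OF xy(1)]
          has_ac_derivative_increment[OF g xy(1,2)] by (simp add: o_def absolutely_integrable_on_def)
      have i2: "integral {x..y} (\<lambda>t. p (f' t) (g x)) = p (f y - f x) (g x)"
        using integral_linear[OF _ p.bounded_linear_left, of f' "{x..y}"] fi[OF xy(1)]
          has_ac_derivative_increment[OF f xy(1,2)] by (simp add: o_def absolutely_integrable_on_def)
      define R where "R t = p (f y) (g' t) + p (f' t) (g x) - G t" for t
      have ia: "(\<lambda>t. p (f y) (g' t)) integrable_on {x..y}" "(\<lambda>t. p (f' t) (g x)) integrable_on {x..y}"
          "G integrable_on {x..y}" "G integrable_on {0..y}"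
        using abs_int[OF xy(1), of y "\<lambda>_. f y"] abs_int'[OF xy(1), of y "\<lambda>_. g x"] Gi[OF xy(1), of y] Gi[of 0 y]
        by (auto simp: absolutely_integrable_on_def)
      have "H y - H x = p (f y) (g y - g x) + p (f y - f x) (g x) - integral {x..y} G"
        using comb[OF ia(4)] by (simp add: H_def algebra_simps p.diff_left p.diff_right)
      also have "\<dots> = integral {x..y} R"
        unfolding R_def using ia by (simp add: integral_diff integral_add integrable_add i1 i2)
      also have "norm \<dots> \<le> integral {x..y} (\<lambda>t. e * K * (norm (f' t) + norm (g' t)))"
      proof (rule integral_norm_bound_integral)
        show "R integrable_on {x..y}" unfolding R_def using ia by (intro integrable_diff integrable_add)
        show "(\<lambda>t. e * K * (norm (f' t) + norm (g' t))) integrable_on {x..y}"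
          using integrable_cmul[OF ni[OF xy(1)], of "e * K"] by simp
        fix t assume t: "t \<in> {x..y}"
        have "R t = p (f y - f t) (g' t) + p (f' t) (g x - g t)"
          by (simp add: R_def G_def p.diff_left p.diff_right algebra_simps)
        also have "norm \<dots> \<le> norm (f y - f t) * norm (g' t) * K + norm (f' t) * norm (g x - g t) * K"
          by (intro norm_triangle_le add_mono K)
        also have "\<dots> \<le> e * norm (g' t) * K + norm (f' t) * e * K"
          using d(3)[of t y] d(4)[of t x] t xy K(1)
          by (intro add_mono mult_right_mono mult_left_mono) (auto simp: dist_norm)
        finally show "norm (R t) \<le> e * K * (norm (f' t) + norm (g' t))" by (simp add: algebra_simps)
      qed
      also have "\<dots> = e * K * \<nu> y - e * K * \<nu> x"
        using comb[OF ni[of 0 y]] by (simp add: \<nu>_def right_diff_distrib[symmetric])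
      finally show "norm (H y - H x) \<le> e * K * \<nu> y - e * K * \<nu> x" .
    qed (use d b in auto)
    then show ?thesis by (simp add: \<nu>_def)
  qed
  have "norm (H b - H 0) \<le> 0"
  proof (rule field_le_epsilon)
    fix e :: real assume "e > 0"
    define e' where "e' = e / (K * \<nu> b + 1)"
    have pos: "K * \<nu> b + 1 > 0" using K \<nu>0 by (simp add: add_nonneg_pos)
    have "e' > 0" using pos \<open>e > 0\<close> by (simp add: e'_def)
    from small[OF this] have "norm (H b - H 0) \<le> e' * (K * \<nu> b)" by (simp add: mult.assoc)
    also have "\<dots> \<le> e' * (K * \<nu> b + 1)" using \<open>e' > 0\<close> by (intro mult_left_mono) auto
    also have "\<dots> = e" using pos by (simp add: e'_def)
    finally show "norm (H b - H 0) \<le> 0 + e" by simp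
  qed
  then show "p (f b) (g b) - p (f 0) (g 0) = integral {0..b} (\<lambda>x. p (f x) (g' x) + p (f' x) (g x))"
    by (simp add: H_def G_def[abs_def] algebra_simps)
qed

lemma integral_tendsto_at_top:
  fixes g :: "real \<Rightarrow> 'a::euclidean_space"
  assumes "g absolutely_integrable_on {a..}"
  shows "((\<lambda>x. integral {a..x} g) \<longlongrightarrow> integral {a..} g) at_top"
proof (rule tendsto_at_topI_sequentially)
  fix X :: "nat \<Rightarrow> real" assume X: "filterlim X at_top sequentially"
  have "(\<lambda>n. integral {a..} (\<lambda>t. if t \<in> {..X n} then g t else 0)) \<longlonglongrightarrow> integral {a..} g"
  proof (rule dominated_convergence(2))
    show "(\<lambda>t. norm (g t)) integrable_on {a..}" using assms by (simp add: absolutely_integrable_on_def)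
    show "(\<lambda>t. if t \<in> {..X n} then g t else 0) integrable_on {a..}" for n
      using absolutely_integrable_on_subinterval[OF assms, of a "X n"]
      by (subst integrable_restrict_Int) (auto simp: absolutely_integrable_on_def atLeastAtMost_def Int_commute)
    show "(\<lambda>n. if t \<in> {..X n} then g t else 0) \<longlonglongrightarrow> g t" for t
    proof (rule tendsto_eventually)
      have "\<forall>\<^sub>F n in sequentially. X n \<ge> t" using X by (simp add: filterlim_at_top)
      then show "\<forall>\<^sub>F n in sequentially. (if t \<in> {..X n} then g t else 0) = g t"
        by eventually_elim auto
    qed
  qed auto
  moreover have "integral {a..} (\<lambda>t. if t \<in> {..X n} then g t else 0) = integral {a..X n} g" for n
    by (subst integral_restrict_Int) (auto simp: atLeastAtMost_def Int_commute)
  ultimately show "(\<lambda>n. integral {a..X n} g) \<longlonglongrightarrow> integral {a..} g" by simp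
qed

lemma has_ac_derivative_tendsto:
  assumes "has_ac_derivative f g" "g absolutely_integrable_on {0..}"
  shows "(f \<longlongrightarrow> f 0 + integral {0..} g) at_top"
proof -
  have "((\<lambda>x. f 0 + integral {0..x} g) \<longlongrightarrow> f 0 + integral {0..} g) at_top"
    by (intro tendsto_intros integral_tendsto_at_top assms)
  moreover have "\<forall>\<^sub>F x in at_top. f x = f 0 + integral {0..x} g"
    using eventually_ge_at_top[of 0] by eventually_elim (rule has_ac_derivativeD(2)[OF assms(1)])
  ultimately show ?thesis by (simp add: tendsto_cong)
qed

lemma has_ac_derivative_bounded:
  assumes "has_ac_derivative f g" "g absolutely_integrable_on {0..}"
  shows "bounded (f ` {0..})"
proof -
  have "norm (f x) \<le> norm (f 0) + integral {0..} (\<lambda>t. norm (g t))" if "x \<ge> 0" for x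
  proof -
    have gi: "g absolutely_integrable_on {0..x}"
      using absolutely_integrable_on_subinterval[OF assms(2)] by auto
    have "norm (integral {0..x} g) \<le> integral {0..x} (\<lambda>t. norm (g t))"
      using gi by (intro integral_norm_bound_integral) (auto simp: absolutely_integrable_on_def)
    also have "\<dots> \<le> integral {0..} (\<lambda>t. norm (g t))"
      using gi assms(2) by (intro integral_subset_le) (auto simp: absolutely_integrable_on_def)
    finally show ?thesis
      using norm_triangle_ineq[of "f 0" "integral {0..x} g"] has_ac_derivativeD(2)[OF assms(1) that] by simp
  qed
  then show ?thesis by (auto simp: bounded_iff)
qed

lemma integrable_tendsto_imp_zero:
  fixes f :: "real \<Rightarrow> 'a::euclidean_space"
  assumes "f absolutely_integrable_on {0..}" "(f \<longlongrightarrow> L) at_top"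
  shows "L = 0"
proof (rule ccontr)
  assume "L \<noteq> 0"
  then have "\<forall>\<^sub>F x in at_top. norm L / 2 < norm (f x)"
    using tendsto_norm[OF assms(2)] by (intro order_tendstoD) auto
  then obtain c where c: "\<And>x. x \<ge> c \<Longrightarrow> norm L / 2 < norm (f x)"
    by (auto simp: eventually_at_top_linorder)
  define a where "a = max c 0"
  define I where "I = integral {0..} (\<lambda>t. norm (f t))"
  have "norm L / 2 * N \<le> I" if "N \<ge> 0" for N
  proof -
    have fi: "f absolutely_integrable_on {a..a+N}"
      using absolutely_integrable_on_subinterval[OF assms(1)] by (auto simp: a_def)
    have "norm L / 2 * N = integral {a..a+N} (\<lambda>t. norm L / 2)"
      using that by simp
    also have "\<dots> \<le> integral {a..a+N} (\<lambda>t. norm (f t))"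
      using fi c by (intro integral_le) (auto simp: absolutely_integrable_on_def a_def less_imp_le)
    also have "\<dots> \<le> I"
      unfolding I_def using fi assms(1)
      by (intro integral_subset_le) (auto simp: absolutely_integrable_on_def a_def)
    finally show ?thesis .
  qed
  from this[of "2 * (\<bar>I\<bar> + 1) / norm L"] \<open>L \<noteq> 0\<close> show False by simp
qed

text \<open>Integrability on \<open>[0,\<infinity>)\<close> with the weight \<open>(1 + x)^n\<close>.\<close>

definition weighted_L1 :: "nat \<Rightarrow> (real \<Rightarrow> 'a::euclidean_space) \<Rightarrow> bool" where
  "weighted_L1 n f \<longleftrightarrow> (\<lambda>x. (1 + x) ^ n *\<^sub>R f x) absolutely_integrable_on {0..}"

text \<open>\<open>regular n r f\<close>: the function \<open>f\<close> is \<open>r\<close> times continuously differentiable on \<open>[0,\<infinity>)\<close>, its derivative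
of order \<open>r\<close> is absolutely continuous, and the derivatives of the orders 1, ..., \<open>r + 1\<close> are integrable
with weight \<open>(1 + x)^n\<close>. Nothing is required of the integrability of \<open>f\<close> itself, so that constants are
regular; regular functions are bounded and form an algebra.\<close>

fun regular :: "nat \<Rightarrow> nat \<Rightarrow> (real \<Rightarrow> 'a::euclidean_space) \<Rightarrow> bool" where
  "regular n 0 f \<longleftrightarrow> (\<exists>g. weighted_L1 n g \<and> has_ac_derivative f g)"
| "regular n (Suc r) f \<longleftrightarrow> (\<exists>g. weighted_L1 n g \<and> regular n r g \<and>
      (\<forall>x\<ge>0. (f has_vector_derivative g x) (at x within {0..})))"

lemma weighted_L1_integrable:
  assumes "weighted_L1 n f"
  shows "f absolutely_integrable_on {0..}"
proof -
  have "(\<lambda>x. (1 / (1 + x) ^ n) *\<^sub>R ((1 + x) ^ n *\<^sub>R f x)) absolutely_integrable_on {0..}"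
  proof (rule absolutely_integrable_bilinear_continuous[OF bounded_bilinear_scaleR])
    show "continuous_on {0..} (\<lambda>x. 1 / (1 + x) ^ n :: real)" by (intro continuous_intros) auto
    show "bounded ((\<lambda>x. 1 / (1 + x) ^ n :: real) ` {0..})"
      unfolding bounded_real by (intro exI[of _ 1]) (auto intro!: divide_le_eq_1_pos[THEN iffD2] one_le_power)
  qed (use assms in \<open>auto simp: weighted_L1_def\<close>)
  moreover have "(\<lambda>x. (1 / (1 + x) ^ n) *\<^sub>R ((1 + x) ^ n *\<^sub>R f x)) absolutely_integrable_on {0..} \<longleftrightarrow>
    f absolutely_integrable_on {0..}"
    by (rule set_integrable_cong) auto
  ultimately show ?thesis by simp
qed

lemma weighted_L1_cong:
  assumes "weighted_L1 n f" "\<And>x. x \<ge> 0 \<Longrightarrow> f x = g x"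
  shows "weighted_L1 n g"
proof -
  have "(\<lambda>x. (1 + x) ^ n *\<^sub>R f x) absolutely_integrable_on {0..} \<longleftrightarrow> (\<lambda>x. (1 + x) ^ n *\<^sub>R g x) absolutely_integrable_on {0..}"
    by (rule set_integrable_cong) (use assms in auto)
  then show ?thesis using assms(1) by (simp add: weighted_L1_def)
qed

lemma weighted_L1_zero [simp]: "weighted_L1 n (\<lambda>x. 0)"
  by (simp add: weighted_L1_def)

lemma weighted_L1_add:
  assumes "weighted_L1 n f" "weighted_L1 n g"
  shows "weighted_L1 n (\<lambda>x. f x + g x)"
  using set_integral_add(1)[OF assms[unfolded weighted_L1_def]]
  by (simp add: weighted_L1_def algebra_simps)

lemma weighted_L1_linear:
  assumes "bounded_linear L" "weighted_L1 n f"
  shows "weighted_L1 n (\<lambda>x. L (f x))"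
  using absolutely_integrable_linear[OF assms(2)[unfolded weighted_L1_def] assms(1)] assms(1)
  by (simp add: weighted_L1_def o_def linear_simps)

lemma weighted_L1_bilinear:
  fixes f :: "real \<Rightarrow> 'a::euclidean_space" and g :: "real \<Rightarrow> 'b::euclidean_space"
    and p :: "'a \<Rightarrow> 'b \<Rightarrow> 'c::euclidean_space"
  assumes p: "bounded_bilinear p" and "continuous_on {0..} f" "bounded (f ` {0..})" "weighted_L1 n g"
  shows "weighted_L1 n (\<lambda>x. p (f x) (g x))"
proof -
  interpret bounded_bilinear p by (rule p)
  show ?thesis
    using absolutely_integrable_bilinear_continuous[OF p assms(2,3) assms(4)[unfolded weighted_L1_def]]
    by (simp add: weighted_L1_def scaleR_right)
qed

lemma regular_ac:
  assumes "regular n r f"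
  obtains g where "weighted_L1 n g" "has_ac_derivative f g"
proof (cases r)
  case 0
  then show ?thesis using assms that by auto
next
  case (Suc r')
  then show ?thesis using assms that
    by (auto intro: has_ac_derivative_of_vector_derivative weighted_L1_integrable)
qed

lemma regular_continuous: "regular n r f \<Longrightarrow> continuous_on {0..} f"
  by (meson regular_ac has_ac_derivative_continuous)

lemma regular_bounded: "regular n r f \<Longrightarrow> bounded (f ` {0..})"
  by (meson regular_ac has_ac_derivative_bounded weighted_L1_integrable)

lemma regular_Suc: "regular n (Suc r) f \<Longrightarrow> regular n r f"
proof (induction r arbitrary: f)
  case 0
  then show ?case by (metis regular.simps(1) regular_ac)
next
  case (Suc r)
  then show ?case by (metis regular.simps(2))
qed

lemma regular_mono:
  assumes "regular n r f" "r' \<le> r"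
  shows "regular n r' f"
  using assms(2,1) by (induction r rule: dec_induct) (auto dest: regular_Suc simp del: regular.simps)

lemma regular_cong:
  assumes "regular n r f" "\<And>x. x \<ge> 0 \<Longrightarrow> f x = g x"
  shows "regular n r g"
proof (cases r)
  case 0
  then show ?thesis using assms has_ac_derivative_cong by (metis regular.simps(1))
next
  case (Suc r')
  then obtain h where h: "weighted_L1 n h" "regular n r' h"
      "\<And>x. x \<ge> 0 \<Longrightarrow> (f has_vector_derivative h x) (at x within {0..})"
    using assms by auto
  have "(g has_vector_derivative h x) (at x within {0..})" if "x \<ge> 0" for x
    by (rule has_vector_derivative_transform[OF _ _ h(3)[OF that]]) (use that assms in auto)
  then show ?thesis using h Suc by auto
qed

lemma regular_const: "regular n r (\<lambda>x. c)"
proof (induction r arbitrary: c)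
  case 0
  have "has_ac_derivative (\<lambda>x. c) (\<lambda>x. 0)" by (simp add: has_ac_derivative_def)
  then show ?case by (metis regular.simps(1) weighted_L1_zero)
next
  case (Suc r)
  then show ?case unfolding regular.simps by (intro exI[of _ "\<lambda>x. 0"]) auto
qed

lemma regular_linear:
  assumes "bounded_linear L" "regular n r f"
  shows "regular n r (\<lambda>x. L (f x))"
  using assms(2)
proof (induction r arbitrary: f)
  case 0
  then show ?case using has_ac_derivative_linear[OF assms(1)] weighted_L1_linear[OF assms(1)]
    by (metis regular.simps(1))
next
  case (Suc r)
  then obtain h where h: "weighted_L1 n h" "regular n r h"
      "\<And>x. x \<ge> 0 \<Longrightarrow> (f has_vector_derivative h x) (at x within {0..})" by auto
  then show ?case
    unfolding regular.simps using Suc.IH weighted_L1_linear[OF assms(1)]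
    by (intro exI[of _ "\<lambda>x. L (h x)"]) (auto intro: bounded_linear.has_vector_derivative[OF assms(1)])
qed

lemma regular_add:
  assumes "regular n r f" "regular n r g"
  shows "regular n r (\<lambda>x. f x + g x)"
  using assms
proof (induction r arbitrary: f g)
  case 0
  then show ?case using has_ac_derivative_add weighted_L1_add
    by (metis regular.simps(1))
next
  case (Suc r)
  then obtain h where h: "weighted_L1 n h" "regular n r h"
      "\<And>x. x \<ge> 0 \<Longrightarrow> (f has_vector_derivative h x) (at x within {0..})" by auto
  obtain k where k: "weighted_L1 n k" "regular n r k"
      "\<And>x. x \<ge> 0 \<Longrightarrow> (g has_vector_derivative k x) (at x within {0..})" using Suc.prems by auto
  from h k show ?case
    unfolding regular.simps using Suc.IH weighted_L1_add
    by (intro exI[of _ "\<lambda>x. h x + k x"]) (auto intro: has_vector_derivative_add)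
qed

lemma regular_bilinear:
  fixes f :: "real \<Rightarrow> 'a::euclidean_space" and g :: "real \<Rightarrow> 'b::euclidean_space"
    and p :: "'a \<Rightarrow> 'b \<Rightarrow> 'c::euclidean_space"
  assumes p: "bounded_bilinear p" and "regular n r f" "regular n r g"
  shows "regular n r (\<lambda>x. p (f x) (g x))"
  using assms(2,3)
proof (induction r arbitrary: f g)
  case 0
  from 0 obtain f' g' where fg: "weighted_L1 n f'" "has_ac_derivative f f'" "weighted_L1 n g'" "has_ac_derivative g g'"
    by auto
  have "weighted_L1 n (\<lambda>x. p (f x) (g' x) + p (f' x) (g x))"
    by (intro weighted_L1_add
        weighted_L1_bilinear[OF p regular_continuous[OF 0(1)] regular_bounded[OF 0(1)] fg(3)]
        weighted_L1_bilinear[OF bounded_bilinear.flip[OF p] regular_continuous[OF 0(2)] regular_bounded[OF 0(2)] fg(1)])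
  then show ?case using has_ac_derivative_bilinear[OF p fg(2,4)] by (metis regular.simps(1))
next
  case (Suc r)
  then obtain f' where f': "weighted_L1 n f'" "regular n r f'"
      "\<And>x. x \<ge> 0 \<Longrightarrow> (f has_vector_derivative f' x) (at x within {0..})" unfolding regular.simps by blast
  obtain g' where g': "weighted_L1 n g'" "regular n r g'"
      "\<And>x. x \<ge> 0 \<Longrightarrow> (g has_vector_derivative g' x) (at x within {0..})" using Suc.prems(2) unfolding regular.simps by blast
  have "weighted_L1 n (\<lambda>x. p (f x) (g' x) + p (f' x) (g x))"
    by (intro weighted_L1_add
        weighted_L1_bilinear[OF p regular_continuous[OF Suc.prems(1)] regular_bounded[OF Suc.prems(1)] g'(1)]
        weighted_L1_bilinear[OF bounded_bilinear.flip[OF p] regular_continuous[OF Suc.prems(2)]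
          regular_bounded[OF Suc.prems(2)] f'(1)])
  moreover have "regular n r (\<lambda>x. p (f x) (g' x) + p (f' x) (g x))"
    by (intro regular_add Suc.IH f'(2) g'(2) regular_Suc[OF Suc.prems(1)] regular_Suc[OF Suc.prems(2)])
  ultimately show ?case
    unfolding regular.simps
    by (intro exI[of _ "\<lambda>x. p (f x) (g' x) + p (f' x) (g x)"])
      (auto intro!: bounded_bilinear.has_vector_derivative[OF p] f' g')
qed

lemma weighted_L1_regular_bilinear:
  assumes "bounded_bilinear p" "weighted_L1 n f" "regular n r g"
  shows "weighted_L1 n (\<lambda>x. p (f x) (g x))"
  using weighted_L1_bilinear[OF bounded_bilinear.flip[OF assms(1)] regular_continuous[OF assms(3)]
      regular_bounded[OF assms(3)] assms(2)] .

lemma regular_antiderivative: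
  assumes "weighted_L1 n g" "regular n r g"
  shows "regular n (Suc r) (\<lambda>x. c + integral {0..x} g)"
    and "x \<ge> 0 \<Longrightarrow> ((\<lambda>x. c + integral {0..x} g) has_vector_derivative g x) (at x within {0..})"
proof -
  show *: "((\<lambda>x. c + integral {0..x} g) has_vector_derivative g x) (at x within {0..})" if "x \<ge> 0" for x
  proof -
    have "continuous_on {0..x+1} g" using regular_continuous[OF assms(2)] by (rule continuous_on_subset) auto
    then have "((\<lambda>x. integral {0..x} g) has_vector_derivative g x) (at x within {0..x+1})"
      using that by (intro integral_has_vector_derivative) auto
    moreover have "at x within {0..x+1} = at x within {0..}"
      by (rule at_within_nhd[of x "{..<x+1}"]) (use that in auto)
    ultimately have "((\<lambda>x. integral {0..x} g) has_vector_derivative g x) (at x within {0..})" by simp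
    then show ?thesis by (auto intro!: derivative_eq_intros)
  qed
  show "regular n (Suc r) (\<lambda>x. c + integral {0..x} g)"
    using assms * by auto
qed

lemma regular_tendsto_zero:
  assumes "weighted_L1 n f" "regular n r f"
  shows "(f \<longlongrightarrow> 0) at_top"
proof -
  obtain g where g: "weighted_L1 n g" "has_ac_derivative f g" using regular_ac[OF assms(2)] .
  have "(f \<longlongrightarrow> f 0 + integral {0..} g) at_top"
    by (intro has_ac_derivative_tendsto g weighted_L1_integrable[OF g(1)])
  moreover from this have "f 0 + integral {0..} g = 0"
    using integrable_tendsto_imp_zero weighted_L1_integrable[OF assms(1)] by blast
  ultimately show ?thesis by simp
qed

lemma weak_derivatives_ac:
  assumes "weak_derivatives N f d" "i < N" "d (Suc i) absolutely_integrable_on {0..}"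
  shows "has_ac_derivative (d i) (d (Suc i))"
  unfolding has_ac_derivative_def
proof (intro allI impI conjI)
  fix x :: real assume x: "x \<ge> 0"
  have cont: "continuous_on {0..} (d i)" and wd: "weak_derivative (d i) (d (Suc i))"
    using assms(1,2) by (auto simp: weak_derivatives_def)
  show gi: "d (Suc i) absolutely_integrable_on {0..x}"
    using absolutely_integrable_on_subinterval[OF assms(3)] by auto
  then have gi': "d (Suc i) integrable_on {0..x}" by (simp add: absolutely_integrable_on_def)
  show "d i x - d i 0 = integral {0..x} (d (Suc i))"
  proof (cases "x = 0")
    case False
    \<comment> \<open>Increments are known for \<open>0 < a < x\<close> only; continuity extends them to \<open>a = 0\<close>.\<close>
    define F where "F a = d i x - d i a - (integral {0..x} (d (Suc i)) - integral {0..a} (d (Suc i)))" for a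
    have cl: "closure {0<..<x} = {0..x}" using False x by simp
    have "continuous_on {0..x} F"
      unfolding F_def using gi'
      by (intro continuous_intros continuous_on_subset[OF cont] indefinite_integral_continuous_1) auto
    moreover have "F a = 0" if "a \<in> {0<..<x}" for a
    proof -
      have "integral {0..a} (d (Suc i)) + integral {a..x} (d (Suc i)) = integral {0..x} (d (Suc i))"
        using that gi' by (intro Henstock_Kurzweil_Integration.integral_combine) auto
      then show ?thesis using weak_derivative_increment[OF wd cont, of a x] that by (simp add: F_def)
    qed
    ultimately have "F 0 = 0"
      using continuous_constant_on_closure[of "{0<..<x}" F 0 0] x unfolding cl by auto
    then show ?thesis by (simp add: F_def)
  qed simp
qed

lemma weak_derivatives_regular:
  assumes "weak_derivatives N f d" "i + r < N" "\<And>j. i < j \<Longrightarrow> j \<le> N \<Longrightarrow> weighted_L1 n (d j)"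
  shows "regular n r (d i)"
  using assms(2,3)
proof (induction r arbitrary: i)
  case 0
  then show ?case using weak_derivatives_ac[OF assms(1), of i] weighted_L1_integrable[of n "d (Suc i)"]
    by (auto intro!: exI[of _ "d (Suc i)"])
next
  case (Suc r)
  have w: "weighted_L1 n (d (Suc i))" using Suc.prems by auto
  have "regular n r (d (Suc i))" by (rule Suc.IH) (use Suc.prems in auto)
  then have "regular n (Suc r) (\<lambda>x. d i 0 + integral {0..x} (d (Suc i)))"
    by (rule regular_antiderivative[OF w])
  moreover have "has_ac_derivative (d i) (d (Suc i))"
    using weak_derivatives_ac[OF assms(1), of i] weighted_L1_integrable[OF w] Suc.prems by simp
  ultimately show ?case
    by (elim regular_cong) (rule has_ac_derivativeD(2)[symmetric])
qed

lemma has_ac_derivative_has_vector_derivative: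
  assumes "has_ac_derivative f g" "continuous_on {0..} g" "x \<ge> 0"
  shows "(f has_vector_derivative g x) (at x within {0..})"
proof -
  have "continuous_on {0..x+1} g" using assms(2) by (rule continuous_on_subset) auto
  then have "((\<lambda>x. integral {0..x} g) has_vector_derivative g x) (at x within {0..x+1})"
    using assms(3) by (intro integral_has_vector_derivative) auto
  moreover have "at x within {0..x+1} = at x within {0..}"
    by (rule at_within_nhd[of x "{..<x+1}"]) (use assms(3) in auto)
  ultimately have "((\<lambda>x. f 0 + integral {0..x} g) has_vector_derivative g x) (at x within {0..})"
    by (auto intro!: derivative_eq_intros)
  then show ?thesis
    by (rule has_vector_derivative_transform[rotated 2])
      (use assms(3) in simp, rule has_ac_derivativeD(2)[OF assms(1)], simp)
qed

lemma weighted_L1_dominated: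
  fixes f :: "real \<Rightarrow> 'a::euclidean_space" and g :: "real \<Rightarrow> 'b::euclidean_space"
  assumes "weighted_L1 n g" "continuous_on {0..} f" "\<And>x. x \<ge> 0 \<Longrightarrow> norm (f x) \<le> norm (g x)"
  shows "weighted_L1 n f"
  unfolding weighted_L1_def
proof (rule measurable_bounded_by_integrable_imp_absolutely_integrable)
  show "(\<lambda>x. (1 + x) ^ n *\<^sub>R f x) \<in> borel_measurable (lebesgue_on {0..})"
    by (intro continuous_imp_measurable_on_sets_lebesgue continuous_intros assms) auto
  show "(\<lambda>x. norm ((1 + x) ^ n *\<^sub>R g x)) integrable_on {0..}"
    using assms(1) by (simp add: weighted_L1_def absolutely_integrable_on_def)
  show "norm ((1 + x) ^ n *\<^sub>R f x) \<le> norm ((1 + x) ^ n *\<^sub>R g x)" if "x \<in> {0..}" for x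
    using assms(3)[of x] that by (auto intro!: mult_left_mono)
qed auto

lemma regular_sin_cos:
  assumes "\<And>x. x \<ge> 0 \<Longrightarrow> (u has_vector_derivative u' x) (at x within {0..})"
    and "weighted_L1 n u'" "regular n r u'"
  shows "regular n r (\<lambda>x. sin (u x :: real)) \<and> regular n r (\<lambda>x. cos (u x))"
proof -
  have cu: "continuous_on {0..} u"
    using assms(1) by (auto simp: continuous_on_eq_continuous_within intro: has_vector_derivative_continuous)
  have d: "((\<lambda>x. sin (u x)) has_vector_derivative cos (u x) * u' x) (at x within {0..})"
    "((\<lambda>x. cos (u x)) has_vector_derivative - (sin (u x) * u' x)) (at x within {0..})" if "x \<ge> 0" for x
    using assms(1)[OF that] unfolding has_real_derivative_iff_has_vector_derivative[symmetric]
    by (auto intro!: derivative_eq_intros)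
  have w: "weighted_L1 n (\<lambda>x. cos (u x) * u' x)" "weighted_L1 n (\<lambda>x. sin (u x) * u' x)"
    by (auto intro!: weighted_L1_bilinear[OF bounded_bilinear_mult] assms continuous_intros cu
       exI[of _ 1] simp: bounded_real)
  have w': "weighted_L1 n (\<lambda>x. - (sin (u x) * u' x))"
    using weighted_L1_linear[OF _ w(2), of uminus] by (simp add: bounded_linear_minus)
  show ?thesis using assms(3)
  proof (induction r)
    case 0
    have "has_ac_derivative (\<lambda>x. sin (u x)) (\<lambda>x. cos (u x) * u' x)"
         "has_ac_derivative (\<lambda>x. cos (u x)) (\<lambda>x. - (sin (u x) * u' x))"
      by (auto intro: has_ac_derivative_of_vector_derivative d weighted_L1_integrable w w')
    then show ?case using w w' unfolding regular.simps by blast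
  next
    case (Suc r)
    then have r: "regular n r u'" by (simp add: regular_Suc del: regular.simps)
    have "regular n r (\<lambda>x. cos (u x) * u' x)" "regular n r (\<lambda>x. sin (u x) * u' x)"
      using Suc.IH[OF r] r by (auto intro: regular_bilinear[OF bounded_bilinear_mult])
    moreover from this have "regular n r (\<lambda>x. - (sin (u x) * u' x))"
      using regular_linear[of uminus] by (simp add: bounded_linear_minus)
    ultimately show ?case using w(1) w' d unfolding regular.simps by blast
  qed
qed

section \<open>The recursion for the coefficients\<close>

lemma mscale_nth [simp]: "(c *m A) $ i $ j = c * A $ i $ j"
  by (simp add: mscale_def)

lemma bounded_bilinear_matrix_mult: "bounded_bilinear ((**) :: cmat2 \<Rightarrow> cmat2 \<Rightarrow> cmat2)"
  unfolding bilinear_conv_bounded_bilinear[symmetric] bilinear_def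
  by (auto intro!: linearI simp: vec_eq_iff matrix_matrix_mult_def sum_2 algebra_simps)

lemma bounded_linear_mscale: "bounded_linear ((*m) c)"
  unfolding linear_conv_bounded_linear[symmetric]
  by (auto intro!: linearI simp: vec_eq_iff algebra_simps)

text \<open>The off-diagonal part (\<open>b = True\<close>) or the diagonal part (\<open>b = False\<close>) of a matrix. With this flag the
recursions for \<open>X, Z\<close> and for \<open>W\<close>, which exchange the roles of the two parts, become one.\<close>

definition proj :: "bool \<Rightarrow> cmat2 \<Rightarrow> cmat2" where
  "proj b = (if b then off_part else diag_part)"

lemma proj_True: "proj True = off_part" and proj_False: "proj False = diag_part"
  by (auto simp: proj_def)

lemma proj_nth: "proj b A $ i $ j = (if (i \<noteq> j) = b then A $ i $ j else 0)"
  by (auto simp: proj_def off_part_def diag_part_def)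

lemma bounded_linear_proj: "bounded_linear (proj b)"
  unfolding linear_conv_bounded_linear[symmetric]
  by (auto intro!: linearI simp: vec_eq_iff proj_nth)

lemma proj_proj [simp]: "proj b (proj b A) = proj b A" "proj (\<not> b) (proj b A) = 0" "proj b (proj (\<not> b) A) = 0"
  by (auto simp: vec_eq_iff proj_nth)

lemma proj_sum: "proj b A + proj (\<not> b) A = A"
  by (auto simp: vec_eq_iff proj_nth)

lemma two_neq_one [simp]: "(2::2) \<noteq> 1" "(1::2) \<noteq> 2" by simp_all

lemma proj_mult_off: "off_part V ** proj b A = proj (\<not> b) (off_part V ** A)"
  by (cases b) (auto simp: vec_eq_iff proj_nth off_part_def matrix_matrix_mult_def sum_2 forall_2)

lemma proj_mult_diag: "diag_part V ** proj b A = proj b (diag_part V ** A)"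
  by (cases b) (auto simp: vec_eq_iff proj_nth diag_part_def matrix_matrix_mult_def sum_2 forall_2)

lemma sigma3_nth [simp]: "sigma3 $ i $ j = (if i = j then (if i = 1 then 1 else -1) else 0)"
  using exhaust_2[of i] exhaust_2[of j] by (auto simp: sigma3_def)

lemma diag_part_mscale_sigma3 [simp]: "diag_part (c *m sigma3) = c *m sigma3"
  by (simp add: vec_eq_iff diag_part_def)

lemma proj_mult_sigma3: "(c *m sigma3) ** proj b A = proj b ((c *m sigma3) ** A)"
  using proj_mult_diag[of "c *m sigma3"] by simp

lemma proj_linear: "proj b (A + B) = proj b A + proj b B" "proj b (- A) = - proj b A" "proj b (A - B) = proj b A - proj b B"
  "proj b 0 = 0"
  using bounded_linear_proj[of b] by (simp_all add: linear_simps)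

text \<open>The common recursion: \<open>proj b\<close> of the next coefficient is given algebraically, the complementary part by
its derivative. The part \<open>proj b\<close> is the one on which the term of order \<open>k\<close> in the differential equation acts.\<close>

definition gen_recursion ::
  "bool \<Rightarrow> (real \<Rightarrow> cmat2) \<Rightarrow> (real \<Rightarrow> cmat2) \<Rightarrow> nat \<Rightarrow> (nat \<Rightarrow> real \<Rightarrow> cmat2) \<Rightarrow> bool"
  where "gen_recursion b V0 V1 N A \<longleftrightarrow>
    (\<forall>j<N. \<forall>x\<ge>0.
      (\<lambda>t. proj b (A j t)) differentiable (at x within {0..}) \<and>
      proj b (A (Suc j) x) = (- 2 * \<i>) *m sigma3 **
        (- vector_derivative (\<lambda>t. proj b (A j t)) (at x within {0..})
         + (\<i> / 2) *m sigma3 ** proj b (pre A j x)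
         + V0 x ** proj (\<not> b) (A j x)
         + off_part (V1 x) ** proj (\<not> b) (pre A j x)
         + diag_part (V1 x) ** proj b (pre A j x)) \<and>
      ((\<lambda>t. proj (\<not> b) (A (Suc j) t)) has_vector_derivative
        (V0 x ** proj b (A (Suc j) x)
         + off_part (V1 x) ** proj b (A j x)
         + diag_part (V1 x) ** proj (\<not> b) (A j x))) (at x within {0..}))"

lemma recursion_XZ_eq: "recursion_XZ V0 V1 N A = gen_recursion True V0 V1 N A"
  and recursion_W_eq: "recursion_W V0 V1 N A = gen_recursion False V0 V1 N A"
  by (simp_all add: recursion_XZ_def recursion_W_def gen_recursion_def proj_def)

text \<open>Every step of the recursion costs one derivative, so \<open>A j\<close> keeps \<open>m + 1 - j\<close> of them; moreover its
algebraically determined part is integrable with weight \<open>(1 + x)^n\<close>.\<close>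

definition coefficients_regular :: "nat \<Rightarrow> nat \<Rightarrow> bool \<Rightarrow> nat \<Rightarrow> (nat \<Rightarrow> real \<Rightarrow> cmat2) \<Rightarrow> bool" where
  "coefficients_regular n m b N A \<longleftrightarrow>
    (\<forall>j\<le>N. regular n (m + 1 - j) (A j) \<and> weighted_L1 n (\<lambda>x. proj b (A j x)))"

lemma at_within_atLeast_neq_bot: "x \<ge> (0::real) \<Longrightarrow> at x within {0..} \<noteq> bot"
  by (metis at_le atLeast_iff greaterThan_subset_iff less_le order_trans subsetI trivial_limit_at_right_real
      bot.extremum_uniqueI greaterThan_iff)

lemma weighted_L1_mult_right:
  fixes V A :: "real \<Rightarrow> cmat2"
  shows "weighted_L1 n V \<Longrightarrow> regular n r A \<Longrightarrow> weighted_L1 n (\<lambda>x. V x ** A x)"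
  by (rule weighted_L1_regular_bilinear[OF bounded_bilinear_matrix_mult])

lemma regular_matrix_mult:
  fixes V A :: "real \<Rightarrow> cmat2"
  shows "regular n r V \<Longrightarrow> regular n r A \<Longrightarrow> regular n r (\<lambda>x. V x ** A x)"
  by (rule regular_bilinear[OF bounded_bilinear_matrix_mult])

lemma bounded_linear_matrix_mult: "bounded_linear ((**) C :: cmat2 \<Rightarrow> cmat2)"
  by (rule bounded_bilinear.bounded_linear_right[OF bounded_bilinear_matrix_mult])

text \<open>One step of the recursion, up to the constant of integration \<open>c\<close>: \<open>F\<close> is the algebraic part of the new
coefficient and \<open>G\<close> the derivative of the complementary part.\<close>

lemma gen_recursion_extend:
  assumes off: "\<And>x. off_part (V0 x) = V0 x"
    and V: "weighted_L1 n V0" "weighted_L1 n V1" "regular n m V0" "regular n m V1"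
    and rec: "gen_recursion b V0 V1 N A" and reg: "coefficients_regular n m b N A" and N: "N \<le> m"
  obtains F G where "\<And>x. proj b (F x) = F x" "\<And>x. proj (\<not> b) (G x) = G x"
    "weighted_L1 n F" "regular n (m - N) F" "weighted_L1 n G" "regular n (m - N) G"
    "\<And>c. proj (\<not> b) c = c \<Longrightarrow> gen_recursion b V0 V1 (Suc N) (A(Suc N := (\<lambda>x. F x + (c + integral {0..x} G))))"
    "\<And>c. proj (\<not> b) c = c \<Longrightarrow> coefficients_regular n m b (Suc N) (A(Suc N := (\<lambda>x. F x + (c + integral {0..x} G))))"
proof -
  define P where "P x = proj b (A N x)" for x
  define B where "B = pre A N"
  have AN: "regular n (Suc (m - N)) (A N)" and ANw: "weighted_L1 n P"
    using reg N by (auto simp: coefficients_regular_def P_def[abs_def] Suc_diff_le simp del: regular.simps)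
  have Bb: "regular n (m - N) B \<and> weighted_L1 n (\<lambda>x. proj b (B x))"
  proof (cases N)
    case 0
    then have "B = (\<lambda>x. 0)" by (auto simp: B_def pre_def)
    then show ?thesis by (simp add: regular_const proj_linear)
  next
    case (Suc N')
    then have "B = A N'" by (auto simp: B_def pre_def)
    then show ?thesis using reg Suc regular_mono[of n "m + 1 - N'" "A N'" "m - N"]
      by (auto simp: coefficients_regular_def)
  qed
  then have Breg: "regular n (m - N) B" and Bw: "weighted_L1 n (\<lambda>x. proj b (B x))" by auto
  have "regular n (Suc (m - N)) P"
    unfolding P_def using AN by (rule regular_linear[OF bounded_linear_proj])
  then obtain f' where f': "weighted_L1 n f'" "regular n (m - N) f'"
      "\<And>x. x \<ge> 0 \<Longrightarrow> (P has_vector_derivative f' x) (at x within {0..})"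
    unfolding regular.simps by blast
  define f where "f x = proj b (f' x)" for x
  have f: "weighted_L1 n f" "regular n (m - N) f"
    unfolding f_def by (intro weighted_L1_linear[OF bounded_linear_proj] regular_linear[OF bounded_linear_proj] f')+
  have fd: "(P has_vector_derivative f x) (at x within {0..})" if "x \<ge> 0" for x
    using bounded_linear.has_vector_derivative[OF bounded_linear_proj f'(3)[OF that], of b]
    by (simp add: P_def[abs_def] f_def)
  have Pd: "P differentiable (at x within {0..})" and vd: "vector_derivative P (at x within {0..}) = f x" if "x \<ge> 0" for x
    using fd[OF that] vector_derivative_within[OF at_within_atLeast_neq_bot[OF that]]
    by (auto simp: differentiableI_vector)
  define F where "F x = (- 2 * \<i>) *m sigma3 ** (- f x + (\<i> / 2) *m sigma3 ** proj b (B x)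
     + V0 x ** proj (\<not> b) (A N x) + off_part (V1 x) ** proj (\<not> b) (B x) + diag_part (V1 x) ** proj b (B x))" for x
  define G where "G x = V0 x ** F x + off_part (V1 x) ** P x + diag_part (V1 x) ** proj (\<not> b) (A N x)" for x
  have AN': "regular n (m - N) (A N)" using regular_Suc[OF AN] .
  have Vr: "regular n (m - N) V0" "regular n (m - N) V1" by (rule regular_mono[OF V(3)], simp, rule regular_mono[OF V(4)], simp)
  have offV: "weighted_L1 n (\<lambda>x. off_part (V1 x))" "regular n (m - N) (\<lambda>x. off_part (V1 x))"
    using weighted_L1_linear[OF bounded_linear_proj V(2), of True] regular_linear[OF bounded_linear_proj Vr(2), of True]
    by (simp_all add: proj_True)
  have diagV: "weighted_L1 n (\<lambda>x. diag_part (V1 x))" "regular n (m - N) (\<lambda>x. diag_part (V1 x))"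
    using weighted_L1_linear[OF bounded_linear_proj V(2), of False] regular_linear[OF bounded_linear_proj Vr(2), of False]
    by (simp_all add: proj_False)
  have pr: "regular n (m - N) (\<lambda>x. proj c (A N x))" "regular n (m - N) (\<lambda>x. proj c (B x))" for c
    by (intro regular_linear[OF bounded_linear_proj] AN' Breg)+
  have Fw: "weighted_L1 n F" unfolding F_def
    by (intro weighted_L1_linear[OF bounded_linear_matrix_mult] weighted_L1_add weighted_L1_mult_right[OF V(1), where r = "m - N"]
       weighted_L1_mult_right[OF offV(1), where r = "m - N"] weighted_L1_mult_right[OF diagV(1), where r = "m - N"] pr Bw
       weighted_L1_linear[OF bounded_linear_minus[OF bounded_linear_ident]] f)
  have Fr: "regular n (m - N) F" unfolding F_def
    by (intro regular_linear[OF bounded_linear_matrix_mult] regular_add regular_matrix_mult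
       regular_linear[OF bounded_linear_minus[OF bounded_linear_ident]] offV diagV Vr pr f)
  have Pr: "regular n (m - N) P" unfolding P_def by (rule pr)
  have Gw: "weighted_L1 n G" unfolding G_def
    by (intro weighted_L1_add weighted_L1_mult_right[OF V(1), where r = "m - N"] Fr Pr
       weighted_L1_mult_right[OF offV(1), where r = "m - N"] weighted_L1_mult_right[OF diagV(1), where r = "m - N"] pr)
  have Gr: "regular n (m - N) G" unfolding G_def
    by (intro regular_add regular_matrix_mult Fr Pr offV diagV Vr pr)
  have V0off: "V0 x ** proj c M = proj (\<not> c) (V0 x ** M)" for x c M
    using proj_mult_off[of "V0 x"] off by simp
  have pF: "proj b (F x) = F x" for x
  proof -
    have "F x = proj b ((- 2 * \<i>) *m sigma3 ** (- f' x + (\<i> / 2) *m sigma3 ** B x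
     + V0 x ** A N x + off_part (V1 x) ** B x + diag_part (V1 x) ** B x))"
      by (simp only: F_def f_def proj_linear proj_mult_sigma3[symmetric] proj_mult_diag[symmetric])
       (simp add: V0off proj_mult_off)
    then show ?thesis by simp
  qed
  have pG: "proj (\<not> b) (G x) = G x" for x
  proof -
    have "G x = proj (\<not> b) (V0 x ** F x + off_part (V1 x) ** A N x + diag_part (V1 x) ** A N x)"
      unfolding G_def P_def by (subst (1) pF[symmetric])
        (simp only: proj_linear V0off proj_mult_off proj_mult_diag)
    then show ?thesis by simp
  qed
  have pI: "proj (\<not> b) (integral {0..x} G) = integral {0..x} G" for x
  proof -
    have "G integrable_on {0..x}"
      using absolutely_integrable_on_subinterval[OF weighted_L1_integrable[OF Gw], of 0 x]
      by (auto simp: absolutely_integrable_on_def)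
    from integral_linear[OF this bounded_linear_proj, of "\<not> b"] show ?thesis
      unfolding o_def pG by (rule sym)
  qed
  have new_b: "proj b (F x + (c + integral {0..x} G)) = F x"
    and new_nb: "proj (\<not> b) (F x + (c + integral {0..x} G)) = c + integral {0..x} G" if "proj (\<not> b) c = c" for c x
  proof -
    have "proj b c = 0" "proj b (integral {0..x} G) = 0" "proj (\<not> b) (F x) = 0"
      by (metis that proj_proj(3), metis pI proj_proj(3), metis pF proj_proj(2))
    then show "proj b (F x + (c + integral {0..x} G)) = F x"
       "proj (\<not> b) (F x + (c + integral {0..x} G)) = c + integral {0..x} G"
      using that by (simp_all add: proj_linear pF pI)
  qed
  show ?thesis
  proof (rule that[OF pF pG Fw Fr Gw Gr])
    fix c assume c: "proj (\<not> b) c = c"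
    let ?A = "A(Suc N := (\<lambda>x. F x + (c + integral {0..x} G)))"
    have pre: "pre ?A j = pre A j" if "j \<le> Suc N" for j using that by (auto simp: pre_def fun_eq_iff)
    show "gen_recursion b V0 V1 (Suc N) ?A"
      unfolding gen_recursion_def
    proof (intro allI impI)
      fix j x assume j: "j < Suc N" and x: "(x::real) \<ge> 0"
      show "(\<lambda>t. proj b (?A j t)) differentiable (at x within {0..}) \<and>
      proj b (?A (Suc j) x) = (- 2 * \<i>) *m sigma3 **
        (- vector_derivative (\<lambda>t. proj b (?A j t)) (at x within {0..})
         + (\<i> / 2) *m sigma3 ** proj b (pre ?A j x)
         + V0 x ** proj (\<not> b) (?A j x)
         + off_part (V1 x) ** proj (\<not> b) (pre ?A j x)
         + diag_part (V1 x) ** proj b (pre ?A j x)) \<and>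
      ((\<lambda>t. proj (\<not> b) (?A (Suc j) t)) has_vector_derivative
        (V0 x ** proj b (?A (Suc j) x)
         + off_part (V1 x) ** proj b (?A j x)
         + diag_part (V1 x) ** proj (\<not> b) (?A j x))) (at x within {0..})"
      proof (cases "j < N")
        case True
        then have eqs: "?A j = A j" "?A (Suc j) = A (Suc j)" "pre ?A j = pre A j"
          using pre by auto
        show ?thesis unfolding eqs using rec x True unfolding gen_recursion_def by blast
      next
        case False
        then have jN: "j = N" using j by simp
        have "((\<lambda>x. c + integral {0..x} G) has_vector_derivative G x) (at x within {0..})"
          by (rule regular_antiderivative(2)[OF Gw Gr x])
        note dG = this
        have eqs: "?A N = A N" "?A (Suc N) = (\<lambda>x. F x + (c + integral {0..x} G))" "pre ?A N = B"
          using pre by (auto simp: B_def)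
        have P: "(\<lambda>t. proj b (A N t)) = P" "proj b (A N x) = P x" by (auto simp: P_def)
        show ?thesis
          unfolding jN eqs new_b[OF c] new_nb[OF c] P vd[OF x]
          using Pd[OF x] dG F_def[of x] G_def[of x] by simp
      qed
    qed
    have "regular n (m - N) (\<lambda>x. F x + (c + integral {0..x} G))"
      by (rule regular_add[OF Fr regular_Suc[OF regular_antiderivative(1)[OF Gw Gr]]])
    then show "coefficients_regular n m b (Suc N) ?A"
      using reg Fw by (auto simp: coefficients_regular_def le_Suc_eq new_b[OF c])
  qed
qed

text \<open>Conversely, a coefficient is determined by the preceding ones up to the constant of integration.\<close>

lemma gen_recursion_unique_step:
  assumes "gen_recursion b V0 V1 N A" "gen_recursion b V0 V1 N A'" "j < N"
    and "\<And>i x. i \<le> j \<Longrightarrow> x \<ge> 0 \<Longrightarrow> A i x = A' i x"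
  shows "\<And>x. x \<ge> 0 \<Longrightarrow> proj b (A (Suc j) x) = proj b (A' (Suc j) x)"
    and "\<exists>c. \<forall>x\<ge>0. proj (\<not> b) (A (Suc j) x) - proj (\<not> b) (A' (Suc j) x) = c"
proof -
  have pre: "pre A j x = pre A' j x" if "x \<ge> 0" for x
    using assms(4) that by (auto simp: pre_def)
  have vd: "vector_derivative (\<lambda>t. proj b (A j t)) (at x within {0..}) = vector_derivative (\<lambda>t. proj b (A' j t)) (at x within {0..})"
    if "x \<ge> 0" for x
    by (rule vector_derivative_cong_eq) (use assms(4)[of j] that in \<open>auto simp: eventually_at_filter\<close>)
  show 1: "proj b (A (Suc j) x) = proj b (A' (Suc j) x)" if "x \<ge> 0" for x
    using assms(1,2,3) that assms(4)[OF order_refl that] pre[OF that] vd[OF that]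
    unfolding gen_recursion_def by simp
  define dif where "dif x = proj (\<not> b) (A (Suc j) x) - proj (\<not> b) (A' (Suc j) x)" for x
  have "(dif has_vector_derivative 0) (at x within {0..})" if "x \<in> {0..}" for x
  proof -
    have x: "x \<ge> 0" using that by simp
    have "(dif has_vector_derivative (V0 x ** proj b (A (Suc j) x)
         + off_part (V1 x) ** proj b (A j x) + diag_part (V1 x) ** proj (\<not> b) (A j x))
      - (V0 x ** proj b (A' (Suc j) x)
         + off_part (V1 x) ** proj b (A' j x) + diag_part (V1 x) ** proj (\<not> b) (A' j x))) (at x within {0..})"
      unfolding dif_def using assms(1,2,3) x unfolding gen_recursion_def
      by (intro has_vector_derivative_diff) blast+
    then show ?thesis using 1[OF x] assms(4)[OF order_refl x] by simp
  qed
  then obtain c where "\<And>x. x \<in> {0..} \<Longrightarrow> dif x = c"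
    using has_vector_derivative_zero_constant[of "{0..}" dif] by auto
  then show "\<exists>c. \<forall>x\<ge>0. proj (\<not> b) (A (Suc j) x) - proj (\<not> b) (A' (Suc j) x) = c"
    by (auto simp: dif_def)
qed

section \<open>Existence and uniqueness of the formal solutions\<close>

lemma formal_X_exists:
  assumes off: "\<And>x. off_part (V0 x) = V0 x"
    and V: "weighted_L1 n V0" "weighted_L1 n V1" "regular n m V0" "regular n m V1"
  shows "N \<le> m + 1 \<Longrightarrow> \<exists>A. (\<forall>x. A 0 x = mat 1) \<and> gen_recursion True V0 V1 N A \<and>
    coefficients_regular n m True N A \<and> (\<forall>j\<in>{1..N}. (A j \<longlongrightarrow> 0) at_top)"
proof (induction N)
  case 0
  have "proj True (mat 1) = 0" by (auto simp: vec_eq_iff proj_nth mat_def)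
  then have "coefficients_regular n m True 0 (\<lambda>_ _. mat 1)"
    by (simp add: coefficients_regular_def regular_const del: regular.simps)
  then show ?case by (intro exI[of _ "\<lambda>_ _. mat 1"]) (auto simp: gen_recursion_def)
next
  case (Suc N)
  then obtain A where A: "\<forall>x. A 0 x = mat 1" "gen_recursion True V0 V1 N A"
    "coefficients_regular n m True N A" "\<forall>j\<in>{1..N}. (A j \<longlongrightarrow> 0) at_top" by auto
  have N: "N \<le> m" using Suc.prems by simp
  obtain F G where FG: "\<And>x. proj True (F x) = F x" "\<And>x. proj (\<not> True) (G x) = G x"
    "weighted_L1 n F" "regular n (m - N) F" "weighted_L1 n G" "regular n (m - N) G"
    "\<And>c. proj (\<not> True) c = c \<Longrightarrow> gen_recursion True V0 V1 (Suc N) (A(Suc N := (\<lambda>x. F x + (c + integral {0..x} G))))"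
    "\<And>c. proj (\<not> True) c = c \<Longrightarrow> coefficients_regular n m True (Suc N) (A(Suc N := (\<lambda>x. F x + (c + integral {0..x} G))))"
  proof (rule gen_recursion_extend[OF off V A(2,3) N], goal_cases)
    case (1 F G)
    show ?case by (rule 1(1)[OF 1(2-)])
  qed
  \<comment> \<open>\<open>F\<close> tends to zero, so this constant of integration makes the new coefficient vanish at infinity.\<close>
  define c where "c = - integral {0..} G"
  have Gi: "G absolutely_integrable_on {0..}" by (rule weighted_L1_integrable[OF FG(5)])
  have "integral {0..} (proj (\<not> True) \<circ> G) = proj (\<not> True) (integral {0..} G)"
    using Gi by (intro integral_linear bounded_linear_proj) (simp add: absolutely_integrable_on_def)
  then have "proj (\<not> True) (integral {0..} G) = integral {0..} G"
    unfolding o_def FG(2) by (rule sym)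
  then have c: "proj (\<not> True) c = c"
    unfolding c_def proj_linear by (rule arg_cong)
  have "((\<lambda>x. F x + (c + integral {0..x} G)) \<longlongrightarrow> 0 + (c + integral {0..} G)) at_top"
    by (intro tendsto_intros regular_tendsto_zero[OF FG(3,4)] integral_tendsto_at_top Gi)
  then have "((\<lambda>x. F x + (c + integral {0..x} G)) \<longlongrightarrow> 0) at_top" by (simp add: c_def)
  then show ?case
    using A(1,4)
    by (intro exI[of _ "A(Suc N := (\<lambda>x. F x + (c + integral {0..x} G)))"] conjI FG(7)[OF c] FG(8)[OF c])
      (auto simp: le_Suc_eq)
qed

lemma formal_Y_exists:
  assumes off: "\<And>x. off_part (V0 x) = V0 x"
    and V: "weighted_L1 n V0" "weighted_L1 n V1" "regular n m V0" "regular n m V1"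
  shows "N \<le> m + 1 \<Longrightarrow> \<exists>Z W. (\<forall>x. Z 0 x = mat 1 \<and> W 0 x = 0) \<and>
    gen_recursion True V0 V1 N Z \<and> coefficients_regular n m True N Z \<and>
    gen_recursion False V0 V1 N W \<and> coefficients_regular n m False N W \<and> (\<forall>j\<in>{1..N}. Z j 0 + W j 0 = 0)"
proof (induction N)
  case 0
  have "proj True (mat 1) = 0" by (auto simp: vec_eq_iff proj_nth mat_def)
  then have "coefficients_regular n m True 0 (\<lambda>_ _. mat 1)" "coefficients_regular n m False 0 (\<lambda>_ _. 0)"
    by (simp_all add: coefficients_regular_def regular_const proj_linear del: regular.simps)
  then show ?case by (intro exI[of _ "\<lambda>_ _. mat 1"] exI[of _ "\<lambda>_ _. 0"]) (auto simp: gen_recursion_def)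
next
  case (Suc N)
  then obtain Z W where A: "\<forall>x. Z 0 x = mat 1 \<and> W 0 x = 0" "gen_recursion True V0 V1 N Z"
    "coefficients_regular n m True N Z" "gen_recursion False V0 V1 N W"
    "coefficients_regular n m False N W" "\<forall>j\<in>{1..N}. Z j 0 + W j 0 = 0" by auto
  have N: "N \<le> m" using Suc.prems by simp
  obtain F G where FG: "\<And>x. proj True (F x) = F x" "\<And>x. proj (\<not> True) (G x) = G x"
    "weighted_L1 n F" "regular n (m - N) F" "weighted_L1 n G" "regular n (m - N) G"
    "\<And>c. proj (\<not> True) c = c \<Longrightarrow> gen_recursion True V0 V1 (Suc N) (Z(Suc N := (\<lambda>x. F x + (c + integral {0..x} G))))"
    "\<And>c. proj (\<not> True) c = c \<Longrightarrow> coefficients_regular n m True (Suc N) (Z(Suc N := (\<lambda>x. F x + (c + integral {0..x} G))))"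
  proof (rule gen_recursion_extend[OF off V A(2,3) N], goal_cases)
    case (1 F G)
    show ?case by (rule 1(1)[OF 1(2-)])
  qed
  obtain F' G' where FG': "\<And>x. proj False (F' x) = F' x" "\<And>x. proj (\<not> False) (G' x) = G' x"
    "weighted_L1 n F'" "regular n (m - N) F'" "weighted_L1 n G'" "regular n (m - N) G'"
    "\<And>c. proj (\<not> False) c = c \<Longrightarrow> gen_recursion False V0 V1 (Suc N) (W(Suc N := (\<lambda>x. F' x + (c + integral {0..x} G'))))"
    "\<And>c. proj (\<not> False) c = c \<Longrightarrow> coefficients_regular n m False (Suc N) (W(Suc N := (\<lambda>x. F' x + (c + integral {0..x} G'))))"
  proof (rule gen_recursion_extend[OF off V A(4,5) N], goal_cases)
    case (1 F G)
    show ?case by (rule 1(1)[OF 1(2-)])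
  qed
  \<comment> \<open>With these constants the new coefficients at \<open>x = 0\<close> are \<open>F 0 - F' 0\<close> and \<open>F' 0 - F 0\<close>; their sum
    vanishes.\<close>
  have c: "proj (\<not> True) (- F' 0) = - F' 0" "proj (\<not> False) (- F 0) = - F 0"
    using FG(1)[of 0] FG'(1)[of 0] by (simp_all add: proj_linear)
  show ?case
    using A(1,6)
    by (intro exI[of _ "Z(Suc N := (\<lambda>x. F x + (- F' 0 + integral {0..x} G)))"]
        exI[of _ "W(Suc N := (\<lambda>x. F' x + (- F 0 + integral {0..x} G')))"]
        conjI FG(7)[OF c(1)] FG(8)[OF c(1)] FG'(7)[OF c(2)] FG'(8)[OF c(2)]) (auto simp: le_Suc_eq)
qed

lemma proj_eqI: "proj b A = proj b B \<Longrightarrow> proj (\<not> b) A = proj (\<not> b) B \<Longrightarrow> A = B"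
  by (metis proj_sum)

lemma formal_X_unique:
  assumes A: "formal_X V0 V1 N A" and A': "formal_X V0 V1 N A'"
  shows "j \<le> N \<Longrightarrow> x \<ge> 0 \<Longrightarrow> A j x = A' j x"
proof (induction j arbitrary: x rule: less_induct)
  case (less j)
  show ?case
  proof (cases j)
    case 0
    then show ?thesis using A A' less.prems by (simp add: formal_X_def)
  next
    case (Suc i)
    have rec: "gen_recursion True V0 V1 N A" "gen_recursion True V0 V1 N A'"
      using A A' by (auto simp: formal_X_def recursion_XZ_eq)
    have eq: "A l x = A' l x" if "l \<le> i" "x \<ge> 0" for l x using less that Suc by auto
    have iN: "i < N" using less.prems Suc by simp
    have step1: "proj True (A (Suc i) x) = proj True (A' (Suc i) x)" if "x \<ge> 0" for x
      by (rule gen_recursion_unique_step(1)[OF rec iN eq that])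
    have step2: "\<exists>c. \<forall>x\<ge>0. proj (\<not> True) (A (Suc i) x) - proj (\<not> True) (A' (Suc i) x) = c"
      by (rule gen_recursion_unique_step(2)[OF rec iN eq])
    obtain c where c: "\<And>x. x \<ge> 0 \<Longrightarrow> proj (\<not> True) (A (Suc i) x) - proj (\<not> True) (A' (Suc i) x) = c"
      using step2 by blast
    have "(A (Suc i) \<longlongrightarrow> 0) at_top" "(A' (Suc i) \<longlongrightarrow> 0) at_top"
      using A A' less.prems Suc by (auto simp: formal_X_def)
    then have "((\<lambda>x. proj (\<not> True) (A (Suc i) x) - proj (\<not> True) (A' (Suc i) x)) \<longlongrightarrow>
        proj (\<not> True) 0 - proj (\<not> True) 0) at_top"
      by (intro tendsto_diff bounded_linear.tendsto[OF bounded_linear_proj])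
    moreover have "\<forall>\<^sub>F x in at_top. proj (\<not> True) (A (Suc i) x) - proj (\<not> True) (A' (Suc i) x) = c"
      using eventually_ge_at_top[of 0] by eventually_elim (rule c)
    ultimately have "((\<lambda>x::real. c) \<longlongrightarrow> 0) at_top"
      by (simp add: tendsto_cong)
    then have "c = 0" by (simp add: tendsto_const_iff)
    then have "A (Suc i) x = A' (Suc i) x"
      using step1[OF less.prems(2)] c[OF less.prems(2)] \<open>c = 0\<close> by - (rule proj_eqI[of True], simp_all)
    then show ?thesis using Suc by simp
  qed
qed

lemma formal_Y_unique:
  assumes A: "formal_Y V0 V1 N Z W" and A': "formal_Y V0 V1 N Z' W'"
  shows "j \<le> N \<Longrightarrow> x \<ge> 0 \<Longrightarrow> Z j x = Z' j x \<and> W j x = W' j x"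
proof (induction j arbitrary: x rule: less_induct)
  case (less j)
  show ?case
  proof (cases j)
    case 0
    then show ?thesis using A A' less.prems by (simp add: formal_Y_def)
  next
    case (Suc i)
    have rec: "gen_recursion True V0 V1 N Z" "gen_recursion True V0 V1 N Z'"
      and rec': "gen_recursion False V0 V1 N W" "gen_recursion False V0 V1 N W'"
      using A A' by (auto simp: formal_Y_def recursion_XZ_eq recursion_W_eq)
    have eq: "Z l x = Z' l x" "W l x = W' l x" if "l \<le> i" "x \<ge> 0" for l x using less that Suc by auto
    have iN: "i < N" using less.prems Suc by simp
    have step1: "proj True (Z (Suc i) x) = proj True (Z' (Suc i) x)" if "x \<ge> 0" for x
      by (rule gen_recursion_unique_step(1)[OF rec iN eq(1) that])
    have step2: "\<exists>c. \<forall>x\<ge>0. proj (\<not> True) (Z (Suc i) x) - proj (\<not> True) (Z' (Suc i) x) = c"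
      by (rule gen_recursion_unique_step(2)[OF rec iN eq(1)])
    have step3: "proj False (W (Suc i) x) = proj False (W' (Suc i) x)" if "x \<ge> 0" for x
      by (rule gen_recursion_unique_step(1)[OF rec' iN eq(2) that])
    have step4: "\<exists>c. \<forall>x\<ge>0. proj (\<not> False) (W (Suc i) x) - proj (\<not> False) (W' (Suc i) x) = c"
      by (rule gen_recursion_unique_step(2)[OF rec' iN eq(2)])
    obtain c c' where c: "\<And>x. x \<ge> 0 \<Longrightarrow> proj (\<not> True) (Z (Suc i) x) - proj (\<not> True) (Z' (Suc i) x) = c"
      and c': "\<And>x. x \<ge> 0 \<Longrightarrow> proj (\<not> False) (W (Suc i) x) - proj (\<not> False) (W' (Suc i) x) = c'"
      using step2 step4 by blast
    have "Z (Suc i) 0 + W (Suc i) 0 = 0" "Z' (Suc i) 0 + W' (Suc i) 0 = 0"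
      using A A' less.prems Suc by (auto simp: formal_Y_def)
    then have Z0: "Z (Suc i) 0 = - W (Suc i) 0" "Z' (Suc i) 0 = - W' (Suc i) 0"
      by (simp_all add: eq_neg_iff_add_eq_0)
    have "c = 0" using c[of 0] step3[of 0] by (simp add: Z0 proj_linear)
    have "proj True (Z (Suc i) 0) = proj True (Z' (Suc i) 0)" by (rule step1[OF order_refl])
    then have "c' = 0" using c'[of 0] by (simp add: Z0 proj_linear)
    have "Z (Suc i) x = Z' (Suc i) x"
      using step1[OF less.prems(2)] c[OF less.prems(2)] \<open>c = 0\<close> by - (rule proj_eqI[of True], simp_all)
    moreover have "W (Suc i) x = W' (Suc i) x"
      using step3[OF less.prems(2)] c'[OF less.prems(2)] \<open>c' = 0\<close> by - (rule proj_eqI[of False], simp_all)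
    ultimately show ?thesis using Suc by simp
  qed
qed

section \<open>The residual of the truncated series\<close>

lemma sigma3_sigma3: "sigma3 ** (sigma3 ** M) = M"
  by (simp add: vec_eq_iff matrix_matrix_mult_def sum_2 forall_2)

lemma mscale_mult [simp]: "(c *m A) ** B = c *m (A ** B)" "A ** (c *m B) = c *m (A ** B)"
  by (simp_all add: vec_eq_iff matrix_matrix_mult_def sum_2 algebra_simps)

lemma mscale_mscale [simp]: "c *m (d *m A) = (c * d) *m A" "1 *m A = A"
  by (simp_all add: vec_eq_iff)

lemma mscale_linear: "c *m (A + B) = c *m A + c *m B" "c *m (A - B) = c *m A - c *m B" "c *m (- A) = - (c *m A)"
  by (simp_all add: vec_eq_iff algebra_simps)

lemma matrix_add_left: "(A + B) ** M = A ** M + B ** (M :: cmat2)" for A B :: cmat2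
  by (rule bounded_bilinear.add_left[OF bounded_bilinear_matrix_mult])

lemma off_plus_diag: "off_part A + diag_part A = A"
  using proj_sum[of True A] by (simp add: proj_def)

text \<open>Substituting the truncated series into the differential equation, at a fixed \<open>x\<close>: \<open>a\<close> stands for the
coefficients, \<open>d\<close> for their derivatives, \<open>p\<close> for the shifted coefficients. The recursion makes the
powers of \<open>1/k\<close> telescope, and only those of the orders \<open>N\<close> and \<open>N + 1\<close> remain.\<close>

lemma residual_identity:
  fixes a d p :: "nat \<Rightarrow> cmat2"
  assumes k: "k \<noteq> 0"
    and p: "p 0 = 0" "\<And>j. p (Suc j) = a j"
    and zero: "d 0 = 0" "proj b (a 0) = 0"
    and fast: "\<And>j. j < N \<Longrightarrow> proj b (a (Suc j)) = (- 2 * \<i>) *m sigma3 **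
        (- proj b (d j) + (\<i> / 2) *m sigma3 ** proj b (p j)
         + V0 ** proj (\<not> b) (a j) + off_part V1 ** proj (\<not> b) (p j) + diag_part V1 ** proj b (p j))"
    and slow: "\<And>j. j \<le> N \<Longrightarrow> proj (\<not> b) (d j) = V0 ** proj b (a j) + off_part V1 ** proj b (p j)
         + diag_part V1 ** proj (\<not> b) (p j)"
  shows "(\<Sum>j\<le>N. (1 / k ^ j) *m (d j - (V0 + (1 / k) *m V1) ** a j + (\<i> / 2 * (k - 1 / k)) *m (sigma3 ** proj b (a j))))
    = (1 / k ^ N) *m ((d N - (\<i> / 2) *m (sigma3 ** proj b (p N)) - V0 ** a N - V1 ** p N)
        + (1 / k) *m (- ((\<i> / 2) *m (sigma3 ** proj b (a N))) - V1 ** a N))"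
  using fast slow
proof (induction N)
  case 0
  show ?case by (simp add: zero p proj_linear vec_eq_iff matrix_matrix_mult_def sum_2 algebra_simps)
next
  case (Suc N)
  define S where "S = sigma3 ** proj b (a (Suc N))"
  define Q where "Q = - proj b (d N) + (\<i> / 2) *m sigma3 ** proj b (p N)
         + V0 ** proj (\<not> b) (a N) + off_part V1 ** proj (\<not> b) (p N) + diag_part V1 ** proj b (p N)"
  have "proj b (a (Suc N)) = (- 2 * \<i>) *m sigma3 ** Q"
    unfolding Q_def using Suc.prems(1)[of N] by simp
  then have "(\<i> / 2) *m S = Q"
    by (simp add: S_def sigma3_sigma3)
  moreover have "d N - (\<i> / 2) *m (sigma3 ** proj b (p N)) - V0 ** a N - V1 ** p N = - Q"
  proof -
    have "d N = proj b (d N) + proj (\<not> b) (d N)" by (simp add: proj_sum)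
    moreover have "V0 ** a N = V0 ** proj b (a N) + V0 ** proj (\<not> b) (a N)"
      by (simp add: proj_sum flip: matrix_add_ldistrib)
    moreover have "V1 ** p N = (off_part V1 ** proj b (p N) + off_part V1 ** proj (\<not> b) (p N))
       + (diag_part V1 ** proj b (p N) + diag_part V1 ** proj (\<not> b) (p N))"
      by (simp add: proj_sum off_plus_diag flip: matrix_add_ldistrib matrix_add_left)
    ultimately show ?thesis using Suc.prems(2)[of N] by (simp add: Q_def algebra_simps)
  qed
  ultimately have R0: "d N - (\<i> / 2) *m (sigma3 ** proj b (p N)) - V0 ** a N - V1 ** p N = - ((\<i> / 2) *m S)"
    by simp
  have IH: "(\<Sum>j\<le>N. (1 / k ^ j) *m (d j - (V0 + (1 / k) *m V1) ** a j + (\<i> / 2 * (k - 1 / k)) *m (sigma3 ** proj b (a j))))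
    = (1 / k ^ N) *m (- ((\<i> / 2) *m S)
        + (1 / k) *m (- ((\<i> / 2) *m (sigma3 ** proj b (a N))) - V1 ** a N))"
    by (subst Suc.IH) (use Suc.prems R0 in auto)
  have dist: "(V0 + (1 / k) *m V1) ** a (Suc N) = V0 ** a (Suc N) + (1 / k) *m (V1 ** a (Suc N))"
    by (simp add: matrix_add_left)
  show ?case
    unfolding sum.atMost_Suc IH p dist S_def[symmetric] vec_eq_iff
    using k by (auto simp: field_simps)
qed

text \<open>The truncated series solves the differential equation up to \<open>k^-(m+1)\<close> times a weighted integrable
residual. For \<open>b = True\<close> the subtracted term is \<open>i \<theta>\<^sub>1 [\<sigma>\<^sub>3, M]\<close>; for \<open>b = False\<close> it is
\<open>2 i \<theta>\<^sub>1 \<sigma>\<^sub>3 M\<^sup>d\<close>, with the diagonal part of \<open>M\<close>, which is what remains after the factor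
\<open>exp (2 i \<theta>\<^sub>1 x \<sigma>\<^sub>3)\<close> has been split off.\<close>

lemma expansion_residual:
  assumes V: "weighted_L1 n V0" "weighted_L1 n V1"
    and rec: "gen_recursion b V0 V1 (m + 1) A" and reg: "coefficients_regular n m b (m + 1) A"
    and A0: "\<And>x. A 0 x = C" "proj b C = 0"
  obtains R0 R1 where "weighted_L1 n R0" "weighted_L1 n R1"
    "\<And>k. k \<noteq> 0 \<Longrightarrow> has_ac_derivative (\<lambda>x. \<Sum>j\<le>m+1. (1 / k ^ j) *m A j x)
      (\<lambda>x. (V0 x + (1 / k) *m V1 x) ** (\<Sum>j\<le>m+1. (1 / k ^ j) *m A j x)
         - (\<i> / 2 * (k - 1 / k)) *m (sigma3 ** proj b (\<Sum>j\<le>m+1. (1 / k ^ j) *m A j x))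
         + (1 / k ^ (m + 1)) *m (R0 x + (1 / k) *m R1 x))"
proof -
  have "\<exists>g. weighted_L1 n g \<and> has_ac_derivative (A j) g \<and>
    (j \<le> m \<longrightarrow> (\<forall>x\<ge>0. (A j has_vector_derivative g x) (at x within {0..})))" if j: "j \<le> m + 1" for j
  proof (cases "j \<le> m")
    case True
    then have "m + 1 - j = Suc (m - j)" by simp
    then have "regular n (Suc (m - j)) (A j)"
      using reg j unfolding coefficients_regular_def by metis
    then obtain g where g: "weighted_L1 n g" "\<forall>x\<ge>0. (A j has_vector_derivative g x) (at x within {0..})"
      unfolding regular.simps by blast
    then have "has_ac_derivative (A j) g"
      by (intro has_ac_derivative_of_vector_derivative weighted_L1_integrable) auto
    then show ?thesis using g by blast
  next
    case False
    have "regular n (m + 1 - j) (A j)" using reg j by (simp add: coefficients_regular_def del: regular.simps)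
    then show ?thesis using False by (meson regular_ac)
  qed
  then obtain g where gw: "\<And>j. j \<le> m + 1 \<Longrightarrow> weighted_L1 n (g j)"
    and gac: "\<And>j. j \<le> m + 1 \<Longrightarrow> has_ac_derivative (A j) (g j)"
    and gd: "\<And>j x. j \<le> m \<Longrightarrow> x \<ge> 0 \<Longrightarrow> (A j has_vector_derivative g j x) (at x within {0..})"
    by (metis le_add1 le_trans)
  define slow where "slow j x = V0 x ** proj b (A j x) + off_part (V1 x) ** proj b (pre A j x)
    + diag_part (V1 x) ** proj (\<not> b) (pre A j x)" for j x
  \<comment> \<open>The coefficient of top order is differentiable only almost everywhere. Taking the complementary part
    of each derivative from the recursion makes the identity hold at every point.\<close>
  define D where "D j x = (if j = 0 then 0 else proj b (g j x) + slow j x)" for j x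
  have slowd: "((\<lambda>t. proj (\<not> b) (A (Suc i) t)) has_vector_derivative slow (Suc i) x) (at x within {0..})"
    if "i \<le> m" "x \<ge> 0" for i x
  proof -
    have p: "pre A (Suc i) x = A i x" by (simp add: pre_def)
    have "i < m + 1" using that by simp
    then show ?thesis using rec that unfolding gen_recursion_def slow_def p by blast
  qed
  have Ar: "regular n 0 (A j)" if "j \<le> m + 1" for j
    by (rule regular_mono[of n "m + 1 - j"]) (use reg that in \<open>auto simp: coefficients_regular_def\<close>)
  have prer: "regular n 0 (pre A j)" if "j \<le> m + 1" for j
  proof (cases j)
    case 0
    then have "pre A j = (\<lambda>x. 0)" by (auto simp: pre_def)
    then show ?thesis using regular_const by metis
  next
    case (Suc i)
    then have "pre A j = A i" by (auto simp: pre_def)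
    then show ?thesis using Ar[of i] Suc that by simp
  qed
  have prew: "weighted_L1 n (\<lambda>x. proj b (pre A j x))" if "j \<le> m + 1" for j
  proof (cases j)
    case 0
    then have "(\<lambda>x. proj b (pre A j x)) = (\<lambda>x. 0)" by (auto simp: pre_def proj_linear)
    then show ?thesis by simp
  next
    case (Suc i)
    then have "pre A j = A i" by (auto simp: pre_def)
    then show ?thesis using reg Suc that by (simp add: coefficients_regular_def)
  qed
  have sloww: "weighted_L1 n (slow j)" if "j \<le> m + 1" for j
    unfolding slow_def proj_True[symmetric] proj_False[symmetric]
    by (intro weighted_L1_add weighted_L1_mult_right[where r = 0] V
        weighted_L1_linear[OF bounded_linear_proj] regular_linear[OF bounded_linear_proj] Ar prer that)
  have Dw: "weighted_L1 n (D j)" if "j \<le> m + 1" for j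
    unfolding D_def using that
    by (cases "j = 0") (auto intro!: weighted_L1_add weighted_L1_linear[OF bounded_linear_proj] gw sloww)
  have Dac: "has_ac_derivative (A j) (D j)" if j: "j \<le> m + 1" for j
  proof (cases j)
    case 0
    then show ?thesis by (simp add: D_def[abs_def] A0 has_ac_derivative_def)
  next
    case (Suc i)
    have "((\<lambda>t. proj (\<not> b) (A j t)) has_vector_derivative slow j x) (at x within {0..})" if "x \<ge> 0" for x
      unfolding Suc by (rule slowd) (use that j Suc in auto)
    then have "has_ac_derivative (\<lambda>t. proj (\<not> b) (A j t)) (slow j)"
      by (intro has_ac_derivative_of_vector_derivative weighted_L1_integrable[OF sloww[OF j]])
    from has_ac_derivative_add[OF has_ac_derivative_linear[OF bounded_linear_proj[of b] gac[OF j]] this]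
    show ?thesis using Suc by (simp add: proj_sum D_def[abs_def])
  qed
  have vd: "vector_derivative (\<lambda>t. proj b (A j t)) (at x within {0..}) = proj b (D j x)" if "j \<le> m" "x \<ge> 0" for j x
  proof (cases "j = 0")
    case True
    have "((\<lambda>t. 0 :: cmat2) has_vector_derivative 0) (at x within {0..})" by simp
    from vector_derivative_within[OF at_within_atLeast_neq_bot[OF that(2)] this]
    show ?thesis using True by (simp add: A0 D_def proj_linear)
  next
    case False
    have "proj b (slow j x) = 0"
    proof -
      obtain i where i: "j = Suc i" using False not0_implies_Suc by blast
      have "((\<lambda>t. proj (\<not> b) (A j t)) has_vector_derivative slow j x) (at x within {0..})"
        unfolding i by (rule slowd) (use that i in auto)
      from bounded_linear.has_vector_derivative[OF bounded_linear_proj this, of b]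
      have "((\<lambda>t. 0 :: cmat2) has_vector_derivative proj b (slow j x)) (at x within {0..})" by simp
      moreover have "((\<lambda>t. 0 :: cmat2) has_vector_derivative 0) (at x within {0..})" by simp
      ultimately show ?thesis
        by (metis vector_derivative_within[OF at_within_atLeast_neq_bot[OF that(2)]])
    qed
    then show ?thesis
      using vector_derivative_within[OF at_within_atLeast_neq_bot[OF that(2)]
          bounded_linear.has_vector_derivative[OF bounded_linear_proj gd[OF that]]] False
      by (simp add: D_def proj_linear)
  qed
  define R0 where "R0 x = D (m+1) x - (\<i> / 2) *m (sigma3 ** proj b (pre A (m+1) x)) - V0 x ** A (m+1) x - V1 x ** pre A (m+1) x" for x
  define R1 where "R1 x = - ((\<i> / 2) *m (sigma3 ** proj b (A (m+1) x))) - V1 x ** A (m+1) x" for x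
  have Aw: "weighted_L1 n (\<lambda>x. proj b (A (m+1) x))"
    using reg by (simp add: coefficients_regular_def)
  have neg: "weighted_L1 n (\<lambda>x. f x - h x :: cmat2)" if "weighted_L1 n f" "weighted_L1 n h" for f h
    using weighted_L1_add[OF that(1) weighted_L1_linear[OF bounded_linear_minus[OF bounded_linear_ident] that(2)]]
    by simp
  have "weighted_L1 n R0"
    unfolding R0_def
    by (intro neg Dw weighted_L1_linear[OF bounded_linear_mscale] weighted_L1_linear[OF bounded_linear_matrix_mult]
        prew weighted_L1_mult_right[where r = 0] V Ar prer) auto
  moreover have "weighted_L1 n R1"
    unfolding R1_def
    by (intro neg weighted_L1_linear[OF bounded_linear_minus[OF bounded_linear_ident]] weighted_L1_linear[OF bounded_linear_mscale] weighted_L1_linear[OF bounded_linear_matrix_mult]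
        Aw weighted_L1_mult_right[where r = 0] V Ar) auto
  moreover have "has_ac_derivative (\<lambda>x. \<Sum>j\<le>m+1. (1 / k ^ j) *m A j x)
      (\<lambda>x. (V0 x + (1 / k) *m V1 x) ** (\<Sum>j\<le>m+1. (1 / k ^ j) *m A j x)
         - (\<i> / 2 * (k - 1 / k)) *m (sigma3 ** proj b (\<Sum>j\<le>m+1. (1 / k ^ j) *m A j x))
         + (1 / k ^ (m + 1)) *m (R0 x + (1 / k) *m R1 x))" if k: "k \<noteq> 0" for k
  proof -
    have "has_ac_derivative (\<lambda>x. \<Sum>j\<le>m+1. (1 / k ^ j) *m A j x) (\<lambda>x. \<Sum>j\<le>m+1. (1 / k ^ j) *m D j x)"
      by (intro has_ac_derivative_sum has_ac_derivative_linear[OF bounded_linear_mscale] Dac) auto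
    then show ?thesis
    proof (rule has_ac_derivative_cong)
      fix x :: real assume x: "x \<ge> 0"
      let ?P = "\<Sum>j\<le>m+1. (1 / k ^ j) *m A j x"
      have "(\<Sum>j\<le>m+1. (1 / k ^ j) *m (D j x - (V0 x + (1 / k) *m V1 x) ** A j x + (\<i> / 2 * (k - 1 / k)) *m (sigma3 ** proj b (A j x))))
        = (1 / k ^ (m+1)) *m (R0 x + (1 / k) *m R1 x)"
        unfolding R0_def R1_def
      proof (rule residual_identity[OF k, where a = "\<lambda>j. A j x" and d = "\<lambda>j. D j x" and p = "\<lambda>j. pre A j x"])
        fix j assume j: "j < m + 1"
        then have "proj b (A (Suc j) x) = (- 2 * \<i>) *m sigma3 **
          (- vector_derivative (\<lambda>t. proj b (A j t)) (at x within {0..})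
           + (\<i> / 2) *m sigma3 ** proj b (pre A j x)
           + V0 x ** proj (\<not> b) (A j x)
           + off_part (V1 x) ** proj (\<not> b) (pre A j x)
           + diag_part (V1 x) ** proj b (pre A j x))"
          using rec x unfolding gen_recursion_def by blast
        then show "proj b (A (Suc j) x) = (- 2 * \<i>) *m sigma3 **
          (- proj b (D j x) + (\<i> / 2) *m sigma3 ** proj b (pre A j x)
           + V0 x ** proj (\<not> b) (A j x)
           + off_part (V1 x) ** proj (\<not> b) (pre A j x)
           + diag_part (V1 x) ** proj b (pre A j x))"
          using vd[of j x] j x by simp
      next
        fix j assume j: "j \<le> m + 1"
        show "proj (\<not> b) (D j x) = V0 x ** proj b (A j x) + off_part (V1 x) ** proj b (pre A j x) +
          diag_part (V1 x) ** proj (\<not> b) (pre A j x)"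
        proof (cases j)
          case 0
          then show ?thesis by (simp add: D_def A0 pre_def proj_linear)
        next
          case (Suc i)
          have "((\<lambda>t. proj (\<not> b) (A j t)) has_vector_derivative slow j x) (at x within {0..})"
            unfolding Suc by (rule slowd) (use x j Suc in auto)
          from vector_derivative_within[OF at_within_atLeast_neq_bot[OF x] this]
            vector_derivative_within[OF at_within_atLeast_neq_bot[OF x]
              bounded_linear.has_vector_derivative[OF bounded_linear_proj this, of "\<not> b"]]
          have "proj (\<not> b) (slow j x) = slow j x" by simp
          then show ?thesis using Suc by (simp add: D_def proj_linear slow_def)
        qed
      qed (auto simp: D_def A0 pre_def)
      moreover have "(\<Sum>j\<le>m+1. (1 / k ^ j) *m (D j x - (V0 x + (1 / k) *m V1 x) ** A j x + (\<i> / 2 * (k - 1 / k)) *m (sigma3 ** proj b (A j x))))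
        = (\<Sum>j\<le>m+1. (1 / k ^ j) *m D j x) - (V0 x + (1 / k) *m V1 x) ** ?P + (\<i> / 2 * (k - 1 / k)) *m (sigma3 ** proj b ?P)"
      proof -
        interpret l1: bounded_linear "(**) (V0 x + (1 / k) *m V1 x) :: cmat2 \<Rightarrow> cmat2" by (rule bounded_linear_matrix_mult)
        interpret l2: bounded_linear "proj b" by (rule bounded_linear_proj)
        interpret l3: bounded_linear "(**) sigma3 :: cmat2 \<Rightarrow> cmat2" by (rule bounded_linear_matrix_mult)
        interpret l4: bounded_linear "(*m) (\<i> / 2 * (k - 1 / k))" by (rule bounded_linear_mscale)
        have pm: "proj b (c *m M) = c *m proj b M" for c M by (simp add: vec_eq_iff proj_nth)
        show ?thesis
          by (simp only: l1.sum l2.sum l3.sum l4.sum pm mscale_mult mscale_linear sum.distrib sum_subtractf mscale_mscale)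
            (simp only: mult.commute)
      qed
      ultimately show "(\<Sum>j\<le>m+1. (1 / k ^ j) *m D j x) = (V0 x + (1 / k) *m V1 x) ** ?P
         - (\<i> / 2 * (k - 1 / k)) *m (sigma3 ** proj b ?P) + (1 / k ^ (m + 1)) *m (R0 x + (1 / k) *m R1 x)"
      proof -
        have gen: "y = r \<Longrightarrow> y = s - u + t \<Longrightarrow> s = u - t + r" for y r s u t :: cmat2
          by (simp add: algebra_simps)
        show ?thesis by (rule gen) fact+
      qed
    qed simp
  qed
  ultimately show ?thesis by (rule that)
qed

section \<open>Jets in the spectral parameter\<close>

text \<open>The coefficient of order \<open>j \<le> n\<close> of \<open>F k\<close> is the derivative of order \<open>j\<close> at \<open>k\<close> of the coefficient of
order 0, divided by \<open>j!\<close>: derivatives in the parameter \<open>k\<close> are packaged as formal power series. The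
Leibniz rule is then multiplication of power series.\<close>

definition taylor_family :: "complex set \<Rightarrow> nat \<Rightarrow> (complex \<Rightarrow> complex fps) \<Rightarrow> bool" where
  "taylor_family U n F \<longleftrightarrow> (\<forall>j<n. \<forall>k\<in>U.
    ((\<lambda>z. fps_nth (F z) j) has_field_derivative of_nat (Suc j) * fps_nth (F k) (Suc j)) (at k))"

text \<open>Taylor families on \<open>D\<close> whose coefficients up to order \<open>n\<close> extend continuously to the closure
of \<open>D\<close>. Coefficients of order above \<open>n\<close> are irrelevant.\<close>

definition jet :: "complex set \<Rightarrow> nat \<Rightarrow> (complex \<Rightarrow> complex fps) \<Rightarrow> bool" where
  "jet D n F \<longleftrightarrow> taylor_family D n F \<and> (\<forall>j\<le>n. continuous_on (closure D) (\<lambda>k. fps_nth (F k) j))"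

lemma taylor_family_add:
  "taylor_family U n F \<Longrightarrow> taylor_family U n G \<Longrightarrow> taylor_family U n (\<lambda>k. F k + G k)"
  unfolding taylor_family_def by (auto simp: distrib_left intro!: DERIV_add)

lemma taylor_family_const: "taylor_family U n (\<lambda>k. fps_const c)"
  unfolding taylor_family_def by auto

lemma taylor_family_mult:
  assumes "taylor_family U n F" "taylor_family U n G"
  shows "taylor_family U n (\<lambda>k. F k * G k)"
  unfolding taylor_family_def
proof (intro allI impI ballI)
  fix j k assume j: "j < n" and k: "k \<in> U"
  have "((\<lambda>z. \<Sum>i=0..j. fps_nth (F z) i * fps_nth (G z) (j - i)) has_field_derivative
    (\<Sum>i=0..j. of_nat (Suc i) * fps_nth (F k) (Suc i) * fps_nth (G k) (j - i)
       + of_nat (Suc (j - i)) * fps_nth (G k) (Suc (j - i)) * fps_nth (F k) i)) (at k)"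
    by (intro DERIV_sum DERIV_mult assms[unfolded taylor_family_def, rule_format] k) (use j in auto)
  also have "(\<Sum>i=0..j. of_nat (Suc i) * fps_nth (F k) (Suc i) * fps_nth (G k) (j - i)
       + of_nat (Suc (j - i)) * fps_nth (G k) (Suc (j - i)) * fps_nth (F k) i)
     = fps_nth (fps_deriv (F k * G k)) j"
    by (simp only: fps_deriv_mult fps_add_nth fps_mult_nth fps_deriv_nth sum.distrib Suc_eq_plus1)
       (simp only: mult_ac add_ac)
  finally show "((\<lambda>z. fps_nth (F z * G z) j) has_field_derivative
       of_nat (Suc j) * fps_nth (F k * G k) (Suc j)) (at k)"
    by (simp only: fps_mult_nth[symmetric] fps_deriv_nth Suc_eq_plus1)
qed

lemma taylor_family_deriv:
  assumes "taylor_family U (Suc n) F"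
  shows "taylor_family U n (\<lambda>k. fps_deriv (F k))"
  using assms unfolding taylor_family_def by (auto intro!: DERIV_cmult simp del: of_nat_Suc)

lemma taylor_family_isCont:
  assumes "taylor_family U (Suc n) F" "k \<in> U" "j \<le> n"
  shows "isCont (\<lambda>z. fps_nth (F z) j) k"
  using assms unfolding taylor_family_def by (meson DERIV_isCont le_imp_less_Suc)

lemma jet_of_taylor_family:
  assumes "taylor_family U (Suc n) F" "closure D \<subseteq> U"
  shows "jet D n F"
proof -
  have "D \<subseteq> U" using assms(2) closure_subset by blast
  then have "taylor_family D n F" using assms(1) by (auto simp: taylor_family_def)
  then show ?thesis
    using taylor_family_isCont[OF assms(1)] assms(2)
    by (auto simp: jet_def intro!: continuous_at_imp_continuous_on)
qed

lemma jet_add: "jet D n F \<Longrightarrow> jet D n G \<Longrightarrow> jet D n (\<lambda>k. F k + G k)"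
  unfolding jet_def by (auto intro: taylor_family_add continuous_intros)

lemma jet_mult: "jet D n F \<Longrightarrow> jet D n G \<Longrightarrow> jet D n (\<lambda>k. F k * G k)"
  unfolding jet_def by (auto intro!: taylor_family_mult continuous_intros simp: fps_mult_nth)

lemma jet_const: "jet D n (\<lambda>k. fps_const c)"
  unfolding jet_def by (auto intro: taylor_family_const)

lemma jet_sum: "finite I \<Longrightarrow> (\<And>i. i \<in> I \<Longrightarrow> jet D n (F i)) \<Longrightarrow> jet D n (\<lambda>k. \<Sum>i\<in>I. F i k)"
proof (induction I rule: finite_induct)
  case empty
  show ?case using jet_const[of D n 0] by simp
qed (auto intro: jet_add)

lemma jet_power: "jet D n F \<Longrightarrow> jet D n (\<lambda>k. F k ^ m)"
proof (induction m)
  case 0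
  show ?case using jet_const[of D n 1] by simp
qed (auto intro: jet_mult)

text \<open>The Taylor series of \<open>1/k\<close>.\<close>

definition inverse_jet :: "complex \<Rightarrow> complex fps" where
  "inverse_jet k = Abs_fps (\<lambda>j. (- 1) ^ j / k ^ Suc j)"

text \<open>The Taylor series of \<open>\<sigma> (k - 1/k)\<close>.\<close>

definition phase_jet :: "complex \<Rightarrow> complex \<Rightarrow> complex fps" where
  "phase_jet \<sigma> k = fps_const \<sigma> * (fps_const k + fps_X - inverse_jet k)"

text \<open>The Taylor series of \<open>exp (\<sigma> (k - 1/k) s)\<close> at \<open>k\<close>.\<close>

definition exp_jet :: "complex \<Rightarrow> real \<Rightarrow> complex \<Rightarrow> complex fps" where
  "exp_jet \<sigma> s k = fps_const (exp (\<sigma> * (k - 1 / k) * s)) *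
     (fps_exp (of_real s) oo (phase_jet \<sigma> k - fps_const (\<sigma> * (k - 1 / k))))"

lemma taylor_family_inverse: "taylor_family (-{0}) n inverse_jet"
  unfolding taylor_family_def inverse_jet_def
proof (intro allI impI ballI)
  fix j and k :: complex assume "k \<in> - {0}"
  then have k: "k \<noteq> 0" by simp
  have "((\<lambda>z. (- 1) ^ j / z ^ Suc j) has_field_derivative
    - ((- 1) ^ j * (of_nat (Suc j) * k ^ j)) / (k ^ Suc j * k ^ Suc j)) (at k)"
    using k by (auto intro!: derivative_eq_intros simp del: power_Suc of_nat_Suc)
  also have "- ((- 1) ^ j * (of_nat (Suc j) * k ^ j)) / (k ^ Suc j * k ^ Suc j) = of_nat (Suc j) * ((- 1) ^ Suc j / k ^ Suc (Suc j))"
    using k by (simp add: divide_simps del: of_nat_Suc)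
  finally show "((\<lambda>z. fps_nth (Abs_fps (\<lambda>j. (- 1) ^ j / z ^ Suc j)) j) has_field_derivative
        of_nat (Suc j) * fps_nth (Abs_fps (\<lambda>j. (- 1) ^ j / k ^ Suc j)) (Suc j)) (at k)"
    by simp
qed

lemma taylor_family_phase: "taylor_family (-{0}) n (phase_jet \<sigma>)"
proof -
  have "taylor_family (-{0}) n (\<lambda>k. fps_const k + fps_X)"
    by (auto simp: taylor_family_def fps_X_def intro!: derivative_eq_intros)
  moreover have "taylor_family (-{0}) n (\<lambda>k. fps_const (-1) * inverse_jet k)"
    by (intro taylor_family_mult taylor_family_const taylor_family_inverse)
  ultimately have "taylor_family (-{0}) n (\<lambda>k. fps_const \<sigma> * ((fps_const k + fps_X) + fps_const (-1) * inverse_jet k))"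
    by (rule taylor_family_mult[OF taylor_family_const taylor_family_add])
  moreover have "fps_const \<sigma> * ((fps_const k + fps_X) + fps_const (-1) * inverse_jet k) = phase_jet \<sigma> k" for k
    by (simp add: phase_jet_def fps_eq_iff)
  ultimately show ?thesis by simp
qed

lemma phase_jet_0: "fps_nth (phase_jet \<sigma> k) 0 = \<sigma> * (k - 1 / k)"
  by (simp add: phase_jet_def inverse_jet_def)

lemma phase_jet_bound:
  assumes "norm \<sigma> \<le> 1 / 2" "norm k \<ge> 1"
  shows "norm (fps_nth (phase_jet \<sigma> k) (Suc i)) \<le> 1"
proof -
  have 1: "norm (fps_nth (inverse_jet k) (Suc i)) \<le> 1"
  proof -
    have "1 / norm k ^ Suc (Suc i) \<le> 1"
      using one_le_power[OF assms(2), of "Suc (Suc i)"] by (subst divide_le_eq_1_pos) linarith+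
    then show ?thesis by (simp add: inverse_jet_def norm_divide norm_power norm_mult del: power_Suc)
  qed
  have "norm (fps_nth (fps_const k + fps_X - inverse_jet k) (Suc i)) \<le> 1 + 1"
    by (rule order_trans[OF _ add_left_mono[OF 1]], simp add: fps_X_def, cases i)
      (auto intro: norm_triangle_ineq4[THEN order_trans])
  then have "norm \<sigma> * norm (fps_nth (fps_const k + fps_X - inverse_jet k) (Suc i)) \<le> (1 / 2) * 2"
    using assms(1) by (intro mult_mono) auto
  then show ?thesis by (simp add: phase_jet_def norm_mult)
qed

lemma exp_jet_0: "fps_nth (exp_jet \<sigma> s k) 0 = exp (\<sigma> * (k - 1 / k) * s)"
  by (simp add: exp_jet_def)

lemma exp_jet_deriv:
  "fps_deriv (exp_jet \<sigma> s k) = fps_const (of_real s) * fps_deriv (phase_jet \<sigma> k) * exp_jet \<sigma> s k"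
proof -
  define M where "M = phase_jet \<sigma> k - fps_const (\<sigma> * (k - 1 / k))"
  have M0: "fps_nth M 0 = 0" by (simp add: M_def phase_jet_0)
  have "fps_deriv (fps_exp (complex_of_real s) oo M) = (fps_deriv (fps_exp (of_real s)) oo M) * fps_deriv M"
    using fps_compose_deriv[OF M0] .
  also have "fps_deriv (fps_exp (complex_of_real s)) oo M = fps_const (of_real s) * (fps_exp (of_real s) oo M)"
    by (simp add: fps_compose_mult_distrib[OF M0])
  also have "fps_deriv M = fps_deriv (phase_jet \<sigma> k)" by (simp add: M_def)
  finally show ?thesis
    unfolding exp_jet_def M_def[symmetric] by (simp add: mult_ac)
qed

lemma exp_jet_Suc:
  "of_nat (Suc j) * fps_nth (exp_jet \<sigma> s k) (Suc j) =
    of_real s * (\<Sum>i=0..j. of_nat (Suc i) * fps_nth (phase_jet \<sigma> k) (Suc i) * fps_nth (exp_jet \<sigma> s k) (j - i))"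
proof -
  have "of_nat (Suc j) * fps_nth (exp_jet \<sigma> s k) (Suc j) = fps_nth (fps_deriv (exp_jet \<sigma> s k)) j"
    by simp
  also have "\<dots> = fps_nth (fps_const (of_real s) * (fps_deriv (phase_jet \<sigma> k) * exp_jet \<sigma> s k)) j"
    by (simp only: exp_jet_deriv mult.assoc)
  also have "\<dots> = of_real s * (\<Sum>i=0..j. of_nat (Suc i) * fps_nth (phase_jet \<sigma> k) (Suc i) * fps_nth (exp_jet \<sigma> s k) (j - i))"
    by (simp only: fps_mult_left_const_nth fps_mult_nth[of "fps_deriv _"] fps_deriv_nth Suc_eq_plus1)
  finally show ?thesis .
qed

text \<open>Every \<open>k\<close>-derivative of the exponential costs one factor \<open>1 + |s|\<close>, uniformly in \<open>|k| \<ge> 1\<close>. This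
follows by induction from the differential equation satisfied by the exponential series.\<close>

lemma exp_jet_bound:
  assumes "norm \<sigma> \<le> 1 / 2" "norm k \<ge> 1" "Re (\<sigma> * (k - 1 / k) * of_real s) \<le> 0"
  shows "norm (fps_nth (exp_jet \<sigma> s k) j) \<le> (2 * (1 + \<bar>s\<bar>)) ^ j"
proof (induction j rule: less_induct)
  case (less j)
  define c where "c = 2 * (1 + \<bar>s\<bar>)"
  show ?case
  proof (cases j)
    case 0
    then show ?thesis using assms(3) by (simp add: exp_jet_0)
  next
    case (Suc l)
    have "real (Suc l) * norm (fps_nth (exp_jet \<sigma> s k) (Suc l)) = norm (of_nat (Suc l) * fps_nth (exp_jet \<sigma> s k) (Suc l))"
      by (simp only: norm_mult norm_of_nat)
    also have "\<dots> = \<bar>s\<bar> * norm (\<Sum>i=0..l. of_nat (Suc i) * fps_nth (phase_jet \<sigma> k) (Suc i) * fps_nth (exp_jet \<sigma> s k) (l - i))"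
      by (simp only: exp_jet_Suc norm_mult norm_of_real)
    also have "\<dots> \<le> \<bar>s\<bar> * (\<Sum>i=0..l. real (Suc l) * 1 * c ^ (l - i))"
    proof (intro mult_left_mono sum_norm_le)
      fix i assume i: "i \<in> {0..l}"
      have "norm (of_nat (Suc i) * fps_nth (phase_jet \<sigma> k) (Suc i) * fps_nth (exp_jet \<sigma> s k) (l - i))
        = real (Suc i) * norm (fps_nth (phase_jet \<sigma> k) (Suc i)) * norm (fps_nth (exp_jet \<sigma> s k) (l - i))"
        by (simp only: norm_mult norm_of_nat)
      also have "\<dots> \<le> real (Suc l) * 1 * c ^ (l - i)"
        using less[of "l - i"] Suc i phase_jet_bound[OF assms(1,2)] unfolding c_def
        by (intro mult_mono) auto
      finally show "norm (of_nat (Suc i) * fps_nth (phase_jet \<sigma> k) (Suc i) * fps_nth (exp_jet \<sigma> s k) (l - i))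
        \<le> real (Suc l) * 1 * c ^ (l - i)" .
    qed auto
    also have "\<dots> = real (Suc l) * (\<bar>s\<bar> * (\<Sum>i=0..l. c ^ (l - i)))"
      by (simp add: sum_distrib_left mult_ac)
    also have "\<dots> \<le> real (Suc l) * c ^ Suc l"
    proof (intro mult_left_mono)
      have eq: "(\<Sum>i=0..l. c ^ (l - i)) = (\<Sum>i<Suc l. c ^ i)"
        by (rule sum.reindex_bij_witness[of _ "\<lambda>i. l - i" "\<lambda>i. l - i"]) auto
      have "\<bar>s\<bar> * (\<Sum>i=0..l. c ^ (l - i)) \<le> (c - 1) * (\<Sum>i=0..l. c ^ (l - i))"
        by (intro mult_right_mono sum_nonneg) (auto simp: c_def)
      also have "\<dots> = c ^ Suc l - 1"
        unfolding eq by (rule power_diff_1_eq[symmetric])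
      finally show "\<bar>s\<bar> * (\<Sum>i=0..l. c ^ (l - i)) \<le> c ^ Suc l" by simp
    qed auto
    finally show ?thesis using Suc by (simp add: c_def del: of_nat_Suc power_Suc)
  qed
qed

lemma taylor_family_exp: "taylor_family (-{0}) n (exp_jet \<sigma> s)"
proof (induction n)
  case 0
  show ?case by (simp add: taylor_family_def)
next
  case (Suc n)
  have "((\<lambda>z. fps_nth (exp_jet \<sigma> s z) n) has_field_derivative of_nat (Suc n) * fps_nth (exp_jet \<sigma> s k) (Suc n)) (at k)"
    if "k \<in> -{0}" for k
  proof (cases n)
    case 0
    have k: "k \<noteq> 0" using that by simp
    have "((\<lambda>z. exp (\<sigma> * (z - 1 / z) * s)) has_field_derivative exp (\<sigma> * (k - 1 / k) * s) * (\<sigma> * (1 + 1 / (k * k)) * s)) (at k)"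
      using k by (auto intro!: derivative_eq_intros simp: field_simps)
    moreover have "fps_nth (exp_jet \<sigma> s k) (Suc 0) = exp (\<sigma> * (k - 1 / k) * s) * (\<sigma> * (1 + 1 / (k * k)) * s)"
      using exp_jet_Suc[of 0 \<sigma> s k] by (simp add: exp_jet_0 phase_jet_def inverse_jet_def)
    ultimately show ?thesis using 0 by (simp add: exp_jet_0)
  next
    case (Suc m)
    have "taylor_family (-{0}) n (\<lambda>k. fps_const (of_real s) * fps_deriv (phase_jet \<sigma> k) * exp_jet \<sigma> s k)"
      by (intro taylor_family_mult taylor_family_const taylor_family_deriv taylor_family_phase Suc.IH)
    then have "taylor_family (-{0}) n (\<lambda>k. fps_deriv (exp_jet \<sigma> s k))" by (simp add: exp_jet_deriv)
    then have "((\<lambda>z. of_nat (Suc m) * fps_nth (exp_jet \<sigma> s z) (Suc m)) has_field_derivative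
      of_nat (Suc m) * (of_nat (Suc (Suc m)) * fps_nth (exp_jet \<sigma> s k) (Suc (Suc m)))) (at k)"
      using that Suc by (auto simp: taylor_family_def simp del: of_nat_Suc)
    from DERIV_cmult[OF this, of "1 / of_nat (Suc m)"]
    show ?thesis using Suc by (simp del: of_nat_Suc)
  qed
  then show ?case using Suc by (auto simp: taylor_family_def less_Suc_eq)
qed

lemma exp_jet_continuous: "continuous_on UNIV (\<lambda>s. fps_nth (exp_jet \<sigma> s k) j)"
  unfolding exp_jet_def fps_mult_left_const_nth fps_compose_nth fps_exp_nth
  by (intro continuous_intros) auto

lemma exp_jet_integrand_continuous: "continuous_on A (\<lambda>t. fps_nth (exp_jet \<sigma> (x - t) k) j)"
  by (rule continuous_on_compose2[OF exp_jet_continuous]) (auto intro!: continuous_intros)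

text \<open>Differentiation in \<open>k\<close> under the integral sign.\<close>

lemma jet_integral:
  fixes F :: "real \<Rightarrow> complex \<Rightarrow> complex fps"
  assumes D: "open D"
    and jets: "\<And>t. t \<in> S \<Longrightarrow> jet D n (F t)"
    and int: "\<And>k j. k \<in> closure D \<Longrightarrow> j \<le> n \<Longrightarrow> (\<lambda>t. fps_nth (F t k) j) integrable_on S"
    and h: "h integrable_on S"
    and bound: "\<And>t k j. t \<in> S \<Longrightarrow> k \<in> closure D \<Longrightarrow> j \<le> n \<Longrightarrow> norm (fps_nth (F t k) j) \<le> h t"
  shows "jet D n (\<lambda>k. Abs_fps (\<lambda>j. integral S (\<lambda>t. fps_nth (F t k) j)))"
  unfolding jet_def taylor_family_def fps_nth_Abs_fps
proof (intro conjI allI impI ballI)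
  fix j assume j: "j \<le> n"
  show "continuous_on (closure D) (\<lambda>k. integral S (\<lambda>t. fps_nth (F t k) j))"
    unfolding continuous_on_sequentially
  proof (intro allI ballI impI, elim conjE)
    fix X a assume a: "a \<in> closure D" and X: "\<forall>n. X n \<in> closure D" "X \<longlonglongrightarrow> a"
    have "(\<lambda>i. integral S (\<lambda>t. fps_nth (F t (X i)) j)) \<longlonglongrightarrow> integral S (\<lambda>t. fps_nth (F t a) j)"
    proof (rule dominated_convergence(2)[OF _ h])
      fix t assume t: "t \<in> S"
      have "continuous_on (closure D) (\<lambda>k. fps_nth (F t k) j)"
        using jets[OF t] j by (simp add: jet_def)
      then show "(\<lambda>i. fps_nth (F t (X i)) j) \<longlonglongrightarrow> fps_nth (F t a) j"
        using a X unfolding continuous_on_sequentially o_def by blast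
    qed (use int bound X j in auto)
    then show "((\<lambda>k. integral S (\<lambda>t. fps_nth (F t k) j)) \<circ> X) \<longlonglongrightarrow> integral S (\<lambda>t. fps_nth (F t a) j)"
      by (simp add: o_def)
  qed
next
  fix j k assume j: "j < n" and k: "k \<in> D"
  obtain r where r: "r > 0" "ball k r \<subseteq> D" using D k openE by blast
  have cl: "z \<in> closure D" if "z \<in> ball k r" for z using r(2) that closure_subset[of D] by blast
  have kb: "k \<in> ball k r" using r by simp
  let ?f = "\<lambda>z. integral S (\<lambda>t. fps_nth (F t z) j)"
  have der: "((\<lambda>z. fps_nth (F t z) j) has_field_derivative of_nat (Suc j) * fps_nth (F t z) (Suc j)) (at z)"
    if "t \<in> S" "z \<in> ball k r" for t z
    using jets[OF that(1)] that(2) r j by (auto simp: jet_def taylor_family_def simp del: of_nat_Suc)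
  have "((\<lambda>z. (?f z - ?f k) / (z - k)) \<longlongrightarrow> integral S (\<lambda>t. of_nat (Suc j) * fps_nth (F t k) (Suc j))) (at k within ball k r)"
    unfolding tendsto_at_iff_sequentially
  proof (intro allI impI)
    fix X assume X: "\<forall>i. X i \<in> ball k r - {k}" "X \<longlonglongrightarrow> k"
    have Xb: "X i \<in> ball k r" "X i \<noteq> k" for i using X(1) by auto
    have i1: "(\<lambda>t. fps_nth (F t z) j) integrable_on S" if "z \<in> ball k r" for z
      using int[OF cl[OF that]] j by simp
    have eq: "(?f (X i) - ?f k) / (X i - k) = integral S (\<lambda>t. (fps_nth (F t (X i)) j - fps_nth (F t k) j) / (X i - k))" for i
      using i1[OF Xb(1)[of i]] i1[OF kb]
      by (simp add: Henstock_Kurzweil_Integration.integral_diff divide_inverse)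
    have "(\<lambda>i. integral S (\<lambda>t. (fps_nth (F t (X i)) j - fps_nth (F t k) j) / (X i - k))) \<longlonglongrightarrow>
       integral S (\<lambda>t. of_nat (Suc j) * fps_nth (F t k) (Suc j))"
    proof (rule dominated_convergence(2))
      show "(\<lambda>t. (fps_nth (F t (X i)) j - fps_nth (F t k) j) / (X i - k)) integrable_on S" for i
        using integrable_linear[OF integrable_diff[OF i1[OF Xb(1)[of i]] i1[OF kb]]
            bounded_linear_mult_left[of "inverse (X i - k)"]]
        by (simp add: divide_inverse o_def)
      show "(\<lambda>t. real (Suc j) * h t) integrable_on S"
        using integrable_cmul[OF h, of "real (Suc j)"] by simp
    next
      fix i t assume t: "t \<in> S"
      have "norm (fps_nth (F t (X i)) j - fps_nth (F t k) j) \<le> (real (Suc j) * h t) * norm (X i - k)"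
      proof (rule field_differentiable_bound[of "ball k r"])
        fix z assume z: "z \<in> ball k r"
        show "((\<lambda>z. fps_nth (F t z) j) has_field_derivative of_nat (Suc j) * fps_nth (F t z) (Suc j)) (at z within ball k r)"
          by (rule has_field_derivative_at_within[OF der[OF t z]])
        have "norm (of_nat (Suc j) * fps_nth (F t z) (Suc j)) = real (Suc j) * norm (fps_nth (F t z) (Suc j))"
          by (simp only: norm_mult norm_of_nat)
        also have "\<dots> \<le> real (Suc j) * h t"
          using bound[OF t cl[OF z], of "Suc j"] j by (intro mult_left_mono) auto
        finally show "norm (of_nat (Suc j) * fps_nth (F t z) (Suc j)) \<le> real (Suc j) * h t" .
      qed (use kb Xb in auto)
      then show "norm ((fps_nth (F t (X i)) j - fps_nth (F t k) j) / (X i - k)) \<le> real (Suc j) * h t"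
        using Xb(2)[of i] by (simp add: norm_divide divide_le_eq del: of_nat_Suc)
    next
      fix t assume t: "t \<in> S"
      have "((\<lambda>z. (fps_nth (F t z) j - fps_nth (F t k) j) / (z - k)) \<longlongrightarrow> of_nat (Suc j) * fps_nth (F t k) (Suc j)) (at k)"
        using der[OF t kb] by (simp add: has_field_derivative_iff del: of_nat_Suc)
      then show "(\<lambda>i. (fps_nth (F t (X i)) j - fps_nth (F t k) j) / (X i - k)) \<longlonglongrightarrow> of_nat (Suc j) * fps_nth (F t k) (Suc j)"
        using X unfolding tendsto_at_iff_sequentially o_def by (auto simp del: of_nat_Suc)
    qed
    then show "((\<lambda>z. (?f z - ?f k) / (z - k)) \<circ> X) \<longlonglongrightarrow> integral S (\<lambda>t. of_nat (Suc j) * fps_nth (F t k) (Suc j))"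
      unfolding o_def eq .
  qed
  moreover have "at k within ball k r = at k" by (rule at_within_open) (use kb in auto)
  ultimately have "(?f has_field_derivative integral S (\<lambda>t. of_nat (Suc j) * fps_nth (F t k) (Suc j))) (at k)"
    by (simp only: has_field_derivative_iff)
  then show "(?f has_field_derivative of_nat (Suc j) * integral S (\<lambda>t. fps_nth (F t k) (Suc j))) (at k)"
    by (simp del: of_nat_Suc)
qed

lemma jet_suminf:
  assumes D: "open D"
    and jets: "\<And>l. jet D n (F l)"
    and bound: "\<And>l k j. k \<in> closure D \<Longrightarrow> j \<le> n \<Longrightarrow> norm (fps_nth (F l k) j) \<le> c l"
    and c: "summable c"
  shows "jet D n (\<lambda>k. Abs_fps (\<lambda>j. \<Sum>l. fps_nth (F l k) j))"
  unfolding jet_def taylor_family_def fps_nth_Abs_fps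
proof (intro conjI allI impI ballI)
  fix j assume j: "j \<le> n"
  have "uniform_limit (closure D) (\<lambda>N k. \<Sum>l<N. fps_nth (F l k) j) (\<lambda>k. \<Sum>l. fps_nth (F l k) j) sequentially"
    by (rule Weierstrass_m_test[OF _ c]) (use bound j in auto)
  then show "continuous_on (closure D) (\<lambda>k. \<Sum>l. fps_nth (F l k) j)"
    by (rule uniform_limit_theorem[rotated])
      (use jets j in \<open>auto simp: jet_def intro!: always_eventually continuous_intros\<close>)
next
  fix j k assume j: "j < n" and k: "k \<in> D"
  obtain r where r: "r > 0" "ball k r \<subseteq> D" using D k openE by blast
  have cl: "z \<in> closure D" if "z \<in> ball k r" for z using r(2) that closure_subset[of D] by blast
  have "((\<lambda>x. \<Sum>l. fps_nth (F l x) j) has_field_derivative (\<Sum>l. of_nat (Suc j) * fps_nth (F l k) (Suc j))) (at k)"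
  proof (rule has_field_derivative_series'(2)[where S = "ball k r" and x0 = k])
    show "((\<lambda>z. fps_nth (F l z) j) has_field_derivative of_nat (Suc j) * fps_nth (F l x) (Suc j)) (at x within ball k r)"
      if "x \<in> ball k r" for l x
    proof (rule has_field_derivative_at_within)
      have "x \<in> D" using that r by blast
      then show "((\<lambda>z. fps_nth (F l z) j) has_field_derivative of_nat (Suc j) * fps_nth (F l x) (Suc j)) (at x)"
        using jets[of l] j unfolding jet_def taylor_family_def by blast
    qed
    show "uniformly_convergent_on (ball k r) (\<lambda>N x. \<Sum>l<N. of_nat (Suc j) * fps_nth (F l x) (Suc j))"
    proof (rule Weierstrass_m_test')
      show "norm (of_nat (Suc j) * fps_nth (F l x) (Suc j)) \<le> real (Suc j) * c l" if "x \<in> ball k r" for l x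
        using bound[OF cl[OF that], of "Suc j" l] j
        by (simp only: norm_mult norm_of_nat) (intro mult_left_mono, auto)
      show "summable (\<lambda>l. real (Suc j) * c l)" by (intro summable_mult c)
    qed
    show "summable (\<lambda>l. fps_nth (F l k) j)"
      by (rule summable_comparison_test'[OF c]) (use bound[of k j] j cl[of k] r in auto)
  qed (use r in auto)
  moreover have "summable (\<lambda>l. fps_nth (F l k) (Suc j))"
    by (rule summable_comparison_test'[OF c]) (use bound[of k "Suc j"] j cl[of k] r in auto)
  ultimately show "((\<lambda>x. \<Sum>l. fps_nth (F l x) j) has_field_derivative of_nat (Suc j) * (\<Sum>l. fps_nth (F l k) (Suc j))) (at k)"
    by (simp add: suminf_mult del: of_nat_Suc)
qed

lemma integral_linear_combination:
  fixes f g :: "real \<Rightarrow> complex" and h :: "nat \<Rightarrow> real \<Rightarrow> complex"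
  assumes "f integrable_on S" "g integrable_on S" "\<And>l. h l integrable_on S"
  shows "c * integral S f - (c * integral S g + (\<Sum>l<N. c * integral S (h l)))
    = c * integral S (\<lambda>t. f t - (g t + (\<Sum>l<N. h l t)))"
proof -
  have "integral S (\<lambda>t. f t - (g t + (\<Sum>l<N. h l t))) = integral S f - (integral S g + (\<Sum>l<N. integral S (h l)))"
    using assms
    by (simp add: Henstock_Kurzweil_Integration.integral_diff Henstock_Kurzweil_Integration.integral_add
        Henstock_Kurzweil_Integration.integral_sum integrable_add integrable_sum)
  then show ?thesis by (simp add: right_diff_distrib distrib_left sum_distrib_left)
qed

section \<open>Volterra equations with jets\<close>

text \<open>A common frame for the equations
\<open>u\<^sub>i(x) = \<epsilon> \<integral>\<^bsub>S x\<^esub> exp (\<sigma>\<^sub>i (k - 1/k) (x - t)) (\<Sum>\<^sub>d (V0 i d t + V1 i d t / k) u\<^sub>d(t) + R\<^sub>i(t)) dt\<close>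
for \<open>k\<close> in the closure of \<open>D\<close>: the domain of integration \<open>S x\<close> is \<open>[x,\<infinity>)\<close> with \<open>\<epsilon> = -1\<close>, or
\<open>[0,x]\<close> with \<open>\<epsilon> = 1\<close>, and the exponential is bounded by 1 there. The function \<open>\<omega> j\<close> is the size in \<open>x\<close>
allowed for Taylor coefficients of order \<open>j\<close> in \<open>k\<close>; the last inequality lets it absorb the factors
\<open>1 + |x - t|\<close> produced by differentiating the exponential.\<close>

locale volterra_setting =
  fixes S :: "real \<Rightarrow> real set" and D :: "complex set" and n :: nat and \<sigma> :: "2 \<Rightarrow> complex"
    and \<omega> :: "nat \<Rightarrow> real \<Rightarrow> real" and \<epsilon> :: complex
  assumes open_D: "open D" and norm_ge: "k \<in> closure D \<Longrightarrow> norm k \<ge> 1"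
    and S_sub: "x \<ge> 0 \<Longrightarrow> S x \<subseteq> {0..}" and S_sets: "S x \<in> sets lebesgue"
    and S_refl: "x \<ge> 0 \<Longrightarrow> x \<in> S x" and S_trans: "x \<ge> 0 \<Longrightarrow> t \<in> S x \<Longrightarrow> S t \<subseteq> S x"
    and S_lim: "x \<ge> 0 \<Longrightarrow> t \<ge> 0 \<Longrightarrow> t \<noteq> x \<Longrightarrow> X \<longlonglongrightarrow> x \<Longrightarrow> \<forall>\<^sub>F p in sequentially. t \<in> S (X p) \<longleftrightarrow> t \<in> S x"
    and sigma_le: "norm (\<sigma> i) \<le> 1 / 2"
    and sigma_Re: "k \<in> closure D \<Longrightarrow> x \<ge> 0 \<Longrightarrow> t \<in> S x \<Longrightarrow> Re (\<sigma> i * (k - 1 / k) * of_real (x - t)) \<le> 0"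
    and omega_nonneg: "x \<ge> 0 \<Longrightarrow> \<omega> j x \<ge> 0" and omega_cont: "continuous_on {0..} (\<omega> j)"
    and omega_mono: "x \<ge> 0 \<Longrightarrow> t \<in> S x \<Longrightarrow> l \<le> j \<Longrightarrow> j \<le> n \<Longrightarrow> (1 + \<bar>x - t\<bar>) ^ (j - l) * \<omega> l t \<le> \<omega> j x"
    and eps: "norm \<epsilon> = 1"
begin

text \<open>Inhomogeneities \<open>G\<close> for which the integral makes sense together with its \<open>k\<close>-derivatives, with
integrable majorant \<open>g\<close>.\<close>

definition admissible :: "(real \<Rightarrow> real) \<Rightarrow> (2 \<Rightarrow> real \<Rightarrow> complex \<Rightarrow> complex fps) \<Rightarrow> bool" where
  "admissible g G \<longleftrightarrow> g absolutely_integrable_on {0..} \<and> (\<forall>t\<ge>0. g t \<ge> 0) \<and>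
    (\<forall>i. \<forall>t\<ge>0. jet D n (G i t)) \<and>
    (\<forall>i. \<forall>k\<in>closure D. \<forall>j\<le>n. (\<lambda>t. fps_nth (G i t k) j) \<in> borel_measurable (lebesgue_on {0..})) \<and>
    (\<forall>i. \<forall>t\<ge>0. \<forall>k\<in>closure D. \<forall>j\<le>n. norm (fps_nth (G i t k) j) \<le> g t * \<omega> j t)"

lemma admissibleD:
  assumes "admissible g G"
  shows "g absolutely_integrable_on {0..}" "\<And>t. t \<ge> 0 \<Longrightarrow> g t \<ge> 0" "\<And>i t. t \<ge> 0 \<Longrightarrow> jet D n (G i t)"
    "\<And>i k j. k \<in> closure D \<Longrightarrow> j \<le> n \<Longrightarrow> (\<lambda>t. fps_nth (G i t k) j) \<in> borel_measurable (lebesgue_on {0..})"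
    "\<And>i t k j. t \<ge> 0 \<Longrightarrow> k \<in> closure D \<Longrightarrow> j \<le> n \<Longrightarrow> norm (fps_nth (G i t k) j) \<le> g t * \<omega> j t"
  using assms unfolding admissible_def by blast+

text \<open>A bound for the norm of \<open>kern\<close> relative to the majorants, from the Leibniz rule and the bound on \<open>exp_jet\<close>.\<close>

definition c0 :: real where "c0 = real (n + 1) * 2 ^ n"

lemma c0_ge: "c0 \<ge> 1"
proof -
  have "1 * 1 \<le> real (n + 1) * 2 ^ n" by (intro mult_mono) auto
  then show ?thesis by (simp add: c0_def)
qed

text \<open>The integral operator, acting on jets.\<close>

definition kern :: "(2 \<Rightarrow> real \<Rightarrow> complex \<Rightarrow> complex fps) \<Rightarrow> 2 \<Rightarrow> real \<Rightarrow> complex \<Rightarrow> complex fps" where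
  "kern G i x k = Abs_fps (\<lambda>j. \<epsilon> * integral (S x) (\<lambda>t. fps_nth (exp_jet (\<sigma> i) (x - t) k * G i t k) j))"

lemma S_ge: "x \<ge> 0 \<Longrightarrow> t \<in> S x \<Longrightarrow> t \<ge> 0"
  using S_sub[of x] by auto

lemma omega_le:
  assumes "t \<ge> 0" "i \<le> j" "j \<le> n"
  shows "\<omega> i t \<le> \<omega> j t"
  using omega_mono[OF assms(1) S_refl[OF assms(1)] assms(2,3)] by simp

lemma integrand_bound:
  assumes G: "admissible g G" and x: "x \<ge> 0" and t: "t \<in> S x" and k: "k \<in> closure D" and j: "j \<le> n"
  shows "norm (fps_nth (exp_jet (\<sigma> i) (x - t) k * G i t k) j) \<le> c0 * g t * \<omega> j x"
proof -
  have t0: "t \<ge> 0" using S_ge[OF x t] .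
  let ?s = "1 + \<bar>x - t\<bar>"
  have "norm (fps_nth (exp_jet (\<sigma> i) (x - t) k * G i t k) j)
    \<le> (\<Sum>l=0..j. 2 ^ n * g t * \<omega> j x)"
    unfolding fps_mult_nth
  proof (rule sum_norm_le)
    fix l assume l: "l \<in> {0..j}"
    have "norm (fps_nth (exp_jet (\<sigma> i) (x - t) k) l * fps_nth (G i t k) (j - l))
      \<le> (2 * ?s) ^ l * (g t * \<omega> (j - l) t)"
      unfolding norm_mult using l j
      by (intro mult_mono exp_jet_bound sigma_le norm_ge k sigma_Re x t admissibleD(5)[OF G t0 k]) auto
    also have "\<dots> = 2 ^ l * g t * (?s ^ (j - (j - l)) * \<omega> (j - l) t)"
      using l by (simp only: power_mult_distrib mult_ac) auto
    also have "\<dots> \<le> 2 ^ n * g t * \<omega> j x"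
      using l j admissibleD(2)[OF G t0] omega_nonneg[OF t0]
      by (intro mult_mono omega_mono x t mult_right_mono power_increasing mult_nonneg_nonneg zero_le_power) auto
    finally show "norm (fps_nth (exp_jet (\<sigma> i) (x - t) k) l * fps_nth (G i t k) (j - l)) \<le> 2 ^ n * g t * \<omega> j x" .
  qed
  also have "\<dots> = real (j + 1) * (2 ^ n * g t * \<omega> j x)" by simp
  also have "\<dots> \<le> real (n + 1) * (2 ^ n * g t * \<omega> j x)"
    using j admissibleD(2)[OF G t0] omega_nonneg[OF x] by (intro mult_right_mono) auto
  finally show ?thesis by (simp add: c0_def mult_ac)
qed

lemma integrand_measurable:
  assumes G: "admissible g G" and k: "k \<in> closure D" and j: "j \<le> n"
  shows "(\<lambda>t. fps_nth (exp_jet (\<sigma> i) (x - t) k * G i t k) j) \<in> borel_measurable (lebesgue_on {0..})"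
  unfolding fps_mult_nth using j
  by (intro borel_measurable_sum borel_measurable_times admissibleD(4)[OF G k]
      continuous_imp_measurable_on_sets_lebesgue exp_jet_integrand_continuous) auto

lemma integrable_on_S:
  assumes "g absolutely_integrable_on {0..}" "x \<ge> 0"
  shows "g absolutely_integrable_on (S x)"
  by (rule set_integrable_subset[OF assms(1) S_sets S_sub[OF assms(2)]])

lemma integrand_integrable:
  assumes G: "admissible g G" and x: "x \<ge> 0" and k: "k \<in> closure D" and j: "j \<le> n"
  shows "(\<lambda>t. fps_nth (exp_jet (\<sigma> i) (x - t) k * G i t k) j) absolutely_integrable_on (S x)"
proof (rule measurable_bounded_by_integrable_imp_absolutely_integrable[OF _ S_sets])
  show "(\<lambda>t. fps_nth (exp_jet (\<sigma> i) (x - t) k * G i t k) j) \<in> borel_measurable (lebesgue_on (S x))"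
    by (rule measurable_restrict_mono[OF integrand_measurable[OF G k j] S_sub[OF x]])
  have "g integrable_on (S x)"
    using integrable_on_S[OF admissibleD(1)[OF G] x] by (simp add: absolutely_integrable_on_def)
  from integrable_cmul[OF this, of "c0 * \<omega> j x"]
  show "(\<lambda>t. c0 * g t * \<omega> j x) integrable_on (S x)" by (simp add: mult_ac)
qed (rule integrand_bound[OF G x _ k j])

lemma kern_bound:
  assumes G: "admissible g G" and x: "x \<ge> 0" and k: "k \<in> closure D" and j: "j \<le> n"
  shows "norm (fps_nth (kern G i x k) j) \<le> c0 * integral (S x) g * \<omega> j x"
proof -
  have gi: "g integrable_on (S x)"
    using integrable_on_S[OF admissibleD(1)[OF G] x] by (simp add: absolutely_integrable_on_def)
  have "norm (fps_nth (kern G i x k) j) = norm (integral (S x) (\<lambda>t. fps_nth (exp_jet (\<sigma> i) (x - t) k * G i t k) j))"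
    by (simp add: kern_def norm_mult eps)
  also have "\<dots> \<le> integral (S x) (\<lambda>t. (c0 * \<omega> j x) * g t)"
  proof (rule integral_norm_bound_integral)
    show "(\<lambda>t. fps_nth (exp_jet (\<sigma> i) (x - t) k * G i t k) j) integrable_on S x"
      using integrand_integrable[OF G x k j] by (simp add: absolutely_integrable_on_def)
    show "(\<lambda>t. c0 * \<omega> j x * g t) integrable_on S x"
      using integrable_cmul[OF gi, of "c0 * \<omega> j x"] by simp
    show "norm (fps_nth (exp_jet (\<sigma> i) (x - t) k * G i t k) j) \<le> c0 * \<omega> j x * g t" if "t \<in> S x" for t
      using integrand_bound[OF G x that k j, of i] by (simp add: mult_ac)
  qed
  also have "\<dots> = c0 * integral (S x) g * \<omega> j x" by simp
  finally show ?thesis .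
qed

lemma exp_jet_jet: "jet D n (exp_jet \<tau> s)"
proof (rule jet_of_taylor_family[OF taylor_family_exp])
  show "closure D \<subseteq> -{0}" using norm_ge by force
qed

lemma kern_jet:
  assumes G: "admissible g G" and x: "x \<ge> 0"
  shows "jet D n (kern G i x)"
proof -
  have gi: "g integrable_on (S x)"
    using integrable_on_S[OF admissibleD(1)[OF G] x] by (simp add: absolutely_integrable_on_def)
  define M where "M = (\<Sum>j\<le>n. \<omega> j x)"
  have M: "\<omega> j x \<le> M" if "j \<le> n" for j
    unfolding M_def using that omega_nonneg[OF x] by (intro member_le_sum) auto
  have "jet D n (\<lambda>k. Abs_fps (\<lambda>j. integral (S x) (\<lambda>t. fps_nth (exp_jet (\<sigma> i) (x - t) k * G i t k) j)))"
  proof (rule jet_integral[OF open_D])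
    show "jet D n (\<lambda>k. exp_jet (\<sigma> i) (x - t) k * G i t k)" if "t \<in> S x" for t
      by (intro jet_mult exp_jet_jet admissibleD(3)[OF G] S_ge[OF x that])
    show "(\<lambda>t. fps_nth (exp_jet (\<sigma> i) (x - t) k * G i t k) j) integrable_on S x" if "k \<in> closure D" "j \<le> n" for k j
      using integrand_integrable[OF G x that] by (simp add: absolutely_integrable_on_def)
    show "(\<lambda>t. (c0 * M) * g t) integrable_on S x"
      using integrable_cmul[OF gi, of "c0 * M"] by simp
    show "norm (fps_nth (exp_jet (\<sigma> i) (x - t) k * G i t k) j) \<le> (c0 * M) * g t"
      if "t \<in> S x" "k \<in> closure D" "j \<le> n" for t k j
    proof -
      have "c0 * g t * \<omega> j x \<le> c0 * g t * M"
        using M[OF that(3)] admissibleD(2)[OF G S_ge[OF x that(1)]] c0_ge by (intro mult_left_mono mult_nonneg_nonneg) auto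
      then show ?thesis using integrand_bound[OF G x that, of i] by (simp add: mult_ac)
    qed
  qed
  then have "jet D n (\<lambda>k. fps_const \<epsilon> * Abs_fps (\<lambda>j. integral (S x) (\<lambda>t. fps_nth (exp_jet (\<sigma> i) (x - t) k * G i t k) j)))"
    by (rule jet_mult[OF jet_const])
  moreover have "(\<lambda>k. fps_const \<epsilon> * Abs_fps (\<lambda>j. integral (S x) (\<lambda>t. fps_nth (exp_jet (\<sigma> i) (x - t) k * G i t k) j))) = kern G i x"
    by (auto simp: kern_def fps_eq_iff)
  ultimately show ?thesis by simp
qed

lemma kern_continuous:
  assumes G: "admissible g G" and k: "k \<in> closure D" and j: "j \<le> n"
  shows "continuous_on {0..} (\<lambda>x. fps_nth (kern G i x k) j)"
  unfolding continuous_on_sequentially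
proof (intro allI ballI impI, elim conjE)
  fix X :: "nat \<Rightarrow> real" and x assume x: "x \<in> {0..}" and X: "\<forall>n. X n \<in> {0..}" "X \<longlonglongrightarrow> x"
  have x0: "x \<ge> 0" and X0: "X l \<ge> 0" for l using x X by auto
  define f where "f y t = fps_nth (exp_jet (\<sigma> i) (y - t) k * G i t k) j" for y t
  \<comment> \<open>Without the point \<open>x\<close> itself, the indicators of \<open>S (X l)\<close> converge pointwise to that of \<open>S x\<close>.\<close>
  define T where "T = {0..} - {x}"
  have Ts: "T \<in> sets lebesgue" unfolding T_def by simp
  have int: "integral (S y) (f y) = integral T (\<lambda>t. if t \<in> S y then f y t else 0)"
    and abs: "(\<lambda>t. if t \<in> S y then f y t else 0) integrable_on T" if "y \<ge> 0" for y
  proof -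
    have fi: "f y absolutely_integrable_on (S y)"
      unfolding f_def by (rule integrand_integrable[OF G that k j])
    have "f y absolutely_integrable_on (T \<inter> S y)"
      by (rule set_integrable_subset[OF fi]) (use Ts S_sets in auto)
    then show "(\<lambda>t. if t \<in> S y then f y t else 0) integrable_on T"
      by (subst integrable_restrict_Int) (simp add: absolutely_integrable_on_def Int_commute)
    have "integral T (\<lambda>t. if t \<in> S y then f y t else 0) = integral (T \<inter> S y) (f y)"
      by (subst integral_restrict_Int) (simp add: Int_commute)
    also have "\<dots> = integral (S y) (f y)"
      by (rule integral_subset_negligible)
        (use S_sub[OF that] in \<open>auto simp: T_def intro: negligible_subset[of "{x}"]\<close>)
    finally show "integral (S y) (f y) = integral T (\<lambda>t. if t \<in> S y then f y t else 0)" by simp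
  qed
  have "(\<lambda>l. \<omega> j (X l)) \<longlonglongrightarrow> \<omega> j x"
    using omega_cont[of j] x X unfolding continuous_on_sequentially o_def by blast
  then have "Bseq (\<lambda>l. \<omega> j (X l))" by (meson convergent_def convergent_imp_Bseq)
  then obtain M where M: "\<And>l. \<omega> j (X l) \<le> M"
    unfolding Bseq_def real_norm_def by (metis abs_le_iff)
  have "(\<lambda>l. integral T (\<lambda>t. if t \<in> S (X l) then f (X l) t else 0)) \<longlonglongrightarrow> integral T (\<lambda>t. if t \<in> S x then f x t else 0)"
  proof (rule dominated_convergence(2)[OF abs[OF X0]])
    have "g absolutely_integrable_on T"
      by (rule set_integrable_subset[OF admissibleD(1)[OF G] Ts]) (auto simp: T_def)
    then have "g integrable_on T" by (simp add: absolutely_integrable_on_def)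
    from integrable_cmul[OF this, of "c0 * \<bar>M\<bar>"] show "(\<lambda>t. c0 * \<bar>M\<bar> * g t) integrable_on T" by simp
  next
    fix l t assume t: "t \<in> T"
    have g0: "g t \<ge> 0" using t admissibleD(2)[OF G] by (auto simp: T_def)
    show "norm (if t \<in> S (X l) then f (X l) t else 0) \<le> c0 * \<bar>M\<bar> * g t"
    proof (cases "t \<in> S (X l)")
      case True
      have "norm (f (X l) t) \<le> c0 * g t * \<omega> j (X l)"
        unfolding f_def by (rule integrand_bound[OF G X0 True k j])
      also have "\<dots> \<le> c0 * g t * \<bar>M\<bar>"
        using M[of l] g0 c0_ge by (intro mult_left_mono) auto
      finally show ?thesis using True by (simp add: mult_ac)
    next
      case False
      then show ?thesis using g0 c0_ge by simp
    qed
  next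
    fix t assume t: "t \<in> T"
    then have "t \<ge> 0" "t \<noteq> x" by (auto simp: T_def)
    from S_lim[OF x0 this X(2)]
    have ev: "\<forall>\<^sub>F l in sequentially. (if t \<in> S x then f (X l) t else 0) = (if t \<in> S (X l) then f (X l) t else 0)"
      by eventually_elim simp
    have e: "(\<lambda>l. fps_nth (exp_jet (\<sigma> i) (X l - t) k) r) \<longlonglongrightarrow> fps_nth (exp_jet (\<sigma> i) (x - t) k) r" for r
    proof -
      have "isCont (\<lambda>s. fps_nth (exp_jet (\<sigma> i) s k) r) (x - t)"
        using exp_jet_continuous by (simp add: continuous_on_eq_continuous_at)
      moreover have "(\<lambda>l. X l - t) \<longlonglongrightarrow> x - t" by (intro tendsto_intros X)
      ultimately show ?thesis by (rule isCont_tendsto_compose)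
    qed
    have "(\<lambda>l. f (X l) t) \<longlonglongrightarrow> f x t"
      unfolding f_def fps_mult_nth by (intro tendsto_intros e)
    then have "(\<lambda>l. if t \<in> S x then f (X l) t else 0) \<longlonglongrightarrow> (if t \<in> S x then f x t else 0)" by simp
    then show "(\<lambda>l. if t \<in> S (X l) then f (X l) t else 0) \<longlonglongrightarrow> (if t \<in> S x then f x t else 0)"
      by (rule Lim_transform_eventually[OF _ ev])
  qed
  then have "(\<lambda>l. integral (S (X l)) (f (X l))) \<longlonglongrightarrow> integral (S x) (f x)"
    using int[OF X0] int[OF x0] by simp
  then have "(\<lambda>l. \<epsilon> * integral (S (X l)) (f (X l))) \<longlonglongrightarrow> \<epsilon> * integral (S x) (f x)"
    by (rule tendsto_mult_left)
  then show "((\<lambda>x. fps_nth (kern G i x k) j) \<circ> X) \<longlonglongrightarrow> fps_nth (kern G i x k) j"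
    by (simp add: kern_def f_def[abs_def] o_def)
qed

text \<open>Multiplication of a column vector by the coefficient matrix \<open>V0 + V1 / k\<close>, on jets.\<close>

definition coeff_mult :: "(2 \<Rightarrow> 2 \<Rightarrow> real \<Rightarrow> complex) \<Rightarrow> (2 \<Rightarrow> 2 \<Rightarrow> real \<Rightarrow> complex) \<Rightarrow>
    (2 \<Rightarrow> real \<Rightarrow> complex \<Rightarrow> complex fps) \<Rightarrow> 2 \<Rightarrow> real \<Rightarrow> complex \<Rightarrow> complex fps" where
  "coeff_mult V0 V1 F i t k =
    (\<Sum>d\<in>UNIV. (fps_const (V0 i d t) + fps_const (V1 i d t) * inverse_jet k) * F d t k)"

lemma inverse_jet_jet: "jet D n inverse_jet"
proof (rule jet_of_taylor_family[OF taylor_family_inverse])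
  show "closure D \<subseteq> -{0}" using norm_ge by force
qed

lemma inverse_jet_le:
  assumes "k \<in> closure D"
  shows "norm (fps_nth (inverse_jet k) p) \<le> 1"
proof -
  have "1 / norm k ^ Suc p \<le> 1"
    using one_le_power[OF norm_ge[OF assms], of "Suc p"] by (subst divide_le_eq_1_pos) linarith+
  then show ?thesis by (simp add: inverse_jet_def norm_divide norm_power norm_mult del: power_Suc)
qed

lemma coeff_jet_le:
  assumes "k \<in> closure D"
  shows "norm (fps_nth (fps_const a + fps_const b * inverse_jet k) p) \<le> norm a + norm b"
proof -
  have "norm (fps_nth (fps_const a + fps_const b * inverse_jet k) p) \<le>
      norm (fps_nth (fps_const a) p) + norm (b * fps_nth (inverse_jet k) p)"
    by (simp add: norm_triangle_ineq del: fps_nth_fps_const)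
  also have "\<dots> \<le> norm a + norm b * 1"
    unfolding norm_mult by (intro add_mono mult_left_mono inverse_jet_le assms) auto
  finally show ?thesis by simp
qed

lemma admissible_coeff_mult:
  assumes V: "\<And>i d. continuous_on {0..} (V0 i d)" "\<And>i d. continuous_on {0..} (V1 i d)"
    and q: "\<And>i d t. t \<ge> 0 \<Longrightarrow> norm (V0 i d t) + norm (V1 i d t) \<le> q t"
    and qh: "(\<lambda>t. q t * h t) absolutely_integrable_on {0..}" and h: "\<And>t. t \<ge> 0 \<Longrightarrow> h t \<ge> 0" and A: "A \<ge> 0"
    and jets: "\<And>d t. t \<ge> 0 \<Longrightarrow> jet D n (F d t)"
    and cont: "\<And>d k j. k \<in> closure D \<Longrightarrow> j \<le> n \<Longrightarrow> continuous_on {0..} (\<lambda>t. fps_nth (F d t k) j)"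
    and bound: "\<And>d t k j. t \<ge> 0 \<Longrightarrow> k \<in> closure D \<Longrightarrow> j \<le> n \<Longrightarrow> norm (fps_nth (F d t k) j) \<le> A * h t * \<omega> j t"
  shows "admissible (\<lambda>t. (2 * real (n + 1) * A) * (q t * h t)) (coeff_mult V0 V1 F)"
proof -
  have q0: "q t \<ge> 0" if "t \<ge> 0" for t using q[OF that, of 1 1] by (smt (verit) norm_ge_zero)
  have 1: "(\<lambda>t. (2 * real (n + 1) * A) * (q t * h t)) absolutely_integrable_on {0..}"
    using qh by (rule set_integrable_mult_right)
  have 2: "(2 * real (n + 1) * A) * (q t * h t) \<ge> 0" if "t \<ge> 0" for t
    using q0[OF that] h[OF that] A by simp
  have 3: "jet D n (coeff_mult V0 V1 F i t)" if "t \<ge> 0" for i t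
    unfolding coeff_mult_def by (intro jet_sum jet_mult jet_add jet_const inverse_jet_jet jets that) auto
  have "continuous_on {0..} (\<lambda>t. fps_nth (coeff_mult V0 V1 F i t k) j)" if "k \<in> closure D" "j \<le> n" for i k j
  proof -
    have *: "continuous_on {0..} (\<lambda>t. fps_nth (fps_const (V0 i d t) + fps_const (V1 i d t) * inverse_jet k) p)" for d p
      by (cases p) (simp_all, (intro continuous_intros V)+)
    show ?thesis
      unfolding coeff_mult_def fps_sum_nth fps_mult_nth
      by (intro continuous_intros cont *) (use that in auto)
  qed
  then have 4: "(\<lambda>t. fps_nth (coeff_mult V0 V1 F i t k) j) \<in> borel_measurable (lebesgue_on {0..})"
    if "k \<in> closure D" "j \<le> n" for i k j
    using that by (intro continuous_imp_measurable_on_sets_lebesgue) auto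
  have 5: "norm (fps_nth (coeff_mult V0 V1 F i t k) j) \<le> (2 * real (n + 1) * A) * (q t * h t) * \<omega> j t"
    if t: "t \<ge> 0" and k: "k \<in> closure D" and j: "j \<le> n" for i t k j
  proof -
    have "norm (fps_nth ((fps_const (V0 i d t) + fps_const (V1 i d t) * inverse_jet k) * F d t k) j) \<le> (\<Sum>l=0..j. q t * (A * h t * \<omega> j t))" for d
      unfolding fps_mult_nth
    proof (rule sum_norm_le)
      fix l assume l: "l \<in> {0..j}"
      have "norm (fps_nth (fps_const (V0 i d t) + fps_const (V1 i d t) * inverse_jet k) l * fps_nth (F d t k) (j - l))
        \<le> q t * (A * h t * \<omega> (j - l) t)"
        unfolding norm_mult using j l q0[OF t]
        by (intro mult_mono order_trans[OF coeff_jet_le[OF k] q[OF t]] bound[OF t k]) auto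
      also have "\<dots> \<le> q t * (A * h t * \<omega> j t)"
        using q0[OF t] h[OF t] A j by (intro mult_left_mono omega_le t mult_nonneg_nonneg) auto
      finally show "norm (fps_nth (fps_const (V0 i d t) + fps_const (V1 i d t) * inverse_jet k) l * fps_nth (F d t k) (j - l))
        \<le> q t * (A * h t * \<omega> j t)" .
    qed
    also have "(\<Sum>l=0..j. q t * (A * h t * \<omega> j t)) \<le> real (n + 1) * (q t * (A * h t * \<omega> j t))"
      using j q0[OF t] h[OF t] A omega_nonneg[OF t] by (auto intro!: mult_right_mono)
    finally have *: "norm (fps_nth ((fps_const (V0 i d t) + fps_const (V1 i d t) * inverse_jet k) * F d t k) j)
        \<le> real (n + 1) * (q t * (A * h t * \<omega> j t))" for d .
    have "norm (fps_nth (coeff_mult V0 V1 F i t k) j) \<le> (\<Sum>d\<in>(UNIV::2 set). real (n + 1) * (q t * (A * h t * \<omega> j t)))"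
      unfolding coeff_mult_def fps_sum_nth by (rule sum_norm_le) (rule *)
    then show ?thesis by (simp add: algebra_simps)
  qed
  show ?thesis unfolding admissible_def using 1 2 3 4 5 by blast
qed

lemma kern_0:
  "fps_nth (kern G i x k) 0 =
    \<epsilon> * integral (S x) (\<lambda>t. exp (\<sigma> i * (k - 1 / k) * of_real (x - t)) * fps_nth (G i t k) 0)"
  by (simp add: kern_def exp_jet_0)

lemma coeff_mult_0:
  "fps_nth (coeff_mult V0 V1 F i t k) 0 = (\<Sum>d\<in>UNIV. (V0 i d t + V1 i d t / k) * fps_nth (F d t k) 0)"
  by (simp add: coeff_mult_def fps_sum_nth inverse_jet_def)

text \<open>The jets of the Neumann series solve the equation with bounds of size \<open>\<omega> j\<close>. The weight \<open>h\<close> satisfies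
\<open>\<integral>\<^bsub>S x\<^esub> q h \<le> h x / (4 c0 (n + 1))\<close>, so that the bounds of successive terms halve.
Any solution \<open>u\<close> which is bounded on \<open>S x\<close> for each fixed \<open>x\<close> and \<open>k\<close> equals the sum of the series, hence has the
same \<open>k\<close>-derivatives.\<close>

theorem volterra_jet_bound:
  assumes V: "\<And>i d. continuous_on {0..} (V0 i d)" "\<And>i d. continuous_on {0..} (V1 i d)"
    and q: "\<And>i d t. t \<ge> 0 \<Longrightarrow> norm (V0 i d t) + norm (V1 i d t) \<le> q t"
    and qh: "(\<lambda>t. q t * h t) absolutely_integrable_on {0..}" and h: "\<And>t. t \<ge> 0 \<Longrightarrow> 1 \<le> h t \<and> h t \<le> B"
    and hS: "\<And>x. x \<ge> 0 \<Longrightarrow> integral (S x) (\<lambda>t. q t * h t) \<le> h x / (4 * c0 * real (n + 1))"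
    and R: "admissible g R"
    and u_int: "\<And>i x k. x \<ge> 0 \<Longrightarrow> k \<in> closure D \<Longrightarrow>
      (\<lambda>t. exp (\<sigma> i * (k - 1 / k) * of_real (x - t)) *
        ((\<Sum>d\<in>UNIV. (V0 i d t + V1 i d t / k) * u d t k) + fps_nth (R i t k) 0)) absolutely_integrable_on (S x)"
    and u_eq: "\<And>i x k. x \<ge> 0 \<Longrightarrow> k \<in> closure D \<Longrightarrow> u i x k = \<epsilon> * integral (S x)
      (\<lambda>t. exp (\<sigma> i * (k - 1 / k) * of_real (x - t)) *
        ((\<Sum>d\<in>UNIV. (V0 i d t + V1 i d t / k) * u d t k) + fps_nth (R i t k) 0))"
    and u_bounded: "\<And>x k. x \<ge> 0 \<Longrightarrow> k \<in> closure D \<Longrightarrow> \<exists>M. \<forall>i. \<forall>t\<in>S x. norm (u i t k) \<le> M"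
  shows "\<exists>C. \<forall>x\<ge>0. \<forall>i. \<exists>F. jet D n F \<and> (\<forall>k\<in>closure D. fps_nth (F k) 0 = u i x k \<and>
      (\<forall>j\<le>n. norm (fps_nth (F k) j) \<le> C * \<omega> j x))"
proof -
  define F where "F l = ((\<lambda>F. kern (coeff_mult V0 V1 F)) ^^ l) (kern R)" for l
  have F0: "F 0 = kern R" and FS: "F (Suc l) = kern (coeff_mult V0 V1 (F l))" for l
    by (simp_all add: F_def)
  define A where "A = c0 * integral {0..} g"
  have gint: "g integrable_on {0..}" using admissibleD(1)[OF R] by (simp add: absolutely_integrable_on_def)
  have A0: "A \<ge> 0" unfolding A_def using c0_ge gint admissibleD(2)[OF R]
    by (intro mult_nonneg_nonneg Henstock_Kurzweil_Integration.integral_nonneg) auto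
  have inv: "(\<forall>d t. t \<ge> 0 \<longrightarrow> jet D n (F l d t)) \<and>
     (\<forall>d. \<forall>k\<in>closure D. \<forall>j\<le>n. continuous_on {0..} (\<lambda>t. fps_nth (F l d t k) j)) \<and>
     (\<forall>d t. t \<ge> 0 \<longrightarrow> (\<forall>k\<in>closure D. \<forall>j\<le>n. norm (fps_nth (F l d t k) j) \<le> (A / 2 ^ l) * h t * \<omega> j t))" for l
  proof (induction l)
    case 0
    have "norm (fps_nth (kern R d t k) j) \<le> A * h t * \<omega> j t" if t: "t \<ge> 0" and k: "k \<in> closure D" and j: "j \<le> n" for d t k j
    proof -
      have "integral (S t) g \<le> integral {0..} g"
        using integrable_on_S[OF admissibleD(1)[OF R] t] gint admissibleD(2)[OF R] S_sub[OF t]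
        by (intro integral_subset_le) (auto simp: absolutely_integrable_on_def)
      then have "c0 * integral (S t) g \<le> A * 1" unfolding A_def using c0_ge by simp
      also have "\<dots> \<le> A * h t" using A0 h[OF t] by (intro mult_left_mono) auto
      finally have "c0 * integral (S t) g * \<omega> j t \<le> A * h t * \<omega> j t"
        by (rule mult_right_mono[OF _ omega_nonneg[OF t]])
      then show ?thesis using kern_bound[OF R t k j, of d] by (rule order_trans[rotated])
    qed
    then show ?case unfolding F0 using kern_jet[OF R] kern_continuous[OF R] by simp
  next
    case (Suc l)
    have Al: "A / 2 ^ l \<ge> 0" using A0 by simp
    have adm: "admissible (\<lambda>t. (2 * real (n + 1) * (A / 2 ^ l)) * (q t * h t)) (coeff_mult V0 V1 (F l))"
    proof (rule admissible_coeff_mult[OF V q qh _ Al])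
      show "0 \<le> h t" if "t \<ge> 0" for t using h[OF that] by linarith
    qed (use Suc in blast)+
    have "norm (fps_nth (F (Suc l) d t k) j) \<le> (A / 2 ^ Suc l) * h t * \<omega> j t" if t: "t \<ge> 0" and k: "k \<in> closure D" and j: "j \<le> n" for d t k j
    proof -
      have "norm (fps_nth (F (Suc l) d t k) j) \<le> c0 * integral (S t) (\<lambda>t. (2 * real (n + 1) * (A / 2 ^ l)) * (q t * h t)) * \<omega> j t"
        unfolding FS by (rule kern_bound[OF adm t k j])
      also have "\<dots> = c0 * (2 * real (n + 1) * (A / 2 ^ l)) * integral (S t) (\<lambda>t. q t * h t) * \<omega> j t"
        by simp
      also have "\<dots> \<le> c0 * (2 * real (n + 1) * (A / 2 ^ l)) * (h t / (4 * c0 * real (n + 1))) * \<omega> j t"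
        using c0_ge A0 by (intro mult_right_mono mult_left_mono hS t omega_nonneg) auto
      also have "\<dots> = (A / 2 ^ Suc l) * h t * \<omega> j t"
      proof -
        have gen: "c0 * (2 * N * (A / 2 ^ l)) * (h t / (4 * c0 * N)) * \<omega> j t = (A / 2 ^ Suc l) * h t * \<omega> j t" if "N > 0" for N
          using c0_ge that by (simp add: field_simps)
        show ?thesis by (rule gen) simp
      qed
      finally show ?thesis .
    qed
    then show ?case unfolding FS using kern_jet[OF adm] kern_continuous[OF adm] by simp
  qed
  have Fjet: "jet D n (F l d t)" if "t \<ge> 0" for l d t using inv[of l] that by blast
  have Fbound: "norm (fps_nth (F l d t k) j) \<le> (A / 2 ^ l) * h t * \<omega> j t" if "t \<ge> 0" "k \<in> closure D" "j \<le> n" for l d t k j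
    using inv[of l] that by blast
  have adm: "admissible (\<lambda>t. (2 * real (n + 1) * (A / 2 ^ l)) * (q t * h t)) (coeff_mult V0 V1 (F l))" for l
  proof (rule admissible_coeff_mult[OF V q qh])
    show "0 \<le> h t" if "t \<ge> 0" for t using h[OF that] by linarith
    show "0 \<le> A / 2 ^ l" using A0 by simp
  qed (use inv[of l] in blast)+
  \<comment> \<open>Uniqueness: for fixed \<open>k\<close>, the bound for the difference between \<open>u\<close> and the partial sums
    halves with every step, again measured against the weight \<open>h\<close>.\<close>
  have approx: "norm (u i y k - (\<Sum>l<N. fps_nth (F l i y k) 0)) \<le> M * h y / 2 ^ N"
    if x: "x \<ge> 0" and k: "k \<in> closure D" and M: "\<And>i t. t \<in> S x \<Longrightarrow> norm (u i t k) \<le> M" and y: "y \<in> S x"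
    for x k M i y N
    using y
  proof (induction N arbitrary: i y)
    case 0
    have "norm (u i y k) \<le> M" using M[OF 0] .
    moreover have "M * 1 \<le> M * h y"
      using h[OF S_ge[OF x 0]] order_trans[OF norm_ge_zero M[OF 0]] by (intro mult_left_mono) auto
    ultimately show ?case by simp
  next
    case (Suc N)
    note y = Suc.prems
    have y0: "y \<ge> 0" by (rule S_ge[OF x y])
    define e where "e t = exp (\<sigma> i * (k - 1 / k) * of_real (y - t))" for t
    define w where "w d t = (\<Sum>l<N. fps_nth (F l d t k) 0)" for d t
    have e1: "norm (e t) \<le> 1" if "t \<in> S y" for t
      using sigma_Re[OF k y0 that, of i] by (simp add: e_def)
    have iR: "(\<lambda>t. e t * fps_nth (R i t k) 0) integrable_on S y"
      using integrand_integrable[OF R y0 k, of 0 i]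
      by (simp add: exp_jet_0 e_def absolutely_integrable_on_def)
    have iF: "(\<lambda>t. e t * fps_nth (coeff_mult V0 V1 (F l) i t k) 0) integrable_on S y" for l
      using integrand_integrable[OF adm[of l] y0 k, of 0 i]
      by (simp add: exp_jet_0 e_def absolutely_integrable_on_def)
    have iu: "(\<lambda>t. e t * ((\<Sum>d\<in>UNIV. (V0 i d t + V1 i d t / k) * u d t k) + fps_nth (R i t k) 0)) integrable_on S y"
      using u_int[OF y0 k, of i] by (simp add: e_def absolutely_integrable_on_def)
    have iw: "(\<lambda>t. \<Sum>l<N. e t * fps_nth (coeff_mult V0 V1 (F l) i t k) 0) integrable_on S y"
      by (intro integrable_sum iF) auto
    have "u i y k - (\<Sum>l<Suc N. fps_nth (F l i y k) 0)
      = \<epsilon> * integral (S y) (\<lambda>t. e t * ((\<Sum>d\<in>UNIV. (V0 i d t + V1 i d t / k) * u d t k) + fps_nth (R i t k) 0))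
       - (\<epsilon> * integral (S y) (\<lambda>t. e t * fps_nth (R i t k) 0)
         + (\<Sum>l<N. \<epsilon> * integral (S y) (\<lambda>t. e t * fps_nth (coeff_mult V0 V1 (F l) i t k) 0)))"
      unfolding sum.lessThan_Suc_shift F0 FS kern_0 e_def[symmetric] using u_eq[OF y0 k, of i]
      by (simp only: e_def)
    also have "\<dots> = \<epsilon> * integral (S y) (\<lambda>t. e t * ((\<Sum>d\<in>UNIV. (V0 i d t + V1 i d t / k) * u d t k) + fps_nth (R i t k) 0)
         - (e t * fps_nth (R i t k) 0 + (\<Sum>l<N. e t * fps_nth (coeff_mult V0 V1 (F l) i t k) 0)))"
      by (rule integral_linear_combination[OF iu iR iF])
    also have "(\<lambda>t. e t * ((\<Sum>d\<in>UNIV. (V0 i d t + V1 i d t / k) * u d t k) + fps_nth (R i t k) 0)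
         - (e t * fps_nth (R i t k) 0 + (\<Sum>l<N. e t * fps_nth (coeff_mult V0 V1 (F l) i t k) 0)))
       = (\<lambda>t. e t * (\<Sum>d\<in>UNIV. (V0 i d t + V1 i d t / k) * (u d t k - w d t)))"
    proof
      fix t
      have "(\<Sum>l<N. e t * fps_nth (coeff_mult V0 V1 (F l) i t k) 0) = e t * (\<Sum>d\<in>UNIV. (V0 i d t + V1 i d t / k) * w d t)"
        unfolding coeff_mult_0 w_def sum_distrib_left by (subst sum.swap) simp
      then show "e t * ((\<Sum>d\<in>UNIV. (V0 i d t + V1 i d t / k) * u d t k) + fps_nth (R i t k) 0)
         - (e t * fps_nth (R i t k) 0 + (\<Sum>l<N. e t * fps_nth (coeff_mult V0 V1 (F l) i t k) 0))
       = e t * (\<Sum>d\<in>UNIV. (V0 i d t + V1 i d t / k) * (u d t k - w d t))"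
        by (simp add: right_diff_distrib sum_subtractf distrib_left)
    qed
    finally have eq: "u i y k - (\<Sum>l<Suc N. fps_nth (F l i y k) 0)
       = \<epsilon> * integral (S y) (\<lambda>t. e t * (\<Sum>d\<in>UNIV. (V0 i d t + V1 i d t / k) * (u d t k - w d t)))" .
    have ie: "(\<lambda>t. e t * (\<Sum>d\<in>UNIV. (V0 i d t + V1 i d t / k) * (u d t k - w d t))) integrable_on S y"
    proof -
      have "(\<lambda>t. e t * ((\<Sum>d\<in>UNIV. (V0 i d t + V1 i d t / k) * u d t k) + fps_nth (R i t k) 0)
         - (e t * fps_nth (R i t k) 0 + (\<Sum>l<N. e t * fps_nth (coeff_mult V0 V1 (F l) i t k) 0))) integrable_on S y"
        by (intro integrable_diff integrable_add iu iR iw)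
      moreover have "e t * ((\<Sum>d\<in>UNIV. (V0 i d t + V1 i d t / k) * u d t k) + fps_nth (R i t k) 0)
         - (e t * fps_nth (R i t k) 0 + (\<Sum>l<N. e t * fps_nth (coeff_mult V0 V1 (F l) i t k) 0))
         = e t * (\<Sum>d\<in>UNIV. (V0 i d t + V1 i d t / k) * (u d t k - w d t))" for t
      proof -
        have "(\<Sum>l<N. e t * fps_nth (coeff_mult V0 V1 (F l) i t k) 0) = e t * (\<Sum>d\<in>UNIV. (V0 i d t + V1 i d t / k) * w d t)"
          unfolding coeff_mult_0 w_def sum_distrib_left by (subst sum.swap) simp
        then show ?thesis by (simp add: right_diff_distrib sum_subtractf distrib_left)
      qed
      ultimately show ?thesis by simp
    qed
    have qhi: "(\<lambda>t. q t * h t) integrable_on S y"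
      using integrable_on_S[OF qh y0] by (simp add: absolutely_integrable_on_def)
    have "norm (u i y k - (\<Sum>l<Suc N. fps_nth (F l i y k) 0)) \<le> integral (S y) (\<lambda>t. (2 * M / 2 ^ N) * (q t * h t))"
      unfolding eq norm_mult eps mult_1_left
    proof (rule integral_norm_bound_integral[OF ie])
      show "(\<lambda>t. (2 * M / 2 ^ N) * (q t * h t)) integrable_on S y"
        using integrable_cmul[OF qhi, of "2 * M / 2 ^ N"] by simp
      fix t assume t: "t \<in> S y"
      have tx: "t \<in> S x" using S_trans[OF x y] t by blast
      have t0: "t \<ge> 0" by (rule S_ge[OF y0 t])
      have "norm ((V0 i d t + V1 i d t / k) * (u d t k - w d t)) \<le> q t * (M * h t / 2 ^ N)" for d
        unfolding norm_mult
      proof (rule mult_mono)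
        have "norm (V1 i d t / k) \<le> norm (V1 i d t)"
          using norm_ge[OF k] by (simp add: norm_divide divide_le_eq mult_le_cancel_left1 order_less_le_trans[OF zero_less_one])
        then show "norm (V0 i d t + V1 i d t / k) \<le> q t"
          using q[OF t0, of i d] norm_triangle_ineq[of "V0 i d t" "V1 i d t / k"] by linarith
        show "norm (u d t k - w d t) \<le> M * h t / 2 ^ N"
          unfolding w_def by (rule Suc.IH[OF tx])
        show "0 \<le> q t" using q[OF t0, of i d] norm_ge_zero[of "V0 i d t"] norm_ge_zero[of "V1 i d t"] by linarith
      qed simp
      then have "norm (\<Sum>d\<in>UNIV. (V0 i d t + V1 i d t / k) * (u d t k - w d t)) \<le> (\<Sum>d\<in>(UNIV::2 set). q t * (M * h t / 2 ^ N))"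
        by (intro sum_norm_le)
      then have "norm (e t) * norm (\<Sum>d\<in>UNIV. (V0 i d t + V1 i d t / k) * (u d t k - w d t)) \<le> 1 * (\<Sum>d\<in>(UNIV::2 set). q t * (M * h t / 2 ^ N))"
        by (intro mult_mono e1 t) auto
      then show "norm (e t * (\<Sum>d\<in>UNIV. (V0 i d t + V1 i d t / k) * (u d t k - w d t))) \<le> (2 * M / 2 ^ N) * (q t * h t)"
        by (simp add: norm_mult mult_ac)
    qed
    also have "\<dots> = (2 * M / 2 ^ N) * integral (S y) (\<lambda>t. q t * h t)" by simp
    also have "\<dots> \<le> (2 * M / 2 ^ N) * (h y / 4)"
    proof (rule mult_left_mono)
      have "1 * 1 \<le> c0 * real (n + 1)" using c0_ge by (intro mult_mono) auto
      then have "h y / (4 * c0 * real (n + 1)) \<le> h y / 4"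
        using h[OF y0] by (intro divide_left_mono) auto
      then show "integral (S y) (\<lambda>t. q t * h t) \<le> h y / 4" using hS[OF y0] by linarith
      show "0 \<le> 2 * M / 2 ^ N" using order_trans[OF norm_ge_zero M[OF y]] by simp
    qed
    also have "\<dots> = M * h y / 2 ^ Suc N" by simp
    finally show ?case .
  qed
  define C where "C = 2 * A * B"
  show ?thesis
  proof (intro exI[of _ C] allI impI)
    fix x :: real and i :: 2 assume x: "x \<ge> 0"
    define T where "T k = Abs_fps (\<lambda>j. \<Sum>l. fps_nth (F l i x k) j)" for k
    define Om where "Om = (\<Sum>j\<le>n. \<omega> j x)"
    have Om: "\<omega> j x \<le> Om" if "j \<le> n" for j
      unfolding Om_def using that omega_nonneg[OF x] by (intro member_le_sum) auto
    have half: "(\<lambda>l. A / 2 ^ l) sums (2 * A)"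
      using sums_mult[OF geometric_sums[of "1 / 2 :: real"], of A] by (simp add: power_one_over field_simps)
    have hB: "0 \<le> h x" "h x \<le> B" using h[OF x] by linarith+
    have jet: "jet D n T"
      unfolding T_def
    proof (rule jet_suminf[OF open_D Fjet[OF x]])
      show "norm (fps_nth (F l i x k) j) \<le> A / 2 ^ l * (h x * Om)" if "k \<in> closure D" "j \<le> n" for l k j
      proof -
        have "A / 2 ^ l * h x * \<omega> j x \<le> A / 2 ^ l * h x * Om"
          using Om[OF that(2)] A0 hB by (intro mult_left_mono) auto
        then show ?thesis using Fbound[OF x that, of l i] by (simp add: mult.assoc)
      qed
      show "summable (\<lambda>l. A / 2 ^ l * (h x * Om))"
        by (intro summable_mult2 sums_summable[OF half])
    qed
    have bound: "norm (fps_nth (T k) j) \<le> C * \<omega> j x" if k: "k \<in> closure D" and j: "j \<le> n" for k j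
    proof -
      have s: "(\<lambda>l. A / 2 ^ l * (h x * \<omega> j x)) sums (2 * A * (h x * \<omega> j x))"
        by (rule sums_mult2[OF half])
      have "norm (\<Sum>l. fps_nth (F l i x k) j) \<le> (\<Sum>l. A / 2 ^ l * (h x * \<omega> j x))"
        by (rule norm_suminf_le[OF _ sums_summable[OF s]]) (use Fbound[OF x k j, of _ i] in \<open>simp add: mult.assoc\<close>)
      also have "\<dots> = 2 * A * (h x * \<omega> j x)" by (rule sums_unique[OF s, symmetric])
      also have "\<dots> \<le> 2 * A * (B * \<omega> j x)"
        using A0 hB omega_nonneg[OF x] by (intro mult_left_mono mult_right_mono) auto
      finally show ?thesis by (simp add: T_def C_def mult_ac)
    qed
    have val: "fps_nth (T k) 0 = u i x k" if k: "k \<in> closure D" for k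
    proof -
      obtain M where "\<forall>i. \<forall>t\<in>S x. norm (u i t k) \<le> M" using u_bounded[OF x k] ..
      then have M: "norm (u i t k) \<le> M" if "t \<in> S x" for i t using that by simp
      have le: "norm (u i x k - (\<Sum>l<N. fps_nth (F l i x k) 0)) \<le> M * h x / 2 ^ N" for N
        by (rule approx[OF x k M S_refl[OF x]])
      have "(\<lambda>N. u i x k - (\<Sum>l<N. fps_nth (F l i x k) 0)) \<longlonglongrightarrow> 0"
      proof (rule Lim_null_comparison)
        show "\<forall>\<^sub>F N in sequentially. norm (u i x k - (\<Sum>l<N. fps_nth (F l i x k) 0)) \<le> M * h x * (1 / 2) ^ N"
          using le by (intro always_eventually allI) (simp only: power_one_over mult_1_right times_divide_eq_right)
        show "(\<lambda>N. M * h x * (1 / 2) ^ N) \<longlonglongrightarrow> 0"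
          by (intro tendsto_mult_right_zero LIMSEQ_realpow_zero) auto
      qed
      then have "(\<lambda>N. \<Sum>l<N. fps_nth (F l i x k) 0) \<longlonglongrightarrow> u i x k"
        by (rule Lim_transform2[OF tendsto_const])
      then show ?thesis unfolding T_def fps_nth_Abs_fps sums_def[symmetric] by (simp add: sums_iff)
    qed
    show "\<exists>F. jet D n F \<and> (\<forall>k\<in>closure D. fps_nth (F k) 0 = u i x k \<and> (\<forall>j\<le>n. norm (fps_nth (F k) j) \<le> C * \<omega> j x))"
      using jet bound val by (intro exI[of _ T]) simp
  qed
qed

end

section \<open>Exponential weights and powers of the spectral parameter\<close>

lemma integral_ge_le_total:
  fixes q :: "real \<Rightarrow> real"
  assumes "q absolutely_integrable_on {0..}" "\<And>t. t \<ge> 0 \<Longrightarrow> q t \<ge> 0" "x \<ge> 0"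
  shows "0 \<le> integral {0..x} q" "integral {0..x} q \<le> integral {0..} q"
proof -
  have qi: "q absolutely_integrable_on {0..x}"
    using absolutely_integrable_on_subinterval[OF assms(1)] by auto
  show "0 \<le> integral {0..x} q"
    using qi assms(2) by (intro Henstock_Kurzweil_Integration.integral_nonneg) (auto simp: absolutely_integrable_on_def)
  show "integral {0..x} q \<le> integral {0..} q"
    using qi assms(1,2) by (intro integral_subset_le) (auto simp: absolutely_integrable_on_def)
qed

text \<open>The weights are exponentials of a multiple of \<open>\<integral> q\<close>. They are at least 1 in two cases: \<open>L > 0\<close> and
\<open>c = 0\<close>, used for integrals over \<open>[0,x]\<close>; \<open>L < 0\<close> and \<open>c\<close> the total integral of \<open>q\<close>, used for
integrals over \<open>[x,\<infinity>)\<close>.\<close>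

lemma exponential_weight:
  fixes q :: "real \<Rightarrow> real" and L :: real
  assumes q: "continuous_on {0..} q" "q absolutely_integrable_on {0..}" "\<And>t. t \<ge> 0 \<Longrightarrow> q t \<ge> 0"
    and L: "\<bar>L\<bar> = \<Lambda>" and c: "c = 0 \<or> c = integral {0..} q"
  defines "h \<equiv> \<lambda>x. exp (L * (integral {0..x} q - c))"
  shows "continuous_on {0..} h"
    and "\<And>x. x \<ge> 0 \<Longrightarrow> h x \<le> exp (\<Lambda> * integral {0..} q)"
    and "\<And>a b. 0 \<le> a \<Longrightarrow> a \<le> b \<Longrightarrow> L * integral {a..b} (\<lambda>t. q t * h t) = h b - h a"
    and "(\<lambda>t. q t * h t) absolutely_integrable_on {0..}"
proof -
  have deriv: "(h has_vector_derivative L * (q x * h x)) (at x within {0..})" if "x \<ge> 0" for x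
  proof -
    have "continuous_on {0..x+1} q" using q(1) by (rule continuous_on_subset) auto
    then have "((\<lambda>x. integral {0..x} q) has_vector_derivative q x) (at x within {0..x+1})"
      using that by (intro integral_has_vector_derivative) auto
    moreover have "at x within {0..x+1} = at x within {0..}"
      by (rule at_within_nhd[of x "{..<x+1}"]) (use that in auto)
    ultimately have "((\<lambda>x. integral {0..x} q) has_real_derivative q x) (at x within {0..})"
      by (simp add: has_real_derivative_iff_has_vector_derivative)
    then have "(h has_real_derivative L * (q x * h x)) (at x within {0..})"
      unfolding h_def by (auto intro!: derivative_eq_intros)
    then show ?thesis by (simp add: has_real_derivative_iff_has_vector_derivative)
  qed
  show cont: "continuous_on {0..} h"
    using deriv by (auto simp: continuous_on_eq_continuous_within intro: has_vector_derivative_continuous)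
  show le: "h x \<le> exp (\<Lambda> * integral {0..} q)" if "x \<ge> 0" for x
  proof -
    have "\<bar>integral {0..x} q - c\<bar> \<le> integral {0..} q"
      using integral_ge_le_total[OF q(2,3) that] c by auto
    then have "\<bar>L * (integral {0..x} q - c)\<bar> \<le> \<Lambda> * integral {0..} q"
      unfolding abs_mult L by (intro mult_left_mono) (use L in auto)
    then show ?thesis by (simp add: h_def)
  qed
  show "L * integral {a..b} (\<lambda>t. q t * h t) = h b - h a" if "0 \<le> a" "a \<le> b" for a b
  proof -
    have "((\<lambda>t. L * (q t * h t)) has_integral (h b - h a)) {a..b}"
      using that by (intro fundamental_theorem_of_calculus) (auto intro!: has_vector_derivative_within_subset[OF deriv])
    from integral_unique[OF this] show ?thesis by simp
  qed
  have "(\<lambda>t. h t * q t) absolutely_integrable_on {0..}"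
  proof (rule absolutely_integrable_bilinear_continuous[OF bounded_bilinear_mult cont _ q(2)])
    show "bounded (h ` {0..})"
      unfolding bounded_real using le by (intro exI[of _ "exp (\<Lambda> * integral {0..} q)"]) (auto simp: h_def)
  qed simp
  then show "(\<lambda>t. q t * h t) absolutely_integrable_on {0..}" by (simp add: mult.commute)
qed

lemma weight_left:
  fixes q :: "real \<Rightarrow> real" and \<theta> :: real
  assumes q: "continuous_on {0..} q" "q absolutely_integrable_on {0..}" "\<And>t. t \<ge> 0 \<Longrightarrow> q t \<ge> 0" and \<theta>: "\<theta> > 0"
  shows "\<exists>h B. (\<forall>t\<ge>0. 1 \<le> h t \<and> h t \<le> B) \<and> (\<lambda>t. q t * h t) absolutely_integrable_on {0..} \<and>
    (\<forall>x\<ge>0. integral {0..x} (\<lambda>t. q t * h t) \<le> \<theta> * h x)"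
proof -
  define L where "L = 1 / \<theta>"
  define h where "h = (\<lambda>x. exp (L * (integral {0..x} q - 0)))"
  have L: "L > 0" "\<bar>L\<bar> = L" using \<theta> by (auto simp: L_def)
  have c: "(0::real) = 0 \<or> 0 = integral {0..} q" by simp
  have w2: "h x \<le> exp (L * integral {0..} q)" if "x \<ge> 0" for x
    unfolding h_def by (rule exponential_weight(2)[OF q(1,2) q(3) L(2) c that])
  have w3: "L * integral {a..b} (\<lambda>t. q t * h t) = h b - h a" if "0 \<le> a" "a \<le> b" for a b
    unfolding h_def by (rule exponential_weight(3)[OF q(1,2) q(3) L(2) c that])
  have w4: "(\<lambda>t. q t * h t) absolutely_integrable_on {0..}"
    unfolding h_def by (rule exponential_weight(4)[OF q(1,2) q(3) L(2) c])
  have h1: "1 \<le> h t" if "t \<ge> 0" for t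
    using integral_ge_le_total(1)[OF q(2,3) that] L by (simp add: h_def)
  have h2: "integral {0..x} (\<lambda>t. q t * h t) \<le> \<theta> * h x" if "x \<ge> 0" for x
  proof -
    have "L * integral {0..x} (\<lambda>t. q t * h t) \<le> h x"
      using w3[of 0 x] that by (simp add: h_def)
    then show ?thesis using \<theta> by (simp add: L_def field_simps)
  qed
  show ?thesis
    using h1 h2 w2 w4 by (intro exI[of _ h] exI[of _ "exp (L * integral {0..} q)"]) simp
qed

lemma weight_right:
  fixes q :: "real \<Rightarrow> real" and \<theta> :: real
  assumes q: "continuous_on {0..} q" "q absolutely_integrable_on {0..}" "\<And>t. t \<ge> 0 \<Longrightarrow> q t \<ge> 0" and \<theta>: "\<theta> > 0"
  shows "\<exists>h B. (\<forall>t\<ge>0. 1 \<le> h t \<and> h t \<le> B) \<and> (\<lambda>t. q t * h t) absolutely_integrable_on {0..} \<and>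
    (\<forall>x\<ge>0. integral {x..} (\<lambda>t. q t * h t) \<le> \<theta> * h x)"
proof -
  define L where "L = 1 / \<theta>"
  define c where "c = integral {0..} q"
  define h where "h = (\<lambda>x. exp (- L * (integral {0..x} q - c)))"
  have L: "L > 0" "\<bar>- L\<bar> = L" using \<theta> by (auto simp: L_def)
  have c: "c = 0 \<or> c = integral {0..} q" by (simp add: c_def)
  have w2: "h x \<le> exp (L * integral {0..} q)" if "x \<ge> 0" for x
    unfolding h_def by (rule exponential_weight(2)[OF q(1,2) q(3) L(2) c that])
  have w3: "- L * integral {a..b} (\<lambda>t. q t * h t) = h b - h a" if "0 \<le> a" "a \<le> b" for a b
    unfolding h_def by (rule exponential_weight(3)[OF q(1,2) q(3) L(2) c that])
  have w4: "(\<lambda>t. q t * h t) absolutely_integrable_on {0..}"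
    unfolding h_def by (rule exponential_weight(4)[OF q(1,2) q(3) L(2) c])
  have h1: "1 \<le> h t" if "t \<ge> 0" for t
    using integral_ge_le_total(2)[OF q(2,3) that] L by (simp add: h_def c_def mult_nonneg_nonpos)
  have h2: "integral {x..} (\<lambda>t. q t * h t) \<le> \<theta> * h x" if x: "x \<ge> 0" for x
  proof (rule tendsto_upperbound)
    have "(\<lambda>t. q t * h t) absolutely_integrable_on {x..}"
      by (rule set_integrable_subset[OF w4]) (use x in auto)
    then show "((\<lambda>T. integral {x..T} (\<lambda>t. q t * h t)) \<longlongrightarrow> integral {x..} (\<lambda>t. q t * h t)) at_top"
      by (rule integral_tendsto_at_top)
    show "\<forall>\<^sub>F T in at_top. integral {x..T} (\<lambda>t. q t * h t) \<le> \<theta> * h x"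
      using eventually_ge_at_top[of x]
    proof eventually_elim
      case (elim T)
      have "L * integral {x..T} (\<lambda>t. q t * h t) = h x - h T"
        using w3[OF x elim] by simp
      also have "\<dots> \<le> h x" by (simp add: h_def)
      finally show ?case using \<theta> by (simp add: L_def field_simps)
    qed
  qed simp
  show ?thesis
    using h1 h2 w2 w4 by (intro exI[of _ h] exI[of _ "exp (L * integral {0..} q)"]) simp
qed

lemma inverse_jet_power_bound:
  assumes "norm k \<ge> 1" "l \<le> n"
  shows "norm (fps_nth (inverse_jet k ^ N) l) \<le> real (n + 1) ^ N / norm k ^ N"
  using assms(2)
proof (induction N arbitrary: l)
  case 0
  then show ?case by (cases l) auto
next
  case (Suc N)
  have k: "norm k > 0" using assms(1) by linarith
  have J: "norm (fps_nth (inverse_jet k) p) \<le> 1 / norm k" for p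
  proof -
    have "norm (fps_nth (inverse_jet k) p) = 1 / norm k ^ Suc p"
      by (simp add: inverse_jet_def norm_divide norm_power norm_mult)
    also have "\<dots> \<le> 1 / norm k ^ 1"
      using assms(1) k by (intro divide_left_mono power_increasing) auto
    finally show ?thesis by simp
  qed
  have "norm (fps_nth (inverse_jet k ^ Suc N) l) \<le> (\<Sum>p=0..l. (1 / norm k) * (real (n + 1) ^ N / norm k ^ N))"
    unfolding power_Suc fps_mult_nth
  proof (rule sum_norm_le)
    fix p assume "p \<in> {0..l}"
    then show "norm (fps_nth (inverse_jet k) p * fps_nth (inverse_jet k ^ N) (l - p)) \<le> (1 / norm k) * (real (n + 1) ^ N / norm k ^ N)"
      unfolding norm_mult using Suc.prems by (intro mult_mono J Suc.IH) auto
  qed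
  also have "\<dots> = real (l + 1) * ((1 / norm k) * (real (n + 1) ^ N / norm k ^ N))" by simp
  also have "\<dots> \<le> real (n + 1) * ((1 / norm k) * (real (n + 1) ^ N / norm k ^ N))"
    using Suc.prems by (intro mult_right_mono) auto
  also have "\<dots> = real (n + 1) ^ Suc N / norm k ^ Suc N" by simp
  finally show ?case .
qed

context volterra_setting
begin

text \<open>The preceding bound for an inhomogeneity with a factor \<open>k^-N\<close>. It is applied to \<open>k^N u\<close>; dividing by
\<open>k^N\<close> again multiplies the jets by those of \<open>1/k^N\<close>.\<close>

theorem volterra_jet_bound_scaled:
  assumes V: "\<And>i d. continuous_on {0..} (V0 i d)" "\<And>i d. continuous_on {0..} (V1 i d)"
    and q: "\<And>i d t. t \<ge> 0 \<Longrightarrow> norm (V0 i d t) + norm (V1 i d t) \<le> q t"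
    and qh: "(\<lambda>t. q t * h t) absolutely_integrable_on {0..}" and h: "\<And>t. t \<ge> 0 \<Longrightarrow> 1 \<le> h t \<and> h t \<le> B"
    and hS: "\<And>x. x \<ge> 0 \<Longrightarrow> integral (S x) (\<lambda>t. q t * h t) \<le> h x / (4 * c0 * real (n + 1))"
    and R: "admissible g R"
    and u_int: "\<And>i x k. x \<ge> 0 \<Longrightarrow> k \<in> closure D \<Longrightarrow>
      (\<lambda>t. exp (\<sigma> i * (k - 1 / k) * of_real (x - t)) *
        ((\<Sum>d\<in>UNIV. (V0 i d t + V1 i d t / k) * u d t k) + (1 / k ^ N) * fps_nth (R i t k) 0)) absolutely_integrable_on (S x)"
    and u_eq: "\<And>i x k. x \<ge> 0 \<Longrightarrow> k \<in> closure D \<Longrightarrow> u i x k = \<epsilon> * integral (S x)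
      (\<lambda>t. exp (\<sigma> i * (k - 1 / k) * of_real (x - t)) *
        ((\<Sum>d\<in>UNIV. (V0 i d t + V1 i d t / k) * u d t k) + (1 / k ^ N) * fps_nth (R i t k) 0))"
    and u_bounded: "\<And>x k. x \<ge> 0 \<Longrightarrow> k \<in> closure D \<Longrightarrow> \<exists>M. \<forall>i. \<forall>t\<in>S x. norm (u i t k) \<le> M"
  shows "\<exists>C. \<forall>x\<ge>0. \<forall>i. \<exists>F. jet D n F \<and> (\<forall>k\<in>closure D. fps_nth (F k) 0 = u i x k \<and>
      (\<forall>j\<le>n. norm (fps_nth (F k) j) \<le> C * \<omega> j x / norm k ^ N))"
proof -
  define U where "U i x k = k ^ N * u i x k" for i x k
  have k0: "k \<noteq> 0" if "k \<in> closure D" for k using norm_ge[OF that] by auto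
  have eq: "exp (\<sigma> i * (k - 1 / k) * of_real (x - t)) *
        ((\<Sum>d\<in>UNIV. (V0 i d t + V1 i d t / k) * U d t k) + fps_nth (R i t k) 0)
    = k ^ N * (exp (\<sigma> i * (k - 1 / k) * of_real (x - t)) *
        ((\<Sum>d\<in>UNIV. (V0 i d t + V1 i d t / k) * u d t k) + (1 / k ^ N) * fps_nth (R i t k) 0))"
    if "k \<in> closure D" for i x t k
    using k0[OF that] by (simp add: U_def sum_2 algebra_simps)
  have "\<exists>C. \<forall>x\<ge>0. \<forall>i. \<exists>F. jet D n F \<and> (\<forall>k\<in>closure D. fps_nth (F k) 0 = U i x k \<and>
      (\<forall>j\<le>n. norm (fps_nth (F k) j) \<le> C * \<omega> j x))"
  proof (rule volterra_jet_bound[OF V q qh h hS R])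
    fix i x k assume x: "(x::real) \<ge> 0" and k: "k \<in> closure D"
    show "(\<lambda>t. exp (\<sigma> i * (k - 1 / k) * complex_of_real (x - t)) *
            ((\<Sum>d\<in>UNIV. (V0 i d t + V1 i d t / k) * U d t k) + fps_nth (R i t k) 0)) absolutely_integrable_on S x"
      unfolding eq[OF k] by (rule set_integrable_mult_right) (rule u_int[OF x k])
    show "U i x k = \<epsilon> * integral (S x) (\<lambda>t. exp (\<sigma> i * (k - 1 / k) * complex_of_real (x - t)) *
            ((\<Sum>d\<in>UNIV. (V0 i d t + V1 i d t / k) * U d t k) + fps_nth (R i t k) 0))"
      unfolding eq[OF k] integral_mult_right U_def[of i x k] by (subst u_eq[OF x k]) simp
  next
    fix x k assume x: "(x::real) \<ge> 0" and k: "k \<in> closure D"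
    obtain M where "\<forall>i. \<forall>t\<in>S x. norm (u i t k) \<le> M" using u_bounded[OF x k] ..
    then have "\<forall>i. \<forall>t\<in>S x. norm (U i t k) \<le> norm k ^ N * M"
      unfolding U_def norm_mult norm_power by (auto intro!: mult_left_mono)
    then show "\<exists>M. \<forall>i. \<forall>t\<in>S x. norm (U i t k) \<le> M" ..
  qed
  then obtain C where C: "\<And>x i. x \<ge> 0 \<Longrightarrow> \<exists>F. jet D n F \<and> (\<forall>k\<in>closure D. fps_nth (F k) 0 = U i x k \<and>
      (\<forall>j\<le>n. norm (fps_nth (F k) j) \<le> C * \<omega> j x))" by meson
  show ?thesis
  proof (intro exI[of _ "real (n + 1) * real (n + 1) ^ N * \<bar>C\<bar>"] allI impI)
    fix x :: real and i :: 2 assume x: "x \<ge> 0"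
    obtain F where F: "jet D n F" "\<And>k. k \<in> closure D \<Longrightarrow> fps_nth (F k) 0 = U i x k"
      "\<And>k j. k \<in> closure D \<Longrightarrow> j \<le> n \<Longrightarrow> norm (fps_nth (F k) j) \<le> C * \<omega> j x"
      using C[OF x, of i] by blast
    define G where "G k = inverse_jet k ^ N * F k" for k
    have "jet D n G" unfolding G_def by (intro jet_mult jet_power inverse_jet_jet F)
    moreover have "fps_nth (G k) 0 = u i x k" if "k \<in> closure D" for k
      using k0[OF that] by (simp add: G_def F(2)[OF that] U_def inverse_jet_def fps_nth_power_0 power_divide)
    moreover have "norm (fps_nth (G k) j) \<le> real (n + 1) * real (n + 1) ^ N * \<bar>C\<bar> * \<omega> j x / norm k ^ N"
      if k: "k \<in> closure D" and j: "j \<le> n" for k j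
    proof -
      have "norm (fps_nth (G k) j) \<le> (\<Sum>l=0..j. (real (n + 1) ^ N / norm k ^ N) * (\<bar>C\<bar> * \<omega> j x))"
        unfolding G_def fps_mult_nth
      proof (rule sum_norm_le)
        fix l assume l: "l \<in> {0..j}"
        have "norm (fps_nth (F k) (j - l)) \<le> C * \<omega> (j - l) x" using F(3)[OF k] j by simp
        also have "\<dots> \<le> \<bar>C\<bar> * \<omega> j x"
          using j omega_nonneg[OF x] by (intro mult_mono omega_le x) auto
        finally show "norm (fps_nth (inverse_jet k ^ N) l * fps_nth (F k) (j - l)) \<le> (real (n + 1) ^ N / norm k ^ N) * (\<bar>C\<bar> * \<omega> j x)"
          unfolding norm_mult using l j by (intro mult_mono inverse_jet_power_bound norm_ge k) auto
      qed
      also have "\<dots> = real (j + 1) * ((real (n + 1) ^ N / norm k ^ N) * (\<bar>C\<bar> * \<omega> j x))" by simp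
      also have "\<dots> \<le> real (n + 1) * ((real (n + 1) ^ N / norm k ^ N) * (\<bar>C\<bar> * \<omega> j x))"
        using j omega_nonneg[OF x] by (intro mult_right_mono) auto
      finally show ?thesis by (simp add: mult_ac)
    qed
    ultimately show "\<exists>F. jet D n F \<and> (\<forall>k\<in>closure D. fps_nth (F k) 0 = u i x k \<and>
      (\<forall>j\<le>n. norm (fps_nth (F k) j) \<le> real (n + 1) * real (n + 1) ^ N * \<bar>C\<bar> * \<omega> j x / norm k ^ N))" by blast
  qed
qed

end

section \<open>Estimates for integrals from infinity and from zero\<close>

text \<open>The diagonal entries of \<open>\<sigma>\<^sub>3\<close>.\<close>

definition sgn2 :: "2 \<Rightarrow> real" where "sgn2 i = (if i = 1 then 1 else - 1)"

text \<open>The exponents in row \<open>i\<close>: for \<open>\<tau> = sgn2 c\<close>, the factor \<open>exp (phase \<tau> i * (k - 1/k) * (x - t))\<close> is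
the one by which conjugation with \<open>exp (i \<theta>\<^sub>1 (t - x) \<sigma>\<^sub>3)\<close> multiplies the entry in row \<open>i\<close> and column
\<open>c\<close>. It is 1 if \<open>i = c\<close>.\<close>

definition phase :: "real \<Rightarrow> 2 \<Rightarrow> complex" where
  "phase \<tau> i = - (\<i> / 4) * of_real (sgn2 i - \<tau>)"

lemma phase_Re:
  assumes "k \<noteq> 0"
  shows "Re (phase \<tau> i * (k - 1 / k) * of_real s) = (sgn2 i - \<tau>) / 4 * s * (Im k * (1 + 1 / (norm k)\<^sup>2))"
proof -
  have "Im (k - 1 / k) = Im k * (1 + 1 / (norm k)\<^sup>2)"
    by (simp add: Im_divide cmod_power2 algebra_simps)
  moreover have "Re (- (\<i> / 4) * of_real d * z * of_real s) = d / 4 * s * Im z" for d z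
    by simp
  ultimately show ?thesis
    unfolding phase_def by (simp only:)
qed

lemma phase_norm: "\<tau> = 1 \<or> \<tau> = - 1 \<Longrightarrow> norm (phase \<tau> i) \<le> 1 / 2"
  by (auto simp: phase_def sgn2_def norm_mult)

lemma phase_Re_nonpos:
  assumes "k \<noteq> 0" "\<tau> = 1 \<or> \<tau> = - 1" "s * \<tau> * Im k \<ge> 0"
  shows "Re (phase \<tau> i * (k - 1 / k) * of_real s) \<le> 0"
proof -
  define W where "W = 1 + 1 / (norm k)\<^sup>2"
  have W: "(s * \<tau> * Im k) * W \<ge> 0" by (rule mult_nonneg_nonneg[OF assms(3)]) (simp add: W_def)
  have "(sgn2 i - \<tau>) / 4 * s * (Im k * W) = (if sgn2 i = \<tau> then 0 else - 1 / 2) * ((s * \<tau> * Im k) * W)"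
    using assms(2) by (auto simp: sgn2_def)
  also have "\<dots> \<le> 0" using W by (intro mult_nonpos_nonneg) auto
  finally show ?thesis unfolding phase_Re[OF assms(1)] W_def .
qed

lemma volterra_setting_right:
  assumes "open D" "\<tau> = 1 \<or> \<tau> = - 1"
    and cl: "\<And>k. k \<in> closure D \<Longrightarrow> norm k \<ge> 1 \<and> \<tau> * Im k \<le> 0"
  shows "volterra_setting (\<lambda>x. {x..}) D n (phase \<tau>) (\<lambda>j x. 1 / (1 + x) ^ (n - j)) (- 1)"
proof
  show "\<And>k. k \<in> closure D \<Longrightarrow> 1 \<le> norm k" using cl by blast
  show "\<And>i. norm (phase \<tau> i) \<le> 1 / 2" by (rule phase_norm[OF assms(2)])
  show "Re (phase \<tau> i * (k - 1 / k) * complex_of_real (x - t)) \<le> 0"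
    if "k \<in> closure D" "0 \<le> x" "t \<in> {x..}" for k x t i
  proof (rule phase_Re_nonpos[OF _ assms(2)])
    show "k \<noteq> 0" using cl[OF that(1)] by auto
    have "(x - t) * (\<tau> * Im k) \<ge> 0" using cl[OF that(1)] that by (intro mult_nonpos_nonpos) auto
    then show "0 \<le> (x - t) * \<tau> * Im k" by (simp add: mult.assoc)
  qed
  show "\<forall>\<^sub>F p in sequentially. (t \<in> {X p..}) = (t \<in> {x..})" if "t \<noteq> x" "X \<longlonglongrightarrow> x" for t x and X :: "nat \<Rightarrow> real"
  proof (cases "t < x")
    case True
    from order_tendstoD(1)[OF that(2) True] show ?thesis by eventually_elim (use True in auto)
  next
    case False
    then have "x < t" using that by simp
    from order_tendstoD(2)[OF that(2) this] show ?thesis by eventually_elim (use \<open>x < t\<close> in auto)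
  qed
  show "continuous_on {0..} (\<lambda>x. 1 / (1 + x) ^ (n - j) :: real)" for j
    by (intro continuous_intros) auto
  show "(1 + \<bar>x - t\<bar>) ^ (j - l) * (1 / (1 + t) ^ (n - l)) \<le> 1 / (1 + x) ^ (n - j)"
    if "0 \<le> x" "t \<in> {x..}" "l \<le> j" "j \<le> n" for x t :: real and l j
  proof -
    have e: "n - l = (j - l) + (n - j)" using that by simp
    have "(1 + \<bar>x - t\<bar>) ^ (j - l) * (1 / (1 + t) ^ (n - l)) \<le> (1 + t) ^ (j - l) * (1 / (1 + t) ^ (n - l))"
      using that by (intro mult_right_mono power_mono) auto
    also have "\<dots> = 1 / (1 + t) ^ (n - j)"
    proof -
      have "(1 + t) ^ (j - l) \<noteq> 0" using that by auto
      then show ?thesis unfolding e power_add by simp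
    qed
    also have "\<dots> \<le> 1 / (1 + x) ^ (n - j)"
      using that by (intro divide_left_mono power_mono) auto
    finally show ?thesis .
  qed
qed (use assms in auto)

lemma volterra_setting_left:
  assumes "open D" "\<tau> = 1 \<or> \<tau> = - 1"
    and cl: "\<And>k. k \<in> closure D \<Longrightarrow> norm k \<ge> 1 \<and> \<tau> * Im k \<ge> 0"
  shows "volterra_setting (\<lambda>x. {0..x}) D n (phase \<tau>) (\<lambda>j x. (1 + x) ^ j) 1"
proof
  show "\<And>k. k \<in> closure D \<Longrightarrow> 1 \<le> norm k" using cl by blast
  show "\<And>i. norm (phase \<tau> i) \<le> 1 / 2" by (rule phase_norm[OF assms(2)])
  show "Re (phase \<tau> i * (k - 1 / k) * complex_of_real (x - t)) \<le> 0"
    if "k \<in> closure D" "0 \<le> x" "t \<in> {0..x}" for k x t i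
  proof (rule phase_Re_nonpos[OF _ assms(2)])
    show "k \<noteq> 0" using cl[OF that(1)] by auto
    have "(x - t) * (\<tau> * Im k) \<ge> 0" using cl[OF that(1)] that by (intro mult_nonneg_nonneg[of "x - t"]) auto
    then show "0 \<le> (x - t) * \<tau> * Im k" by (simp add: mult.assoc)
  qed
  show "\<forall>\<^sub>F p in sequentially. (t \<in> {0..X p}) = (t \<in> {0..x})" if "t \<noteq> x" "X \<longlonglongrightarrow> x" for t x and X :: "nat \<Rightarrow> real"
  proof (cases "t < x")
    case True
    from order_tendstoD(1)[OF that(2) True] show ?thesis by eventually_elim (use True in auto)
  next
    case False
    then have "x < t" using that by simp
    from order_tendstoD(2)[OF that(2) this] show ?thesis by eventually_elim (use \<open>x < t\<close> in auto)
  qed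
  show "continuous_on {0..} (\<lambda>x. (1 + x) ^ j :: real)" for j
    by (intro continuous_intros)
  show "(1 + \<bar>x - t\<bar>) ^ (j - l) * (1 + t) ^ l \<le> (1 + x) ^ j"
    if "0 \<le> x" "t \<in> {0..x}" "l \<le> j" "j \<le> n" for x t :: real and l j
  proof -
    have "(1 + \<bar>x - t\<bar>) ^ (j - l) * (1 + t) ^ l \<le> (1 + x) ^ (j - l) * (1 + x) ^ l"
      using that by (intro mult_mono power_mono) auto
    also have "\<dots> = (1 + x) ^ j" using that by (simp flip: power_add)
    finally show ?thesis .
  qed
qed (use assms in auto)


lemma norm_entry_le: "norm ((A :: cmat2) $ i $ j) \<le> norm A"
  by (rule order_trans[OF Finite_Cartesian_Product.norm_nth_le Finite_Cartesian_Product.norm_nth_le])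

lemma bounded_linear_entry: "bounded_linear (\<lambda>A :: cmat2. A $ i $ j)"
  by (intro bounded_linear_compose[OF bounded_linear_vec_nth bounded_linear_vec_nth, unfolded o_def])

lemma lax_majorant:
  fixes V0 V1 :: "real \<Rightarrow> cmat2"
  assumes V: "V0 absolutely_integrable_on {0..}" "V1 absolutely_integrable_on {0..}"
    and c: "continuous_on {0..} V0" "continuous_on {0..} V1"
    and q_def: "q = (\<lambda>t. norm (V0 t) + norm (V1 t))"
  shows "continuous_on {0..} q" "q absolutely_integrable_on {0..}" "\<And>t. q t \<ge> 0"
    "\<And>i d t. norm (V0 t $ i $ d) + norm (V1 t $ i $ d) \<le> q t"
    "\<And>i d. continuous_on {0..} (\<lambda>t. V0 t $ i $ d)" "\<And>i d. continuous_on {0..} (\<lambda>t. V1 t $ i $ d)"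
proof -
  show "continuous_on {0..} q" unfolding q_def by (intro continuous_intros c)
  show "q absolutely_integrable_on {0..}" unfolding q_def
    by (intro set_integral_add(1) absolutely_integrable_norm[unfolded o_def] V)
  show "q t \<ge> 0" for t by (simp add: q_def)
  show "norm (V0 t $ i $ d) + norm (V1 t $ i $ d) \<le> q t" for i d t
    unfolding q_def by (intro add_mono norm_entry_le)
  show "continuous_on {0..} (\<lambda>t. V0 t $ i $ d)" "continuous_on {0..} (\<lambda>t. V1 t $ i $ d)" for i d
    by (intro bounded_linear.continuous_on[OF bounded_linear_entry] c)+
qed

lemma weighted_L1_norm:
  assumes "weighted_L1 n f"
  shows "(\<lambda>t. (1 + t) ^ n * norm (f t)) absolutely_integrable_on {0..}"
proof -
  have "(\<lambda>t. norm ((1 + t) ^ n *\<^sub>R f t)) absolutely_integrable_on {0..}"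
    using absolutely_integrable_norm[OF assms[unfolded weighted_L1_def]] by (simp add: o_def)
  moreover have "(\<lambda>t. norm ((1 + t) ^ n *\<^sub>R f t)) absolutely_integrable_on {0..} \<longleftrightarrow>
    (\<lambda>t. (1 + t) ^ n * norm (f t)) absolutely_integrable_on {0..}"
    by (rule set_integrable_cong) auto
  ultimately show ?thesis by simp
qed

lemma weighted_L1_measurable:
  fixes f :: "real \<Rightarrow> complex"
  assumes "weighted_L1 n f"
  shows "f \<in> borel_measurable (lebesgue_on {0..})"
  by (rule absolutely_integrable_imp_borel_measurable[OF weighted_L1_integrable[OF assms]]) simp

text \<open>The Volterra estimate for integrals over \<open>[x,\<infinity>)\<close>: an inhomogeneity integrable with weight
\<open>(1 + x)^n\<close> gives decay of order \<open>n - j\<close> of the \<open>k\<close>-derivative of order \<open>j\<close>.\<close>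

lemma right_estimate:
  fixes V0 V1 :: "real \<Rightarrow> cmat2" and Pa Pb :: "2 \<Rightarrow> real \<Rightarrow> complex" and E :: "2 \<Rightarrow> real \<Rightarrow> complex \<Rightarrow> complex"
  assumes D: "open D" "\<tau> = 1 \<or> \<tau> = - 1" "\<And>k. k \<in> closure D \<Longrightarrow> norm k \<ge> 1 \<and> \<tau> * Im k \<le> 0"
    and V: "weighted_L1 n V0" "weighted_L1 n V1" "continuous_on {0..} V0" "continuous_on {0..} V1"
    and P: "\<And>i. weighted_L1 n (Pa i)" "\<And>i. weighted_L1 n (Pb i)"
    and E_int: "\<And>i x k. x \<ge> 0 \<Longrightarrow> k \<in> closure D \<Longrightarrow>
      (\<lambda>t. exp (phase \<tau> i * (k - 1 / k) * of_real (x - t)) *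
        ((\<Sum>d\<in>UNIV. (V0 t $ i $ d + V1 t $ i $ d / k) * E d t k) + (1 / k ^ N) * (Pa i t + Pb i t / k))) absolutely_integrable_on {x..}"
    and E_eq: "\<And>i x k. x \<ge> 0 \<Longrightarrow> k \<in> closure D \<Longrightarrow> E i x k = - 1 * integral {x..}
      (\<lambda>t. exp (phase \<tau> i * (k - 1 / k) * of_real (x - t)) *
        ((\<Sum>d\<in>UNIV. (V0 t $ i $ d + V1 t $ i $ d / k) * E d t k) + (1 / k ^ N) * (Pa i t + Pb i t / k)))"
    and E_bounded: "\<And>x k. x \<ge> 0 \<Longrightarrow> k \<in> closure D \<Longrightarrow> \<exists>M. \<forall>i. \<forall>t\<in>{x..}. norm (E i t k) \<le> M"
  shows "\<exists>C. \<forall>x\<ge>0. \<forall>i. \<exists>F. jet D n F \<and> (\<forall>k\<in>closure D. fps_nth (F k) 0 = E i x k \<and>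
      (\<forall>j\<le>n. norm (fps_nth (F k) j) \<le> C * (1 / (1 + x) ^ (n - j)) / norm k ^ N))"
proof -
  interpret volterra_setting "\<lambda>x. {x..}" D n "phase \<tau>" "\<lambda>j x. 1 / (1 + x) ^ (n - j)" "- 1"
    by (rule volterra_setting_right[OF D(1,2)]) (rule D(3))
  define q where "q = (\<lambda>t. norm (V0 t) + norm (V1 t))"
  note q = lax_majorant[OF weighted_L1_integrable[OF V(1)] weighted_L1_integrable[OF V(2)] V(3,4) q_def]
  define \<theta> where "\<theta> = 1 / (4 * c0 * real (n + 1))"
  have \<theta>: "\<theta> > 0" unfolding \<theta>_def using c0_ge by simp
  obtain h B where h: "\<And>t. t \<ge> 0 \<Longrightarrow> 1 \<le> h t \<and> h t \<le> B" "(\<lambda>t. q t * h t) absolutely_integrable_on {0..}"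
    "\<And>x. x \<ge> 0 \<Longrightarrow> integral {x..} (\<lambda>t. q t * h t) \<le> \<theta> * h x"
    using weight_right[OF q(1,2,3) \<theta>] by blast
  define R where "R i t k = fps_const (Pa i t) + fps_const (Pb i t) * inverse_jet k" for i t k
  define g where "g t = (\<Sum>i\<in>UNIV. (1 + t) ^ n * norm (Pa i t) + (1 + t) ^ n * norm (Pb i t))" for t
  have g_int: "g absolutely_integrable_on {0..}"
    unfolding g_def by (intro absolutely_integrable_sum set_integral_add(1) weighted_L1_norm P finite)
  have g_ge: "norm (Pa i t) + norm (Pb i t) \<le> g t * (1 / (1 + t) ^ (n - j))" if t: "t \<ge> 0" for i t j
  proof -
    have "(1 + t) ^ n * norm (Pa i t) + (1 + t) ^ n * norm (Pb i t) \<le> g t"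
      unfolding g_def using t by (intro member_le_sum) auto
    moreover have "(1 + t) ^ (n - j) * (norm (Pa i t) + norm (Pb i t)) \<le> (1 + t) ^ n * (norm (Pa i t) + norm (Pb i t))"
      using t by (intro mult_right_mono power_increasing) auto
    ultimately have "(1 + t) ^ (n - j) * (norm (Pa i t) + norm (Pb i t)) \<le> g t" by (simp add: distrib_left)
    then show ?thesis using t by (simp add: pos_le_divide_eq mult.commute)
  qed
  have "admissible g R"
    unfolding admissible_def
  proof (intro conjI allI impI ballI)
    show "g absolutely_integrable_on {0..}" by (rule g_int)
    show "0 \<le> g t" if "0 \<le> t" for t unfolding g_def using that by (intro sum_nonneg) auto
    show "jet D n (R i t)" for i t
      unfolding R_def by (intro jet_add jet_mult jet_const inverse_jet_jet)
    show "(\<lambda>t. fps_nth (R i t k) j) \<in> borel_measurable (lebesgue_on {0..})" for i k j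
      unfolding R_def using weighted_L1_measurable[OF P(1)[of i]] weighted_L1_measurable[OF P(2)[of i]]
      by (cases j) (simp_all add: borel_measurable_add borel_measurable_times)
    show "norm (fps_nth (R i t k) j) \<le> g t * (1 / (1 + t) ^ (n - j))" if "0 \<le> t" "k \<in> closure D" for i t k j
      unfolding R_def by (rule order_trans[OF coeff_jet_le[OF that(2)] g_ge[OF that(1)]])
  qed
  note adm = this
  have R0: "fps_nth (R i t k) 0 = Pa i t + Pb i t / k" for i t k
    by (simp add: R_def inverse_jet_def)
  show ?thesis
  proof (rule volterra_jet_bound_scaled[where ?V0.0 = "\<lambda>i d t. V0 t $ i $ d" and ?V1.0 = "\<lambda>i d t. V1 t $ i $ d"
        and q = q and h = h and B = B and g = g and R = R])
    show "integral {x..} (\<lambda>t. q t * h t) \<le> h x / (4 * c0 * real (n + 1))" if "x \<ge> 0" for x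
      using h(3)[OF that] by (simp add: \<theta>_def)
  qed (rule q(5), rule q(6), rule q(4), rule h(2), erule h(1), rule adm, simp only: R0, erule (1) E_int,
      simp only: R0, erule (1) E_eq, erule (1) E_bounded)
qed

text \<open>The Volterra estimate for integrals over \<open>[0,x]\<close>. Part of the inhomogeneity may carry the factor
\<open>exp (i \<tau> (k - 1/k) t / 2)\<close>, which has modulus at most 1 on the domain; its \<open>k\<close>-derivatives grow, and so
do those of the solution.\<close>

lemma left_estimate:
  fixes V0 V1 :: "real \<Rightarrow> cmat2" and Pa Pb Qa Qb :: "2 \<Rightarrow> real \<Rightarrow> complex" and E :: "2 \<Rightarrow> real \<Rightarrow> complex \<Rightarrow> complex"
  assumes D: "open D" "\<tau> = 1 \<or> \<tau> = - 1" "\<And>k. k \<in> closure D \<Longrightarrow> norm k \<ge> 1 \<and> \<tau> * Im k \<ge> 0"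
    and V: "weighted_L1 n V0" "weighted_L1 n V1" "continuous_on {0..} V0" "continuous_on {0..} V1"
    and P: "\<And>i. weighted_L1 n (Pa i)" "\<And>i. weighted_L1 n (Pb i)" "\<And>i. weighted_L1 n (Qa i)" "\<And>i. weighted_L1 n (Qb i)"
    and E_int: "\<And>i x k. x \<ge> 0 \<Longrightarrow> k \<in> closure D \<Longrightarrow>
      (\<lambda>t. exp (phase \<tau> i * (k - 1 / k) * of_real (x - t)) *
        ((\<Sum>d\<in>UNIV. (V0 t $ i $ d + V1 t $ i $ d / k) * E d t k) + (1 / k ^ N) *
          (Pa i t + Pb i t / k + exp (\<i> / 2 * of_real \<tau> * (k - 1 / k) * of_real t) * (Qa i t + Qb i t / k)))) absolutely_integrable_on {0..x}"
    and E_eq: "\<And>i x k. x \<ge> 0 \<Longrightarrow> k \<in> closure D \<Longrightarrow> E i x k = 1 * integral {0..x}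
      (\<lambda>t. exp (phase \<tau> i * (k - 1 / k) * of_real (x - t)) *
        ((\<Sum>d\<in>UNIV. (V0 t $ i $ d + V1 t $ i $ d / k) * E d t k) + (1 / k ^ N) *
          (Pa i t + Pb i t / k + exp (\<i> / 2 * of_real \<tau> * (k - 1 / k) * of_real t) * (Qa i t + Qb i t / k))))"
    and E_bounded: "\<And>x k. x \<ge> 0 \<Longrightarrow> k \<in> closure D \<Longrightarrow> \<exists>M. \<forall>i. \<forall>t\<in>{0..x}. norm (E i t k) \<le> M"
  shows "\<exists>C. \<forall>x\<ge>0. \<forall>i. \<exists>F. jet D n F \<and> (\<forall>k\<in>closure D. fps_nth (F k) 0 = E i x k \<and>
      (\<forall>j\<le>n. norm (fps_nth (F k) j) \<le> C * (1 + x) ^ j / norm k ^ N))"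
proof -
  interpret volterra_setting "\<lambda>x. {0..x}" D n "phase \<tau>" "\<lambda>j x. (1 + x) ^ j" 1
    by (rule volterra_setting_left[OF D(1,2)]) (rule D(3))
  define q where "q = (\<lambda>t. norm (V0 t) + norm (V1 t))"
  note q = lax_majorant[OF weighted_L1_integrable[OF V(1)] weighted_L1_integrable[OF V(2)] V(3,4) q_def]
  define \<theta> where "\<theta> = 1 / (4 * c0 * real (n + 1))"
  have \<theta>: "\<theta> > 0" unfolding \<theta>_def using c0_ge by simp
  obtain h B where h: "\<And>t. t \<ge> 0 \<Longrightarrow> 1 \<le> h t \<and> h t \<le> B" "(\<lambda>t. q t * h t) absolutely_integrable_on {0..}"
    "\<And>x. x \<ge> 0 \<Longrightarrow> integral {0..x} (\<lambda>t. q t * h t) \<le> \<theta> * h x"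
    using weight_left[OF q(1,2,3) \<theta>] by blast
  \<comment> \<open>The row with nonzero phase: the oscillating factor is the exponential of this phase.\<close>
  define r :: 2 where "r = (if \<tau> = 1 then 2 else 1)"
  have r: "phase \<tau> r = \<i> / 2 * of_real \<tau>"
    using D(2) by (auto simp: phase_def r_def sgn2_def)
  define R where "R i t k = fps_const (Pa i t) + fps_const (Pb i t) * inverse_jet k
     + exp_jet (phase \<tau> r) t k * (fps_const (Qa i t) + fps_const (Qb i t) * inverse_jet k)" for i t k
  define g where "g t = c0 * (\<Sum>i\<in>UNIV. norm (Pa i t) + norm (Pb i t) + (norm (Qa i t) + norm (Qb i t)))" for t
  have "(\<lambda>t. norm (f t)) absolutely_integrable_on {0..}" if "weighted_L1 n f" for f :: "real \<Rightarrow> complex"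
    using absolutely_integrable_norm[OF weighted_L1_integrable[OF that]] by (simp add: o_def)
  then have g_int: "g absolutely_integrable_on {0..}"
    unfolding g_def by (intro set_integrable_mult_right absolutely_integrable_sum set_integral_add(1) P finite) (use P in auto)
  have g0: "g t \<ge> 0" for t unfolding g_def using c0_ge by (intro mult_nonneg_nonneg sum_nonneg) auto
  have g_ge: "norm (Pa i t) + norm (Pb i t) + c0 * (1 + t) ^ j * (norm (Qa i t) + norm (Qb i t)) \<le> g t * (1 + t) ^ j" if t: "t \<ge> 0" for i t j
  proof -
    have 1: "norm (Pa i t) + norm (Pb i t) + (norm (Qa i t) + norm (Qb i t)) \<le>
      (\<Sum>i\<in>UNIV. norm (Pa i t) + norm (Pb i t) + (norm (Qa i t) + norm (Qb i t)))"
      by (intro member_le_sum) auto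
    have c: "1 * 1 \<le> c0 * (1 + t) ^ j" using c0_ge t by (intro mult_mono one_le_power) auto
    have "norm (Pa i t) + norm (Pb i t) + c0 * (1 + t) ^ j * (norm (Qa i t) + norm (Qb i t)) \<le>
      c0 * (1 + t) ^ j * (norm (Pa i t) + norm (Pb i t)) + c0 * (1 + t) ^ j * (norm (Qa i t) + norm (Qb i t))"
      using mult_right_mono[OF c, of "norm (Pa i t) + norm (Pb i t)"] by simp
    also have "\<dots> = c0 * (1 + t) ^ j * (norm (Pa i t) + norm (Pb i t) + (norm (Qa i t) + norm (Qb i t)))"
      by (simp only: distrib_left)
    also have "\<dots> \<le> c0 * (1 + t) ^ j * (\<Sum>i\<in>UNIV. norm (Pa i t) + norm (Pb i t) + (norm (Qa i t) + norm (Qb i t)))"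
      using c by (intro mult_left_mono 1) auto
    also have "\<dots> = g t * (1 + t) ^ j" by (simp only: g_def mult_ac)
    finally show ?thesis .
  qed
  have "admissible g R"
    unfolding admissible_def
  proof (intro conjI allI impI ballI)
    show "g absolutely_integrable_on {0..}" by (rule g_int)
    show "0 \<le> g t" for t by (rule g0)
    show "jet D n (R i t)" for i t
      unfolding R_def by (intro jet_add jet_mult jet_const inverse_jet_jet exp_jet_jet)
    have m: "(\<lambda>t. fps_nth (fps_const (f t) + fps_const (f' t) * inverse_jet k) j) \<in> borel_measurable (lebesgue_on {0..})"
      if "weighted_L1 n f" "weighted_L1 n f'" for f f' k j
      using weighted_L1_measurable[OF that(1)] weighted_L1_measurable[OF that(2)]
      by (cases j) (simp_all add: borel_measurable_add borel_measurable_times)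
    have me: "(\<lambda>t. fps_nth (exp_jet (phase \<tau> r) t k) j) \<in> borel_measurable (lebesgue_on {0..})" for k j
      by (intro continuous_imp_measurable_on_sets_lebesgue continuous_on_subset[OF exp_jet_continuous]) auto
    show "(\<lambda>t. fps_nth (R i t k) j) \<in> borel_measurable (lebesgue_on {0..})" for i k j
      unfolding R_def fps_add_nth[of "_ + _" "_ * _"] fps_mult_nth[of "exp_jet _ _ _"]
      by (intro borel_measurable_add borel_measurable_sum borel_measurable_times m me P)
    show "norm (fps_nth (R i t k) j) \<le> g t * (1 + t) ^ j" if t: "0 \<le> t" and k: "k \<in> closure D" and j: "j \<le> n" for i t k j
    proof -
      have "Re (phase \<tau> r * (k - 1 / k) * complex_of_real t) \<le> 0"
        using sigma_Re[OF k t, of 0 r] t by simp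
      then have e: "norm (fps_nth (exp_jet (phase \<tau> r) t k) l) \<le> (2 * (1 + \<bar>t\<bar>)) ^ l" for l
        by (intro exp_jet_bound sigma_le norm_ge k)
      have "norm (fps_nth (exp_jet (phase \<tau> r) t k * (fps_const (Qa i t) + fps_const (Qb i t) * inverse_jet k)) j)
        \<le> (\<Sum>l=0..j. (2 ^ n * (1 + t) ^ j) * (norm (Qa i t) + norm (Qb i t)))"
        unfolding fps_mult_nth[of "exp_jet _ _ _"]
      proof (rule sum_norm_le)
        fix l assume l: "l \<in> {0..j}"
        have "(2 * (1 + \<bar>t\<bar>)) ^ l \<le> 2 ^ n * (1 + t) ^ j"
          unfolding power_mult_distrib abs_of_nonneg[OF t] using t l j by (intro mult_mono power_increasing) auto
        then show "norm (fps_nth (exp_jet (phase \<tau> r) t k) l * fps_nth (fps_const (Qa i t) + fps_const (Qb i t) * inverse_jet k) (j - l))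
          \<le> (2 ^ n * (1 + t) ^ j) * (norm (Qa i t) + norm (Qb i t))"
          unfolding norm_mult using t
          by (intro mult_mono order_trans[OF e] coeff_jet_le k) auto
      qed
      also have "\<dots> = real (j + 1) * ((2 ^ n * (1 + t) ^ j) * (norm (Qa i t) + norm (Qb i t)))" by simp
      also have "\<dots> \<le> real (n + 1) * ((2 ^ n * (1 + t) ^ j) * (norm (Qa i t) + norm (Qb i t)))"
        using j t by (intro mult_right_mono) auto
      also have "\<dots> = c0 * (1 + t) ^ j * (norm (Qa i t) + norm (Qb i t))"
        by (simp only: c0_def mult.assoc)
      finally have "norm (fps_nth (exp_jet (phase \<tau> r) t k * (fps_const (Qa i t) + fps_const (Qb i t) * inverse_jet k)) j)
        \<le> c0 * (1 + t) ^ j * (norm (Qa i t) + norm (Qb i t))" .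
      moreover have "norm (fps_nth (fps_const (Pa i t) + fps_const (Pb i t) * inverse_jet k) j) \<le> norm (Pa i t) + norm (Pb i t)"
        by (rule coeff_jet_le[OF k])
      ultimately have "norm (fps_nth (R i t k) j) \<le> norm (Pa i t) + norm (Pb i t) + c0 * (1 + t) ^ j * (norm (Qa i t) + norm (Qb i t))"
        unfolding R_def fps_add_nth[of "_ + _" "_ * _"] by (rule norm_triangle_mono[rotated])
      then show ?thesis using g_ge[OF t] by (rule order_trans)
    qed
  qed
  note adm = this
  have R0: "fps_nth (R i t k) 0 = Pa i t + Pb i t / k + exp (\<i> / 2 * of_real \<tau> * (k - 1 / k) * of_real t) * (Qa i t + Qb i t / k)" for i t k
    by (simp add: R_def inverse_jet_def exp_jet_0 r)
  show ?thesis
  proof (rule volterra_jet_bound_scaled[where ?V0.0 = "\<lambda>i d t. V0 t $ i $ d" and ?V1.0 = "\<lambda>i d t. V1 t $ i $ d"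
        and q = q and h = h and B = B and g = g and R = R])
    show "integral {0..x} (\<lambda>t. q t * h t) \<le> h x / (4 * c0 * real (n + 1))" if "x \<ge> 0" for x
      using h(3)[OF that] by (simp add: \<theta>_def)
  qed (rule q(5), rule q(6), rule q(4), rule h(2), erule h(1), rule adm, simp only: R0, erule (1) E_int,
      simp only: R0, erule (1) E_eq, erule (1) E_bounded)
qed

text \<open>Solutions of the equation over \<open>[x,\<infinity>)\<close> are assumed to have an integrable integrand only; they are
nevertheless bounded. Component \<open>p\<close>, without exponential, is the tail of an integrable function.
For component \<open>r\<close>, the product \<open>b\<close> with the exponential is such a tail, and iterating the equation
improves this bound to one by the modulus \<open>w\<close> of the exponential, which is nonincreasing.\<close>

lemma volterra_right_bounded:
  fixes u :: "2 \<Rightarrow> real \<Rightarrow> complex" and V :: "2 \<Rightarrow> 2 \<Rightarrow> real \<Rightarrow> complex" and \<mu> :: "2 \<Rightarrow> complex"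
  assumes pr: "p \<noteq> r" and \<mu>: "\<mu> p = 0" "Re (\<mu> r) \<ge> 0"
    and q: "continuous_on {0..} q" "q absolutely_integrable_on {0..}" "\<And>t. t \<ge> 0 \<Longrightarrow> q t \<ge> 0"
    and V: "\<And>i d t. t \<ge> 0 \<Longrightarrow> norm (V i d t) \<le> q t"
    and int: "\<And>i x. x \<ge> 0 \<Longrightarrow> (\<lambda>t. exp (\<mu> i * of_real (x - t)) * (\<Sum>d\<in>UNIV. V i d t * u d t)) absolutely_integrable_on {x..}"
    and eq: "\<And>i x. x \<ge> 0 \<Longrightarrow> u i x = (if i = p then 1 else 0) - integral {x..} (\<lambda>t. exp (\<mu> i * of_real (x - t)) * (\<Sum>d\<in>UNIV. V i d t * u d t))"
  shows "\<exists>M. \<forall>i. \<forall>x\<ge>0. norm (u i x) \<le> M"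
proof -
  define G where "G i t = (\<Sum>d\<in>UNIV. V i d t * u d t)" for i t
  have UN: "(UNIV :: 2 set) = {p, r}"
    using pr exhaust_2[of p] exhaust_2[of r] by (auto simp: UNIV_2)
  have G_le: "norm (G i t) \<le> q t * (norm (u p t) + norm (u r t))" if "t \<ge> 0" for i t
  proof -
    have "norm (G i t) \<le> norm (V i p t * u p t) + norm (V i r t * u r t)"
      unfolding G_def UN using pr by (simp add: norm_triangle_ineq)
    also have "\<dots> \<le> q t * norm (u p t) + q t * norm (u r t)"
      unfolding norm_mult by (intro add_mono mult_right_mono V that) auto
    finally show ?thesis by (simp add: distrib_left)
  qed
  have tail: "norm (integral {x..} f) \<le> integral {0..} (\<lambda>t. norm (f t))"
    if "f absolutely_integrable_on {0..}" "x \<ge> 0" for f :: "real \<Rightarrow> complex" and x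
  proof -
    have fx: "f absolutely_integrable_on {x..}"
      by (rule set_integrable_subset[OF that(1)]) (use that(2) in auto)
    have "norm (integral {x..} f) \<le> integral {x..} (\<lambda>t. norm (f t))"
      using fx by (intro integral_norm_bound_integral) (auto simp: absolutely_integrable_on_def)
    also have "\<dots> \<le> integral {0..} (\<lambda>t. norm (f t))"
      using fx that by (intro integral_subset_le) (auto simp: absolutely_integrable_on_def)
    finally show ?thesis .
  qed
  have Gp: "G p absolutely_integrable_on {0..}" using int[of 0 p] by (simp add: \<mu> G_def[abs_def])
  define A where "A = 1 + integral {0..} (\<lambda>t. norm (G p t))"
  have up: "norm (u p x) \<le> A" if "x \<ge> 0" for x
  proof -
    have "u p x = 1 - integral {x..} (G p)" using eq[OF that, of p] by (simp add: \<mu> G_def[abs_def])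
    then show ?thesis using norm_triangle_ineq4[of 1 "integral {x..} (G p)"] tail[OF Gp that] by (simp add: A_def)
  qed
  have A0: "A \<ge> 0" using order_trans[OF norm_ge_zero up[of 0]] by simp
  define e where "e t = exp (- \<mu> r * of_real t)" for t
  define w where "w t = norm (e t)" for t
  have w0: "w t > 0" for t by (simp add: w_def e_def)
  have w_mono: "w t \<le> w x" if "x \<le> t" for x t
  proof -
    have "Re (\<mu> r) * x \<le> Re (\<mu> r) * t" using \<mu>(2) that by (intro mult_left_mono)
    then show ?thesis by (simp add: w_def e_def)
  qed
  define b where "b x = e x * u r x" for x
  have eG: "(\<lambda>t. e t * G r t) absolutely_integrable_on {0..}"
    using int[of 0 r] by (simp add: e_def G_def[abs_def])
  have b_eq: "b x = - integral {x..} (\<lambda>t. e t * G r t)" if "x \<ge> 0" for x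
  proof -
    have "exp (\<mu> r * of_real (x - t)) = exp (\<mu> r * of_real x) * e t" for t
      by (simp add: e_def algebra_simps flip: exp_add)
    then have "u r x = - integral {x..} (\<lambda>t. exp (\<mu> r * of_real x) * (e t * G r t))"
      using eq[OF that, of r] pr by (simp add: G_def mult.assoc)
    then have "u r x = - (exp (\<mu> r * of_real x) * integral {x..} (\<lambda>t. e t * G r t))" by simp
    then show ?thesis by (simp add: b_def e_def mult.assoc[symmetric] flip: exp_add)
  qed
  define B0 where "B0 = integral {0..} (\<lambda>t. norm (e t * G r t))"
  have bB: "norm (b x) \<le> B0" if "x \<ge> 0" for x
    using tail[OF eG that] b_eq[OF that] by (simp add: B0_def)
  have B00: "B0 \<ge> 0" using order_trans[OF norm_ge_zero bB[of 0]] by simp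
  obtain h B where h: "\<And>t. t \<ge> 0 \<Longrightarrow> 1 \<le> h t \<and> h t \<le> B" "(\<lambda>t. q t * h t) absolutely_integrable_on {0..}"
    "\<And>x. x \<ge> 0 \<Longrightarrow> integral {x..} (\<lambda>t. q t * h t) \<le> (1 / 4) * h x"
    using weight_right[OF q, of "1 / 4"] by auto
  \<comment> \<open>The constant in front of the term without \<open>w\<close> halves in every iteration.\<close>
  have step: "norm (b x) \<le> w x * A * h x + B0 / 2 ^ l * h x" if "x \<ge> 0" for l x
    using that
  proof (induction l arbitrary: x)
    case 0
    have "norm (b x) \<le> B0 * 1" using bB[OF 0] by simp
    also have "\<dots> \<le> B0 * h x" using h(1)[OF 0] B00 by (intro mult_left_mono) auto
    also have "\<dots> \<le> w x * A * h x + B0 * h x" using h(1)[OF 0] A0 w0[of x] by simp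
    finally show ?case by simp
  next
    case (Suc l)
    note x = Suc.prems
    have hx: "1 \<le> h x" using h(1)[OF x] by simp
    have qh: "(\<lambda>t. q t * h t) integrable_on {x..}"
      using set_integrable_subset[OF h(2), of "{x..}"] x by (auto simp: absolutely_integrable_on_def)
    have eGx: "(\<lambda>t. e t * G r t) integrable_on {x..}"
      using set_integrable_subset[OF eG, of "{x..}"] x by (auto simp: absolutely_integrable_on_def)
    have "norm (b x) \<le> integral {x..} (\<lambda>t. (2 * (w x * A) + B0 / 2 ^ l) * (q t * h t))"
      unfolding b_eq[OF x] norm_minus_cancel
    proof (rule integral_norm_bound_integral[OF eGx])
      show "(\<lambda>t. (2 * (w x * A) + B0 / 2 ^ l) * (q t * h t)) integrable_on {x..}"
        using integrable_cmul[OF qh, of "2 * (w x * A) + B0 / 2 ^ l"] by simp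
      fix t assume "t \<in> {x..}"
      then have t: "x \<le> t" "t \<ge> 0" using x by auto
      have ht: "1 \<le> h t" using h(1)[OF t(2)] by simp
      have "norm (e t * G r t) \<le> w t * (q t * (norm (u p t) + norm (u r t)))"
        unfolding norm_mult w_def by (intro mult_left_mono G_le t) auto
      also have "\<dots> = q t * (w t * norm (u p t) + norm (b t))"
        by (simp add: b_def norm_mult w_def algebra_simps)
      also have "\<dots> \<le> q t * (w x * A * h t + (w x * A * h t + B0 / 2 ^ l * h t))"
      proof (intro mult_left_mono add_mono q(3) t)
        have wA: "w t * A \<le> w x * A" by (intro mult_right_mono w_mono t A0)
        have "w t * norm (u p t) \<le> w t * A" using w0[of t] by (intro mult_left_mono up t) auto
        also have "\<dots> \<le> w x * A * 1" using wA by simp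
        also have "\<dots> \<le> w x * A * h t" using ht A0 w0[of x] by (intro mult_left_mono) auto
        finally show "w t * norm (u p t) \<le> w x * A * h t" .
        have "w t * A * h t \<le> w x * A * h t" using ht by (intro mult_right_mono[OF wA]) auto
        then show "norm (b t) \<le> w x * A * h t + B0 / 2 ^ l * h t" using Suc.IH[OF t(2)] by linarith
      qed
      also have "\<dots> = (2 * (w x * A) + B0 / 2 ^ l) * (q t * h t)" by (simp add: algebra_simps)
      finally show "norm (e t * G r t) \<le> (2 * (w x * A) + B0 / 2 ^ l) * (q t * h t)" .
    qed
    also have "\<dots> = (2 * (w x * A) + B0 / 2 ^ l) * integral {x..} (\<lambda>t. q t * h t)" by simp
    also have "\<dots> \<le> (2 * (w x * A) + B0 / 2 ^ l) * (1 / 4 * h x)"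
      using A0 B00 w0[of x] by (intro mult_left_mono h(3) x) auto
    also have "\<dots> \<le> w x * A * h x + B0 / 2 ^ Suc l * h x"
    proof -
      have gen: "(2 * X + \<beta>) * (1 / 4 * h x) = (X * h x) / 2 + (\<beta> * h x) / 4" for X \<beta>
        by (simp add: algebra_simps)
      have nn: "0 \<le> w x * A * h x" "0 \<le> B0 / 2 ^ l * h x" using A0 B00 w0[of x] hx by auto
      have eq: "B0 / 2 ^ Suc l * h x = (B0 / 2 ^ l * h x) / 2" by simp
      have half: "X / 2 + Y / 4 \<le> X + Y / 2" if "0 \<le> X" "0 \<le> Y" for X Y :: real
        using that by simp
      show ?thesis unfolding gen eq by (rule half[OF nn])
    qed
    finally show ?case .
  qed
  have b_le: "norm (b x) \<le> w x * A * h x" if "x \<ge> 0" for x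
  proof (rule LIMSEQ_le_const)
    have "(\<lambda>l. w x * A * h x + B0 * h x * (1 / 2) ^ l) \<longlonglongrightarrow> w x * A * h x + B0 * h x * 0"
      by (intro tendsto_intros LIMSEQ_realpow_zero) auto
    then show "(\<lambda>l. w x * A * h x + B0 * h x * (1 / 2) ^ l) \<longlonglongrightarrow> w x * A * h x" by simp
    have "norm (b x) \<le> w x * A * h x + B0 * h x * (1 / 2) ^ l" for l
    proof -
      have "B0 * h x * (1 / 2) ^ l = B0 / 2 ^ l * h x" by (simp add: power_one_over)
      then show ?thesis using step[OF that, of l] by (simp only:)
    qed
    then show "\<exists>N. \<forall>l\<ge>N. norm (b x) \<le> w x * A * h x + B0 * h x * (1 / 2) ^ l" by blast
  qed
  have ur: "norm (u r x) \<le> A * B" if "x \<ge> 0" for x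
  proof -
    have "w x * norm (u r x) \<le> w x * (A * h x)"
      using b_le[OF that] by (simp add: b_def norm_mult w_def mult.assoc)
    then have "norm (u r x) \<le> A * h x" using w0[of x] by simp
    also have "\<dots> \<le> A * B" using h(1)[OF that] A0 by (intro mult_left_mono) auto
    finally show ?thesis .
  qed
  have "norm (u i x) \<le> A + A * B" if "x \<ge> 0" for i x
  proof -
    have "0 \<le> A * B" using order_trans[OF norm_ge_zero ur[OF that]] .
    moreover have "i = p \<or> i = r" using UN by blast
    ultimately show ?thesis using up[OF that] ur[OF that] A0 by auto
  qed
  then show ?thesis by blast
qed

section \<open>Regularity of the Lax coefficients\<close>

lemma off_part_U0: "off_part (U0 f g x) = U0 f g x"
  by (simp add: vec_eq_iff off_part_def U0_def sigma2_def forall_2)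

lemma abs_cos_minus_one_le: "\<bar>cos y - 1\<bar> \<le> \<bar>y::real\<bar>"
proof -
  have "cos y - 1 = - 2 * (sin (y / 2))\<^sup>2"
    using cos_double_sin[of "y / 2"] by simp
  then have "\<bar>cos y - 1\<bar> = 2 * (\<bar>sin (y / 2)\<bar> * \<bar>sin (y / 2)\<bar>)"
    by (simp add: abs_mult power2_eq_square)
  also have "\<dots> \<le> 2 * (1 * \<bar>y / 2\<bar>)"
    by (intro mult_left_mono mult_mono abs_sin_le_one abs_sin_x_le_abs_x) auto
  finally show ?thesis by simp
qed

lemma lax_coefficients_regular:
  fixes u0 u1 :: "real \<Rightarrow> real" and du0 du1 :: "nat \<Rightarrow> real \<Rightarrow> real"
  assumes "weak_derivatives (m + 2) u0 du0" "weak_derivatives (m + 1) u1 du1"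
    and "(\<lambda>x. (1 + x) ^ n * (u0 x - 2 * pi * of_int Nx)) absolutely_integrable_on {0..}"
    and "\<forall>i\<in>{1..m + 2}. (\<lambda>x. (1 + x) ^ n * du0 i x) absolutely_integrable_on {0..}"
    and "\<forall>i\<in>{0..m + 1}. (\<lambda>x. (1 + x) ^ n * du1 i x) absolutely_integrable_on {0..}"
  shows "weighted_L1 n (U0 (du0 1) u1)" "weighted_L1 n (U1 u0)"
    "regular n m (U0 (du0 1) u1)" "regular n m (U1 u0)"
proof -
  have w0: "weighted_L1 n (du0 i)" if "1 \<le> i" "i \<le> m + 2" for i
    using assms(4) that by (simp add: weighted_L1_def)
  have w1: "weighted_L1 n (du1 i)" if "i \<le> m + 1" for i
    using assms(5) that by (simp add: weighted_L1_def)
  have wu: "weighted_L1 n (\<lambda>x. u0 x - 2 * pi * of_int Nx)"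
    using assms(3) by (simp add: weighted_L1_def)
  have r0: "regular n m (du0 1)"
    by (rule weak_derivatives_regular[OF assms(1)]) (auto intro: w0)
  have r1: "regular n m (du1 0)"
    by (rule weak_derivatives_regular[OF assms(2)]) (auto intro: w1)
  have u0: "du0 0 x = u0 x" and u1: "du1 0 x = u1 x" if "x \<ge> 0" for x
    using assms(1,2) that unfolding weak_derivatives_def by blast+
  have deriv: "(du0 0 has_vector_derivative du0 1 x) (at x within {0..})" if "x \<ge> 0" for x
    using has_ac_derivative_has_vector_derivative[OF weak_derivatives_ac[OF assms(1), of 0] _ that]
      weighted_L1_integrable[OF w0[of 1]] regular_continuous[OF r0] by simp
  have sc: "regular n m (\<lambda>x. sin (du0 0 x))" "regular n m (\<lambda>x. cos (du0 0 x))"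
    using regular_sin_cos[OF deriv w0[of 1] r0] by auto
  \<comment> \<open>Shifting by \<open>2 \<pi> N\<^sub>x\<close> changes neither sine nor cosine, and \<open>|sin y|\<close> and \<open>|cos y - 1|\<close> are at most
    \<open>|y|\<close>; this is how the integrability of \<open>u\<^sub>0 - 2 \<pi> N\<^sub>x\<close> enters.\<close>
  have shift: "sin (du0 0 x) = sin (u0 x - 2 * pi * of_int Nx)" "cos (du0 0 x) = cos (u0 x - 2 * pi * of_int Nx)"
    if "x \<ge> 0" for x
  proof -
    have "sin (2 * pi * of_int Nx) = 0" "cos (2 * pi * of_int Nx) = 1"
      using sin_int_2pin[of Nx] cos_int_2pin[of Nx] by (simp_all add: mult_ac)
    then show "sin (du0 0 x) = sin (u0 x - 2 * pi * of_int Nx)" "cos (du0 0 x) = cos (u0 x - 2 * pi * of_int Nx)"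
      using u0[OF that] by (simp_all add: sin_diff cos_diff)
  qed
  have c1r: "regular n m (\<lambda>x. cos (du0 0 x) + (- 1))" by (intro regular_add sc regular_const)
  have sw: "weighted_L1 n (\<lambda>x. sin (du0 0 x))"
    by (rule weighted_L1_dominated[OF wu regular_continuous[OF sc(1)]])
      (simp only: shift real_norm_def abs_sin_x_le_abs_x)
  have cw: "weighted_L1 n (\<lambda>x. cos (du0 0 x) + (- 1))"
    by (rule weighted_L1_dominated[OF wu regular_continuous[OF c1r]])
      (simp only: shift real_norm_def abs_cos_minus_one_le flip: diff_conv_add_uminus)
  have bl: "bounded_linear (\<lambda>r::real. r *\<^sub>R (M::cmat2))" for M by (rule bounded_linear_scaleR_left)
  have e0: "(du0 1 x + du1 0 x) *\<^sub>R ((- (\<i> / 4)) *m sigma2) = U0 (du0 1) u1 x" if "x \<ge> 0" for x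
    using u1[OF that] by (simp add: U0_def vec_eq_iff scaleR_conv_of_real[where 'a = complex] algebra_simps)
  have e1: "sin (du0 0 x) *\<^sub>R ((\<i> / 4) *m sigma1) + (cos (du0 0 x) + (- 1)) *\<^sub>R ((\<i> / 4) *m sigma3) = U1 u0 x" if "x \<ge> 0" for x
    using u0[OF that] by (simp add: U1_def vec_eq_iff scaleR_conv_of_real[where 'a = complex] field_simps)
  show "weighted_L1 n (U0 (du0 1) u1)"
    by (rule weighted_L1_cong[OF weighted_L1_linear[OF bl weighted_L1_add[OF w0 w1]] e0]) auto
  show "regular n m (U0 (du0 1) u1)"
    by (rule regular_cong[OF regular_linear[OF bl regular_add[OF r0 r1]] e0])
  show "weighted_L1 n (U1 u0)"
    by (rule weighted_L1_cong[OF weighted_L1_add[OF weighted_L1_linear[OF bl sw] weighted_L1_linear[OF bl cw]] e1])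
  show "regular n m (U1 u0)"
    by (rule regular_cong[OF regular_add[OF regular_linear[OF bl sc(1)] regular_linear[OF bl c1r]] e1])
qed

section \<open>The equations for the matrix entries\<close>

lemma has_ac_derivative_exp:
  "has_ac_derivative (\<lambda>x. exp (\<mu> * of_real x)) (\<lambda>x. \<mu> * exp (\<mu> * of_real x) :: complex)"
  unfolding has_ac_derivative_def
proof (intro allI impI conjI)
  fix x :: real assume x: "x \<ge> 0"
  show "(\<lambda>x. \<mu> * exp (\<mu> * of_real x)) absolutely_integrable_on {0..x}"
    by (intro absolutely_integrable_continuous_real continuous_intros)
  have d: "((\<lambda>x. exp (\<mu> * of_real x)) has_vector_derivative \<mu> * exp (\<mu> * of_real y)) (at y within A)" for y A
  proof -
    have "((\<lambda>z. exp (\<mu> * z)) has_field_derivative \<mu> * exp (\<mu> * of_real y)) (at (of_real y))"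
      by (auto intro!: derivative_eq_intros)
    from has_vector_derivative_real_field[OF this] show ?thesis by (rule has_vector_derivative_at_within)
  qed
  have "((\<lambda>y. \<mu> * exp (\<mu> * of_real y)) has_integral (exp (\<mu> * of_real x) - exp (\<mu> * of_real 0))) {0..x}"
    using x by (intro fundamental_theorem_of_calculus d)
  then show "exp (\<mu> * of_real x) - exp (\<mu> * of_real 0) = integral {0..x} (\<lambda>x. \<mu> * exp (\<mu> * of_real x))"
    by (rule integral_unique[symmetric])
qed

lemma has_ac_derivative_exp_mult:
  fixes p g :: "real \<Rightarrow> complex"
  assumes "has_ac_derivative p (\<lambda>x. \<mu> * p x + g x)"
  shows "has_ac_derivative (\<lambda>x. exp (\<nu> * of_real x) * p x)
    (\<lambda>x. (\<mu> + \<nu>) * (exp (\<nu> * of_real x) * p x) + exp (\<nu> * of_real x) * g x)"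
  by (rule has_ac_derivative_cong[OF has_ac_derivative_bilinear[OF bounded_bilinear_mult has_ac_derivative_exp assms]])
    (simp_all add: algebra_simps)

text \<open>Variation of constants for absolutely continuous functions.\<close>

lemma duhamel_increment:
  fixes p g :: "real \<Rightarrow> complex"
  assumes "has_ac_derivative p (\<lambda>x. \<mu> * p x + g x)" "0 \<le> a" "a \<le> b"
  shows "exp (- \<mu> * of_real b) * p b - exp (- \<mu> * of_real a) * p a = integral {a..b} (\<lambda>t. exp (- \<mu> * of_real t) * g t)"
proof -
  have "has_ac_derivative (\<lambda>x. exp (- \<mu> * of_real x) * p x) (\<lambda>x. exp (- \<mu> * of_real x) * g x)"
    by (rule has_ac_derivative_cong[OF has_ac_derivative_exp_mult[OF assms(1), of "- \<mu>"]]) simp_all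
  from has_ac_derivative_increment[OF this assms(2,3)] show ?thesis .
qed

lemma exp_sigma3_nth: "exp_sigma3 \<alpha> $ i $ j = (if i = j then exp (of_real (sgn2 i) * \<alpha>) else 0)"
  using exhaust_2[of i] exhaust_2[of j] by (auto simp: exp_sigma3_def sgn2_def)

lemma exp_sigma3_conj_nth:
  "(exp_sigma3 a ** A ** exp_sigma3 b) $ i $ c = exp (of_real (sgn2 i) * a) * A $ i $ c * exp (of_real (sgn2 c) * b)"
  using exhaust_2[of i] exhaust_2[of c] by (auto simp: matrix_matrix_mult_def sum_2 exp_sigma3_nth)

lemma volterra_integrand_nth:
  "volterra_integrand U M k x t $ i $ c =
    exp (phase (sgn2 c) i * (k - 1 / k) * of_real (x - t)) * (\<Sum>d\<in>UNIV. U t k $ i $ d * M t k $ d $ c)"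
proof -
  define \<alpha> where "\<alpha> = \<i> * theta1 k * of_real (t - x)"
  have "volterra_integrand U M k x t $ i $ c = exp (of_real (sgn2 i) * \<alpha>) * (U t k ** M t k) $ i $ c * exp (of_real (sgn2 c) * - \<alpha>)"
    unfolding volterra_integrand_def exp_hat_sigma3_def \<alpha>_def[symmetric] by (rule exp_sigma3_conj_nth)
  also have "\<dots> = exp (of_real (sgn2 i) * \<alpha> + of_real (sgn2 c) * - \<alpha>) * (U t k ** M t k) $ i $ c"
    unfolding exp_add by (simp only: mult_ac)
  also have "of_real (sgn2 i) * \<alpha> + of_real (sgn2 c) * - \<alpha> = phase (sgn2 c) i * (k - 1 / k) * of_real (x - t)"
    by (simp add: \<alpha>_def phase_def theta1_def algebra_simps add_divide_distrib diff_divide_distrib)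
  finally show ?thesis by (simp add: matrix_matrix_mult_def)
qed

lemma U_lax_nth: "U_lax u0 u0x u1 t k $ i $ d = U0 u0x u1 t $ i $ d + U1 u0 t $ i $ d / k"
  by (simp add: U_lax_def)

lemma column_nth: "column c A $ i = A $ i $ c"
  by (simp add: column_def)

lemma volterra_X_entry:
  assumes "volterra_X U X" "k \<in> colwise ({k. Im k \<le> 0} - {0}) ({k. Im k \<ge> 0} - {0}) c" "x \<ge> 0"
  shows "(\<lambda>t. exp (phase (sgn2 c) i * (k - 1 / k) * of_real (x - t)) * (\<Sum>d\<in>UNIV. U t k $ i $ d * X t k $ d $ c)) absolutely_integrable_on {x..}"
    and "X x k $ i $ c = (if i = c then 1 else 0) -
      integral {x..} (\<lambda>t. exp (phase (sgn2 c) i * (k - 1 / k) * of_real (x - t)) * (\<Sum>d\<in>UNIV. U t k $ i $ d * X t k $ d $ c))"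
proof -
  let ?F = "\<lambda>t. column c (volterra_integrand U X k x t)"
  have F: "?F absolutely_integrable_on {x..}" "column c (X x k) = column c (mat 1) - integral {x..} ?F"
    using assms unfolding volterra_X_def by blast+
  have e: "?F t $ i = exp (phase (sgn2 c) i * (k - 1 / k) * of_real (x - t)) * (\<Sum>d\<in>UNIV. U t k $ i $ d * X t k $ d $ c)" for t
    by (simp only: column_nth volterra_integrand_nth)
  show "(\<lambda>t. exp (phase (sgn2 c) i * (k - 1 / k) * of_real (x - t)) * (\<Sum>d\<in>UNIV. U t k $ i $ d * X t k $ d $ c)) absolutely_integrable_on {x..}"
    using absolutely_integrable_linear[OF F(1) bounded_linear_vec_nth[of i]] unfolding o_def e .
  have "integral {x..} ((\<lambda>v. v $ i) \<circ> ?F) = integral {x..} ?F $ i"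
    using F(1) by (intro integral_linear bounded_linear_vec_nth) (simp add: absolutely_integrable_on_def)
  then have "integral {x..} ?F $ i = integral {x..} (\<lambda>t. exp (phase (sgn2 c) i * (k - 1 / k) * of_real (x - t)) * (\<Sum>d\<in>UNIV. U t k $ i $ d * X t k $ d $ c))"
    unfolding o_def e by (rule sym)
  moreover have "X x k $ i $ c = column c (X x k) $ i" by (simp add: column_nth)
  ultimately show "X x k $ i $ c = (if i = c then 1 else 0) -
      integral {x..} (\<lambda>t. exp (phase (sgn2 c) i * (k - 1 / k) * of_real (x - t)) * (\<Sum>d\<in>UNIV. U t k $ i $ d * X t k $ d $ c))"
    unfolding F(2) by (simp add: column_nth mat_def)
qed

lemma volterra_Y_entry:
  assumes "volterra_Y U Y" "k \<noteq> 0" "x \<ge> 0"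
  shows "(\<lambda>t. exp (phase (sgn2 c) i * (k - 1 / k) * of_real (x - t)) * (\<Sum>d\<in>UNIV. U t k $ i $ d * Y t k $ d $ c)) absolutely_integrable_on {0..x}"
    and "Y x k $ i $ c = (if i = c then 1 else 0) +
      integral {0..x} (\<lambda>t. exp (phase (sgn2 c) i * (k - 1 / k) * of_real (x - t)) * (\<Sum>d\<in>UNIV. U t k $ i $ d * Y t k $ d $ c))"
proof -
  let ?F = "volterra_integrand U Y k x"
  have F: "?F absolutely_integrable_on {0..x}" "Y x k = mat 1 + integral {0..x} ?F"
    using assms unfolding volterra_Y_def by blast+
  show "(\<lambda>t. exp (phase (sgn2 c) i * (k - 1 / k) * of_real (x - t)) * (\<Sum>d\<in>UNIV. U t k $ i $ d * Y t k $ d $ c)) absolutely_integrable_on {0..x}"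
    using absolutely_integrable_linear[OF F(1) bounded_linear_entry[of i c]] unfolding o_def volterra_integrand_nth .
  have "integral {0..x} ((\<lambda>v. v $ i $ c) \<circ> ?F) = integral {0..x} ?F $ i $ c"
    using F(1) by (intro integral_linear bounded_linear_entry) (simp add: absolutely_integrable_on_def)
  then have "integral {0..x} ?F $ i $ c = integral {0..x} (\<lambda>t. exp (phase (sgn2 c) i * (k - 1 / k) * of_real (x - t)) * (\<Sum>d\<in>UNIV. U t k $ i $ d * Y t k $ d $ c))"
    unfolding o_def volterra_integrand_nth by (rule sym)
  then show "Y x k $ i $ c = (if i = c then 1 else 0) +
      integral {0..x} (\<lambda>t. exp (phase (sgn2 c) i * (k - 1 / k) * of_real (x - t)) * (\<Sum>d\<in>UNIV. U t k $ i $ d * Y t k $ d $ c))"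
    unfolding F(2) by (simp add: mat_def)
qed

lemma phase_fast:
  "- (\<i> / 2 * of_real (sgn2 i) * (if (i \<noteq> c) = b then 1 else 0)) = phase ((if b then 1 else - 1) * sgn2 c) i"
  using exhaust_2[of i] exhaust_2[of c] by (auto simp: phase_def sgn2_def)

text \<open>Multiplication by \<open>exp (2 i \<theta>\<^sub>1 x \<sigma>\<^sub>3)\<close> from the right turns the exponents \<open>phase (- \<tau>)\<close> of the
\<open>W\<close>-part into the exponents \<open>phase \<tau>\<close> of the equation itself.\<close>

lemma phase_shift: "phase (- \<tau>) i + \<i> / 2 * of_real \<tau> = phase \<tau> i"
proof -
  have "- (\<i> / 4) * (a - - b) + \<i> / 2 * b = - (\<i> / 4) * (a - b)" for a b :: complex
    by (simp add: field_simps)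
  then show ?thesis unfolding phase_def by (simp only: of_real_diff of_real_minus)
qed

lemma partial_sum_regular:
  assumes "coefficients_regular n m b (m + 1) A"
  shows "l \<le> m + 1 \<Longrightarrow> regular n 0 (\<lambda>x. \<Sum>j\<le>l. (1 / k ^ j) *m A j x)"
proof (induction l)
  case 0
  have "regular n 0 (A 0)"
    by (rule regular_mono[of n "m + 1 - 0"]) (use assms in \<open>auto simp: coefficients_regular_def simp del: regular.simps\<close>)
  then show ?case by (simp del: regular.simps)
next
  case (Suc l)
  have "regular n 0 (A (Suc l))"
    by (rule regular_mono[of n "m + 1 - Suc l"])
      (use assms Suc.prems in \<open>auto simp: coefficients_regular_def simp del: regular.simps\<close>)
  moreover have "regular n 0 (\<lambda>x. \<Sum>j\<le>l. (1 / k ^ j) *m A j x)" using Suc by (simp del: regular.simps)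
  ultimately show ?case
    unfolding sum.atMost_Suc by (intro regular_add regular_linear[OF bounded_linear_mscale])
qed

text \<open>The equation for the truncated series, entry by entry. In column \<open>c\<close> the exponents are those of
\<open>\<tau> = sgn2 c\<close> for the recursion of \<open>X\<close> and \<open>Z\<close>, and of \<open>\<tau> = - sgn2 c\<close> for that of \<open>W\<close>.\<close>

lemma expansion_residual_entry:
  assumes V: "weighted_L1 n V0" "weighted_L1 n V1"
    and rec: "gen_recursion b V0 V1 (m + 1) A" and reg: "coefficients_regular n m b (m + 1) A"
    and A0: "\<And>x. A 0 x = C" "proj b C = 0"
    and P: "P = (\<lambda>k x. \<Sum>j\<le>m+1. (1 / k ^ j) *m A j x)"
  shows "\<exists>R0 R1. weighted_L1 n R0 \<and> weighted_L1 n R1 \<and>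
    (\<forall>k i c. k \<noteq> 0 \<longrightarrow> has_ac_derivative (\<lambda>x. P k x $ i $ c)
      (\<lambda>x. phase ((if b then 1 else - 1) * sgn2 c) i * (k - 1 / k) * P k x $ i $ c +
         ((\<Sum>d\<in>UNIV. (V0 x $ i $ d + V1 x $ i $ d / k) * P k x $ d $ c) + (1 / k ^ (m + 1)) * (R0 x $ i $ c + R1 x $ i $ c / k)))) \<and>
    (\<forall>k i c. (\<lambda>x. (\<Sum>d\<in>UNIV. (V0 x $ i $ d + V1 x $ i $ d / k) * P k x $ d $ c) + (1 / k ^ (m + 1)) * (R0 x $ i $ c + R1 x $ i $ c / k))
        absolutely_integrable_on {0..})"
proof -
  obtain R0 R1 where R: "weighted_L1 n R0" "weighted_L1 n R1" and ac: "\<And>k. k \<noteq> 0 \<Longrightarrow> has_ac_derivative (P k)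
      (\<lambda>x. (V0 x + (1 / k) *m V1 x) ** P k x
         - (\<i> / 2 * (k - 1 / k)) *m (sigma3 ** proj b (P k x))
         + (1 / k ^ (m + 1)) *m (R0 x + (1 / k) *m R1 x))"
    unfolding P
  proof (rule expansion_residual[OF V rec reg A0], goal_cases)
    case (1 R0 R1)
    show ?case by (rule 1(1)[OF 1(2-)])
  qed
  have Preg: "regular n 0 (P k)" for k
    unfolding P by (rule partial_sum_regular[OF reg order_refl])
  have prod: "((V0 x + (1 / k) *m V1 x) ** P k x) $ i $ c = (\<Sum>d\<in>UNIV. (V0 x $ i $ d + V1 x $ i $ d / k) * P k x $ d $ c)" for x k i c
    by (simp add: matrix_matrix_mult_def)
  have fast: "((\<i> / 2 * (k - 1 / k)) *m (sigma3 ** proj b (P k x))) $ i $ c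
      = - (phase ((if b then 1 else - 1) * sgn2 c) i * (k - 1 / k) * P k x $ i $ c)" for x k i c
  proof -
    have "(sigma3 ** proj b (P k x)) $ i $ c = of_real (sgn2 i) * (if (i \<noteq> c) = b then 1 else 0) * P k x $ i $ c"
      using exhaust_2[of i] by (auto simp: matrix_matrix_mult_def sum_2 sgn2_def proj_nth)
    then show ?thesis
      unfolding phase_fast[symmetric] mscale_nth by (simp add: mult_ac)
  qed
  have 1: "has_ac_derivative (\<lambda>x. P k x $ i $ c)
      (\<lambda>x. phase ((if b then 1 else - 1) * sgn2 c) i * (k - 1 / k) * P k x $ i $ c +
         ((\<Sum>d\<in>UNIV. (V0 x $ i $ d + V1 x $ i $ d / k) * P k x $ d $ c) + (1 / k ^ (m + 1)) * (R0 x $ i $ c + R1 x $ i $ c / k)))"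
    if "k \<noteq> 0" for k i c
  proof (rule has_ac_derivative_cong[OF has_ac_derivative_linear[OF bounded_linear_entry[of i c] ac[OF that]]])
    show "((V0 x + (1 / k) *m V1 x) ** P k x - (\<i> / 2 * (k - 1 / k)) *m (sigma3 ** proj b (P k x))
         + (1 / k ^ (m + 1)) *m (R0 x + (1 / k) *m R1 x)) $ i $ c
      = phase ((if b then 1 else - 1) * sgn2 c) i * (k - 1 / k) * P k x $ i $ c +
         ((\<Sum>d\<in>UNIV. (V0 x $ i $ d + V1 x $ i $ d / k) * P k x $ d $ c) + (1 / k ^ (m + 1)) * (R0 x $ i $ c + R1 x $ i $ c / k))" for x
      unfolding vector_add_component vector_minus_component prod fast by simp
  qed simp
  have 2: "(\<lambda>x. (\<Sum>d\<in>UNIV. (V0 x $ i $ d + V1 x $ i $ d / k) * P k x $ d $ c) + (1 / k ^ (m + 1)) * (R0 x $ i $ c + R1 x $ i $ c / k))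
        absolutely_integrable_on {0..}" for k i c
  proof -
    have "weighted_L1 n (\<lambda>x. (V0 x + (1 / k) *m V1 x) ** P k x + (1 / k ^ (m + 1)) *m (R0 x + (1 / k) *m R1 x))"
      by (intro weighted_L1_add weighted_L1_mult_right[OF _ Preg] weighted_L1_linear[OF bounded_linear_mscale] V R)
    from weighted_L1_integrable[OF weighted_L1_linear[OF bounded_linear_entry[of i c] this]]
    show ?thesis unfolding vector_add_component prod by simp
  qed
  show ?thesis using R 1 2 by blast
qed

section \<open>From jets to derivatives\<close>

text \<open>Jets of the entries give derivatives of the columns: the derivative of order \<open>j\<close> is \<open>j!\<close> times the
coefficient, and the norm of a column is at most the sum over its two entries.\<close>

lemma k_derivatives_bounded_of_jets:
  assumes "\<And>c. \<exists>C. \<forall>x\<ge>0. \<forall>i. \<exists>F. jet (D c) n F \<and> (\<forall>k\<in>closure (D c). fps_nth (F k) 0 = f x k $ i $ c \<and>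
      (\<forall>j\<le>n. norm (fps_nth (F k) j) \<le> C * w j x / norm k ^ N))"
    and w: "\<And>j x. x \<ge> 0 \<Longrightarrow> w j x \<ge> 0"
  shows "\<exists>C>0. k_derivatives_bounded D n f (\<lambda>j x k. C * w j x / norm k ^ N)"
proof -
  obtain C where C: "\<And>c x i. x \<ge> 0 \<Longrightarrow> \<exists>F. jet (D c) n F \<and> (\<forall>k\<in>closure (D c). fps_nth (F k) 0 = f x k $ i $ c \<and>
      (\<forall>j\<le>n. norm (fps_nth (F k) j) \<le> C c * w j x / norm k ^ N))"
    using assms(1) by metis
  define K where "K = \<bar>C 1\<bar> + \<bar>C 2\<bar> + 1"
  have K: "C c \<le> K" for c using exhaust_2[of c] by (auto simp: K_def)
  have K0: "K > 0" by (simp add: K_def)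
  have "k_derivatives_bounded D n f (\<lambda>j x k. (2 * fact n * K) * w j x / norm k ^ N)"
    unfolding k_derivatives_bounded_def
  proof (intro allI impI)
    fix x :: real assume x: "x \<ge> 0"
    have "\<forall>c i. \<exists>F. jet (D c) n F \<and> (\<forall>k\<in>closure (D c). fps_nth (F k) 0 = f x k $ i $ c \<and>
      (\<forall>j\<le>n. norm (fps_nth (F k) j) \<le> C c * w j x / norm k ^ N))" using C[OF x] by blast
    then obtain F where F: "\<And>c i. jet (D c) n (F c i)"
      and F0: "\<And>c i k. k \<in> closure (D c) \<Longrightarrow> fps_nth (F c i k) 0 = f x k $ i $ c"
      and Fb: "\<And>c i k j. k \<in> closure (D c) \<Longrightarrow> j \<le> n \<Longrightarrow> norm (fps_nth (F c i k) j) \<le> C c * w j x / norm k ^ N"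
      by metis
    define G :: "nat \<Rightarrow> complex \<Rightarrow> cmat2" where "G j k = (\<chi> i c. fact j * fps_nth (F c i k) j)" for j k
    have G: "G j k $ i $ c = fact j * fps_nth (F c i k) j" for j k i c by (simp add: G_def)
    have "k_derivatives D n (f x) G"
      unfolding k_derivatives_def
    proof (intro allI conjI ballI impI)
      fix c k assume "k \<in> closure (D c)"
      then show "column c (G 0 k) = column c (f x k)" by (simp add: vec_eq_iff column_nth G F0)
    next
      fix c j assume "j \<le> n"
      then have "continuous_on (closure (D c)) (\<lambda>k. fps_nth (F c i k) j)" for i
        using F[of c i] by (simp add: jet_def)
      then show "continuous_on (closure (D c)) (\<lambda>k. column c (G j k))"
        unfolding column_def G by (intro continuous_on_vec_lambda continuous_intros)
    next
      fix c j k i assume j: "j < n" and k: "k \<in> D c"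
      have "((\<lambda>z. fps_nth (F c i z) j) has_field_derivative of_nat (Suc j) * fps_nth (F c i k) (Suc j)) (at k)"
        using F[of c i] j k unfolding jet_def taylor_family_def by blast
      from DERIV_cmult[OF this, of "fact j"]
      have "((\<lambda>z. fact j * fps_nth (F c i z) j) has_field_derivative fact j * (of_nat (Suc j) * fps_nth (F c i k) (Suc j))) (at k)" .
      also have "fact j * (of_nat (Suc j) * fps_nth (F c i k) (Suc j)) = fact (Suc j) * fps_nth (F c i k) (Suc j)"
        by (simp only: fact_Suc mult_ac of_nat_mult)
      finally show "((\<lambda>z. G j z $ i $ c) has_field_derivative G (Suc j) k $ i $ c) (at k)"
        unfolding G .
    qed
    moreover have "norm (column c (G j k)) \<le> (2 * fact n * K) * w j x / norm k ^ N"
      if j: "j \<le> n" and k: "k \<in> closure (D c)" for j c k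
    proof -
      have "norm (column c (G j k)) \<le> (\<Sum>i\<in>UNIV. norm (column c (G j k) $ i))"
        unfolding norm_vec_def by (rule L2_set_le_sum) simp
      also have "\<dots> \<le> (\<Sum>i\<in>(UNIV::2 set). fact n * (K * w j x / norm k ^ N))"
      proof (rule sum_mono)
        fix i
        have "norm (column c (G j k) $ i) = fact j * norm (fps_nth (F c i k) j)"
          by (simp add: column_nth G norm_mult)
        also have "\<dots> \<le> fact n * (K * w j x / norm k ^ N)"
        proof (rule mult_mono)
          show "(fact j :: real) \<le> fact n" using j by (rule fact_mono)
          have "C c * w j x / norm k ^ N \<le> K * w j x / norm k ^ N"
            using K[of c] w[OF x] by (intro divide_right_mono mult_right_mono) auto
          then show "norm (fps_nth (F c i k) j) \<le> K * w j x / norm k ^ N"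
            using Fb[OF k j, of i] by linarith
        qed auto
        finally show "norm (column c (G j k) $ i) \<le> fact n * (K * w j x / norm k ^ N)" .
      qed
      finally show ?thesis by (simp add: mult_ac)
    qed
    ultimately show "\<exists>F. k_derivatives D n (f x) F \<and>
        (\<forall>j\<le>n. \<forall>c. \<forall>k\<in>closure (D c). norm (column c (F j k)) \<le> 2 * fact n * K * w j x / norm k ^ N)"
      by blast
  qed
  moreover have "2 * fact n * K > 0" using K0 by simp
  ultimately show ?thesis by blast
qed

lemma k_derivatives_bounded_mono:
  assumes "k_derivatives_bounded D n f B"
    and "\<And>j x k c. j \<le> n \<Longrightarrow> x \<ge> 0 \<Longrightarrow> k \<in> closure (D c) \<Longrightarrow> B j x k \<le> B' j x k"
  shows "k_derivatives_bounded D n f B'"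
  unfolding k_derivatives_bounded_def
proof (intro allI impI)
  fix x :: real assume x: "x \<ge> 0"
  obtain F where F: "k_derivatives D n (f x) F" "\<forall>j\<le>n. \<forall>c. \<forall>k\<in>closure (D c). norm (column c (F j k)) \<le> B j x k"
    using assms(1) x unfolding k_derivatives_bounded_def by blast
  have "\<forall>j\<le>n. \<forall>c. \<forall>k\<in>closure (D c). norm (column c (F j k)) \<le> B' j x k"
    using F(2) assms(2)[OF _ x] by (meson order_trans)
  then show "\<exists>F. k_derivatives D n (f x) F \<and> (\<forall>j\<le>n. \<forall>c. \<forall>k\<in>closure (D c). norm (column c (F j k)) \<le> B' j x k)"
    using F(1) by blast
qed

section \<open>The solution normalized at infinity\<close>

lemma phase_self [simp]: "phase (sgn2 c) c = 0" by (simp add: phase_def)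

lemma sgn2_cases: "sgn2 c = 1 \<or> sgn2 c = - 1" by (simp add: sgn2_def)

lemma integral_exp_shift:
  fixes g :: "real \<Rightarrow> complex"
  shows "integral S (\<lambda>t. exp (\<mu> * of_real (x - t)) * g t) = exp (\<mu> * of_real x) * integral S (\<lambda>t. exp (- \<mu> * of_real t) * g t)"
proof -
  have "\<mu> * of_real (x - t) = \<mu> * of_real x + - \<mu> * of_real t" for t
    by (simp add: algebra_simps)
  then have "(\<lambda>t. exp (\<mu> * of_real (x - t)) * g t) = (\<lambda>t. exp (\<mu> * of_real x) * (exp (- \<mu> * of_real t) * g t))"
    by (simp only: exp_add mult.assoc)
  then show ?thesis by (simp only: integral_mult_right)
qed

lemma absolutely_integrable_exp_mult:
  fixes g :: "real \<Rightarrow> complex"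
  assumes "g absolutely_integrable_on S" "S \<in> sets lebesgue" "\<And>t. t \<in> S \<Longrightarrow> Re (\<mu> * of_real (x - t)) \<le> B"
  shows "(\<lambda>t. exp (\<mu> * of_real (x - t)) * g t) absolutely_integrable_on S"
proof (rule absolutely_integrable_bilinear_continuous[OF bounded_bilinear_mult _ _ assms(1,2)])
  show "continuous_on S (\<lambda>t. exp (\<mu> * of_real (x - t)))" by (intro continuous_intros)
  show "bounded ((\<lambda>t. exp (\<mu> * of_real (x - t))) ` S)"
    unfolding bounded_iff using assms(3) by (intro exI[of _ "exp B"]) (auto simp: norm_exp_eq_Re)
qed

lemma lax_entry_le:
  assumes "norm k \<ge> 1"
  shows "norm (V0 t $ i $ d + V1 t $ i $ d / k) \<le> norm (V0 t :: cmat2) + norm (V1 t :: cmat2)"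
proof -
  have "norm (V1 t $ i $ d / k) \<le> norm (V1 t $ i $ d) / 1"
    unfolding norm_divide using assms by (intro divide_left_mono) auto
  then show ?thesis
    using norm_triangle_ineq[of "V0 t $ i $ d" "V1 t $ i $ d / k"] norm_entry_le[of "V0 t" i d] norm_entry_le[of "V1 t" i d]
    by simp
qed

text \<open>Column \<open>c\<close> of \<open>X\<close> minus its expansion. Both satisfy Volterra equations from infinity with the same
boundary value, the expansion with an additional residual of order \<open>k^-(m+1)\<close>.\<close>

theorem X_estimate:
  fixes V0 V1 :: "real \<Rightarrow> cmat2" and X :: "real \<Rightarrow> complex \<Rightarrow> cmat2" and D :: "complex set"
  assumes D: "open D" "\<And>k. k \<in> closure D \<Longrightarrow> norm k \<ge> 1 \<and> sgn2 c * Im k \<le> 0"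
    and V: "weighted_L1 n V0" "weighted_L1 n V1" "regular n m V0" "regular n m V1"
    and A: "gen_recursion True V0 V1 (m + 1) A" "coefficients_regular n m True (m + 1) A" "\<And>x. A 0 x = mat 1"
      "\<And>j. j \<in> {1..m + 1} \<Longrightarrow> (A j \<longlongrightarrow> 0) at_top"
    and X_int: "\<And>i x k. k \<in> closure D \<Longrightarrow> x \<ge> 0 \<Longrightarrow>
      (\<lambda>t. exp (phase (sgn2 c) i * (k - 1 / k) * of_real (x - t)) * (\<Sum>d\<in>UNIV. (V0 t $ i $ d + V1 t $ i $ d / k) * X t k $ d $ c)) absolutely_integrable_on {x..}"
    and X_eq: "\<And>i x k. k \<in> closure D \<Longrightarrow> x \<ge> 0 \<Longrightarrow> X x k $ i $ c = (if i = c then 1 else 0) - integral {x..}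
      (\<lambda>t. exp (phase (sgn2 c) i * (k - 1 / k) * of_real (x - t)) * (\<Sum>d\<in>UNIV. (V0 t $ i $ d + V1 t $ i $ d / k) * X t k $ d $ c))"
  shows "\<exists>C. \<forall>x\<ge>0. \<forall>i. \<exists>F. jet D n F \<and> (\<forall>k\<in>closure D.
      fps_nth (F k) 0 = (X x k - X_trunc A (m + 1) x k) $ i $ c \<and>
      (\<forall>j\<le>n. norm (fps_nth (F k) j) \<le> C * (1 / (1 + x) ^ (n - j)) / norm k ^ (m + 1)))"
proof -
  define P where "P = (\<lambda>k x. \<Sum>j\<le>m+1. (1 / k ^ j) *m A j x)"
  have off1: "proj True (mat 1) = 0" by (auto simp: vec_eq_iff proj_nth mat_def)
  obtain R0 R1 where R: "weighted_L1 n R0" "weighted_L1 n R1"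
    and ac: "\<And>k i c. k \<noteq> 0 \<Longrightarrow> has_ac_derivative (\<lambda>x. P k x $ i $ c)
      (\<lambda>x. phase (sgn2 c) i * (k - 1 / k) * P k x $ i $ c +
         ((\<Sum>d\<in>UNIV. (V0 x $ i $ d + V1 x $ i $ d / k) * P k x $ d $ c) + (1 / k ^ (m + 1)) * (R0 x $ i $ c + R1 x $ i $ c / k)))"
    and gi: "\<And>k i c. (\<lambda>x. (\<Sum>d\<in>UNIV. (V0 x $ i $ d + V1 x $ i $ d / k) * P k x $ d $ c) + (1 / k ^ (m + 1)) * (R0 x $ i $ c + R1 x $ i $ c / k))
        absolutely_integrable_on {0..}"
    using expansion_residual_entry[OF V(1,2) A(1,2,3) off1 P_def] by (simp only: if_True mult_1_left) blast
  have P_eq: "X_trunc A (m + 1) x k = P k x" for x k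
  proof -
    have "P k x = (1 / k ^ 0) *m A 0 x + (\<Sum>j=1..m+1. (1 / k ^ j) *m A j x)"
      unfolding P_def by (simp add: atMost_atLeast0 sum.atLeast_Suc_atMost del: sum.cl_ivl_Suc)
    then show ?thesis by (simp add: X_trunc_def A(3))
  qed
  have P_lim: "((\<lambda>x. P k x $ i $ c) \<longlongrightarrow> mat 1 $ i $ c) at_top" for k i
  proof -
    have "((\<lambda>x. (1 / k ^ j) *m A j x) \<longlongrightarrow> (if j = 0 then mat 1 else 0)) at_top" if "j \<le> m + 1" for j
    proof (cases "j = 0")
      case True
      then show ?thesis by (simp add: A(3))
    next
      case False
      then have "(A j \<longlongrightarrow> 0) at_top" using A(4)[of j] that by simp
      then have "((\<lambda>x. (1 / k ^ j) *m A j x) \<longlongrightarrow> (1 / k ^ j) *m 0) at_top"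
        by (rule bounded_linear.tendsto[OF bounded_linear_mscale])
      moreover have "(1 / k ^ j) *m (0 :: cmat2) = 0" by (simp add: vec_eq_iff)
      ultimately show ?thesis using False by simp
    qed
    then have "(P k \<longlongrightarrow> (\<Sum>j\<le>m+1. if j = 0 then mat 1 else 0)) at_top"
      unfolding P_def by (intro tendsto_sum) auto
    also have "(\<Sum>j\<le>m+1. if j = 0 then mat 1 else (0::cmat2)) = mat 1" by simp
    finally show ?thesis by (rule bounded_linear.tendsto[OF bounded_linear_entry])
  qed
  have k0: "k \<noteq> 0" if "k \<in> closure D" for k using D(2)[OF that] by auto
  have Re_le: "Re (phase (sgn2 c) i * (k - 1 / k) * of_real (x - t)) \<le> 0" if "k \<in> closure D" "x \<le> t" for i k x t
  proof (rule phase_Re_nonpos[OF k0[OF that(1)] sgn2_cases])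
    have "(x - t) * (sgn2 c * Im k) \<ge> 0" using D(2)[OF that(1)] that(2) by (intro mult_nonpos_nonpos) auto
    then show "0 \<le> (x - t) * sgn2 c * Im k" by (simp only: mult.assoc)
  qed
  define g where "g k i t = (\<Sum>d\<in>UNIV. (V0 t $ i $ d + V1 t $ i $ d / k) * P k t $ d $ c) + (1 / k ^ (m + 1)) * (R0 t $ i $ c + R1 t $ i $ c / k)" for k i t
  have g_int: "(\<lambda>t. exp (phase (sgn2 c) i * (k - 1 / k) * of_real (x - t)) * g k i t) absolutely_integrable_on {x..}"
    if "k \<in> closure D" "x \<ge> 0" for i k x
  proof (rule absolutely_integrable_exp_mult)
    show "g k i absolutely_integrable_on {x..}"
      unfolding g_def by (rule set_integrable_subset[OF gi]) (use that in auto)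
    show "Re (phase (sgn2 c) i * (k - 1 / k) * complex_of_real (x - t)) \<le> 0" if "t \<in> {x..}" for t
      using Re_le[OF \<open>k \<in> closure D\<close>] that by simp
  qed simp
  have P_volterra: "P k x $ i $ c = (if i = c then 1 else 0) - integral {x..} (\<lambda>t. exp (phase (sgn2 c) i * (k - 1 / k) * of_real (x - t)) * g k i t)"
    if k: "k \<in> closure D" and x: "x \<ge> 0" for i k x
  proof -
    define \<mu> where "\<mu> = phase (sgn2 c) i * (k - 1 / k)"
    have inc: "exp (- \<mu> * of_real T) * P k T $ i $ c - exp (- \<mu> * of_real x) * P k x $ i $ c = integral {x..T} (\<lambda>t. exp (- \<mu> * of_real t) * g k i t)"
      if "x \<le> T" for T
      unfolding \<mu>_def g_def by (rule duhamel_increment[OF ac[OF k0[OF k]] x that])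
    have int: "(\<lambda>t. exp (- \<mu> * of_real t) * g k i t) absolutely_integrable_on {x..}"
      using set_integrable_subset[OF g_int[OF k order_refl, of i], of "{x..}"] x unfolding \<mu>_def by simp
    \<comment> \<open>In the diagonal entry the exponential is 1; in the other one it has modulus at most 1 and the
      expansion tends to zero.\<close>
    have lim1: "((\<lambda>T. exp (- \<mu> * of_real T) * P k T $ i $ c) \<longlongrightarrow> (if i = c then 1 else 0)) at_top"
    proof (cases "i = c")
      case True
      then show ?thesis using P_lim[of k i] by (simp add: \<mu>_def mat_def)
    next
      case False
      have "((\<lambda>T. exp (- \<mu> * of_real T) * P k T $ i $ c) \<longlongrightarrow> 0) at_top"
      proof (rule Lim_null_comparison)
        show "\<forall>\<^sub>F T in at_top. norm (exp (- \<mu> * of_real T) * P k T $ i $ c) \<le> norm (P k T $ i $ c)"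
          using eventually_ge_at_top[of 0]
        proof eventually_elim
          case (elim T)
          have "norm (exp (- \<mu> * of_real T)) \<le> 1"
            using Re_le[OF k elim, of i] by (simp add: \<mu>_def norm_exp_eq_Re)
          then show ?case unfolding norm_mult by (intro mult_left_le_one_le) auto
        qed
        show "((\<lambda>T. norm (P k T $ i $ c)) \<longlongrightarrow> 0) at_top"
          using tendsto_norm[OF P_lim[of k i]] False by (simp add: mat_def)
      qed
      then show ?thesis using False by simp
    qed
    have "((\<lambda>T. exp (- \<mu> * of_real T) * P k T $ i $ c - exp (- \<mu> * of_real x) * P k x $ i $ c) \<longlongrightarrow> integral {x..} (\<lambda>t. exp (- \<mu> * of_real t) * g k i t)) at_top"
    proof (rule Lim_transform_eventually[OF integral_tendsto_at_top[OF int]])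
      show "\<forall>\<^sub>F T in at_top. integral {x..T} (\<lambda>t. exp (- \<mu> * of_real t) * g k i t) = exp (- \<mu> * of_real T) * P k T $ i $ c - exp (- \<mu> * of_real x) * P k x $ i $ c"
        using eventually_ge_at_top[of x] by eventually_elim (rule inc[symmetric])
    qed
    moreover have "((\<lambda>T. exp (- \<mu> * of_real T) * P k T $ i $ c - exp (- \<mu> * of_real x) * P k x $ i $ c) \<longlongrightarrow> (if i = c then 1 else 0) - exp (- \<mu> * of_real x) * P k x $ i $ c) at_top"
      by (intro tendsto_diff lim1 tendsto_const)
    ultimately have I: "integral {x..} (\<lambda>t. exp (- \<mu> * of_real t) * g k i t) = (if i = c then 1 else 0) - exp (- \<mu> * of_real x) * P k x $ i $ c"
      by (rule tendsto_unique[OF trivial_limit_at_top_linorder])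
    have e: "exp (\<mu> * of_real x) * exp (- \<mu> * of_real x) = 1" by (simp add: exp_minus)
    have d: "exp (\<mu> * of_real x) * (if i = c then 1 else 0) = (if i = c then 1 else 0 :: complex)" by (simp add: \<mu>_def)
    have "exp (\<mu> * of_real x) * integral {x..} (\<lambda>t. exp (- \<mu> * of_real t) * g k i t) = (if i = c then 1 else 0) - P k x $ i $ c"
      unfolding I right_diff_distrib mult.assoc[symmetric] e d by simp
    then have "P k x $ i $ c = (if i = c then 1 else 0) - integral {x..} (\<lambda>t. exp (\<mu> * of_real (x - t)) * g k i t)"
      unfolding integral_exp_shift by simp
    then show ?thesis unfolding \<mu>_def .
  qed
  have X_bounded: "\<exists>M. \<forall>i. \<forall>x\<ge>0. norm (X x k $ i $ c) \<le> M" if k: "k \<in> closure D" for k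
  proof -
    define r :: 2 where "r = (if c = 1 then 2 else 1)"
    define q where "q = (\<lambda>t. norm (V0 t) + norm (V1 t))"
    note q = lax_majorant[OF weighted_L1_integrable[OF V(1)] weighted_L1_integrable[OF V(2)]
        regular_continuous[OF V(3)] regular_continuous[OF V(4)] q_def]
    show ?thesis
    proof (rule volterra_right_bounded[where p = c and r = r and \<mu> = "\<lambda>i. phase (sgn2 c) i * (k - 1 / k)"
          and V = "\<lambda>i d t. V0 t $ i $ d + V1 t $ i $ d / k" and q = q])
      show "c \<noteq> r" by (simp add: r_def)
      show "phase (sgn2 c) c * (k - 1 / k) = 0" by simp
      show "0 \<le> Re (phase (sgn2 c) r * (k - 1 / k))"
        using Re_le[OF k, of 0 1 r] by simp
      show "norm (V0 t $ i $ d + V1 t $ i $ d / k) \<le> q t" for i d t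
        unfolding q_def by (rule lax_entry_le) (use D(2)[OF k] in simp)
    qed (rule q(1), rule q(2), rule q(3), erule X_int[OF k], erule X_eq[OF k])
  qed
  define E where "E i x k = X x k $ i $ c - P k x $ i $ c" for i x k
  have integrand: "exp \<phi> * ((\<Sum>d\<in>UNIV. (V0 t $ i $ d + V1 t $ i $ d / k) * E d t k) + 1 / k ^ (m + 1) * (- R0 t $ i $ c + - R1 t $ i $ c / k))
    = exp \<phi> * (\<Sum>d\<in>UNIV. (V0 t $ i $ d + V1 t $ i $ d / k) * X t k $ d $ c) - exp \<phi> * g k i t" for \<phi> t i k
    by (simp add: E_def g_def right_diff_distrib sum_subtractf diff_divide_distrib algebra_simps)
  have "\<exists>C. \<forall>x\<ge>0. \<forall>i. \<exists>F. jet D n F \<and> (\<forall>k\<in>closure D. fps_nth (F k) 0 = E i x k \<and>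
      (\<forall>j\<le>n. norm (fps_nth (F k) j) \<le> C * (1 / (1 + x) ^ (n - j)) / norm k ^ (m + 1)))"
  proof (rule right_estimate[where ?V0.0 = V0 and ?V1.0 = V1 and \<tau> = "sgn2 c" and Pa = "\<lambda>i t. - R0 t $ i $ c" and Pb = "\<lambda>i t. - R1 t $ i $ c"])
    show "weighted_L1 n (\<lambda>t. - R0 t $ i $ c)" "weighted_L1 n (\<lambda>t. - R1 t $ i $ c)" for i
      by (intro weighted_L1_linear[OF bounded_linear_minus[OF bounded_linear_entry]] R)+
    fix i x k assume x: "(0::real) \<le> x" and k: "k \<in> closure D"
    show "(\<lambda>t. exp (phase (sgn2 c) i * (k - 1 / k) * complex_of_real (x - t)) *
             ((\<Sum>d\<in>UNIV. (V0 t $ i $ d + V1 t $ i $ d / k) * E d t k) +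
              1 / k ^ (m + 1) * (- R0 t $ i $ c + - R1 t $ i $ c / k))) absolutely_integrable_on {x..}"
      unfolding integrand by (intro set_integral_diff(1) X_int g_int x k)
    have "E i x k = - (integral {x..} (\<lambda>t. exp (phase (sgn2 c) i * (k - 1 / k) * complex_of_real (x - t)) *
        (\<Sum>d\<in>UNIV. (V0 t $ i $ d + V1 t $ i $ d / k) * X t k $ d $ c))
      - integral {x..} (\<lambda>t. exp (phase (sgn2 c) i * (k - 1 / k) * complex_of_real (x - t)) * g k i t))"
      unfolding E_def X_eq[OF k x, of i] P_volterra[OF k x, of i] by simp
    also have "\<dots> = - (integral {x..} (\<lambda>t. exp (phase (sgn2 c) i * (k - 1 / k) * complex_of_real (x - t)) *
        (\<Sum>d\<in>UNIV. (V0 t $ i $ d + V1 t $ i $ d / k) * X t k $ d $ c)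
      - exp (phase (sgn2 c) i * (k - 1 / k) * complex_of_real (x - t)) * g k i t))"
      using X_int[OF k x, of i] g_int[OF k x, of i]
      by (subst Henstock_Kurzweil_Integration.integral_diff) (auto simp: absolutely_integrable_on_def)
    finally show "E i x k = - 1 * integral {x..} (\<lambda>t. exp (phase (sgn2 c) i * (k - 1 / k) * complex_of_real (x - t)) *
             ((\<Sum>d\<in>UNIV. (V0 t $ i $ d + V1 t $ i $ d / k) * E d t k) +
              1 / k ^ (m + 1) * (- R0 t $ i $ c + - R1 t $ i $ c / k)))"
      unfolding integrand by simp
  next
    fix x k assume x: "(0::real) \<le> x" and k: "k \<in> closure D"
    obtain M where M: "\<forall>i. \<forall>x\<ge>0. norm (X x k $ i $ c) \<le> M" using X_bounded[OF k] ..
    have "\<exists>B. \<forall>t\<ge>0. norm (P k t $ i $ c) \<le> B" for i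
    proof -
      have "bounded ((\<lambda>t. P k t $ i $ c) ` {0..})"
      proof -
        have "regular n 0 (P k)" unfolding P_def by (rule partial_sum_regular[OF A(2) order_refl])
        from regular_bounded[OF regular_linear[OF bounded_linear_entry this]] show ?thesis .
      qed
      then show ?thesis unfolding bounded_iff by auto
    qed
    then obtain B where B: "\<And>i t. t \<ge> 0 \<Longrightarrow> norm (P k t $ i $ c) \<le> B i" by metis
    have "norm (E i t k) \<le> M + (\<bar>B 1\<bar> + \<bar>B 2\<bar>)" if "t \<ge> 0" for i t
    proof -
      have "B i \<le> \<bar>B 1\<bar> + \<bar>B 2\<bar>" using exhaust_2[of i] by auto
      then show ?thesis
        using M that B[OF that, of i] norm_triangle_ineq4[of "X t k $ i $ c" "P k t $ i $ c"] unfolding E_def by (smt (verit))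
    qed
    then show "\<exists>M. \<forall>i. \<forall>t\<in>{x..}. norm (E i t k) \<le> M" using x by (meson atLeast_iff order_trans)
  next
    show "1 \<le> norm k \<and> sgn2 c * Im k \<le> 0" if "k \<in> closure D" for k by (rule D(2)[OF that])
  qed (rule D(1), rule sgn2_cases, rule V(1), rule V(2), rule regular_continuous[OF V(3)], rule regular_continuous[OF V(4)])
  then show ?thesis unfolding P_eq vector_minus_component E_def .
qed

section \<open>The solution normalized at zero\<close>

text \<open>On bounded intervals, solutions of a Volterra equation from 0 are bounded because they are continuous.\<close>

lemma volterra_left_bounded:
  fixes u H :: "2 \<Rightarrow> real \<Rightarrow> complex" and \<mu> :: "2 \<Rightarrow> complex"
  assumes x: "x \<ge> 0"
    and int: "\<And>i y. y \<ge> 0 \<Longrightarrow> (\<lambda>t. exp (\<mu> i * of_real (y - t)) * H i t) absolutely_integrable_on {0..y}"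
    and eq: "\<And>i y. y \<ge> 0 \<Longrightarrow> u i y = 1 * integral {0..y} (\<lambda>t. exp (\<mu> i * of_real (y - t)) * H i t)"
  shows "\<exists>M. \<forall>i. \<forall>t\<in>{0..x}. norm (u i t) \<le> M"
proof -
  have "\<exists>B. \<forall>t\<in>{0..x}. norm (u i t) \<le> B" for i
  proof -
    have split: "\<mu> i * of_real (y - t) = \<mu> i * of_real y + - \<mu> i * of_real t" for y t
      by (simp add: algebra_simps)
    have "(\<lambda>t. exp (- \<mu> i * of_real x) * (exp (\<mu> i * of_real (x - t)) * H i t)) absolutely_integrable_on {0..x}"
      by (rule set_integrable_mult_right) (rule int[OF x])
    moreover have "exp (- \<mu> i * of_real x) * (exp (\<mu> i * of_real (x - t)) * H i t) = exp (- \<mu> i * of_real t) * H i t" for t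
    proof -
      have "- \<mu> i * of_real x + \<mu> i * of_real (x - t) = - \<mu> i * of_real t" by (simp add: algebra_simps)
      then show ?thesis by (simp only: mult.assoc[symmetric] exp_add[symmetric])
    qed
    ultimately have "(\<lambda>t. exp (- \<mu> i * of_real t) * H i t) integrable_on {0..x}"
      by (simp only: absolutely_integrable_on_def)
    then have "continuous_on {0..x} (\<lambda>y. exp (\<mu> i * of_real y) * integral {0..y} (\<lambda>t. exp (- \<mu> i * of_real t) * H i t))"
      by (intro continuous_intros indefinite_integral_continuous_1)
    then have "bounded ((\<lambda>y. exp (\<mu> i * of_real y) * integral {0..y} (\<lambda>t. exp (- \<mu> i * of_real t) * H i t)) ` {0..x})"
      by (intro compact_imp_bounded compact_continuous_image) auto
    then obtain B where B: "\<And>y. y \<in> {0..x} \<Longrightarrow> norm (exp (\<mu> i * of_real y) * integral {0..y} (\<lambda>t. exp (- \<mu> i * of_real t) * H i t)) \<le> B"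
      unfolding bounded_iff by blast
    have "norm (u i t) \<le> B" if t: "t \<in> {0..x}" for t
    proof -
      have "u i t = exp (\<mu> i * of_real t) * integral {0..t} (\<lambda>s. exp (- \<mu> i * of_real s) * H i s)"
        using eq[of t i] t unfolding integral_exp_shift by simp
      then show ?thesis using B[OF t] by (simp only:)
    qed
    then show ?thesis by blast
  qed
  then obtain B where B: "\<And>i t. t \<in> {0..x} \<Longrightarrow> norm (u i t) \<le> B i" by metis
  have "norm (u i t) \<le> \<bar>B 1\<bar> + \<bar>B 2\<bar>" if "t \<in> {0..x}" for i t
    using B[OF that, of i] exhaust_2[of i] by auto
  then show ?thesis by blast
qed

text \<open>The Volterra equation for the entries of \<open>Y\<close> minus its expansion. The residual of the \<open>Z\<close>-part appears
as it is, that of the \<open>W\<close>-part with an oscillating factor. There is no boundary term, since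
\<open>Z\<^sub>j(0) + W\<^sub>j(0) = 0\<close>.\<close>

lemma Y_error_volterra:
  fixes V0 V1 :: "real \<Rightarrow> cmat2" and Y :: "real \<Rightarrow> complex \<Rightarrow> cmat2"
  assumes V: "weighted_L1 n V0" "weighted_L1 n V1"
    and Z: "gen_recursion True V0 V1 (m + 1) Z" "coefficients_regular n m True (m + 1) Z" "\<And>x. Z 0 x = mat 1"
    and W: "gen_recursion False V0 V1 (m + 1) W" "coefficients_regular n m False (m + 1) W" "\<And>x. W 0 x = 0"
    and ZW: "\<forall>j\<in>{1..m + 1}. Z j 0 + W j 0 = 0"
    and Y_int': "\<forall>i c x k. k \<noteq> 0 \<longrightarrow> x \<ge> 0 \<longrightarrow>
      (\<lambda>t. exp (phase (sgn2 c) i * (k - 1 / k) * of_real (x - t)) * (\<Sum>d\<in>UNIV. (V0 t $ i $ d + V1 t $ i $ d / k) * Y t k $ d $ c)) absolutely_integrable_on {0..x}"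
    and Y_eq': "\<forall>i c x k. k \<noteq> 0 \<longrightarrow> x \<ge> 0 \<longrightarrow> Y x k $ i $ c = (if i = c then 1 else 0) + integral {0..x}
      (\<lambda>t. exp (phase (sgn2 c) i * (k - 1 / k) * of_real (x - t)) * (\<Sum>d\<in>UNIV. (V0 t $ i $ d + V1 t $ i $ d / k) * Y t k $ d $ c))"
    and E_def: "E = (\<lambda>c i x k. (Y x k - Y_trunc Z W (m + 1) x k) $ i $ c)"
  shows "\<exists>R0 R1 Q0 Q1. weighted_L1 n R0 \<and> weighted_L1 n R1 \<and> weighted_L1 n Q0 \<and> weighted_L1 n Q1 \<and>
    (\<forall>k c i x. k \<noteq> 0 \<longrightarrow> x \<ge> 0 \<longrightarrow>
      (\<lambda>t. exp (phase (sgn2 c) i * (k - 1 / k) * of_real (x - t)) *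
        ((\<Sum>d\<in>UNIV. (V0 t $ i $ d + V1 t $ i $ d / k) * E c d t k) + (1 / k ^ (m + 1)) *
          (R0 t $ i $ c + R1 t $ i $ c / k + exp (\<i> / 2 * of_real (sgn2 c) * (k - 1 / k) * of_real t) * (Q0 t $ i $ c + Q1 t $ i $ c / k)))) absolutely_integrable_on {0..x} \<and>
      E c i x k = integral {0..x} (\<lambda>t. exp (phase (sgn2 c) i * (k - 1 / k) * of_real (x - t)) *
        ((\<Sum>d\<in>UNIV. (V0 t $ i $ d + V1 t $ i $ d / k) * E c d t k) + (1 / k ^ (m + 1)) *
          (R0 t $ i $ c + R1 t $ i $ c / k + exp (\<i> / 2 * of_real (sgn2 c) * (k - 1 / k) * of_real t) * (Q0 t $ i $ c + Q1 t $ i $ c / k)))))"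
proof -
  note Y_int = Y_int'[rule_format] and Y_eq = Y_eq'[rule_format]
  define P where "P = (\<lambda>k x. \<Sum>j\<le>m+1. (1 / k ^ j) *m Z j x)"
  define PW where "PW = (\<lambda>k x. \<Sum>j\<le>m+1. (1 / k ^ j) *m W j x)"
  have off1: "proj True (mat 1) = 0" by (auto simp: vec_eq_iff proj_nth mat_def)
  have off0: "proj False 0 = 0" by (rule proj_linear(4))
  obtain R0 R1 where R: "weighted_L1 n R0" "weighted_L1 n R1"
    and acZ: "\<And>k i c. k \<noteq> 0 \<Longrightarrow> has_ac_derivative (\<lambda>x. P k x $ i $ c)
      (\<lambda>x. phase (sgn2 c) i * (k - 1 / k) * P k x $ i $ c +
         ((\<Sum>d\<in>UNIV. (V0 x $ i $ d + V1 x $ i $ d / k) * P k x $ d $ c) + (1 / k ^ (m + 1)) * (R0 x $ i $ c + R1 x $ i $ c / k)))"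
    and giZ: "\<And>k i c. (\<lambda>x. (\<Sum>d\<in>UNIV. (V0 x $ i $ d + V1 x $ i $ d / k) * P k x $ d $ c) + (1 / k ^ (m + 1)) * (R0 x $ i $ c + R1 x $ i $ c / k))
        absolutely_integrable_on {0..}"
    using expansion_residual_entry[OF V Z(1,2,3) off1 P_def] by (simp only: if_True mult_1_left) blast
  obtain Q0 Q1 where Q: "weighted_L1 n Q0" "weighted_L1 n Q1"
    and acW: "\<And>k i c. k \<noteq> 0 \<Longrightarrow> has_ac_derivative (\<lambda>x. PW k x $ i $ c)
      (\<lambda>x. phase (- 1 * sgn2 c) i * (k - 1 / k) * PW k x $ i $ c +
         ((\<Sum>d\<in>UNIV. (V0 x $ i $ d + V1 x $ i $ d / k) * PW k x $ d $ c) + (1 / k ^ (m + 1)) * (Q0 x $ i $ c + Q1 x $ i $ c / k)))"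
    and giW: "\<And>k i c. (\<lambda>x. (\<Sum>d\<in>UNIV. (V0 x $ i $ d + V1 x $ i $ d / k) * PW k x $ d $ c) + (1 / k ^ (m + 1)) * (Q0 x $ i $ c + Q1 x $ i $ c / k))
        absolutely_integrable_on {0..}"
    using expansion_residual_entry[OF V W(1,2,3) off0 PW_def] by (simp only: if_False) blast
  have trunc_sum: "(\<Sum>j\<le>m+1. (1 / k ^ j) *m A j x) = A 0 x + (\<Sum>j=1..m+1. (1 / k ^ j) *m A j x)" for A :: "nat \<Rightarrow> real \<Rightarrow> cmat2" and k x
    by (simp add: atMost_atLeast0 sum.atLeast_Suc_atMost del: sum.cl_ivl_Suc)
  define \<nu> where "\<nu> c k = \<i> / 2 * of_real (sgn2 c) * (k - 1 / k)" for c k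
  have Yp: "Y_trunc Z W (m + 1) x k $ i $ c = P k x $ i $ c + exp (\<nu> c k * of_real x) * PW k x $ i $ c" for x k i c
  proof -
    have P': "P k x = mat 1 + (\<Sum>j=1..m+1. (1 / k ^ j) *m Z j x)" "PW k x = (\<Sum>j=1..m+1. (1 / k ^ j) *m W j x)"
      unfolding P_def PW_def trunc_sum by (simp_all add: Z(3) W(3))
    have e: "of_real (sgn2 c) * (2 * \<i> * theta1 k * of_real x) = \<nu> c k * of_real x"
      by (simp add: \<nu>_def theta1_def)
    have "(PW k x ** exp_sigma3 (2 * \<i> * theta1 k * of_real x)) $ i $ c = PW k x $ i $ c * exp (\<nu> c k * of_real x)"
      using exhaust_2[of c] by (auto simp: matrix_matrix_mult_def sum_2 exp_sigma3_nth e[symmetric])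
    then show ?thesis unfolding Y_trunc_def P'[symmetric] vector_add_component by (simp only: mult.commute)
  qed
  define p where "p c i k x = P k x $ i $ c + exp (\<nu> c k * of_real x) * PW k x $ i $ c" for c i k x
  define g where "g c i k t = (\<Sum>d\<in>UNIV. (V0 t $ i $ d + V1 t $ i $ d / k) * p c d k t) + (1 / k ^ (m + 1)) *
    (R0 t $ i $ c + R1 t $ i $ c / k + exp (\<nu> c k * of_real t) * (Q0 t $ i $ c + Q1 t $ i $ c / k))" for c i k t
  have ac: "has_ac_derivative (p c i k) (\<lambda>x. phase (sgn2 c) i * (k - 1 / k) * p c i k x + g c i k x)" if k: "k \<noteq> 0" for c i k
    unfolding p_def
  proof (rule has_ac_derivative_cong[OF has_ac_derivative_add[OF acZ[OF k] has_ac_derivative_exp_mult[OF acW[OF k], of "\<nu> c k"]]])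
    fix x :: real
    have "phase (- 1 * sgn2 c) i * (k - 1 / k) + \<nu> c k = (phase (- 1 * sgn2 c) i + \<i> / 2 * of_real (sgn2 c)) * (k - 1 / k)"
      by (simp only: \<nu>_def distrib_right)
    also have "\<dots> = phase (sgn2 c) i * (k - 1 / k)" using phase_shift[of "sgn2 c" i] by simp
    finally have s: "phase (- 1 * sgn2 c) i * (k - 1 / k) + \<nu> c k = phase (sgn2 c) i * (k - 1 / k)" .
    have alg: "\<mu> * a + (v1 * a1 + v2 * a2 + K * r) + (\<mu> * (e * b) + e * (v1 * b1 + v2 * b2 + K * q))
      = \<mu> * (a + e * b) + (v1 * (a1 + e * b1) + v2 * (a2 + e * b2) + K * (r + e * q))" for \<mu> a v1 a1 v2 a2 K r e b b1 b2 q :: complex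
      by (simp add: algebra_simps)
    show "phase (sgn2 c) i * (k - 1 / k) * P k x $ i $ c +
         ((\<Sum>d\<in>UNIV. (V0 x $ i $ d + V1 x $ i $ d / k) * P k x $ d $ c) + 1 / k ^ (m + 1) * (R0 x $ i $ c + R1 x $ i $ c / k)) +
         ((phase (- 1 * sgn2 c) i * (k - 1 / k) + \<nu> c k) * (exp (\<nu> c k * complex_of_real x) * PW k x $ i $ c) +
          exp (\<nu> c k * complex_of_real x) *
          ((\<Sum>d\<in>UNIV. (V0 x $ i $ d + V1 x $ i $ d / k) * PW k x $ d $ c) + 1 / k ^ (m + 1) * (Q0 x $ i $ c + Q1 x $ i $ c / k))) =
         phase (sgn2 c) i * (k - 1 / k) * (P k x $ i $ c + exp (\<nu> c k * complex_of_real x) * PW k x $ i $ c) + g c i k x"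
      unfolding s g_def p_def sum_2 by (rule alg)
  qed simp
  have g_int: "(\<lambda>t. exp (\<mu> * of_real (x - t)) * g c i k t) absolutely_integrable_on {0..x}" if x: "x \<ge> 0" for \<mu> c i k x
  proof -
    have sub: "f absolutely_integrable_on {0..x}" if "f absolutely_integrable_on {0..}" for f :: "real \<Rightarrow> complex"
      by (rule absolutely_integrable_on_subinterval[OF that]) auto
    have bnd: "(\<lambda>t. exp (\<mu> * of_real (x - t)) * f t) absolutely_integrable_on {0..x}" if "f absolutely_integrable_on {0..x}" for f :: "real \<Rightarrow> complex" and \<mu> and x :: real
      by (rule absolutely_integrable_bilinear_continuous[OF bounded_bilinear_mult _ _ that])
        (auto intro!: continuous_intros compact_imp_bounded compact_continuous_image)
    have bnd0: "(\<lambda>t. exp (\<mu> * of_real t) * f t) absolutely_integrable_on {0..x}" if "f absolutely_integrable_on {0..x}" for f :: "real \<Rightarrow> complex" and \<mu> and x :: real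
      by (rule absolutely_integrable_bilinear_continuous[OF bounded_bilinear_mult _ _ that])
        (auto intro!: continuous_intros compact_imp_bounded compact_continuous_image)
    have "(\<lambda>t. ((\<Sum>d\<in>UNIV. (V0 t $ i $ d + V1 t $ i $ d / k) * P k t $ d $ c) + (1 / k ^ (m + 1)) * (R0 t $ i $ c + R1 t $ i $ c / k))
      + exp (\<nu> c k * of_real t) * ((\<Sum>d\<in>UNIV. (V0 t $ i $ d + V1 t $ i $ d / k) * PW k t $ d $ c) + (1 / k ^ (m + 1)) * (Q0 t $ i $ c + Q1 t $ i $ c / k)))
      absolutely_integrable_on {0..x}"
      by (intro set_integral_add(1) bnd0 sub giZ giW)
    moreover have "((\<Sum>d\<in>UNIV. (V0 t $ i $ d + V1 t $ i $ d / k) * P k t $ d $ c) + (1 / k ^ (m + 1)) * (R0 t $ i $ c + R1 t $ i $ c / k))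
      + exp (\<nu> c k * of_real t) * ((\<Sum>d\<in>UNIV. (V0 t $ i $ d + V1 t $ i $ d / k) * PW k t $ d $ c) + (1 / k ^ (m + 1)) * (Q0 t $ i $ c + Q1 t $ i $ c / k))
      = g c i k t" for t
    proof -
      have alg: "(v1 * a1 + v2 * a2 + K * r) + e * (v1 * b1 + v2 * b2 + K * q)
        = v1 * (a1 + e * b1) + v2 * (a2 + e * b2) + K * (r + e * q)" for v1 a1 v2 a2 K r e b1 b2 q :: complex
        by (simp add: algebra_simps)
      show ?thesis unfolding g_def p_def sum_2 by (rule alg)
    qed
    ultimately have "g c i k absolutely_integrable_on {0..x}" by (simp only:)
    then show ?thesis by (rule bnd)
  qed
  have p0: "p c i k 0 = (if i = c then 1 else 0)" for c i k
  proof -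
    have "P k 0 + PW k 0 = mat 1 + (\<Sum>j=1..m+1. (1 / k ^ j) *m (Z j 0 + W j 0))"
      unfolding P_def PW_def trunc_sum by (simp add: Z(3) W(3) mscale_linear sum.distrib)
    also have "(\<Sum>j=1..m+1. (1 / k ^ j) *m (Z j 0 + W j 0)) = (\<Sum>j=1..m+1. 0)"
    proof (rule sum.cong)
      fix j assume "j \<in> {1..m + 1}"
      then have "Z j 0 + W j 0 = 0" by (rule ZW[rule_format])
      then show "(1 / k ^ j) *m (Z j 0 + W j 0) = 0" by (simp add: vec_eq_iff)
    qed simp
    finally have "(P k 0 + PW k 0) $ i $ c = (if i = c then 1 else 0)" by (simp add: mat_def)
    then show ?thesis by (simp add: p_def)
  qed
  have p_eq: "p c i k x = (if i = c then 1 else 0) + integral {0..x} (\<lambda>t. exp (phase (sgn2 c) i * (k - 1 / k) * of_real (x - t)) * g c i k t)"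
    if k: "k \<noteq> 0" and x: "x \<ge> 0" for c i k x
  proof -
    define \<mu> where "\<mu> = phase (sgn2 c) i * (k - 1 / k)"
    have "exp (- \<mu> * of_real x) * p c i k x - exp (- \<mu> * of_real 0) * p c i k 0 = integral {0..x} (\<lambda>t. exp (- \<mu> * of_real t) * g c i k t)"
      unfolding \<mu>_def by (rule duhamel_increment[OF ac[OF k] order_refl x])
    then have I: "integral {0..x} (\<lambda>t. exp (- \<mu> * of_real t) * g c i k t) = exp (- \<mu> * of_real x) * p c i k x - (if i = c then 1 else 0)"
      by (simp add: p0)
    have e: "exp (\<mu> * of_real x) * exp (- \<mu> * of_real x) = 1" by (simp add: exp_minus)
    have d: "exp (\<mu> * of_real x) * (if i = c then 1 else 0) = (if i = c then 1 else 0 :: complex)" by (simp add: \<mu>_def)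
    have "exp (\<mu> * of_real x) * integral {0..x} (\<lambda>t. exp (- \<mu> * of_real t) * g c i k t) = p c i k x - (if i = c then 1 else 0)"
      unfolding I right_diff_distrib mult.assoc[symmetric] e d by simp
    then have "p c i k x = (if i = c then 1 else 0) + integral {0..x} (\<lambda>t. exp (\<mu> * of_real (x - t)) * g c i k t)"
      unfolding integral_exp_shift by simp
    then show ?thesis unfolding \<mu>_def .
  qed
  have E: "E c i x k = Y x k $ i $ c - p c i k x" for c i x k
    unfolding E_def vector_minus_component Yp p_def ..
  have integrand: "e * ((\<Sum>d\<in>UNIV. (V0 t $ i $ d + V1 t $ i $ d / k) * E c d t k) + (1 / k ^ (m + 1)) *
          ((- R0 t) $ i $ c + (- R1 t) $ i $ c / k + exp (\<i> / 2 * of_real (sgn2 c) * (k - 1 / k) * of_real t) * ((- Q0 t) $ i $ c + (- Q1 t) $ i $ c / k)))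
    = e * (\<Sum>d\<in>UNIV. (V0 t $ i $ d + V1 t $ i $ d / k) * Y t k $ d $ c) - e * g c i k t" for e t i k c
  proof -
    have alg: "e * ((v1 * (y1 - p1) + v2 * (y2 - p2)) + K * (- r + - s / k + f * (- q + - u / k)))
      = e * (v1 * y1 + v2 * y2) - e * (v1 * p1 + v2 * p2 + K * (r + s / k + f * (q + u / k)))" for v1 y1 p1 v2 y2 p2 K r s f q u :: complex
      by (simp add: algebra_simps)
    show ?thesis unfolding g_def E sum_2 \<nu>_def[symmetric] vector_uminus_component by (rule alg)
  qed
  have neg: "weighted_L1 n (\<lambda>t. - f t)" if "weighted_L1 n f" for f :: "real \<Rightarrow> cmat2"
    by (rule weighted_L1_linear[OF bounded_linear_minus[OF bounded_linear_ident] that])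
  show ?thesis
  proof (rule exI[of _ "\<lambda>t. - R0 t"], rule exI[of _ "\<lambda>t. - R1 t"], rule exI[of _ "\<lambda>t. - Q0 t"], rule exI[of _ "\<lambda>t. - Q1 t"],
      intro conjI allI impI neg R Q)
    fix k :: complex and c i :: 2 and x :: real assume k: "k \<noteq> 0" and x: "x \<ge> 0"
    let ?e = "\<lambda>t. exp (phase (sgn2 c) i * (k - 1 / k) * complex_of_real (x - t))"
    show "(\<lambda>t. ?e t * ((\<Sum>d\<in>UNIV. (V0 t $ i $ d + V1 t $ i $ d / k) * E c d t k) + 1 / k ^ (m + 1) *
      ((- R0 t) $ i $ c + (- R1 t) $ i $ c / k + exp (\<i> / 2 * complex_of_real (sgn2 c) * (k - 1 / k) * complex_of_real t) * ((- Q0 t) $ i $ c + (- Q1 t) $ i $ c / k)))) absolutely_integrable_on {0..x}"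
      unfolding integrand by (intro set_integral_diff(1) Y_int g_int x k)
    have "E c i x k = integral {0..x} (\<lambda>t. ?e t * (\<Sum>d\<in>UNIV. (V0 t $ i $ d + V1 t $ i $ d / k) * Y t k $ d $ c)) - integral {0..x} (\<lambda>t. ?e t * g c i k t)"
      unfolding E Y_eq[OF k x, of i c] p_eq[OF k x, of c i] by simp
    also have "\<dots> = integral {0..x} (\<lambda>t. ?e t * (\<Sum>d\<in>UNIV. (V0 t $ i $ d + V1 t $ i $ d / k) * Y t k $ d $ c) - ?e t * g c i k t)"
      using Y_int[OF k x, of c i] g_int[OF x, of "phase (sgn2 c) i * (k - 1 / k)" c i k]
      by (subst Henstock_Kurzweil_Integration.integral_diff) (auto simp: absolutely_integrable_on_def)
    finally show "E c i x k = integral {0..x} (\<lambda>t. ?e t * ((\<Sum>d\<in>UNIV. (V0 t $ i $ d + V1 t $ i $ d / k) * E c d t k) + 1 / k ^ (m + 1) *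
      ((- R0 t) $ i $ c + (- R1 t) $ i $ c / k + exp (\<i> / 2 * complex_of_real (sgn2 c) * (k - 1 / k) * complex_of_real t) * ((- Q0 t) $ i $ c + (- Q1 t) $ i $ c / k))))"
      unfolding integrand .
  qed
qed

text \<open>The two estimates for a column of \<open>Y\<close>, on opposite half planes. For the second one, the solution
multiplied by \<open>exp (- 2 i \<theta>\<^sub>1 x \<sigma>\<^sub>3)\<close> satisfies an equation of the same form with \<open>s\<close> replaced by
\<open>- s\<close> and with the two kinds of residual exchanged.\<close>

theorem Y_estimate:
  fixes V0 V1 :: "real \<Rightarrow> cmat2" and E :: "2 \<Rightarrow> real \<Rightarrow> complex \<Rightarrow> complex" and R0 R1 Q0 Q1 :: "2 \<Rightarrow> real \<Rightarrow> complex"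
  assumes V: "weighted_L1 n V0" "weighted_L1 n V1" "continuous_on {0..} V0" "continuous_on {0..} V1"
    and R: "\<And>i. weighted_L1 n (R0 i)" "\<And>i. weighted_L1 n (R1 i)" "\<And>i. weighted_L1 n (Q0 i)" "\<And>i. weighted_L1 n (Q1 i)"
    and s: "s = 1 \<or> s = - 1"
    and E_int: "\<And>k i x. k \<noteq> 0 \<Longrightarrow> x \<ge> 0 \<Longrightarrow>
      (\<lambda>t. exp (phase s i * (k - 1 / k) * of_real (x - t)) *
        ((\<Sum>d\<in>UNIV. (V0 t $ i $ d + V1 t $ i $ d / k) * E d t k) + (1 / k ^ N) *
          (R0 i t + R1 i t / k + exp (\<i> / 2 * of_real s * (k - 1 / k) * of_real t) * (Q0 i t + Q1 i t / k)))) absolutely_integrable_on {0..x}"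
    and E_eq: "\<And>k i x. k \<noteq> 0 \<Longrightarrow> x \<ge> 0 \<Longrightarrow>
      E i x k = integral {0..x} (\<lambda>t. exp (phase s i * (k - 1 / k) * of_real (x - t)) *
        ((\<Sum>d\<in>UNIV. (V0 t $ i $ d + V1 t $ i $ d / k) * E d t k) + (1 / k ^ N) *
          (R0 i t + R1 i t / k + exp (\<i> / 2 * of_real s * (k - 1 / k) * of_real t) * (Q0 i t + Q1 i t / k))))"
  shows "open D \<Longrightarrow> (\<And>k. k \<in> closure D \<Longrightarrow> norm k \<ge> 1 \<and> s * Im k \<ge> 0) \<Longrightarrow>
     \<exists>C. \<forall>x\<ge>0. \<forall>i. \<exists>F. jet D n F \<and> (\<forall>k\<in>closure D. fps_nth (F k) 0 = E i x k \<and>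
      (\<forall>j\<le>n. norm (fps_nth (F k) j) \<le> C * (1 + x) ^ j / norm k ^ N))"
    and "open D \<Longrightarrow> (\<And>k. k \<in> closure D \<Longrightarrow> norm k \<ge> 1 \<and> - s * Im k \<ge> 0) \<Longrightarrow>
     \<exists>C. \<forall>x\<ge>0. \<forall>i. \<exists>F. jet D n F \<and> (\<forall>k\<in>closure D. fps_nth (F k) 0 = E i x k * exp (- (\<i> / 2 * of_real s * (k - 1 / k) * of_real x)) \<and>
      (\<forall>j\<le>n. norm (fps_nth (F k) j) \<le> C * (1 + x) ^ j / norm k ^ N))"
proof -
  assume D: "open D" "\<And>k. k \<in> closure D \<Longrightarrow> norm k \<ge> 1 \<and> s * Im k \<ge> 0"
  have k0: "k \<noteq> 0" if "k \<in> closure D" for k using D(2)[OF that] by auto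
  show "\<exists>C. \<forall>x\<ge>0. \<forall>i. \<exists>F. jet D n F \<and> (\<forall>k\<in>closure D. fps_nth (F k) 0 = E i x k \<and>
      (\<forall>j\<le>n. norm (fps_nth (F k) j) \<le> C * (1 + x) ^ j / norm k ^ N))"
  proof (rule left_estimate[where ?V0.0 = V0 and ?V1.0 = V1 and \<tau> = s and Pa = R0 and Pb = R1 and Qa = Q0 and Qb = Q1,
        OF D(1) s _ V R])
    show "1 \<le> norm k \<and> 0 \<le> s * Im k" if "k \<in> closure D" for k by (rule D(2)[OF that])
    fix x k assume x: "(0::real) \<le> x" and k: "k \<in> closure D"
    show "\<exists>M. \<forall>i. \<forall>t\<in>{0..x}. norm (E i t k) \<le> M"
      by (rule volterra_left_bounded[OF x E_int[OF k0[OF k]]]) (assumption, unfold mult_1_left, erule E_eq[OF k0[OF k]])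
  qed (erule E_int[OF k0], assumption, unfold mult_1_left, erule E_eq[OF k0], assumption)
next
  assume D: "open D" "\<And>k. k \<in> closure D \<Longrightarrow> norm k \<ge> 1 \<and> - s * Im k \<ge> 0"
  have k0: "k \<noteq> 0" if "k \<in> closure D" for k using D(2)[OF that] by auto
  define \<nu> where "\<nu> k = \<i> / 2 * of_real s * (k - 1 / k)" for k
  define G where "G i x k = E i x k * exp (- (\<i> / 2 * of_real s * (k - 1 / k) * of_real x))" for i x k
  have G: "G i x k = exp (- \<nu> k * of_real x) * E i x k" for i x k
    by (simp add: G_def \<nu>_def)
  have integrand: "exp (phase (- s) i * (k - 1 / k) * of_real (x - t)) *
        ((\<Sum>d\<in>UNIV. (V0 t $ i $ d + V1 t $ i $ d / k) * G d t k) + (1 / k ^ N) *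
          (Q0 i t + Q1 i t / k + exp (\<i> / 2 * of_real (- s) * (k - 1 / k) * of_real t) * (R0 i t + R1 i t / k)))
    = exp (- \<nu> k * of_real x) * (exp (phase s i * (k - 1 / k) * of_real (x - t)) *
        ((\<Sum>d\<in>UNIV. (V0 t $ i $ d + V1 t $ i $ d / k) * E d t k) + (1 / k ^ N) *
          (R0 i t + R1 i t / k + exp (\<i> / 2 * of_real s * (k - 1 / k) * of_real t) * (Q0 i t + Q1 i t / k))))" for i k x t
  proof -
    have ph: "phase s i * (k - 1 / k) = phase (- s) i * (k - 1 / k) + \<nu> k"
      unfolding phase_shift[of s i, symmetric] \<nu>_def by (simp only: distrib_right)
    have "phase (- s) i * (k - 1 / k) * of_real (x - t) + - \<nu> k * of_real t = - \<nu> k * of_real x + phase s i * (k - 1 / k) * of_real (x - t)"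
      unfolding ph by (simp add: algebra_simps)
    then have e1: "exp (phase (- s) i * (k - 1 / k) * of_real (x - t)) * exp (- \<nu> k * of_real t) = exp (- \<nu> k * of_real x) * exp (phase s i * (k - 1 / k) * of_real (x - t))"
      by (simp only: exp_add[symmetric])
    have e2: "exp (- \<nu> k * of_real t) * exp (\<nu> k * of_real t) = 1" by (simp add: exp_minus)
    have e3: "exp (\<i> / 2 * of_real (- s) * (k - 1 / k) * of_real t) = exp (- \<nu> k * of_real t)" by (simp add: \<nu>_def)
    have alg: "a * (v1 * (b * y1) + v2 * (b * y2) + K * (q + b * r)) = c * (d * (v1 * y1 + v2 * y2 + K * (r + f * q)))"
      if "a * b = c * d" "b * f = 1" for a b c d f v1 y1 v2 y2 K q r :: complex
    proof -
      have "a * (v1 * (b * y1) + v2 * (b * y2) + K * (q + b * r)) = a * (v1 * (b * y1) + v2 * (b * y2) + K * ((b * f) * q + b * r))"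
        by (simp add: that(2))
      also have "\<dots> = (a * b) * (v1 * y1 + v2 * y2 + K * (r + f * q))" by (simp add: algebra_simps)
      finally show ?thesis unfolding that(1) by (simp only: mult.assoc)
    qed
    show ?thesis unfolding G sum_2 e3 \<nu>_def[symmetric] by (rule alg[OF e1 e2])
  qed
  have G_int: "(\<lambda>t. exp (phase (- s) i * (k - 1 / k) * of_real (x - t)) *
        ((\<Sum>d\<in>UNIV. (V0 t $ i $ d + V1 t $ i $ d / k) * G d t k) + (1 / k ^ N) *
          (Q0 i t + Q1 i t / k + exp (\<i> / 2 * of_real (- s) * (k - 1 / k) * of_real t) * (R0 i t + R1 i t / k)))) absolutely_integrable_on {0..x}"
    if "k \<noteq> 0" "x \<ge> 0" for i x k
    unfolding integrand by (rule set_integrable_mult_right) (rule E_int[OF that])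
  have G_eq: "G i x k = 1 * integral {0..x} (\<lambda>t. exp (phase (- s) i * (k - 1 / k) * of_real (x - t)) *
        ((\<Sum>d\<in>UNIV. (V0 t $ i $ d + V1 t $ i $ d / k) * G d t k) + (1 / k ^ N) *
          (Q0 i t + Q1 i t / k + exp (\<i> / 2 * of_real (- s) * (k - 1 / k) * of_real t) * (R0 i t + R1 i t / k))))"
    if "k \<noteq> 0" "x \<ge> 0" for i x k
    unfolding integrand integral_mult_right mult_1_left E_eq[OF that, of i, symmetric] by (rule G)
  have s': "- s = 1 \<or> - s = - 1" using s by auto
  show "\<exists>C. \<forall>x\<ge>0. \<forall>i. \<exists>F. jet D n F \<and> (\<forall>k\<in>closure D. fps_nth (F k) 0 = E i x k * exp (- (\<i> / 2 * of_real s * (k - 1 / k) * of_real x)) \<and>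
      (\<forall>j\<le>n. norm (fps_nth (F k) j) \<le> C * (1 + x) ^ j / norm k ^ N))"
    unfolding G_def[symmetric]
  proof (rule left_estimate[where ?V0.0 = V0 and ?V1.0 = V1 and \<tau> = "- s" and Pa = Q0 and Pb = Q1 and Qa = R0 and Qb = R1,
        OF D(1) s' _ V R(3,4,1,2)])
    show "1 \<le> norm k \<and> 0 \<le> - s * Im k" if "k \<in> closure D" for k by (rule D(2)[OF that])
    fix x k assume x: "(0::real) \<le> x" and k: "k \<in> closure D"
    show "\<exists>M. \<forall>i. \<forall>t\<in>{0..x}. norm (G i t k) \<le> M"
      by (rule volterra_left_bounded[OF x G_int[OF k0[OF k]]]) (assumption, erule G_eq[OF k0[OF k]])
  qed (erule G_int[OF k0], assumption, erule G_eq[OF k0], assumption)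
qed

section \<open>The asymptotic expansions\<close>

lemma D1_D4_properties:
  "open D1" "open D4" "k \<in> closure D1 \<Longrightarrow> norm k \<ge> 1 \<and> Im k \<ge> 0" "k \<in> closure D4 \<Longrightarrow> norm k \<ge> 1 \<and> Im k \<le> 0"
proof -
  show "open D1" "open D4"
    unfolding D1_def D4_def by (intro open_Collect_conj open_Collect_less continuous_intros)+
  have "closure D1 \<subseteq> {k. Im k \<ge> 0 \<and> norm k \<ge> 1}" "closure D4 \<subseteq> {k. Im k \<le> 0 \<and> norm k \<ge> 1}"
    unfolding D1_def D4_def
    by (rule closure_minimal, force, intro closed_Collect_conj closed_Collect_le continuous_intros)+
  then show "k \<in> closure D1 \<Longrightarrow> norm k \<ge> 1 \<and> Im k \<ge> 0" "k \<in> closure D4 \<Longrightarrow> norm k \<ge> 1 \<and> Im k \<le> 0"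
    by blast+
qed

lemma colwise_D4_D1:
  shows "open (colwise D4 D1 c)"
    and "k \<in> closure (colwise D4 D1 c) \<Longrightarrow> norm k \<ge> 1 \<and> sgn2 c * Im k \<le> 0"
    and "k \<in> closure (colwise D4 D1 c) \<Longrightarrow> k \<in> colwise ({k. Im k \<le> 0} - {0}) ({k. Im k \<ge> 0} - {0}) c"
  using D1_D4_properties(1,2) D1_D4_properties(3,4)[of k] by (auto simp: colwise_def sgn2_def split: if_splits)

lemma colwise_D1_D4:
  shows "open (colwise D1 D4 c)"
    and "k \<in> closure (colwise D1 D4 c) \<Longrightarrow> norm k \<ge> 1 \<and> sgn2 c * Im k \<ge> 0"
  using D1_D4_properties(1,2) D1_D4_properties(3,4)[of k] by (auto simp: colwise_def sgn2_def split: if_splits)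

theorem theorem3p3:
  fixes m n :: nat and Nx :: int
    and u0 u1 :: "real \<Rightarrow> real" and du0 du1 :: "nat \<Rightarrow> real \<Rightarrow> real"
    and X Y :: "real \<Rightarrow> complex \<Rightarrow> complex^2^2"
  assumes "m \<ge> 1" and "n \<ge> 1"
    and "weak_derivatives (m + 2) u0 du0"
    and "weak_derivatives (m + 1) u1 du1"
    and "(\<lambda>x. (1 + x) ^ n * (u0 x - 2 * pi * of_int Nx)) absolutely_integrable_on {0..}"
    and "\<forall>i\<in>{1..m + 2}. (\<lambda>x. (1 + x) ^ n * du0 i x) absolutely_integrable_on {0..}"
    and "\<forall>i\<in>{0..m + 1}. (\<lambda>x. (1 + x) ^ n * du1 i x) absolutely_integrable_on {0..}"
    and "volterra_X (U_lax u0 (du0 1) u1) X"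
    and "volterra_Y (U_lax u0 (du0 1) u1) Y"
  shows "\<exists>XC ZC WC.
    formal_X (U0 (du0 1) u1) (U1 u0) (m + 1) XC \<and>
    (\<forall>XC'. formal_X (U0 (du0 1) u1) (U1 u0) (m + 1) XC' \<longrightarrow>
      (\<forall>j\<le>m + 1. \<forall>x\<ge>0. XC' j x = XC j x)) \<and>
    formal_Y (U0 (du0 1) u1) (U1 u0) (m + 1) ZC WC \<and>
    (\<forall>ZC' WC'. formal_Y (U0 (du0 1) u1) (U1 u0) (m + 1) ZC' WC' \<longrightarrow>
      (\<forall>j\<le>m + 1. \<forall>x\<ge>0. ZC' j x = ZC j x \<and> WC' j x = WC j x)) \<and>
    (\<exists>C>0.
      k_derivatives_bounded (colwise D4 D1) n
        (\<lambda>x k. X x k - X_trunc XC (m + 1) x k)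
        (\<lambda>j x k. C / (norm k ^ (m + 1) * (1 + x) ^ (n - j))) \<and>
      k_derivatives_bounded (colwise D1 D4) n
        (\<lambda>x k. Y x k - Y_trunc ZC WC (m + 1) x k)
        (\<lambda>j x k. C * (1 + x) ^ (j + 2) * exp (C * x / norm k ^ (m + 1)) / norm k ^ (m + 1)) \<and>
      k_derivatives_bounded (colwise D4 D1) n
        (\<lambda>x k. (Y x k - Y_trunc ZC WC (m + 1) x k) ** exp_sigma3 (- (2 * \<i> * theta1 k * of_real x)))
        (\<lambda>j x k. C * (1 + x) ^ (j + 2) * exp (C * x / norm k ^ (m + 1)) / norm k ^ (m + 1)))"
proof -
  define V0 where "V0 = U0 (du0 1) u1"
  define V1 where "V1 = U1 u0"
  note V = lax_coefficients_regular[OF assms(3-7), folded V0_def V1_def]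
  have off: "off_part (V0 x) = V0 x" for x by (simp add: V0_def off_part_U0)
  have lax: "U_lax u0 (du0 1) u1 t k $ i $ d = V0 t $ i $ d + V1 t $ i $ d / k" for t k i d
    by (simp add: U_lax_nth V0_def V1_def)
  have Vc: "continuous_on {0..} V0" "continuous_on {0..} V1"
    using regular_continuous[OF V(3)] regular_continuous[OF V(4)] .
  obtain A where A: "\<forall>x. A 0 x = mat 1" "gen_recursion True V0 V1 (m + 1) A"
    "coefficients_regular n m True (m + 1) A" "\<forall>j\<in>{1..m + 1}. (A j \<longlongrightarrow> 0) at_top"
    using formal_X_exists[OF off V order_refl] by blast
  obtain Z W where ZW: "\<forall>x. Z 0 x = mat 1 \<and> W 0 x = 0" "gen_recursion True V0 V1 (m + 1) Z"
    "coefficients_regular n m True (m + 1) Z" "gen_recursion False V0 V1 (m + 1) W"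
    "coefficients_regular n m False (m + 1) W" "\<forall>j\<in>{1..m + 1}. Z j 0 + W j 0 = 0"
    using formal_Y_exists[OF off V order_refl] by blast
  have fX: "formal_X V0 V1 (m + 1) A"
    using A by (simp add: formal_X_def recursion_XZ_eq)
  have fY: "formal_Y V0 V1 (m + 1) Z W"
    using ZW by (simp add: formal_Y_def recursion_XZ_eq recursion_W_eq)
  have uX: "\<forall>A'. formal_X V0 V1 (m + 1) A' \<longrightarrow> (\<forall>j\<le>m + 1. \<forall>x\<ge>0. A' j x = A j x)"
    using formal_X_unique[OF _ fX] by blast
  have uY: "\<forall>Z' W'. formal_Y V0 V1 (m + 1) Z' W' \<longrightarrow> (\<forall>j\<le>m + 1. \<forall>x\<ge>0. Z' j x = Z j x \<and> W' j x = W j x)"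
    using formal_Y_unique[OF _ fY] by blast
  have "\<exists>C. \<forall>x\<ge>0. \<forall>i. \<exists>F. jet (colwise D4 D1 c) n F \<and> (\<forall>k\<in>closure (colwise D4 D1 c).
      fps_nth (F k) 0 = (X x k - X_trunc A (m + 1) x k) $ i $ c \<and>
      (\<forall>j\<le>n. norm (fps_nth (F k) j) \<le> C * (1 / (1 + x) ^ (n - j)) / norm k ^ (m + 1)))" for c
  proof (rule X_estimate[OF colwise_D4_D1(1) _ V A(2,3)])
    fix i x k assume k: "k \<in> closure (colwise D4 D1 c)" and x: "(0::real) \<le> x"
    note X = volterra_X_entry[OF assms(8) colwise_D4_D1(3)[OF k] x, where i = i]
    show "(\<lambda>t. exp (phase (sgn2 c) i * (k - 1 / k) * complex_of_real (x - t)) *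
         (\<Sum>d\<in>UNIV. (V0 t $ i $ d + V1 t $ i $ d / k) * X t k $ d $ c)) absolutely_integrable_on {x..}"
      using X(1) unfolding lax .
    show "X x k $ i $ c = (if i = c then 1 else 0) - integral {x..}
         (\<lambda>t. exp (phase (sgn2 c) i * (k - 1 / k) * complex_of_real (x - t)) *
           (\<Sum>d\<in>UNIV. (V0 t $ i $ d + V1 t $ i $ d / k) * X t k $ d $ c))"
      using X(2) unfolding lax .
  qed (use A(1,4) colwise_D4_D1(2) in auto)
  then have "\<exists>C>0. k_derivatives_bounded (colwise D4 D1) n (\<lambda>x k. X x k - X_trunc A (m + 1) x k)
      (\<lambda>j x k. C * (1 / (1 + x) ^ (n - j)) / norm k ^ (m + 1))"
    by (rule k_derivatives_bounded_of_jets) simp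
  then obtain C1 where C1: "C1 > 0" "k_derivatives_bounded (colwise D4 D1) n (\<lambda>x k. X x k - X_trunc A (m + 1) x k)
      (\<lambda>j x k. C1 * (1 / (1 + x) ^ (n - j)) / norm k ^ (m + 1))" by blast
  define E where "E = (\<lambda>c i x k. (Y x k - Y_trunc Z W (m + 1) x k) $ i $ c)"
  have Y_entry: "(\<lambda>t. exp (phase (sgn2 c) i * (k - 1 / k) * complex_of_real (x - t)) *
         (\<Sum>d\<in>UNIV. (V0 t $ i $ d + V1 t $ i $ d / k) * Y t k $ d $ c)) absolutely_integrable_on {0..x}"
    "Y x k $ i $ c = (if i = c then 1 else 0) + integral {0..x}
         (\<lambda>t. exp (phase (sgn2 c) i * (k - 1 / k) * complex_of_real (x - t)) *
           (\<Sum>d\<in>UNIV. (V0 t $ i $ d + V1 t $ i $ d / k) * Y t k $ d $ c))"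
    if "k \<noteq> 0" "x \<ge> 0" for i c x k
    using volterra_Y_entry[OF assms(9) that, where i = i and c = c] unfolding lax .
  have ZW0: "Z 0 x = mat 1" "W 0 x = 0" for x using ZW(1) by auto
  obtain R0 R1 Q0 Q1 where RQ: "weighted_L1 n R0" "weighted_L1 n R1" "weighted_L1 n Q0" "weighted_L1 n Q1"
    and E_vol: "\<forall>k c i x. k \<noteq> 0 \<longrightarrow> x \<ge> 0 \<longrightarrow>
      (\<lambda>t. exp (phase (sgn2 c) i * (k - 1 / k) * of_real (x - t)) *
        ((\<Sum>d\<in>UNIV. (V0 t $ i $ d + V1 t $ i $ d / k) * E c d t k) + (1 / k ^ (m + 1)) *
          (R0 t $ i $ c + R1 t $ i $ c / k + exp (\<i> / 2 * of_real (sgn2 c) * (k - 1 / k) * of_real t) * (Q0 t $ i $ c + Q1 t $ i $ c / k)))) absolutely_integrable_on {0..x} \<and>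
      E c i x k = integral {0..x} (\<lambda>t. exp (phase (sgn2 c) i * (k - 1 / k) * of_real (x - t)) *
        ((\<Sum>d\<in>UNIV. (V0 t $ i $ d + V1 t $ i $ d / k) * E c d t k) + (1 / k ^ (m + 1)) *
          (R0 t $ i $ c + R1 t $ i $ c / k + exp (\<i> / 2 * of_real (sgn2 c) * (k - 1 / k) * of_real t) * (Q0 t $ i $ c + Q1 t $ i $ c / k))))"
    using Y_error_volterra[OF V(1,2) ZW(2,3) ZW0(1) ZW(4,5) ZW0(2) ZW(6) _ _ E_def] Y_entry by blast
  have E_entry: "(Y x k - Y_trunc Z W (m + 1) x k) $ i $ c = E c i x k" for x k i c
    by (simp only: E_def)
  note entry = weighted_L1_linear[OF bounded_linear_entry]
  have E_int: "(\<lambda>t. exp (phase (sgn2 c) i * (k - 1 / k) * of_real (x - t)) *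
        ((\<Sum>d\<in>UNIV. (V0 t $ i $ d + V1 t $ i $ d / k) * E c d t k) + (1 / k ^ (m + 1)) *
          (R0 t $ i $ c + R1 t $ i $ c / k + exp (\<i> / 2 * of_real (sgn2 c) * (k - 1 / k) * of_real t) * (Q0 t $ i $ c + Q1 t $ i $ c / k)))) absolutely_integrable_on {0..x}"
    and E_eq: "E c i x k = integral {0..x} (\<lambda>t. exp (phase (sgn2 c) i * (k - 1 / k) * of_real (x - t)) *
        ((\<Sum>d\<in>UNIV. (V0 t $ i $ d + V1 t $ i $ d / k) * E c d t k) + (1 / k ^ (m + 1)) *
          (R0 t $ i $ c + R1 t $ i $ c / k + exp (\<i> / 2 * of_real (sgn2 c) * (k - 1 / k) * of_real t) * (Q0 t $ i $ c + Q1 t $ i $ c / k))))"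
    if "k \<noteq> 0" "x \<ge> 0" for c i x k
    using E_vol[rule_format, OF that, of c i] by blast+
  have "\<exists>C. \<forall>x\<ge>0. \<forall>i. \<exists>F. jet (colwise D1 D4 c) n F \<and> (\<forall>k\<in>closure (colwise D1 D4 c).
      fps_nth (F k) 0 = (Y x k - Y_trunc Z W (m + 1) x k) $ i $ c \<and>
      (\<forall>j\<le>n. norm (fps_nth (F k) j) \<le> C * (1 + x) ^ j / norm k ^ (m + 1)))" for c
    unfolding E_entry
  proof (rule Y_estimate(1)[OF V(1,2) Vc entry[OF RQ(1)] entry[OF RQ(2)] entry[OF RQ(3)] entry[OF RQ(4)] sgn2_cases
        E_int E_eq colwise_D1_D4(1)])
    show "1 \<le> norm k \<and> 0 \<le> sgn2 c * Im k" if "k \<in> closure (colwise D1 D4 c)" for k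
      by (rule colwise_D1_D4(2)[OF that])
  qed
  then have "\<exists>C>0. k_derivatives_bounded (colwise D1 D4) n (\<lambda>x k. Y x k - Y_trunc Z W (m + 1) x k)
      (\<lambda>j x k. C * (1 + x) ^ j / norm k ^ (m + 1))"
    by (rule k_derivatives_bounded_of_jets) simp
  then obtain C2 where C2: "C2 > 0" "k_derivatives_bounded (colwise D1 D4) n (\<lambda>x k. Y x k - Y_trunc Z W (m + 1) x k)
      (\<lambda>j x k. C2 * (1 + x) ^ j / norm k ^ (m + 1))" by blast
  have twist: "((Y x k - Y_trunc Z W (m + 1) x k) ** exp_sigma3 (- (2 * \<i> * theta1 k * of_real x))) $ i $ c
     = E c i x k * exp (- (\<i> / 2 * of_real (sgn2 c) * (k - 1 / k) * of_real x))" for x k i c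
  proof -
    have "of_real (sgn2 c) * - (2 * \<i> * theta1 k * of_real x) = - (\<i> / 2 * of_real (sgn2 c) * (k - 1 / k) * of_real x)"
      by (simp add: theta1_def)
    moreover have "(B ** exp_sigma3 \<alpha>) $ i $ c = B $ i $ c * exp (of_real (sgn2 c) * \<alpha>)" for B :: cmat2 and \<alpha>
      using exhaust_2[of c] by (auto simp: matrix_matrix_mult_def sum_2 exp_sigma3_nth)
    ultimately show ?thesis unfolding E_def by (simp only:)
  qed
  have "\<exists>C. \<forall>x\<ge>0. \<forall>i. \<exists>F. jet (colwise D4 D1 c) n F \<and> (\<forall>k\<in>closure (colwise D4 D1 c).
      fps_nth (F k) 0 = ((Y x k - Y_trunc Z W (m + 1) x k) ** exp_sigma3 (- (2 * \<i> * theta1 k * of_real x))) $ i $ c \<and>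
      (\<forall>j\<le>n. norm (fps_nth (F k) j) \<le> C * (1 + x) ^ j / norm k ^ (m + 1)))" for c
    unfolding twist
  proof (rule Y_estimate(2)[OF V(1,2) Vc entry[OF RQ(1)] entry[OF RQ(2)] entry[OF RQ(3)] entry[OF RQ(4)] sgn2_cases
        E_int E_eq colwise_D4_D1(1)])
    show "1 \<le> norm k \<and> 0 \<le> - sgn2 c * Im k" if "k \<in> closure (colwise D4 D1 c)" for k
      using colwise_D4_D1(2)[OF that] by simp
  qed
  then have "\<exists>C>0. k_derivatives_bounded (colwise D4 D1) n
      (\<lambda>x k. (Y x k - Y_trunc Z W (m + 1) x k) ** exp_sigma3 (- (2 * \<i> * theta1 k * of_real x)))
      (\<lambda>j x k. C * (1 + x) ^ j / norm k ^ (m + 1))"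
    by (rule k_derivatives_bounded_of_jets) simp
  then obtain C3 where C3: "C3 > 0" "k_derivatives_bounded (colwise D4 D1) n
      (\<lambda>x k. (Y x k - Y_trunc Z W (m + 1) x k) ** exp_sigma3 (- (2 * \<i> * theta1 k * of_real x)))
      (\<lambda>j x k. C3 * (1 + x) ^ j / norm k ^ (m + 1))" by blast
  define C where "C = C1 + C2 + C3"
  have C: "C > 0" "C1 \<le> C" "C2 \<le> C" "C3 \<le> C" using C1(1) C2(1) C3(1) by (auto simp: C_def)
  \<comment> \<open>The estimates obtained for \<open>Y\<close> have neither the factor \<open>(1 + x)^2\<close> nor the exponential; both are at
    least 1.\<close>
  have weaken: "c * (1 + x) ^ j / norm k ^ (m + 1) \<le> C * (1 + x) ^ (j + 2) * exp (C * x / norm k ^ (m + 1)) / norm k ^ (m + 1)"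
    if "c \<le> C" "x \<ge> 0" for c x j and k :: complex
  proof (rule divide_right_mono)
    have "c * (1 + x) ^ j \<le> C * (1 + x) ^ (j + 2) * 1"
      unfolding mult_1_right using that C(1) by (intro mult_mono power_increasing) auto
    also have "C * (1 + x) ^ (j + 2) * 1 \<le> C * (1 + x) ^ (j + 2) * exp (C * x / norm k ^ (m + 1))"
      using that(2) C(1) by (intro mult_left_mono) auto
    finally show "c * (1 + x) ^ j \<le> C * (1 + x) ^ (j + 2) * exp (C * x / norm k ^ (m + 1))" .
  qed simp
  have b1: "k_derivatives_bounded (colwise D4 D1) n (\<lambda>x k. X x k - X_trunc A (m + 1) x k)
      (\<lambda>j x k. C / (norm k ^ (m + 1) * (1 + x) ^ (n - j)))"
  proof (rule k_derivatives_bounded_mono[OF C1(2)])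
    fix j x k assume "(x::real) \<ge> 0"
    then have "C1 / (norm k ^ (m + 1) * (1 + x) ^ (n - j)) \<le> C / (norm (k::complex) ^ (m + 1) * (1 + x) ^ (n - j))"
      using C(2) by (intro divide_right_mono) auto
    then show "C1 * (1 / (1 + x) ^ (n - j)) / norm k ^ (m + 1) \<le> C / (norm k ^ (m + 1) * (1 + x) ^ (n - j))"
      by (simp add: mult.commute)
  qed
  have b2: "k_derivatives_bounded (colwise D1 D4) n (\<lambda>x k. Y x k - Y_trunc Z W (m + 1) x k)
      (\<lambda>j x k. C * (1 + x) ^ (j + 2) * exp (C * x / norm k ^ (m + 1)) / norm k ^ (m + 1))"
    by (rule k_derivatives_bounded_mono[OF C2(2)]) (rule weaken[OF C(3)])
  have b3: "k_derivatives_bounded (colwise D4 D1) n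
      (\<lambda>x k. (Y x k - Y_trunc Z W (m + 1) x k) ** exp_sigma3 (- (2 * \<i> * theta1 k * of_real x)))
      (\<lambda>j x k. C * (1 + x) ^ (j + 2) * exp (C * x / norm k ^ (m + 1)) / norm k ^ (m + 1))"
    by (rule k_derivatives_bounded_mono[OF C3(2)]) (rule weaken[OF C(4)])
  show ?thesis
    unfolding V0_def[symmetric] V1_def[symmetric]
    using fX uX fY uY C(1) b1 b2 b3 by blast
qed

end
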